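(* Let $\Omega\subset\mathbf{R}^N$ be a bounded domain, let $d(\cdot)\in\mathcal{D}$ and let $H$ be a fourth-order operator on $L^2(\Omega)$ with quadratic form $Q$, as described in the context. Let $\alpha\in(0,1)$ be fixed, and for $n\in\mathbf{N}$ let $d_n=d+\frac1n$ and $\omega_n=d_n^{-\alpha}$. Assume that there exist $k,k'>0$ independent of $n\in\mathbf{N}$ such that $$Q(\omega_n u)\leq k\,Q(u,\omega_n^2u)+k'\|u\|_2^2,\qquad u\in C^2_c(\Omega),$$ for all $n\in\mathbf{N}$. Then there exists $c>0$ such that $$\int_{\Omega}\left(\frac{|\nabla^2u|^2}{d^{2\alpha}}+\frac{|\nabla u|^2}{d^{2+2\alpha}}+\frac{u^2}{d^{4+2\alpha}}\right)dx\leq c\,\|Hu\|_2\,\|H^{\alpha/2}u\|_2,\qquad u\in\mathrm{Dom}(H).$$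
   Context: Distance. $d(\cdot,\cdot)$ is a distance function on the bounded domain $\Omega\subset\mathbf{R}^N$ and $d(x)=\inf_{y\in\partial\Omega}d(x,y)$ is the corresponding distance to the boundary ($d(x,\cdot)$ extended to $\partial\Omega$ by continuity). One writes $d(\cdot)\in\mathcal{D}$ if: (D1) there exist $c_1,c_2>0$ such that for all $x,y\in\Omega$: $c_1\le|\nabla_z d(z,y)|\le c_2$ for $z\in\Omega$, and $c_1|x-y|\le d(x,y)\le c_2|x-y|$; (D2) there exist $\theta,\tau>0$ such that $d(x)$ is $C^2$ on $\{0<d(x)<\theta\}$ and $|\nabla^2d(x)|\le c\,d(x)^{-1+\tau}$ there, for some constant $c$; (D3) there exists $c_3>0$ such that for all $v\in C^2_c(\Omega)$: $\int_\Omega(\Delta v)^2dx\ge c_3\int_\Omega v^2d^{-4}dx$ and $\int_\Omega(\Delta v)^2dx\ge c_3\int_\Omega|\nabla v|^2d^{-2}dx$. Convention: $d(x)$ is redefined away from the boundary (on $\{d(x)>\theta\}$) so that it becomes a positive $C^2$ function on all of $\Omega$; it equals the distance to $\partial\Omega$ only near $\partial\Omega$. Operator. $a=\{a_{\eta\zeta}\}_{|\eta|=|\zeta|=2}$ is a real symmetric matrix-valued function with $L^\infty(\Omega)$ entries, $Q(u,v)=\int_\Omega\sum_{|\eta|=|\zeta|=2}a_{\eta\zeta}D^\eta u\,D^\zeta v\,dx$ and $Q(u)=Q(u,u)$ for $u,v\in H^2_0(\Omega)$. It is assumed that there are $\lambda,\Lambda>0$ with $\lambda Q_0(u)\le Q(u)\le\Lambda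 Q_0(u)$ for $u\in H_0^2(\Omega)$, where $Q_0(u)=\int_\Omega(\Delta u)^2dx$. $H$ is the self-adjoint operator on $L^2(\Omega)$ associated with $Q$ (Dirichlet boundary conditions). $\nabla^2u=(u_{x_ix_j})_{i,j=1}^N$. *)

theory Defs
  imports "HOL-Analysis.Analysis"
begin

section \<open>Classical derivatives\<close>

definition partial_deriv :: "'n::finite \<Rightarrow> (real^'n \<Rightarrow> real) \<Rightarrow> real^'n \<Rightarrow> real" where
  "partial_deriv i f x = frechet_derivative f (at x) (axis i 1)"

text \<open>\<open>C\<^sup>k\<close> on an open set \<open>S\<close>; not meant to be used for other sets.\<close>

fun Ck_on :: "nat \<Rightarrow> (real^'n::finite) set \<Rightarrow> (real^'n \<Rightarrow> real) \<Rightarrow> bool" where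
  "Ck_on 0 S f \<longleftrightarrow> continuous_on S f"
| "Ck_on (Suc k) S f \<longleftrightarrow> f differentiable_on S \<and> (\<forall>i. Ck_on k S (partial_deriv i f))"

text \<open>Compactly supported functions are functions on the whole space (extended by 0).\<close>

definition Cc :: "nat \<Rightarrow> (real^'n::finite) set \<Rightarrow> (real^'n \<Rightarrow> real) set" where
  "Cc k \<Omega> = {f. Ck_on k UNIV f \<and> compact (closure {x. f x \<noteq> 0}) \<and> closure {x. f x \<noteq> 0} \<subseteq> \<Omega>}"

definition Cc_inf :: "(real^'n::finite) set \<Rightarrow> (real^'n \<Rightarrow> real) set" where
  "Cc_inf \<Omega> = (\<Inter>k. Cc k \<Omega>)"

definition gradient :: "(real^'n::finite \<Rightarrow> real) \<Rightarrow> real^'n \<Rightarrow> real^'n" where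
  "gradient f x = (\<chi> i. partial_deriv i f x)"

definition hessian :: "(real^'n::finite \<Rightarrow> real) \<Rightarrow> real^'n \<Rightarrow> real^'n^'n" where
  "hessian f x = (\<chi> i j. partial_deriv i (partial_deriv j f) x)"

definition laplacian :: "(real^'n::finite \<Rightarrow> real) \<Rightarrow> real^'n \<Rightarrow> real" where
  "laplacian f x = (\<Sum>i\<in>UNIV. partial_deriv i (partial_deriv i f) x)"


section \<open>Multi-indices and weak derivatives\<close>

type_synonym 'n mindex = "'n \<Rightarrow> nat"

definition mdeg :: "'n::finite mindex \<Rightarrow> nat" where
  "mdeg \<eta> = (\<Sum>i\<in>UNIV. \<eta> i)"

definition mi1 :: "'n \<Rightarrow> 'n mindex" where
  "mi1 i = (\<lambda>k. of_bool (k = i))"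

definition mi2 :: "'n \<Rightarrow> 'n \<Rightarrow> 'n mindex" where
  "mi2 i j = (\<lambda>k. of_bool (k = i) + of_bool (k = j))"

text \<open>The list enumerates the partial derivatives prescribed by \<open>\<eta>\<close> in some order; \<open>mderiv\<close> is
  only applied to smooth functions, for which the order is irrelevant.\<close>

definition mderiv :: "'n::finite mindex \<Rightarrow> (real^'n \<Rightarrow> real) \<Rightarrow> real^'n \<Rightarrow> real" where
  "mderiv \<eta> f = foldr partial_deriv (SOME is. \<forall>i. count_list is i = \<eta> i) f"

definition loc_integrable :: "(real^'n::finite) set \<Rightarrow> (real^'n \<Rightarrow> real) \<Rightarrow> bool" where
  "loc_integrable \<Omega> f \<longleftrightarrow> (\<forall>K. compact K \<and> K \<subseteq> \<Omega> \<longrightarrow> set_integrable lebesgue K f)"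

definition has_weak_deriv ::
  "(real^'n::finite) set \<Rightarrow> 'n mindex \<Rightarrow> (real^'n \<Rightarrow> real) \<Rightarrow> (real^'n \<Rightarrow> real) \<Rightarrow> bool" where
  "has_weak_deriv \<Omega> \<eta> u g \<longleftrightarrow> loc_integrable \<Omega> u \<and> loc_integrable \<Omega> g \<and>
     (\<forall>\<phi>\<in>Cc_inf \<Omega>. (LINT x|lebesgue_on \<Omega>. u x * mderiv \<eta> \<phi> x)
        = (- 1) ^ mdeg \<eta> * (LINT x|lebesgue_on \<Omega>. g x * \<phi> x))"

text \<open>A representative of \<open>D\<^sup>\<eta> u\<close>, which is determined up to null sets.\<close>

definition weak_deriv ::
  "(real^'n::finite) set \<Rightarrow> 'n mindex \<Rightarrow> (real^'n \<Rightarrow> real) \<Rightarrow> real^'n \<Rightarrow> real" where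
  "weak_deriv \<Omega> \<eta> u = (SOME g. has_weak_deriv \<Omega> \<eta> u g)"

definition weak_gradient :: "(real^'n::finite) set \<Rightarrow> (real^'n \<Rightarrow> real) \<Rightarrow> real^'n \<Rightarrow> real^'n" where
  "weak_gradient \<Omega> u x = (\<chi> i. weak_deriv \<Omega> (mi1 i) u x)"

definition weak_hessian :: "(real^'n::finite) set \<Rightarrow> (real^'n \<Rightarrow> real) \<Rightarrow> real^'n \<Rightarrow> real^'n^'n" where
  "weak_hessian \<Omega> u x = (\<chi> i j. weak_deriv \<Omega> (mi2 i j) u x)"

definition weak_laplacian :: "(real^'n::finite) set \<Rightarrow> (real^'n \<Rightarrow> real) \<Rightarrow> real^'n \<Rightarrow> real" where
  "weak_laplacian \<Omega> u x = (\<Sum>i\<in>UNIV. weak_deriv \<Omega> (mi2 i i) u x)"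


section \<open>\<open>L\<^sup>2(\<Omega>)\<close> and \<open>H\<^sup>2\<^sub>0(\<Omega>)\<close>\<close>

text \<open>Elements are functions, not classes; values outside \<open>\<Omega>\<close> are irrelevant throughout.\<close>

definition L2 :: "(real^'n::finite) set \<Rightarrow> (real^'n \<Rightarrow> real) set" where
  "L2 \<Omega> = {f. f \<in> borel_measurable (lebesgue_on \<Omega>) \<and> integrable (lebesgue_on \<Omega>) (\<lambda>x. (f x)\<^sup>2)}"

definition L2_inner :: "(real^'n::finite) set \<Rightarrow> (real^'n \<Rightarrow> real) \<Rightarrow> (real^'n \<Rightarrow> real) \<Rightarrow> real" where
  "L2_inner \<Omega> f g = (LINT x|lebesgue_on \<Omega>. f x * g x)"

definition L2_norm :: "(real^'n::finite) set \<Rightarrow> (real^'n \<Rightarrow> real) \<Rightarrow> real" where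
  "L2_norm \<Omega> f = sqrt (L2_inner \<Omega> f f)"

text \<open>The closure of the test functions in \<open>H\<^sup>2(\<Omega>)\<close>.\<close>

definition H20 :: "(real^'n::finite) set \<Rightarrow> (real^'n \<Rightarrow> real) set" where
  "H20 \<Omega> = {u \<in> L2 \<Omega>. (\<forall>\<eta>. mdeg \<eta> \<le> 2 \<longrightarrow> (\<exists>g\<in>L2 \<Omega>. has_weak_deriv \<Omega> \<eta> u g)) \<and>
     (\<exists>\<phi>::nat \<Rightarrow> real^'n \<Rightarrow> real. (\<forall>m. \<phi> m \<in> Cc_inf \<Omega>) \<and>
        (\<forall>\<eta>. mdeg \<eta> \<le> 2 \<longrightarrow>
           (\<lambda>m. L2_norm \<Omega> (\<lambda>x. mderiv \<eta> (\<phi> m) x - weak_deriv \<Omega> \<eta> u x)) \<longlonglongrightarrow> 0))}"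


section \<open>The class of distance functions\<close>

definition bdry_dist :: "(real^'n::finite) set \<Rightarrow> (real^'n \<Rightarrow> real^'n \<Rightarrow> real) \<Rightarrow> real^'n \<Rightarrow> real" where
  "bdry_dist \<Omega> d x = (INF y\<in>frontier \<Omega>. Lim (at y within \<Omega>) (d x))"

text \<open>The gradient bounds cannot hold at \<open>z = y\<close>, where \<open>d(\<cdot>, y)\<close> is not differentiable; they are
  required for almost every \<open>z\<close>.\<close>

definition cond_D1 :: "(real^'n::finite) set \<Rightarrow> (real^'n \<Rightarrow> real^'n \<Rightarrow> real) \<Rightarrow> bool" where
  "cond_D1 \<Omega> d \<longleftrightarrow> (\<exists>c1>0. \<exists>c2>0.
     (\<forall>y\<in>\<Omega>. AE z in lebesgue_on \<Omega>. \<exists>g. GDERIV (\<lambda>z. d z y) z :> g \<and> c1 \<le> norm g \<and> norm g \<le> c2) \<and>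
     (\<forall>x\<in>\<Omega>. \<forall>y\<in>\<Omega>. c1 * norm (x - y) \<le> d x y \<and> d x y \<le> c2 * norm (x - y)))"

definition cond_D2 :: "(real^'n::finite) set \<Rightarrow> (real^'n \<Rightarrow> real^'n \<Rightarrow> real) \<Rightarrow> bool" where
  "cond_D2 \<Omega> d \<longleftrightarrow> (\<exists>\<theta>>0. \<exists>\<tau>>0. \<exists>c.
     (let S = {x\<in>\<Omega>. 0 < bdry_dist \<Omega> d x \<and> bdry_dist \<Omega> d x < \<theta>} in
      Ck_on 2 S (bdry_dist \<Omega> d) \<and>
      (\<forall>x\<in>S. norm (hessian (bdry_dist \<Omega> d) x) \<le> c * bdry_dist \<Omega> d x powr (- 1 + \<tau>))))"

definition cond_D3 :: "(real^'n::finite) set \<Rightarrow> (real^'n \<Rightarrow> real^'n \<Rightarrow> real) \<Rightarrow> bool" where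
  "cond_D3 \<Omega> d \<longleftrightarrow> (\<exists>c3>0. \<forall>v\<in>Cc 2 \<Omega>.
     (\<integral>\<^sup>+x. ennreal ((laplacian v x)\<^sup>2) \<partial>lebesgue_on \<Omega>)
       \<ge> ennreal c3 * (\<integral>\<^sup>+x. ennreal ((v x)\<^sup>2 / bdry_dist \<Omega> d x ^ 4) \<partial>lebesgue_on \<Omega>) \<and>
     (\<integral>\<^sup>+x. ennreal ((laplacian v x)\<^sup>2) \<partial>lebesgue_on \<Omega>)
       \<ge> ennreal c3 * (\<integral>\<^sup>+x. ennreal ((norm (gradient v x))\<^sup>2 / (bdry_dist \<Omega> d x)\<^sup>2) \<partial>lebesgue_on \<Omega>))"

definition dist_class :: "(real^'n::finite) set \<Rightarrow> (real^'n \<Rightarrow> real^'n \<Rightarrow> real) set" where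
  "dist_class \<Omega> = {d. Metric_space \<Omega> d \<and> cond_D1 \<Omega> d \<and> cond_D2 \<Omega> d \<and> cond_D3 \<Omega> d}"

text \<open>\<open>\<delta>\<close> is the distance to the boundary redefined away from the boundary.\<close>

definition regularised_dist ::
  "(real^'n::finite) set \<Rightarrow> (real^'n \<Rightarrow> real^'n \<Rightarrow> real) \<Rightarrow> (real^'n \<Rightarrow> real) \<Rightarrow> bool" where
  "regularised_dist \<Omega> d \<delta> \<longleftrightarrow> Ck_on 2 \<Omega> \<delta> \<and> (\<forall>x\<in>\<Omega>. 0 < \<delta> x) \<and>
     (\<exists>\<theta>>0. \<forall>x\<in>\<Omega>. bdry_dist \<Omega> d x < \<theta> \<longrightarrow> \<delta> x = bdry_dist \<Omega> d x)"

definition omega :: "(real^'n::finite \<Rightarrow> real) \<Rightarrow> real \<Rightarrow> nat \<Rightarrow> real^'n \<Rightarrow> real" where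
  "omega \<delta> \<alpha> n x = (\<delta> x + 1 / real n) powr (- \<alpha>)"


section \<open>The quadratic form and the operator\<close>

definition Linf_symmetric ::
  "(real^'n::finite) set \<Rightarrow> ('n mindex \<Rightarrow> 'n mindex \<Rightarrow> real^'n \<Rightarrow> real) \<Rightarrow> bool" where
  "Linf_symmetric \<Omega> a \<longleftrightarrow> (\<forall>\<eta> \<zeta>. mdeg \<eta> = 2 \<and> mdeg \<zeta> = 2 \<longrightarrow>
     a \<eta> \<zeta> \<in> borel_measurable (lebesgue_on \<Omega>) \<and>
     (\<exists>M. AE x in lebesgue_on \<Omega>. \<bar>a \<eta> \<zeta> x\<bar> \<le> M) \<and>
     (AE x in lebesgue_on \<Omega>. a \<eta> \<zeta> x = a \<zeta> \<eta> x))"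

definition Qform ::
  "(real^'n::finite) set \<Rightarrow> ('n mindex \<Rightarrow> 'n mindex \<Rightarrow> real^'n \<Rightarrow> real)
     \<Rightarrow> (real^'n \<Rightarrow> real) \<Rightarrow> (real^'n \<Rightarrow> real) \<Rightarrow> real" where
  "Qform \<Omega> a u v = (LINT x|lebesgue_on \<Omega>.
     (\<Sum>\<eta> | mdeg \<eta> = 2. \<Sum>\<zeta> | mdeg \<zeta> = 2. a \<eta> \<zeta> x * weak_deriv \<Omega> \<eta> u x * weak_deriv \<Omega> \<zeta> v x))"

definition Q0 :: "(real^'n::finite) set \<Rightarrow> (real^'n \<Rightarrow> real) \<Rightarrow> real" where
  "Q0 \<Omega> u = (LINT x|lebesgue_on \<Omega>. (weak_laplacian \<Omega> u x)\<^sup>2)"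

text \<open>Operators on \<open>L\<^sup>2(\<Omega>)\<close> are represented by their graphs.\<close>

type_synonym 'n L2_op = "((real^'n \<Rightarrow> real) \<times> (real^'n \<Rightarrow> real)) set"

definition form_operator ::
  "(real^'n::finite) set \<Rightarrow> ('n mindex \<Rightarrow> 'n mindex \<Rightarrow> real^'n \<Rightarrow> real) \<Rightarrow> 'n L2_op" where
  "form_operator \<Omega> a = {(u, f). u \<in> H20 \<Omega> \<and> f \<in> L2 \<Omega> \<and>
     (\<forall>v\<in>H20 \<Omega>. Qform \<Omega> a u v = L2_inner \<Omega> f v)}"


section \<open>Functional calculus\<close>

text \<open>Projection-valued measures on the Borel sets of the line, acting on the real Hilbert space
  \<open>L\<^sup>2(\<Omega>)\<close>. Linearity of \<open>E B\<close> (up to null sets) follows from symmetry, and idempotence is the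
  multiplicativity with \<open>A = B\<close>.\<close>

definition spectral_measure ::
  "(real^'n::finite) set \<Rightarrow> (real set \<Rightarrow> (real^'n \<Rightarrow> real) \<Rightarrow> (real^'n \<Rightarrow> real)) \<Rightarrow> bool" where
  "spectral_measure \<Omega> E \<longleftrightarrow>
     (\<forall>B\<in>sets borel. \<forall>u\<in>L2 \<Omega>. E B u \<in> L2 \<Omega>) \<and>
     (\<forall>B\<in>sets borel. \<forall>u\<in>L2 \<Omega>. \<forall>v\<in>L2 \<Omega>. L2_inner \<Omega> (E B u) v = L2_inner \<Omega> u (E B v)) \<and>
     (\<forall>A\<in>sets borel. \<forall>B\<in>sets borel. \<forall>u\<in>L2 \<Omega>.
        AE x in lebesgue_on \<Omega>. E A (E B u) x = E (A \<inter> B) u x) \<and>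
     (\<forall>u\<in>L2 \<Omega>. AE x in lebesgue_on \<Omega>. E UNIV u x = u x) \<and>
     (\<forall>A::nat \<Rightarrow> real set. range A \<subseteq> sets borel \<and> disjoint_family A \<longrightarrow>
        (\<forall>u\<in>L2 \<Omega>. \<forall>v\<in>L2 \<Omega>.
           (\<lambda>i. L2_inner \<Omega> (E (A i) u) v) sums L2_inner \<Omega> (E (\<Union>i. A i) u) v))"

definition scalar_measure ::
  "(real^'n::finite) set \<Rightarrow> (real set \<Rightarrow> (real^'n \<Rightarrow> real) \<Rightarrow> (real^'n \<Rightarrow> real))
     \<Rightarrow> (real^'n \<Rightarrow> real) \<Rightarrow> real measure" where
  "scalar_measure \<Omega> E u = measure_of UNIV (sets borel) (\<lambda>B. ennreal (L2_inner \<Omega> (E B u) u))"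

text \<open>\<open>\<integral> f dE\<close>, with domain \<open>{u. \<integral> f\<^sup>2 d\<langle>E u, u\<rangle> < \<infinity>}\<close>; its values are determined by
  \<open>\<langle>(\<integral> f dE) u, v\<rangle> = \<integral> f d\<langle>E u, v\<rangle>\<close> for \<open>v\<close> in the (dense) domain, where the signed measure is
  written by polarisation: \<open>4 \<langle>E u, v\<rangle> = \<langle>E (u + v), u + v\<rangle> - \<langle>E (u - v), u - v\<rangle>\<close>.\<close>

definition spectral_dom ::
  "(real^'n::finite) set \<Rightarrow> (real set \<Rightarrow> (real^'n \<Rightarrow> real) \<Rightarrow> (real^'n \<Rightarrow> real))
     \<Rightarrow> (real \<Rightarrow> real) \<Rightarrow> (real^'n \<Rightarrow> real) set" where
  "spectral_dom \<Omega> E f = {u \<in> L2 \<Omega>. integrable (scalar_measure \<Omega> E u) (\<lambda>t. (f t)\<^sup>2)}"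

definition spectral_integral ::
  "(real^'n::finite) set \<Rightarrow> (real set \<Rightarrow> (real^'n \<Rightarrow> real) \<Rightarrow> (real^'n \<Rightarrow> real))
     \<Rightarrow> (real \<Rightarrow> real) \<Rightarrow> 'n L2_op" where
  "spectral_integral \<Omega> E f = {(u, w). u \<in> spectral_dom \<Omega> E f \<and> w \<in> L2 \<Omega> \<and>
     (\<forall>v\<in>spectral_dom \<Omega> E f.
        4 * L2_inner \<Omega> w v = (LINT t|scalar_measure \<Omega> E (\<lambda>x. u x + v x). f t)
                         - (LINT t|scalar_measure \<Omega> E (\<lambda>x. u x - v x). f t))}"

definition spectral_measure_of ::
  "(real^'n::finite) set \<Rightarrow> 'n L2_op \<Rightarrow> (real set \<Rightarrow> (real^'n \<Rightarrow> real) \<Rightarrow> (real^'n \<Rightarrow> real)) \<Rightarrow> bool" where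
  "spectral_measure_of \<Omega> H E \<longleftrightarrow> spectral_measure \<Omega> E \<and> H = spectral_integral \<Omega> E (\<lambda>t. t)"

text \<open>The power \<open>H\<^sup>s\<close>, for \<open>s > 0\<close>, of a nonnegative self-adjoint operator; the negative half-line
  is then null for the spectral measure, which is unique.\<close>

definition frac_power :: "(real^'n::finite) set \<Rightarrow> 'n L2_op \<Rightarrow> real \<Rightarrow> 'n L2_op" where
  "frac_power \<Omega> H s = {(u, w). \<exists>E. spectral_measure_of \<Omega> H E \<and>
     (u, w) \<in> spectral_integral \<Omega> E (\<lambda>t. if 0 \<le> t then t powr s else 0)}"

end

theory Submission
  imports Defs
begin

text \<open>
  With \<open>\<omega> = \<omega>\<^sub>n\<close>, the Hardy and Rellich inequalities of (D3), applied to \<open>\<omega> u\<close>, control the weighted left-hand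
  side by \<open>Q(\<omega> u)\<close>, uniformly in \<open>n\<close>, because \<open>|\<nabla>\<omega>| \<le> c \<omega> / d\<close> and \<open>|\<nabla>\<^sup>2\<omega>| \<le> c \<omega> / d\<^sup>2\<close>. By hypothesis
  \<open>Q(\<omega> u) \<le> k Q(u, \<omega>\<^sup>2 u) + k' \<parallel>u\<parallel>\<^sup>2\<close>, and \<open>Q(u, \<omega>\<^sup>2 u) = \<langle>Hu, \<omega>\<^sup>2 u\<rangle>\<close> is at most
  \<open>\<parallel>Hu\<parallel> \<parallel>d\<^bsup>-2\<alpha>\<^esup> u\<parallel>\<close>. Rellich's inequality reads \<open>d\<^bsup>-4\<^esup> \<le> c H\<close>, hence \<open>\<parallel>d\<^bsup>-2\<alpha>\<^esup> u\<parallel> \<le> c \<parallel>H\<^bsup>\<alpha>/2\<^esup> u\<parallel>\<close>.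
  This operator monotonicity is obtained by real interpolation: splitting \<open>u\<close> by the spectral projections of
  \<open>H\<close> at the level \<open>s\<close> gives \<open>\<integral> min(d\<^bsup>-4\<^esup>, s) u\<^sup>2 \<le> c \<integral> min(t, s) d\<mu>\<^sub>u(t)\<close>, which is integrated against
  \<open>s\<^bsup>\<alpha>-2\<^esup> ds\<close>. Finally \<open>n \<rightarrow> \<infinity>\<close> by Fatou's lemma.
\<close>

section \<open>Functions of class \<open>C\<^sup>k\<close> and smooth bumps\<close>

text \<open>The hypothesis and (D3) concern C^2 functions of compact support, \<open>H20\<close> is
  the closure of smooth ones, and the conclusion concerns the operator domain inside
  \<open>H20\<close>. Passing between the three shapes the proof. A product of \<omega>_n with a
  test function is only C^2, so mollification is required to place it in \<open>H20\<close>.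
  Moreover the second derivatives of \<omega>_n need not be bounded near the boundary even for fixed
  n, since those of \<delta> are only O(1/\<delta>); multiplication by \<omega>_n acts on
  \<open>H20\<close> because Hardy and Rellich absorb the factors 1/\<delta> and 1/\<delta>^2. Two
  kinds of constants are kept apart: bounds that depend on n only justify membership and limits,
  while bounds relative to \<omega>_n itself enter the estimate. The term k'|u|^2 is treated by
  bounding one factor |u| by |Hu| and the other by |H^(\<alpha>/2) u|. The spectral integral is
  given only through polarised scalar measures, so what is needed of it is obtained by testing
  against combinations of vectors E(B)u.\<close>

lemma partial_deriv_eqI:
  "(f has_derivative f') (at x) \<Longrightarrow> partial_deriv i f x = f' (axis i 1)"
  unfolding partial_deriv_def using frechet_derivative_at by metis

lemma has_derivative_partial_deriv:
  fixes f :: "real^'n::finite \<Rightarrow> real"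
  assumes "f differentiable (at x)"
  shows "(f has_derivative (\<lambda>h. \<Sum>i\<in>UNIV. partial_deriv i f x * h $ i)) (at x)"
proof -
  obtain f' where f': "(f has_derivative f') (at x)"
    using assms by (auto simp: differentiable_def)
  then have lin: "linear f'" using has_derivative_linear by blast
  have "f' h = (\<Sum>i\<in>UNIV. partial_deriv i f x * h $ i)" for h
  proof -
    have "h = (\<Sum>i\<in>UNIV. (h $ i) *\<^sub>R axis i 1)"
      using basis_expansion[of h] by (simp add: scalar_mult_eq_scaleR)
    then have "f' h = f' (\<Sum>i\<in>UNIV. (h $ i) *\<^sub>R axis i 1)" by simp
    also have "\<dots> = (\<Sum>i\<in>UNIV. (h $ i) * f' (axis i 1))"
      using lin by (simp add: linear_sum linear_scale)
    finally show ?thesis using partial_deriv_eqI[OF f'] by (simp add: mult.commute)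
  qed
  then have "f' = (\<lambda>h. \<Sum>i\<in>UNIV. partial_deriv i f x * h $ i)" by auto
  with f' show ?thesis by simp
qed

lemma partial_deriv_cong_open:
  assumes "open S" "x \<in> S" "\<And>y. y \<in> S \<Longrightarrow> f y = g y"
  shows "partial_deriv i f x = partial_deriv i g x"
proof -
  have "(f has_derivative D) (at x) \<longleftrightarrow> (g has_derivative D) (at x)" for D
    using has_derivative_transform_within_open[OF _ assms(1,2), of f D UNIV g]
      has_derivative_transform_within_open[OF _ assms(1,2), of g D UNIV f] assms(3) by auto
  then show ?thesis unfolding partial_deriv_def frechet_derivative_def by simp
qed

lemma partial_deriv_add:
  "f differentiable (at x) \<Longrightarrow> g differentiable (at x) \<Longrightarrow>
    partial_deriv i (\<lambda>x. f x + g x) x = partial_deriv i f x + partial_deriv i g x"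
  by (subst partial_deriv_eqI[OF has_derivative_add])
     (auto simp: frechet_derivative_works partial_deriv_def)

lemma partial_deriv_diff:
  "f differentiable (at x) \<Longrightarrow> g differentiable (at x) \<Longrightarrow>
    partial_deriv i (\<lambda>x. f x - g x) x = partial_deriv i f x - partial_deriv i g x"
  by (subst partial_deriv_eqI[OF has_derivative_diff])
     (auto simp: frechet_derivative_works partial_deriv_def)

lemma partial_deriv_mult:
  "f differentiable (at x) \<Longrightarrow> g differentiable (at x) \<Longrightarrow>
    partial_deriv i (\<lambda>x. f x * g x) x = partial_deriv i f x * g x + f x * partial_deriv i g x"
  by (subst partial_deriv_eqI[OF has_derivative_mult])
     (auto simp: frechet_derivative_works partial_deriv_def)

lemma partial_deriv_const [simp]: "partial_deriv i (\<lambda>x. c) = (\<lambda>x. 0)"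
  by (rule ext, subst partial_deriv_eqI[OF has_derivative_const]) auto

lemma partial_deriv_nth [simp]:
  "partial_deriv i (\<lambda>x::real^'n::finite. x $ j) = (\<lambda>x. if i = j then 1 else 0)"
proof
  fix x :: "real^'n"
  have "((\<lambda>x::real^'n. x $ j) has_derivative (\<lambda>x. x $ j)) (at x)"
    by (rule bounded_linear.has_derivative[OF bounded_linear_vec_nth]) (rule has_derivative_ident)
  then show "partial_deriv i (\<lambda>x::real^'n. x $ j) x = (if i = j then 1 else 0)"
    by (simp add: partial_deriv_eqI axis_def)
qed

lemma partial_deriv_compose:
  assumes "f differentiable (at x)" "(h has_real_derivative h') (at (f x))"
  shows "partial_deriv i (\<lambda>x. h (f x)) x = h' * partial_deriv i f x"
    and "(\<lambda>x. h (f x)) differentiable (at x)"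
proof -
  have *: "((\<lambda>x. h (f x)) has_derivative (\<lambda>y. h' * frechet_derivative f (at x) y)) (at x)"
    using diff_chain_at[of f "frechet_derivative f (at x)" x h "(*) h'"] assms
    by (auto simp: frechet_derivative_works has_field_derivative_def o_def)
  show "partial_deriv i (\<lambda>x. h (f x)) x = h' * partial_deriv i f x"
    by (subst partial_deriv_eqI[OF *]) (simp add: partial_deriv_def)
  show "(\<lambda>x. h (f x)) differentiable (at x)"
    using * by (auto simp: differentiable_def)
qed

lemma Ck_on_SucD: "Ck_on (Suc k) S f \<Longrightarrow> open S \<Longrightarrow> x \<in> S \<Longrightarrow> f differentiable (at x)"
  using differentiable_on_eq_differentiable_at[of S f] by simp

lemma Ck_on_subset: "Ck_on k S f \<Longrightarrow> T \<subseteq> S \<Longrightarrow> Ck_on k T f"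
  by (induction k arbitrary: f) (auto intro: continuous_on_subset differentiable_on_subset)

lemma Ck_on_Suc_imp: "Ck_on (Suc k) S f \<Longrightarrow> Ck_on k S f"
  by (induction k arbitrary: f) (auto intro: differentiable_imp_continuous_on)

lemma Ck_on_le: "Ck_on l S f \<Longrightarrow> k \<le> l \<Longrightarrow> Ck_on k S f"
proof (induction l)
  case (Suc l)
  then show ?case using Ck_on_Suc_imp[of l S f] by (cases "k = Suc l") (auto simp del: Ck_on.simps)
qed simp

text \<open>\<open>partial_deriv\<close> looks at a full neighbourhood of the point, so agreement on
  S passes to the derivatives because S is open; the induction then runs on
  \<open>partial_deriv i\<close>.\<close>

lemma Ck_on_cong:
  assumes "open S" "\<And>x. x \<in> S \<Longrightarrow> f x = g x" "Ck_on k S f"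
  shows "Ck_on k S g"
  using assms(2,3)
proof (induction k arbitrary: f g)
  case 0
  then show ?case using continuous_on_cong[of S S f g] by simp
next
  case (Suc k)
  have "Ck_on k S (partial_deriv i g)" for i
  proof (rule Suc.IH[of "partial_deriv i f"])
    show "partial_deriv i f x = partial_deriv i g x" if "x \<in> S" for x
      by (rule partial_deriv_cong_open[OF assms(1) that Suc.prems(1)])
  qed (use Suc.prems(2) in simp)
  moreover have "g differentiable_on S"
    unfolding differentiable_on_def
  proof
    fix x assume x: "x \<in> S"
    have "f differentiable (at x within S)" using Suc.prems(2) x by (auto simp: differentiable_on_def)
    then show "g differentiable (at x within S)"
      by (rule differentiable_transform_within[OF _ zero_less_one x]) (use Suc.prems(1) in blast)
  qed
  ultimately show ?case by simp
qed

text \<open>Gluing for products with a compactly supported factor: such a product is C^k on \<Omega>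
  and, being zero, on the complement of the support, and these two open sets cover the
  space.\<close>

lemma Ck_on_Un:
  "open S \<Longrightarrow> open T \<Longrightarrow> Ck_on k S f \<Longrightarrow> Ck_on k T f \<Longrightarrow> Ck_on k (S \<union> T) f"
proof (induction k arbitrary: f)
  case (Suc k)
  have "f differentiable_on S \<union> T"
    using Ck_on_SucD[OF Suc.prems(3,1)] Ck_on_SucD[OF Suc.prems(4,2)]
    by (intro differentiable_at_imp_differentiable_on) blast
  moreover have "Ck_on k (S \<union> T) (partial_deriv i f)" for i
    by (rule Suc.IH) (use Suc.prems in simp_all)
  ultimately show ?case by simp
qed (simp add: continuous_on_open_Un)

lemma Ck_on_const [simp, intro]: "Ck_on k S (\<lambda>x. c)"
  by (induction k arbitrary: c) simp_all

lemma Ck_on_nth [simp, intro]: "Ck_on k S (\<lambda>x::real^'n::finite. x $ j)"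
proof (cases k)
  case (Suc l)
  have "(\<lambda>x::real^'n. x $ j) differentiable_on S"
    by (intro linear_imp_differentiable_on bounded_linear.linear bounded_linear_vec_nth)
  with Suc show ?thesis by simp
qed (auto intro!: continuous_intros)

lemma Ck_on_add:
  "open S \<Longrightarrow> Ck_on k S f \<Longrightarrow> Ck_on k S g \<Longrightarrow> Ck_on k S (\<lambda>x. f x + g x)"
proof (induction k arbitrary: f g)
  case (Suc k)
  have "Ck_on k S (partial_deriv i (\<lambda>x. f x + g x))" for i
    by (rule Ck_on_cong[OF Suc.prems(1), of "\<lambda>x. partial_deriv i f x + partial_deriv i g x"])
       (use Suc Ck_on_SucD[OF Suc.prems(2,1)] Ck_on_SucD[OF Suc.prems(3,1)] in \<open>auto simp: partial_deriv_add\<close>)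
  with Suc show ?case by (auto intro: differentiable_on_add)
qed (auto intro: continuous_intros)

lemma Ck_on_mult:
  "open S \<Longrightarrow> Ck_on k S f \<Longrightarrow> Ck_on k S g \<Longrightarrow> Ck_on k S (\<lambda>x. f x * g x)"
proof (induction k arbitrary: f g)
  case (Suc k)
  have "Ck_on k S f" "Ck_on k S g" using Suc.prems(2,3) by (blast intro: Ck_on_Suc_imp)+
  then have "Ck_on k S (\<lambda>x. partial_deriv i f x * g x + f x * partial_deriv i g x)" for i
    using Suc by (intro Ck_on_add Suc.IH) auto
  then have "Ck_on k S (partial_deriv i (\<lambda>x. f x * g x))" for i
    by (rule Ck_on_cong[OF Suc.prems(1), rotated])
       (use Ck_on_SucD[OF Suc.prems(2,1)] Ck_on_SucD[OF Suc.prems(3,1)] in \<open>auto simp: partial_deriv_mult\<close>)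
  with Suc show ?case by (auto intro: differentiable_on_mult)
qed (auto intro: continuous_intros)

lemma Ck_on_diff:
  "open S \<Longrightarrow> Ck_on k S f \<Longrightarrow> Ck_on k S g \<Longrightarrow> Ck_on k S (\<lambda>x. f x - g x)"
  using Ck_on_add[of S k f "\<lambda>x. (-1) * g x"] Ck_on_mult[of S k "\<lambda>x. -1" g] by simp

lemma Ck_on_prod:
  assumes "open S" "\<And>i. i \<in> I \<Longrightarrow> Ck_on k S (f i)"
  shows "Ck_on k S (\<lambda>x. \<Prod>i\<in>I. f i x)"
  using assms(2) by (induction I rule: infinite_finite_induct) (auto intro!: Ck_on_mult assms(1))

text \<open>A family F closed under differentiation on the range of f stands for smoothness of the
  outer function, so that a single chain rule step suffices in the induction. The families used are
  the multiples of powers and the functions \<open>exp_cut p\<close>. The premise on t says that S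
  is nonempty, hence the separate treatment of the empty set in the proof.\<close>

lemma Ck_on_compose:
  fixes f :: "real^'n::finite \<Rightarrow> real"
  assumes S: "open S"
    and F: "\<And>h t. h \<in> F \<Longrightarrow> t \<in> f ` S \<Longrightarrow> \<exists>h'\<in>F. \<forall>t\<in>f ` S. (h has_real_derivative h' t) (at t)"
  shows "Ck_on k S f \<Longrightarrow> h \<in> F \<Longrightarrow> Ck_on k S (\<lambda>x. h (f x))"
proof (induction k arbitrary: h)
  case 0
  show ?case
  proof (cases "S = {}")
    case False
    then obtain h' where "\<forall>t\<in>f ` S. (h has_real_derivative h' t) (at t)"
      using F[OF 0(2)] by blast
    then have "continuous_on (f ` S) h"
      by (meson DERIV_continuous_on DERIV_subset subset_UNIV)
    then show ?thesis using 0 by (auto intro: continuous_on_compose2)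
  qed auto
next
  case (Suc k)
  show ?case
  proof (cases "S = {}")
    case False
    then obtain h' where h': "h' \<in> F" "\<forall>t\<in>f ` S. (h has_real_derivative h' t) (at t)"
      using F[OF Suc.prems(2)] by blast
    have "Ck_on k S (\<lambda>x. h' (f x) * partial_deriv i f x)" for i
    proof (intro Ck_on_mult S)
      show "Ck_on k S (\<lambda>x. h' (f x))"
        by (rule Suc.IH[OF Ck_on_Suc_imp[OF Suc.prems(1)] h'(1)])
      show "Ck_on k S (partial_deriv i f)" using Suc.prems(1) by simp
    qed
    then have "Ck_on k S (partial_deriv i (\<lambda>x. h (f x)))" for i
      by (rule Ck_on_cong[OF S, rotated])
         (use h' Ck_on_SucD[OF Suc.prems(1) S] in \<open>auto simp: partial_deriv_compose(1)\<close>)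
    moreover have "(\<lambda>x. h (f x)) differentiable_on S"
      using h' Ck_on_SucD[OF Suc.prems(1) S] partial_deriv_compose(2)
      by (metis S differentiable_on_eq_differentiable_at image_eqI)
    ultimately show ?thesis by simp
  next
    case True
    have "Ck_on k {} g" for k and g :: "real^'n \<Rightarrow> real" by (induction k arbitrary: g) (auto simp: differentiable_on_def)
    then show ?thesis using True by simp
  qed
qed

lemma Ck_on_powr:
  assumes "open S" "Ck_on k S f" "\<And>x. x \<in> S \<Longrightarrow> 0 < f x"
  shows "Ck_on k S (\<lambda>x. f x powr p)"
proof -
  let ?F = "{\<lambda>t::real. c * t powr p | c p. True}"
  have "Ck_on k S (\<lambda>x. (\<lambda>t. 1 * t powr p) (f x))"
  proof (rule Ck_on_compose[where F = ?F, OF assms(1) _ assms(2)])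
    fix h t assume "h \<in> ?F"
    then obtain c p where h: "h = (\<lambda>t. c * t powr p)" by blast
    have "\<forall>t\<in>f ` S. (h has_real_derivative (c * p) * t powr (p - 1)) (at t)"
      using assms(3) by (auto simp: h intro!: derivative_eq_intros)
    then show "\<exists>h'\<in>?F. \<forall>t\<in>f ` S. (h has_real_derivative h' t) (at t)"
      by (intro bexI[of _ "\<lambda>t. (c * p) * t powr (p - 1)"]) auto
  qed blast
  then show ?thesis by simp
qed

section \<open>The flat function exp(-1/t) and bumps on boxes\<close>

definition exp_cut :: "real poly \<Rightarrow> real \<Rightarrow> real" where
  "exp_cut p t = (if 0 < t then poly p (1 / t) * exp (- (1 / t)) else 0)"

lemma tendsto_poly_exp_0: "((\<lambda>s. poly p s * exp (- s)) \<longlongrightarrow> 0) (at_top :: real filter)"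
proof -
  have "((\<lambda>s. \<Sum>i\<le>degree p. coeff p i * (s ^ i / exp s)) \<longlongrightarrow> (\<Sum>i\<le>degree p. coeff p i * 0)) at_top"
    by (intro tendsto_intros tendsto_power_div_exp_0)
  then show ?thesis
    by (simp add: poly_altdef sum_distrib_right exp_minus divide_inverse mult.assoc)
qed

text \<open>With s = 1/t one has ds/dt = -s^2, so p(s) e^(-s) has the derivative s^2 (p - p')(s)
  e^(-s), again of the same form; \<open>[:0, 0, 1:]\<close> stands for s^2. This is why
  \<open>exp_cut\<close> carries a polynomial.\<close>

lemma exp_cut_deriv:
  "(exp_cut p has_real_derivative exp_cut ([:0, 0, 1:] * (p - pderiv p)) t) (at t)"
proof -
  consider "t > 0" | "t < 0" | "t = 0" by linarith
  then show ?thesis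
  proof cases
    case 1
    have d: "((\<lambda>t. 1 / t) has_real_derivative (- ((1 / t) ^ 2))) (at t)"
      using 1 by (auto intro!: derivative_eq_intros simp: power2_eq_square)
    have "((\<lambda>t. poly p (1 / t) * exp (- (1 / t))) has_real_derivative
        poly (pderiv p) (1 / t) * (- ((1 / t) ^ 2)) * exp (- (1 / t))
          + exp (- (1 / t)) * (- (- ((1 / t) ^ 2))) * poly p (1 / t)) (at t)"
      by (rule DERIV_mult[OF DERIV_chain2[OF poly_DERIV d] DERIV_fun_exp[OF DERIV_minus[OF d]]])
    also have "poly (pderiv p) (1 / t) * (- ((1 / t) ^ 2)) * exp (- (1 / t))
          + exp (- (1 / t)) * (- (- ((1 / t) ^ 2))) * poly p (1 / t)
        = exp_cut ([:0, 0, 1:] * (p - pderiv p)) t"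
      using 1 by (simp add: exp_cut_def power2_eq_square algebra_simps)
    finally have "((\<lambda>t. poly p (1 / t) * exp (- (1 / t))) has_real_derivative
        exp_cut ([:0, 0, 1:] * (p - pderiv p)) t) (at t)" .
    then show ?thesis
      by (rule has_field_derivative_transform_within_open[where S = "{0<..}"])
         (use 1 in \<open>auto simp: exp_cut_def\<close>)
  next
    case 2
    have "((\<lambda>t. 0) has_real_derivative exp_cut ([:0, 0, 1:] * (p - pderiv p)) t) (at t)"
      using 2 by (auto simp: exp_cut_def)
    then show ?thesis
      by (rule has_field_derivative_transform_within_open[where S = "{..<0}"])
         (use 2 in \<open>auto simp: exp_cut_def\<close>)
  next
    case 3
    have "((\<lambda>h. exp_cut p h / h) \<longlongrightarrow> 0) (at 0)"
    proof (rule filterlim_split_at)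
      \<comment> \<open>At the origin the quotient with h = 1/s is s p(s) e^(-s), and the
        exponential wins as s tends to infinity.\<close>
      have "((\<lambda>h. exp_cut p h / h) \<longlongrightarrow> 0) (at_right 0) \<longleftrightarrow>
          ((\<lambda>s. poly ([:0, 1:] * p) s * exp (- s)) \<longlongrightarrow> 0) at_top"
        unfolding filterlim_at_right_to_top[where f = "\<lambda>h. exp_cut p h / h"]
        by (rule filterlim_cong[OF refl refl eventually_mono[OF eventually_gt_at_top[of 0]]])
           (auto simp: exp_cut_def field_simps)
      then show "((\<lambda>h. exp_cut p h / h) \<longlongrightarrow> 0) (at_right 0)"
        using tendsto_poly_exp_0 by blast
      show "((\<lambda>h. exp_cut p h / h) \<longlongrightarrow> 0) (at_left 0)"
        by (rule tendsto_eventually) (auto simp: eventually_at_filter exp_cut_def)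
    qed
    then show ?thesis using 3 by (simp add: has_field_derivative_iff exp_cut_def)
  qed
qed

lemma Ck_on_exp_cut: "open S \<Longrightarrow> Ck_on k S f \<Longrightarrow> Ck_on k S (\<lambda>x. exp_cut p (f x))"
  by (rule Ck_on_compose[where F = "range exp_cut"]) (use exp_cut_deriv in blast)+

text \<open>The parameter s sharpens the bump: for large s it tends to the indicator of the open
  box, which serves for testing, while s = 1 gives the profile of the mollifier. Boxes instead of
  balls make it a product of functions of one variable.\<close>

definition box_bump :: "real \<Rightarrow> real^'n::finite \<Rightarrow> real^'n \<Rightarrow> real^'n \<Rightarrow> real" where
  "box_bump s a b x = (\<Prod>i\<in>UNIV. exp_cut 1 (s * (x $ i - a $ i)) * exp_cut 1 (s * (b $ i - x $ i)))"

lemma exp_cut_one_bounds: "0 \<le> exp_cut 1 t" "exp_cut 1 t \<le> 1"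
  by (auto simp: exp_cut_def)

lemma Ck_on_box_bump: "Ck_on k UNIV (box_bump s a b)"
proof -
  have "Ck_on k UNIV (\<lambda>x. box_bump s a b x)"
    unfolding box_bump_def
    by (intro Ck_on_prod Ck_on_mult Ck_on_exp_cut Ck_on_diff Ck_on_const Ck_on_nth open_UNIV)
  then show ?thesis by simp
qed

lemma box_bump_bounds: "0 \<le> box_bump s a b x" "box_bump s a b x \<le> 1"
  unfolding box_bump_def
  by (auto intro!: prod_nonneg prod_le_1 mult_nonneg_nonneg mult_le_one simp: exp_cut_one_bounds)

lemma box_bump_pos: "s > 0 \<Longrightarrow> box_bump s a b x \<noteq> 0 \<longleftrightarrow> x \<in> box a b"
  by (auto simp: box_bump_def exp_cut_def mem_box_cart zero_less_mult_iff)

lemma box_bump_tendsto: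
  "(\<lambda>j. box_bump (real (Suc j)) a b x) \<longlonglongrightarrow> indicator (box a b) x"
proof (cases "x \<in> box a b")
  case False
  then have "box_bump (real (Suc j)) a b x = 0" for j using box_bump_pos[of "real (Suc j)" a b x] by auto
  then show ?thesis using False by simp
next
  case True
  have *: "(\<lambda>j. exp_cut 1 (real (Suc j) * t)) \<longlonglongrightarrow> 1" if "t > 0" for t
  proof -
    have "(\<lambda>j. inverse (real (Suc j)) * (1 / t)) \<longlonglongrightarrow> 0 * (1 / t)"
      by (intro tendsto_intros LIMSEQ_inverse_real_of_nat)
    then have "(\<lambda>j. exp (- (inverse (real (Suc j)) * (1 / t)))) \<longlonglongrightarrow> exp (- 0)"
      by (intro tendsto_intros) simp
    moreover have "exp_cut 1 (real (Suc j) * t) = exp (- (inverse (real (Suc j)) * (1 / t)))" for j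
      using that by (simp add: exp_cut_def divide_inverse del: of_nat_Suc)
    ultimately show ?thesis by simp
  qed
  have "(\<lambda>j. box_bump (real (Suc j)) a b x) \<longlonglongrightarrow> (\<Prod>i\<in>(UNIV::'a set). 1 * 1)"
    unfolding box_bump_def using True by (intro tendsto_intros *) (auto simp: mem_box_cart)
  then show ?thesis using True by simp
qed

lemma Cc_I:
  assumes "Ck_on k UNIV f" "compact K" "K \<subseteq> \<Omega>" "\<And>x. x \<notin> K \<Longrightarrow> f x = 0"
  shows "f \<in> Cc k \<Omega>"
proof -
  have "closure {x. f x \<noteq> 0} \<subseteq> K"
    using assms(2,4) by (intro closure_minimal) (auto simp: compact_imp_closed)
  with assms(1-3) show ?thesis
    using compact_Int_closed[of K "closure {x. f x \<noteq> 0}"] unfolding Cc_def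
    by (auto simp: Int_absorb1)
qed

lemma box_bump_Cc_inf:
  assumes "s > 0" "cbox a b \<subseteq> \<Omega>"
  shows "box_bump s a b \<in> Cc_inf \<Omega>"
proof -
  have "box_bump s a b x = 0" if "x \<notin> cbox a b" for x
    using box_bump_pos[OF assms(1), of a b x] box_subset_cbox[of a b] that by blast
  then have "box_bump s a b \<in> Cc k \<Omega>" for k
    by (rule Cc_I[OF Ck_on_box_bump compact_cbox assms(2)])
  then show ?thesis by (simp add: Cc_inf_def)
qed

section \<open>Integration by parts\<close>

lemma has_real_derivative_line:
  assumes "f differentiable (at (y + t *\<^sub>R axis i 1))"
  shows "((\<lambda>t. f (y + t *\<^sub>R axis i 1)) has_real_derivative partial_deriv i f (y + t *\<^sub>R axis i 1)) (at t)"
proof -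
  have "((\<lambda>t. y + t *\<^sub>R axis i 1) has_derivative (\<lambda>h. h *\<^sub>R axis i 1)) (at t)"
    by (auto intro!: derivative_eq_intros)
  moreover have "(f has_derivative frechet_derivative f (at (y + t *\<^sub>R axis i 1))) (at (y + t *\<^sub>R axis i 1))"
    using assms frechet_derivative_works by blast
  ultimately have "((\<lambda>t. f (y + t *\<^sub>R axis i 1)) has_derivative
      (\<lambda>h. frechet_derivative f (at (y + t *\<^sub>R axis i 1)) (h *\<^sub>R axis i 1))) (at t)"
    using diff_chain_at[of "\<lambda>t. y + t *\<^sub>R axis i 1" "\<lambda>h. h *\<^sub>R axis i 1" t f] by (simp add: o_def)
  then show ?thesis
    using linear_frechet_derivative[OF assms]
    by (simp add: has_field_derivative_def linear_scale partial_deriv_def mult.commute[of _ "frechet_derivative _ _ _"])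
qed

lemma Ck_on_mean_value:
  assumes "Ck_on 1 UNIV f" "h > 0"
  obtains s where "0 < s" "s < h" "f (y + h *\<^sub>R axis i 1) - f y = h * partial_deriv i f (y + s *\<^sub>R axis i 1)"
proof -
  have d: "f differentiable (at x)" for x using Ck_on_SucD[of 0 UNIV f x] assms by simp
  have "\<exists>s. 0 < s \<and> s < h \<and> f (y + h *\<^sub>R axis i 1) - f (y + 0 *\<^sub>R axis i 1)
      = (h - 0) * partial_deriv i f (y + s *\<^sub>R axis i 1)"
    by (rule MVT2[OF assms(2) has_real_derivative_line]) (rule d)
  then show ?thesis using that by auto
qed

lemma partial_deriv_comp_translate:
  assumes "f differentiable (at (x + c))"
  shows "partial_deriv i (\<lambda>x. f (x + c)) x = partial_deriv i f (x + c)"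
    "(\<lambda>x. f (x + c)) differentiable (at x)"
proof -
  have *: "((\<lambda>x. f (x + c)) has_derivative frechet_derivative f (at (x + c))) (at x)"
    using diff_chain_at[of "\<lambda>x. x + c" "\<lambda>h. h" x f "frechet_derivative f (at (x + c))"]
      has_derivative_add_const[OF has_derivative_ident, of c] assms frechet_derivative_works
    by (auto simp: o_def)
  show "partial_deriv i (\<lambda>x. f (x + c)) x = partial_deriv i f (x + c)"
    by (subst partial_deriv_eqI[OF *]) (simp add: partial_deriv_def)
  show "(\<lambda>x. f (x + c)) differentiable (at x)" using * by (auto simp: differentiable_def)
qed

text \<open>Mean value theorem twice: in direction i for the increment g(y) = f(y + h e_j) - f(y),
  then in direction j for \<open>partial_deriv i f\<close>. The second difference is symmetric in i
  and j, which the next lemma exploits.\<close>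

lemma Ck_on_second_difference:
  assumes f: "Ck_on 2 UNIV f" and h: "h > 0"
  shows "\<exists>p. norm (p - x) \<le> 2 * h \<and>
    f (x + h *\<^sub>R axis i 1 + h *\<^sub>R axis j 1) - f (x + h *\<^sub>R axis i 1) - f (x + h *\<^sub>R axis j 1) + f x
      = h\<^sup>2 * partial_deriv j (partial_deriv i f) p"
proof -
  have f1: "Ck_on 1 UNIV f" by (rule Ck_on_le[OF f]) simp
  have df: "f differentiable (at x)" for x using Ck_on_SucD[of 0 UNIV f x] f1 by simp
  have f2: "Ck_on 1 UNIV (partial_deriv i f)" using f by (simp add: numeral_2_eq_2)
  define g where "g y = f (y + h *\<^sub>R axis j 1) - f y" for y
  have pg: "partial_deriv k g y = partial_deriv k f (y + h *\<^sub>R axis j 1) - partial_deriv k f y" for k y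
    unfolding g_def using partial_deriv_comp_translate[OF df] df by (simp add: partial_deriv_diff)
  have dg: "g differentiable (at y)" for y
    unfolding g_def using partial_deriv_comp_translate(2)[OF df] df by (intro differentiable_diff)
  have "\<exists>s. 0 < s \<and> s < h \<and> g (x + h *\<^sub>R axis i 1) - g (x + 0 *\<^sub>R axis i 1)
      = (h - 0) * partial_deriv i g (x + s *\<^sub>R axis i 1)"
    by (rule MVT2[OF h has_real_derivative_line]) (rule dg)
  then obtain s where s: "0 < s" "s < h"
    "g (x + h *\<^sub>R axis i 1) - g x = h * partial_deriv i g (x + s *\<^sub>R axis i 1)" by auto
  obtain t where t: "0 < t" "t < h"
    "partial_deriv i f (x + s *\<^sub>R axis i 1 + h *\<^sub>R axis j 1) - partial_deriv i f (x + s *\<^sub>R axis i 1)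
      = h * partial_deriv j (partial_deriv i f) (x + s *\<^sub>R axis i 1 + t *\<^sub>R axis j 1)"
    by (rule Ck_on_mean_value[OF f2 h])
  have "norm (s *\<^sub>R axis i 1 + t *\<^sub>R axis j (1::real)) \<le> 2 * h"
    using s t norm_triangle_ineq[of "s *\<^sub>R axis i (1::real)" "t *\<^sub>R axis j 1"] by simp
  then show ?thesis
    by (intro exI[of _ "x + s *\<^sub>R axis i 1 + t *\<^sub>R axis j 1"])
       (use s t pg in \<open>auto simp: g_def power2_eq_square add.assoc\<close>)
qed

text \<open>Schwarz's theorem: the second difference divided by h^2 converges to either mixed
  derivative, by continuity of the second derivatives along the intermediate points.\<close>

lemma partial_deriv_commute:
  assumes f: "Ck_on 2 UNIV f"
  shows "partial_deriv i (partial_deriv j f) x = partial_deriv j (partial_deriv i f) x"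
proof -
  define h where "h n = inverse (real (Suc n))" for n
  have h: "h n > 0" for n by (simp add: h_def)
  have h0: "(\<lambda>n. 2 * h n) \<longlonglongrightarrow> 0"
    unfolding h_def using tendsto_mult[OF tendsto_const[of 2] LIMSEQ_inverse_real_of_nat] by simp
  define S where "S i j n = f (x + h n *\<^sub>R axis i 1 + h n *\<^sub>R axis j 1) - f (x + h n *\<^sub>R axis i 1)
    - f (x + h n *\<^sub>R axis j 1) + f x" for i j n
  have "(\<lambda>n. S i j n / (h n)\<^sup>2) \<longlonglongrightarrow> partial_deriv j (partial_deriv i f) x" for i j
  proof -
    have cont: "continuous_on UNIV (partial_deriv j (partial_deriv i f))"
      using f by (simp add: numeral_2_eq_2)
    have "\<forall>n. \<exists>p. norm (p - x) \<le> 2 * h n \<and> S i j n = (h n)\<^sup>2 * partial_deriv j (partial_deriv i f) p"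
      using Ck_on_second_difference[OF f h] unfolding S_def by blast
    from choice[OF this] obtain p where p: "\<And>n. norm (p n - x) \<le> 2 * h n"
      "\<And>n. S i j n = (h n)\<^sup>2 * partial_deriv j (partial_deriv i f) (p n)" by blast
    have "(\<lambda>n. p n - x) \<longlonglongrightarrow> 0"
      by (rule Lim_null_comparison[OF always_eventually h0]) (use p(1) in blast)
    then have "p \<longlonglongrightarrow> x" by (simp add: LIM_zero_iff)
    then have "(\<lambda>n. partial_deriv j (partial_deriv i f) (p n)) \<longlonglongrightarrow> partial_deriv j (partial_deriv i f) x"
      using continuous_on_tendsto_compose[OF cont] by simp
    moreover have "S i j n / (h n)\<^sup>2 = partial_deriv j (partial_deriv i f) (p n)" for n
      using h[of n] by (simp add: p(2))
    ultimately show ?thesis by simp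
  qed
  moreover have "S i j = S j i"
    by (rule ext) (simp add: S_def algebra_simps)
  ultimately show ?thesis using LIMSEQ_unique by metis
qed

section \<open>Compactly supported functions: closure properties and integrals\<close>

lemma Cc_le: "f \<in> Cc l \<Omega> \<Longrightarrow> k \<le> l \<Longrightarrow> f \<in> Cc k \<Omega>"
  unfolding Cc_def using Ck_on_le by blast

lemma Cc_inf_imp_Cc: "f \<in> Cc_inf \<Omega> \<Longrightarrow> f \<in> Cc k \<Omega>"
  by (simp add: Cc_inf_def)

lemma Cc_continuous: "f \<in> Cc k \<Omega> \<Longrightarrow> continuous_on UNIV f"
  using Cc_le[of f k \<Omega> 0] by (simp add: Cc_def)

lemma Cc_differentiable: "f \<in> Cc (Suc k) \<Omega> \<Longrightarrow> f differentiable (at x)"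
  by (rule Ck_on_SucD[of k UNIV]) (auto simp: Cc_def)

lemma Cc_support:
  assumes "f \<in> Cc k \<Omega>"
  shows "\<exists>K. compact K \<and> K \<subseteq> \<Omega> \<and> (\<forall>x. x \<notin> K \<longrightarrow> f x = 0)"
  by (rule exI[of _ "closure {x. f x \<noteq> 0}"])
     (use assms closure_subset[of "{x. f x \<noteq> 0}"] in \<open>auto simp: Cc_def\<close>)

lemma partial_deriv_zero_outside:
  assumes "compact K" "\<And>x. x \<notin> K \<Longrightarrow> f x = 0" "x \<notin> K"
  shows "partial_deriv i f x = 0"
  using partial_deriv_cong_open[of "- K" x f "\<lambda>_. 0" i] assms
  by (auto simp: compact_imp_closed open_Compl)

lemma Cc_partial_deriv: "f \<in> Cc (Suc k) \<Omega> \<Longrightarrow> partial_deriv i f \<in> Cc k \<Omega>"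
proof -
  assume f: "f \<in> Cc (Suc k) \<Omega>"
  obtain K where "compact K" "K \<subseteq> \<Omega>" "\<And>x. x \<notin> K \<Longrightarrow> f x = 0" using Cc_support[OF f] by blast
  then show ?thesis
    using f by (intro Cc_I[of k _ K] partial_deriv_zero_outside[of K f]) (auto simp: Cc_def)
qed

lemma Cc_inf_partial_deriv: "f \<in> Cc_inf \<Omega> \<Longrightarrow> partial_deriv i f \<in> Cc_inf \<Omega>"
  unfolding Cc_inf_def using Cc_partial_deriv by blast

text \<open>The values of f outside \<Omega> are multiplied by zero. This admits weights such as
  powers of \<delta>, which are regular only inside \<Omega>, as factors.\<close>

lemma Cc_mult:
  assumes "open \<Omega>" "Ck_on k \<Omega> f" "g \<in> Cc k \<Omega>"
  shows "(\<lambda>x. f x * g x) \<in> Cc k \<Omega>"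
proof -
  obtain K where K: "compact K" "K \<subseteq> \<Omega>" "\<And>x. x \<notin> K \<Longrightarrow> g x = 0" using Cc_support[OF assms(3)] by blast
  have g: "Ck_on k UNIV g" using assms(3) by (simp add: Cc_def)
  have opK: "open (- K)" using K(1) by (simp add: compact_imp_closed open_Compl)
  have "Ck_on k (- K) (\<lambda>x. f x * g x)"
    by (rule Ck_on_cong[OF opK, of "\<lambda>_. 0"]) (use K(3) in simp_all)
  moreover have "Ck_on k \<Omega> (\<lambda>x. f x * g x)"
    by (intro Ck_on_mult assms Ck_on_subset[OF g] subset_UNIV)
  ultimately have "Ck_on k (\<Omega> \<union> - K) (\<lambda>x. f x * g x)"
    by (intro Ck_on_Un assms(1) opK)
  moreover have "\<Omega> \<union> - K = UNIV" using K(2) by blast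
  ultimately have "Ck_on k UNIV (\<lambda>x. f x * g x)" by simp
  then show ?thesis by (rule Cc_I[OF _ K(1,2)]) (simp add: K(3))
qed

lemma Cc_diff: "f \<in> Cc k \<Omega> \<Longrightarrow> g \<in> Cc k \<Omega> \<Longrightarrow> (\<lambda>x. f x - g x) \<in> Cc k \<Omega>"
proof -
  assume f: "f \<in> Cc k \<Omega>" and g: "g \<in> Cc k \<Omega>"
  obtain K where K: "compact K" "K \<subseteq> \<Omega>" "\<And>x. x \<notin> K \<Longrightarrow> f x = 0" using Cc_support[OF f] by blast
  obtain L where L: "compact L" "L \<subseteq> \<Omega>" "\<And>x. x \<notin> L \<Longrightarrow> g x = 0" using Cc_support[OF g] by blast
  show ?thesis
  proof (rule Cc_I)
    show "Ck_on k UNIV (\<lambda>x. f x - g x)" using f g by (intro Ck_on_diff) (simp_all add: Cc_def)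
    show "compact (K \<union> L)" "K \<union> L \<subseteq> \<Omega>" using K L by blast+
    show "f x - g x = 0" if "x \<notin> K \<union> L" for x using K(3)[of x] L(3)[of x] that by simp
  qed
qed

lemma integrable_continuous_compact_support:
  fixes f :: "'a::euclidean_space \<Rightarrow> real"
  assumes "continuous_on UNIV f" "compact K" "\<And>x. x \<notin> K \<Longrightarrow> f x = 0"
  shows "integrable lborel f"
proof -
  have "integrable lborel (\<lambda>x. indicator K x *\<^sub>R f x)"
    by (rule borel_integrable_compact) (use assms in \<open>auto intro: continuous_on_subset\<close>)
  moreover have "(\<lambda>x. indicator K x *\<^sub>R f x) = f"
  proof
    show "indicator K x *\<^sub>R f x = f x" for x using assms(3)[of x] by (cases "x \<in> K") auto
  qed
  ultimately show ?thesis by simp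
qed

lemma bounded_continuous_compact_support:
  fixes f :: "'a::euclidean_space \<Rightarrow> real"
  assumes "continuous_on UNIV f" "compact K" "\<And>x. x \<notin> K \<Longrightarrow> f x = 0"
  obtains M where "M > 0" "\<And>x. \<bar>f x\<bar> \<le> M"
proof -
  have "bounded (f ` K)"
    by (intro compact_imp_bounded compact_continuous_image assms continuous_on_subset[OF assms(1)]) auto
  then obtain M where "M > 0" "\<forall>x\<in>K. \<bar>f x\<bar> \<le> M" by (auto simp: bounded_pos)
  moreover have "\<bar>f x\<bar> \<le> M" for x
    using calculation assms(3)[of x] by (cases "x \<in> K") auto
  ultimately show ?thesis using that by blast
qed

lemma Cc_integrable: "f \<in> Cc k \<Omega> \<Longrightarrow> integrable lborel f"
  using Cc_support[of f k \<Omega>] integrable_continuous_compact_support[OF Cc_continuous] by blast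

lemma Cc_bounded: "f \<in> Cc k \<Omega> \<Longrightarrow> \<exists>M>0. \<forall>x. \<bar>f x\<bar> \<le> M"
proof -
  assume f: "f \<in> Cc k \<Omega>"
  obtain K where K: "compact K" "\<And>x. x \<notin> K \<Longrightarrow> f x = 0" using Cc_support[OF f] by blast
  obtain M where "M > 0" "\<And>x. \<bar>f x\<bar> \<le> M"
    by (rule bounded_continuous_compact_support[OF Cc_continuous[OF f] K]) auto
  then show ?thesis by blast
qed

lemma integral_lborel_translate:
  fixes f :: "'a::euclidean_space \<Rightarrow> real"
  assumes "f \<in> borel_measurable borel"
  shows "(LINT x|lborel. f (x + c)) = (LINT x|lborel. f x)"
proof -
  have "(LINT x|lborel. f x) = (LINT x|distr lborel borel ((+) c). f x)"
    by (simp add: lborel_distr_plus)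
  also have "\<dots> = (LINT x|lborel. f (c + x))"
    using assms by (intro integral_distr) auto
  finally show ?thesis by (simp add: add.commute)
qed

text \<open>The integrals of the difference quotients vanish by translation invariance.\<close>

lemma integral_partial_deriv_eq_0:
  assumes f: "f \<in> Cc 1 \<Omega>"
  shows "(LINT x|lborel. partial_deriv i f x) = 0"
proof -
  obtain K where K: "compact K" "\<And>x. x \<notin> K \<Longrightarrow> f x = 0" using Cc_support[OF f] by blast
  have cf: "continuous_on UNIV f" using Cc_continuous[OF f] .
  have df: "f differentiable (at x)" for x using Cc_differentiable[of f 0] f by simp
  have f1: "Ck_on 1 UNIV f" using f by (simp add: Cc_def)
  obtain M where M: "M > 0" "\<And>x. \<bar>partial_deriv i f x\<bar> \<le> M"
    using Cc_bounded[of "partial_deriv i f" 0 \<Omega>] Cc_partial_deriv[of f 0 \<Omega> i] f by auto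
  obtain R where R: "\<And>x. x \<in> K \<Longrightarrow> norm x \<le> R"
    using compact_imp_bounded[OF K(1)] by (auto simp: bounded_iff)
  define h where "h n = inverse (real (Suc n))" for n
  have h: "h n > 0" "h n \<le> 1" "real (Suc n) * h n = 1" for n
    by (simp_all add: h_def field_simps)
  define F where "F n x = real (Suc n) * (f (x + h n *\<^sub>R axis i 1) - f x)" for n x
  have cont: "continuous_on UNIV (\<lambda>x. f (x + c))" for c
    by (rule continuous_on_compose2[OF cf]) (auto intro!: continuous_intros)
  have int1: "integrable lborel (\<lambda>x. f (x + c))" for c
  proof (rule integrable_continuous_compact_support[OF cont])
    show "compact ((\<lambda>x. x - c) ` K)"
      by (intro compact_continuous_image continuous_intros K(1))
    show "f (x + c) = 0" if "x \<notin> (\<lambda>x. x - c) ` K" for x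
      using that K(2)[of "x + c"] by (metis add_diff_cancel image_eqI)
  qed
  \<comment> \<open>Since \<open>h n\<close> is at most 1, all difference quotients vanish outside
    the ball of radius R + 1; inside it the mean value theorem bounds them by the bound M of the
    derivative. This gives the integrable majorant.\<close>
  have bound: "norm (F n x) \<le> M * indicator (cball 0 (R + 1)) x" for n x
  proof (cases "norm x \<le> R + 1")
    case True
    obtain s where s: "f (x + h n *\<^sub>R axis i 1) - f x = h n * partial_deriv i f (x + s *\<^sub>R axis i 1)"
      using Ck_on_mean_value[OF f1 h(1)] by blast
    have "F n x = partial_deriv i f (x + s *\<^sub>R axis i 1)"
      unfolding F_def s using h(3)[of n] by (simp add: mult.assoc[symmetric])
    then show ?thesis using M(2) True by simp
  next
    case False
    then have "x \<notin> K" using R by force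
    moreover have "x + h n *\<^sub>R axis i 1 \<notin> K"
    proof
      assume "x + h n *\<^sub>R axis i 1 \<in> K"
      then have "norm (x + h n *\<^sub>R axis i 1) \<le> R" using R by blast
      moreover have "norm x \<le> norm (x + h n *\<^sub>R axis i 1) + norm (h n *\<^sub>R axis i (1::real))"
        using norm_triangle_ineq4[of "x + h n *\<^sub>R axis i 1" "h n *\<^sub>R axis i 1"] by simp
      ultimately show False using False h[of n] by simp
    qed
    ultimately show ?thesis using K(2) M(1) by (simp add: F_def)
  qed
  have "(\<lambda>n. LINT x|lborel. F n x) \<longlonglongrightarrow> (LINT x|lborel. partial_deriv i f x)"
  proof (rule integral_dominated_convergence[where w = "\<lambda>x. M * indicator (cball 0 (R + 1)) x"])
    show "partial_deriv i f \<in> borel_measurable lborel"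
      using Cc_continuous[OF Cc_partial_deriv[of f 0 \<Omega> i]] f borel_measurable_continuous_onI by simp
    show "F n \<in> borel_measurable lborel" for n
      unfolding F_def using cont[of "h n *\<^sub>R axis i 1"] cf
      by (intro borel_measurable_times borel_measurable_diff borel_measurable_const)
         (auto dest: borel_measurable_continuous_onI)
    show "integrable lborel (\<lambda>x. M * indicator (cball 0 (R + 1)) x :: real)"
      by (intro integrable_mult_right integrable_real_indicator) (use emeasure_lborel_cball_finite[of 0 "R + 1"] in \<open>auto simp: top.not_eq_extremum\<close>)
    show "AE x in lborel. (\<lambda>n. F n x) \<longlonglongrightarrow> partial_deriv i f x"
    proof (rule AE_I2)
      fix x
      have "((\<lambda>t. f (x + t *\<^sub>R axis i 1)) has_real_derivative partial_deriv i f x) (at 0)"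
        using has_real_derivative_line[of f x 0 i] df by simp
      then have "((\<lambda>t. (f (x + t *\<^sub>R axis i 1) - f x) / t) \<longlongrightarrow> partial_deriv i f x) (at 0)"
        by (simp add: has_field_derivative_iff)
      moreover have "filterlim h (at 0) sequentially"
        unfolding filterlim_at
      proof
        show "\<forall>\<^sub>F n in sequentially. h n \<in> UNIV \<and> h n \<noteq> 0"
          using h(1) by (intro always_eventually) (metis UNIV_I less_irrefl)
        show "h \<longlonglongrightarrow> 0" unfolding h_def[abs_def] by (rule LIMSEQ_inverse_real_of_nat)
      qed
      ultimately have "(\<lambda>n. (f (x + h n *\<^sub>R axis i 1) - f x) / h n) \<longlonglongrightarrow> partial_deriv i f x"
        by (rule filterlim_compose)
      then show "(\<lambda>n. F n x) \<longlonglongrightarrow> partial_deriv i f x"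
        by (simp add: F_def h_def divide_inverse mult.commute del: of_nat_Suc)
    qed
  qed (use bound in auto)
  moreover have "(LINT x|lborel. F n x) = 0" for n
    unfolding F_def using int1[of "h n *\<^sub>R axis i 1"] Cc_integrable[OF f]
      integral_lborel_translate[OF borel_measurable_continuous_onI[OF cf]] by simp
  ultimately show ?thesis by (simp add: LIMSEQ_const_iff)
qed

text \<open>Compact support of g is enough for the product to lie in \<open>Cc\<close>, and the
  derivative of a \<open>Cc\<close> function integrates to zero.\<close>

lemma integral_by_parts_Cc:
  assumes f: "Ck_on 1 UNIV f" and g: "g \<in> Cc 1 UNIV"
  shows "(LINT x|lborel. f x * partial_deriv i g x) = - (LINT x|lborel. partial_deriv i f x * g x)"
proof -
  have df: "f differentiable (at x)" for x using Ck_on_SucD[of 0 UNIV f x] f by simp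
  have dg: "g differentiable (at x)" for x using Cc_differentiable[of g 0] g by simp
  have cont: "continuous_on UNIV f" "continuous_on UNIV (partial_deriv i f)"
    using f Ck_on_le[OF f, of 0] by auto
  have "(LINT x|lborel. partial_deriv i (\<lambda>x. f x * g x) x) = 0"
    by (rule integral_partial_deriv_eq_0[OF Cc_mult[OF open_UNIV f g]])
  moreover have "partial_deriv i (\<lambda>x. f x * g x) = (\<lambda>x. partial_deriv i f x * g x + f x * partial_deriv i g x)"
    using partial_deriv_mult[OF df dg] by auto
  moreover have "(\<lambda>x. partial_deriv i f x * g x) \<in> Cc 0 UNIV"
    using cont Cc_le[OF g, of 0] by (intro Cc_mult) auto
  moreover have "(\<lambda>x. f x * partial_deriv i g x) \<in> Cc 0 UNIV"
    using cont Cc_partial_deriv[of g 0 UNIV] g by (intro Cc_mult) auto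
  ultimately show ?thesis
    using Cc_integrable[of "\<lambda>x. partial_deriv i f x * g x"] Cc_integrable[of "\<lambda>x. f x * partial_deriv i g x"]
    by (simp add: algebra_simps)
qed

text \<open>Carries integrals over \<Omega> to the whole space, where translation invariance and
  integration by parts are available.\<close>

lemma Cc_integral_lebesgue_on:
  assumes "open \<Omega>" "f \<in> Cc 0 \<Omega>"
  shows "(LINT x|lebesgue_on \<Omega>. f x) = (LINT x|lborel. f x)"
    "integrable (lebesgue_on \<Omega>) f"
proof -
  have "(\<lambda>x. indicator \<Omega> x *\<^sub>R f x) = f"
  proof
    show "indicator \<Omega> x *\<^sub>R f x = f x" for x
      using Cc_support[OF assms(2)] by (cases "x \<in> \<Omega>") auto
  qed
  moreover have m: "f \<in> borel_measurable borel"
    using Cc_continuous[OF assms(2)] borel_measurable_continuous_onI by blast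
  moreover have "\<Omega> \<inter> space lebesgue \<in> sets lebesgue" using assms(1) by (auto intro: borel_open)
  ultimately show "(LINT x|lebesgue_on \<Omega>. f x) = (LINT x|lborel. f x)" "integrable (lebesgue_on \<Omega>) f"
    using integral_completion[of f lborel] integrable_completion[of f lborel] Cc_integrable[OF assms(2)]
    by (simp_all add: integral_restrict_space integrable_restrict_space)
qed

section \<open>Uniqueness of weak derivatives\<close>

lemma loc_integrable_Cc_mult:
  assumes \<Omega>: "open \<Omega>" and g: "loc_integrable \<Omega> g" and \<phi>: "\<phi> \<in> Cc 0 \<Omega>"
  shows "integrable (lebesgue_on \<Omega>) (\<lambda>x. g x * \<phi> x)"
    and "(LINT x|lebesgue_on \<Omega>. g x * \<phi> x) = (LINT x|lebesgue. g x * \<phi> x)"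
proof -
  obtain K where K: "compact K" "K \<subseteq> \<Omega>" "\<And>x. x \<notin> K \<Longrightarrow> \<phi> x = 0" using Cc_support[OF \<phi>] by blast
  obtain M where M: "M > 0" "\<And>x. \<bar>\<phi> x\<bar> \<le> M" using Cc_bounded[OF \<phi>] by blast
  have mphi: "\<phi> \<in> borel_measurable lebesgue"
    using borel_measurable_continuous_onI[OF Cc_continuous[OF \<phi>]] by (intro measurable_completion) simp
  have gi: "integrable lebesgue (\<lambda>x. indicator K x *\<^sub>R g x)"
    using g K by (auto simp: loc_integrable_def set_integrable_def)
  have eq: "indicator \<Omega> x *\<^sub>R (g x * \<phi> x) = (indicator K x *\<^sub>R g x) * \<phi> x" for x
    using K(2) K(3)[of x] by (cases "x \<in> K") auto
  have eq': "(indicator K x *\<^sub>R g x) * \<phi> x = g x * \<phi> x" for x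
    using K(3)[of x] by (cases "x \<in> K") auto
  have int: "integrable lebesgue (\<lambda>x. (indicator K x *\<^sub>R g x) * \<phi> x)"
  proof (rule Bochner_Integration.integrable_bound[OF integrable_mult_left[OF gi, of M]])
    show "(\<lambda>x. (indicator K x *\<^sub>R g x) * \<phi> x) \<in> borel_measurable lebesgue"
      using borel_measurable_integrable[OF gi] mphi by (rule borel_measurable_times)
    show "AE x in lebesgue. norm ((indicator K x *\<^sub>R g x) * \<phi> x) \<le> norm ((indicator K x *\<^sub>R g x) * M)"
      using M by (intro AE_I2) (auto simp: abs_mult intro!: mult_left_mono)
  qed
  have \<Omega>s: "\<Omega> \<inter> space lebesgue \<in> sets lebesgue" using \<Omega> by auto
  show "integrable (lebesgue_on \<Omega>) (\<lambda>x. g x * \<phi> x)"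
    unfolding integrable_restrict_space[OF \<Omega>s] eq by (rule int)
  show "(LINT x|lebesgue_on \<Omega>. g x * \<phi> x) = (LINT x|lebesgue. g x * \<phi> x)"
    unfolding integral_restrict_space[OF \<Omega>s] eq eq' ..
qed

text \<open>Testing against bumps that converge to the indicator functions of boxes.\<close>

lemma integral_cbox_eq_0_if_orthogonal:
  assumes \<Omega>: "open \<Omega>" and g: "loc_integrable \<Omega> g"
    and orth: "\<And>\<phi>. \<phi> \<in> Cc_inf \<Omega> \<Longrightarrow> (LINT x|lebesgue_on \<Omega>. g x * \<phi> x) = 0"
    and sub: "cbox a b \<subseteq> \<Omega>"
  shows "(LINT x|lebesgue. indicator (box a b) x * g x) = 0"
proof -
  have gi: "integrable lebesgue (\<lambda>x. indicator (cbox a b) x *\<^sub>R g x)"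
    using g sub compact_cbox by (auto simp: loc_integrable_def set_integrable_def)
  define F where "F j x = g x * box_bump (real (Suc j)) a b x" for j x
  have z: "(LINT x|lebesgue. F j x) = 0" for j
    using orth[OF box_bump_Cc_inf[of "real (Suc j)", OF _ sub]]
      loc_integrable_Cc_mult(2)[OF \<Omega> g Cc_inf_imp_Cc[OF box_bump_Cc_inf[of "real (Suc j)", OF _ sub]]]
    by (simp add: F_def del: of_nat_Suc)
  have eq: "F j x = (indicator (cbox a b) x *\<^sub>R g x) * box_bump (real (Suc j)) a b x" for j x
    using box_bump_pos[of "real (Suc j)" a b x] box_subset_cbox[of a b]
    by (cases "x \<in> cbox a b") (auto simp: F_def)
  have mb: "box_bump s a b \<in> borel_measurable lebesgue" for s
    using Ck_on_box_bump[of 0 s a b]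
    by (intro measurable_completion) (simp add: borel_measurable_continuous_onI)
  have "(\<lambda>j. LINT x|lebesgue. F j x) \<longlonglongrightarrow> (LINT x|lebesgue. g x * indicator (box a b) x)"
  proof (rule integral_dominated_convergence[where w = "\<lambda>x. norm (indicator (cbox a b) x *\<^sub>R g x)"])
    have "(\<lambda>x. (indicator (cbox a b) x *\<^sub>R g x) * indicator (box a b) x) \<in> borel_measurable lebesgue"
      using borel_measurable_integrable[OF gi]
      by (rule borel_measurable_times) (rule borel_measurable_indicator, simp)
    moreover have "(\<lambda>x. (indicator (cbox a b) x *\<^sub>R g x) * indicator (box a b) x) = (\<lambda>x. g x * indicator (box a b) x)"
      using box_subset_cbox[of a b] by (auto simp: indicator_def fun_eq_iff)
    ultimately show "(\<lambda>x. g x * indicator (box a b) x) \<in> borel_measurable lebesgue" by simp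
    show "F j \<in> borel_measurable lebesgue" for j
      unfolding eq[abs_def] using borel_measurable_integrable[OF gi] mb by (rule borel_measurable_times)
    show "integrable lebesgue (\<lambda>x. norm (indicator (cbox a b) x *\<^sub>R g x))"
      using gi by (rule integrable_norm)
    show "AE x in lebesgue. norm (F j x) \<le> norm (indicator (cbox a b) x *\<^sub>R g x)" for j
      unfolding eq using box_bump_bounds[of "real (Suc j)" a b]
      by (intro AE_I2) (auto simp: abs_mult intro!: mult_left_le simp del: of_nat_Suc)
    show "AE x in lebesgue. (\<lambda>j. F j x) \<longlonglongrightarrow> g x * indicator (box a b) x"
      unfolding F_def by (intro AE_I2 tendsto_mult tendsto_const box_bump_tendsto)
  qed
  then show ?thesis by (simp add: z LIMSEQ_const_iff mult.commute)
qed

text \<open>The cubes of the Lebesgue differentiation theorem used below have their lower corner at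
  x instead of being centred there; small ones still lie in any given neighbourhood.\<close>

lemma cbox_cart_shift_subset:
  fixes x :: "real^'n::finite"
  assumes "open U" "x \<in> U"
  obtains d where "d > 0" "\<And>h. 0 < h \<Longrightarrow> h < d \<Longrightarrow> cbox x (x + h *\<^sub>R One) \<subseteq> U"
proof -
  obtain e where e: "e > 0" "ball x e \<subseteq> U" using assms open_contains_ball by blast
  have n: "norm (One :: real^'n) > 0" using nonzero_Basis by (auto simp: zero_less_norm_iff)
  show ?thesis
  proof (rule that[of "e / norm (One :: real^'n)"])
    show "e / norm (One :: real^'n) > 0" using e n by simp
    fix h :: real assume h: "0 < h" "h < e / norm (One :: real^'n)"
    show "cbox x (x + h *\<^sub>R One) \<subseteq> U"
    proof
      fix y assume y: "y \<in> cbox x (x + h *\<^sub>R One)"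
      have "norm (y - x) \<le> norm (h *\<^sub>R (One :: real^'n))"
        by (rule norm_le_componentwise) (use y h in \<open>auto simp: mem_box inner_diff_left inner_add_left\<close>)
      also have "\<dots> = h * norm (One :: real^'n)" using h by simp
      also have "\<dots> < e" using h n by (simp add: field_simps)
      finally have "dist x y < e" by (simp add: dist_norm norm_minus_commute)
      then show "y \<in> U" using e by auto
    qed
  qed
qed

text \<open>Fundamental lemma of the calculus of variations. The integrals of g over all boxes
  inside \<Omega> vanish, so Lebesgue differentiation gives g = 0 almost everywhere in each of them;
  countably many closed boxes cover \<Omega>, and their boundaries are negligible.\<close>

lemma AE_eq_0_if_orthogonal:
  fixes g :: "real^'n::finite \<Rightarrow> real"
  assumes \<Omega>: "open \<Omega>" and g: "loc_integrable \<Omega> g"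
    and orth: "\<And>\<phi>. \<phi> \<in> Cc_inf \<Omega> \<Longrightarrow> (LINT x|lebesgue_on \<Omega>. g x * \<phi> x) = 0"
  shows "AE x in lebesgue_on \<Omega>. g x = 0"
proof -
  have box0: "AE x in lebesgue. x \<in> box a b \<longrightarrow> g x = 0" if sub: "cbox a b \<subseteq> \<Omega>" for a b
  proof -
    \<comment> \<open>The truncation to the box is needed because g is only locally integrable in
      \<Omega>, whereas the differentiation theorem is applied to a function that is integrable on
      every box.\<close>
    define f where "f x = indicator (cbox a b) x *\<^sub>R g x" for x
    have fi: "integrable lebesgue f"
      unfolding f_def using g sub compact_cbox by (auto simp: loc_integrable_def set_integrable_def)
    have fs: "f absolutely_integrable_on S" if "S \<in> sets lebesgue" for S
      using fi that unfolding set_integrable_def by (rule integrable_mult_indicator[rotated])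
    have "f integrable_on cbox c d" for c d
      using fs[of "cbox c d"] set_lebesgue_integral_eq_integral(1) by auto
    then obtain N where N: "negligible N"
      "\<And>x e. \<lbrakk>x \<notin> N; 0 < e\<rbrakk> \<Longrightarrow> \<exists>d>0. \<forall>h. 0 < h \<and> h < d \<longrightarrow>
          norm (integral (cbox x (x + h *\<^sub>R One)) f /\<^sub>R h ^ DIM(real^'n) - f x) < e"
      using integrable_ccontinuous_explicit[of f] by blast
    have "g x = 0" if x: "x \<in> box a b" "x \<notin> N" for x
    proof -
      have "\<bar>f x\<bar> < e" if "e > 0" for e
      proof -
        obtain d where d: "d > 0" "\<forall>h. 0 < h \<and> h < d \<longrightarrow>
          norm (integral (cbox x (x + h *\<^sub>R One)) f /\<^sub>R h ^ DIM(real^'n) - f x) < e"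
          using N(2)[OF x(2) \<open>e > 0\<close>] by blast
        obtain d' where d': "d' > 0" "\<And>h. 0 < h \<Longrightarrow> h < d' \<Longrightarrow> cbox x (x + h *\<^sub>R One) \<subseteq> box a b"
          using cbox_cart_shift_subset[OF open_box x(1)] by blast
        define h where "h = min d d' / 2"
        have h: "0 < h" "h < d" "h < d'" using d d' by (auto simp: h_def)
        let ?c = "x + h *\<^sub>R One"
        have sub2: "cbox x ?c \<subseteq> box a b" using d'(2) h by blast
        have "integral (cbox x ?c) f = (LINT y|lebesgue. indicator (cbox x ?c) y *\<^sub>R f y)"
          using set_lebesgue_integral_eq_integral(2)[OF fs[of "cbox x ?c"]] by (simp add: set_lebesgue_integral_def)
        also have "\<dots> = (LINT y|lebesgue. indicator (box x ?c) y * g y)"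
        proof (rule integral_cong_AE)
          show "(\<lambda>y. indicator (cbox x ?c) y *\<^sub>R f y) \<in> borel_measurable lebesgue"
            using borel_measurable_integrable[OF fi] by (intro borel_measurable_scaleR borel_measurable_indicator) auto
          have "(\<lambda>y. indicator (box x ?c) y *\<^sub>R f y) \<in> borel_measurable lebesgue"
            using borel_measurable_integrable[OF fi] by (intro borel_measurable_scaleR borel_measurable_indicator) auto
          moreover have "(\<lambda>y. indicator (box x ?c) y *\<^sub>R f y) = (\<lambda>y. indicator (box x ?c) y * g y)"
            using sub2 box_subset_cbox[of x ?c] box_subset_cbox[of a b]
            by (auto simp: f_def indicator_def fun_eq_iff)
          ultimately show "(\<lambda>y. indicator (box x ?c) y * g y) \<in> borel_measurable lebesgue" by simp
          have "negligible (cbox x ?c - box x ?c)" by (rule negligible_frontier_interval)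
          then have "AE y in lebesgue. y \<notin> cbox x ?c - box x ?c"
            unfolding negligible_iff_null_sets by (rule AE_not_in)
          then show "AE y in lebesgue. indicator (cbox x ?c) y *\<^sub>R f y = indicator (box x ?c) y * g y"
            by (rule AE_mp) (use sub2 box_subset_cbox[of x ?c] box_subset_cbox[of a b] in
               \<open>intro AE_I2, auto simp: f_def indicator_def\<close>)
        qed
        also have "\<dots> = 0"
          by (rule integral_cbox_eq_0_if_orthogonal[OF \<Omega> g orth]) (use sub sub2 box_subset_cbox[of a b] in auto)
        finally have i0: "integral (cbox x ?c) f = 0" .
        have "norm (integral (cbox x ?c) f /\<^sub>R h ^ DIM(real^'n) - f x) < e"
          using d(2) h by blast
        then show ?thesis unfolding i0 by simp
      qed
      then have "f x = 0" by (metis abs_0 abs_abs less_irrefl zero_less_abs_iff)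
      then show ?thesis using x box_subset_cbox[of a b] by (auto simp: f_def)
    qed
    moreover have "AE x in lebesgue. x \<notin> N" using N(1) by (simp add: negligible_iff_null_sets AE_not_in)
    ultimately show ?thesis by (auto elim!: AE_mp)
  qed
  obtain D where D: "countable D" "D \<subseteq> Pow \<Omega>" "\<And>X. X \<in> D \<Longrightarrow> \<exists>a b. X = cbox a b" "\<Union>D = \<Omega>"
    using open_countable_Union_open_cbox[OF \<Omega>] by metis
  have "AE x in lebesgue. \<forall>X\<in>D. x \<in> X \<longrightarrow> g x = 0"
  proof (subst AE_ball_countable[OF D(1)], rule ballI)
    fix X assume X: "X \<in> D"
    then obtain a b where ab: "X = cbox a b" using D(3) by blast
    have "negligible (cbox a b - box a b)" by (rule negligible_frontier_interval)
    then have "AE y in lebesgue. y \<notin> cbox a b - box a b"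
      unfolding negligible_iff_null_sets by (rule AE_not_in)
    moreover have "AE x in lebesgue. x \<in> box a b \<longrightarrow> g x = 0"
      by (rule box0) (use D X ab in blast)
    ultimately show "AE x in lebesgue. x \<in> X \<longrightarrow> g x = 0" by eventually_elim (auto simp: ab)
  qed
  then have "AE x in lebesgue. x \<in> \<Omega> \<longrightarrow> g x = 0" by (rule AE_mp) (use D(4) in \<open>intro AE_I2, blast\<close>)
  then show ?thesis using \<Omega> by (subst AE_restrict_space_iff) auto
qed

lemma loc_integrable_diff:
  "loc_integrable \<Omega> f \<Longrightarrow> loc_integrable \<Omega> g \<Longrightarrow> loc_integrable \<Omega> (\<lambda>x. f x - g x)"
  unfolding loc_integrable_def using set_integral_diff(1) by blast

lemma has_weak_deriv_unique:
  assumes "open \<Omega>" "has_weak_deriv \<Omega> \<eta> u g" "has_weak_deriv \<Omega> \<eta> u h"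
  shows "AE x in lebesgue_on \<Omega>. g x = h x"
proof -
  have l: "loc_integrable \<Omega> g" "loc_integrable \<Omega> h" using assms by (auto simp: has_weak_deriv_def)
  have "AE x in lebesgue_on \<Omega>. g x - h x = 0"
  proof (rule AE_eq_0_if_orthogonal[OF assms(1) loc_integrable_diff[OF l]])
    fix \<phi> assume \<phi>: "\<phi> \<in> Cc_inf \<Omega>"
    note i = loc_integrable_Cc_mult(1)[OF assms(1) l(1) Cc_inf_imp_Cc[OF \<phi>]]
      loc_integrable_Cc_mult(1)[OF assms(1) l(2) Cc_inf_imp_Cc[OF \<phi>]]
    have "(- 1) ^ mdeg \<eta> * (LINT x|lebesgue_on \<Omega>. g x * \<phi> x) = (- 1) ^ mdeg \<eta> * (LINT x|lebesgue_on \<Omega>. h x * \<phi> x)"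
      using assms(2,3)[unfolded has_weak_deriv_def, THEN conjunct2, THEN conjunct2, THEN bspec, OF \<phi>]
      by simp
    then have "(LINT x|lebesgue_on \<Omega>. g x * \<phi> x) = (LINT x|lebesgue_on \<Omega>. h x * \<phi> x)" by simp
    then show "(LINT x|lebesgue_on \<Omega>. (g x - h x) * \<phi> x) = 0"
      using i by (simp add: left_diff_distrib)
  qed
  then show ?thesis by simp
qed

text \<open>\<open>weak_deriv\<close> is a representative obtained by choice; uniqueness pins it
  down up to a null set, so under integrals it may be exchanged for any candidate.\<close>

lemma weak_deriv_AE:
  assumes "open \<Omega>" "has_weak_deriv \<Omega> \<eta> u g"
  shows "AE x in lebesgue_on \<Omega>. weak_deriv \<Omega> \<eta> u x = g x"
    and "has_weak_deriv \<Omega> \<eta> u (weak_deriv \<Omega> \<eta> u)"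
proof -
  show *: "has_weak_deriv \<Omega> \<eta> u (weak_deriv \<Omega> \<eta> u)"
    unfolding weak_deriv_def using assms(2) by (rule someI[where P = "has_weak_deriv \<Omega> \<eta> u"])
  show "AE x in lebesgue_on \<Omega>. weak_deriv \<Omega> \<eta> u x = g x"
    by (rule has_weak_deriv_unique[OF assms(1) * assms(2)])
qed

section \<open>Multi-indices of order at most two\<close>

lemma mdeg_mi: "mdeg (\<lambda>_::'n::finite. 0) = 0" "mdeg (mi1 i) = 1" "mdeg (mi2 i j) = 2"
  by (simp_all add: mdeg_def mi1_def mi2_def sum.distrib of_bool_def)

lemma mi_apply:
  "mi1 i k = (if k = i then 1 else 0)"
  "mi2 i j k = (if k = i then 1 else 0) + (if k = j then 1 else 0)"
  by (simp_all add: mi1_def mi2_def)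

lemma mindex_list_length: "\<forall>i. count_list is i = \<eta> i \<Longrightarrow> length is = mdeg \<eta>"
  using sum_count_set[of "is" UNIV] by (simp add: mdeg_def)

lemma ex_mindex_list: "\<exists>is. \<forall>i. count_list is i = (\<eta>::'n::finite mindex) i"
proof -
  obtain xs :: "'n list" where xs: "mset xs = (\<Sum>i\<in>UNIV. replicate_mset (\<eta> i) i)"
    using ex_mset by blast
  have "count (mset xs) k = \<eta> k" for k
    unfolding xs by (simp add: count_sum if_distrib cong: if_cong)
  then show ?thesis by (intro exI[of _ xs]) (simp add: count_mset)
qed

lemma mindex_list: "\<forall>i. count_list (SOME is. \<forall>i. count_list is i = (\<eta>::'n::finite mindex) i) i = \<eta> i"
  by (rule someI_ex) (rule ex_mindex_list)

lemma mderiv_0: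
  fixes f :: "real^'n::finite \<Rightarrow> real"
  shows "mderiv (\<lambda>_. 0) f = f"
proof -
  have "(SOME is. \<forall>i::'n. count_list is i = 0) = []"
    using mindex_list_length[OF mindex_list, of "\<lambda>_. 0"] by (simp add: mdeg_mi)
  then show ?thesis unfolding mderiv_def by simp
qed

lemma mderiv_mi1: "mderiv (mi1 i) f = partial_deriv i f"
proof -
  define xs where "xs = (SOME is. \<forall>k. count_list is k = mi1 i k)"
  have c: "\<forall>k. count_list xs k = mi1 i k" unfolding xs_def by (rule mindex_list)
  have "length xs = 1" using mindex_list_length[OF c] by (simp add: mdeg_mi)
  then obtain k where k: "xs = [k]" by (auto simp: length_Suc_conv)
  have "count_list [k] k = mi1 i k" using c unfolding k by blast
  then have "k = i" by (simp add: mi_apply split: if_splits)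
  then show ?thesis by (simp add: mderiv_def xs_def[symmetric] k)
qed

text \<open>\<open>mderiv\<close> picks some list with the right multiplicities, so it may
  differentiate in either order; symmetry of the second derivatives removes the choice, which is
  where C^2 enters.\<close>

lemma mderiv_mi2:
  assumes "Ck_on 2 UNIV f"
  shows "mderiv (mi2 i j) f = partial_deriv i (partial_deriv j f)"
proof -
  define xs where "xs = (SOME is. \<forall>k. count_list is k = mi2 i j k)"
  have c: "\<forall>k. count_list xs k = mi2 i j k" unfolding xs_def by (rule mindex_list)
  have "length xs = 2" using mindex_list_length[OF c] by (simp add: mdeg_mi)
  then obtain k l where k: "xs = [k, l]" by (auto simp: length_Suc_conv numeral_2_eq_2)
  have m: "mderiv (mi2 i j) f = partial_deriv k (partial_deriv l f)"
    unfolding mderiv_def xs_def[symmetric] k by simp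
  have "mset xs = {#i, j#}"
    by (rule multiset_eqI) (simp add: count_mset c mi_apply)
  then have "{#k, l#} = {#i, j#}" unfolding k by simp
  then have "(k = i \<and> l = j) \<or> (k = j \<and> l = i)"
    by (auto simp: add_eq_conv_ex)
  then show ?thesis
  proof
    assume "k = i \<and> l = j"
    then show ?thesis using m by simp
  next
    assume *: "k = j \<and> l = i"
    show ?thesis
      by (rule ext) (use * in \<open>simp only: m partial_deriv_commute[OF assms, of j i]\<close>)
  qed
qed

lemma mindex_le_2_cases:
  fixes \<eta> :: "'n::finite mindex"
  assumes "mdeg \<eta> \<le> 2"
  obtains "\<eta> = (\<lambda>_. 0)" | i where "\<eta> = mi1 i" | i j where "\<eta> = mi2 i j"
proof -
  obtain xs where c: "\<forall>k. count_list xs k = \<eta> k" using ex_mindex_list by blast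
  have e: "\<eta> k = count_list xs k" for k using c by simp
  have "length xs \<le> 2" using mindex_list_length[OF c] assms by simp
  then consider "xs = []" | i where "xs = [i]" | i j where "xs = [i, j]"
    by (cases xs rule: remdups_adj.cases) auto
  then show ?thesis
  proof cases
    case 1
    then show ?thesis using e by (intro that(1)) (simp add: fun_eq_iff)
  next
    case (2 i)
    then have "\<eta> = mi1 i" using e by (simp add: fun_eq_iff mi_apply)
    then show ?thesis by (rule that(2))
  next
    case (3 i j)
    then have "\<eta> = mi2 i j" using e by (simp add: fun_eq_iff mi_apply)
    then show ?thesis by (rule that(3))
  qed
qed

lemma Cc_mderiv: "f \<in> Cc 2 \<Omega> \<Longrightarrow> mdeg \<eta> \<le> 2 \<Longrightarrow> mderiv \<eta> f \<in> Cc 0 \<Omega>"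
proof (erule mindex_le_2_cases[of \<eta>])
  assume f: "f \<in> Cc 2 \<Omega>"
  then have f2: "Ck_on 2 UNIV f" by (simp add: Cc_def)
  show "mderiv \<eta> f \<in> Cc 0 \<Omega>" if "\<eta> = (\<lambda>_. 0)"
    using that Cc_le[OF f] by (simp add: mderiv_0)
  show "mderiv \<eta> f \<in> Cc 0 \<Omega>" if "\<eta> = mi1 i" for i
  proof -
    have "partial_deriv i f \<in> Cc (Suc 0) \<Omega>" using f by (intro Cc_partial_deriv) (simp add: numeral_2_eq_2)
    then show ?thesis using Cc_le[of _ "Suc 0" \<Omega> 0] by (simp add: that mderiv_mi1)
  qed
  show "mderiv \<eta> f \<in> Cc 0 \<Omega>" if "\<eta> = mi2 i j" for i j
  proof -
    have "partial_deriv j f \<in> Cc (Suc 0) \<Omega>" using f by (intro Cc_partial_deriv) (simp add: numeral_2_eq_2)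
    then have "partial_deriv i (partial_deriv j f) \<in> Cc 0 \<Omega>" by (rule Cc_partial_deriv)
    then show ?thesis by (simp add: that mderiv_mi2[OF f2])
  qed
qed

lemma Cc_loc_integrable: "f \<in> Cc 0 \<Omega> \<Longrightarrow> loc_integrable \<Omega> f"
  unfolding loc_integrable_def
proof (intro allI impI)
  fix K assume f: "f \<in> Cc 0 \<Omega>" and K: "compact K \<and> K \<subseteq> \<Omega>"
  have "integrable lebesgue f"
    using Cc_integrable[OF f] integrable_completion[of f lborel] borel_measurable_integrable by blast
  then show "set_integrable lebesgue K f"
    unfolding set_integrable_def using K by (intro integrable_mult_indicator) (auto simp: compact_imp_closed)
qed

lemma Cc_has_weak_deriv:
  assumes \<Omega>: "open \<Omega>" and f: "f \<in> Cc 2 \<Omega>" and "mdeg \<eta> \<le> 2"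
  shows "has_weak_deriv \<Omega> \<eta> f (mderiv \<eta> f)"
proof -
  have f2: "Ck_on 2 UNIV f" using f by (simp add: Cc_def)
  have f1: "Ck_on 1 UNIV f" by (rule Ck_on_le[OF f2]) simp
  have pf: "Ck_on 1 UNIV (partial_deriv i f)" for i using f2 by (simp add: numeral_2_eq_2)
  have f0: "f \<in> Cc 0 \<Omega>" using Cc_le[OF f] by simp
  have "(LINT x|lebesgue_on \<Omega>. f x * mderiv \<eta> \<phi> x) = (- 1) ^ mdeg \<eta> * (LINT x|lebesgue_on \<Omega>. mderiv \<eta> f x * \<phi> x)"
    if \<phi>: "\<phi> \<in> Cc_inf \<Omega>" for \<phi>
  proof -
    have U: "\<psi> \<in> Cc k UNIV" if "\<psi> \<in> Cc_inf \<Omega>" for \<psi> k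
      using Cc_inf_imp_Cc[OF that, of k] by (simp add: Cc_def)
    have c0: "Ck_on 0 \<Omega> \<psi>" if "\<psi> \<in> Cc 0 \<Omega>" for \<psi>
      using that by (auto simp: Cc_def intro: continuous_on_subset)
    have "mderiv \<eta> \<phi> \<in> Cc 0 \<Omega>"
      by (rule Cc_mderiv[OF Cc_inf_imp_Cc[OF \<phi>] assms(3)])
    then have "(LINT x|lebesgue_on \<Omega>. f x * mderiv \<eta> \<phi> x) = (LINT x|lborel. f x * mderiv \<eta> \<phi> x)"
      by (intro Cc_integral_lebesgue_on(1)[OF \<Omega>] Cc_mult[OF \<Omega>] c0[OF f0])
    moreover have "(LINT x|lebesgue_on \<Omega>. mderiv \<eta> f x * \<phi> x) = (LINT x|lborel. mderiv \<eta> f x * \<phi> x)"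
      by (intro Cc_integral_lebesgue_on(1)[OF \<Omega>] Cc_mult[OF \<Omega>] c0 Cc_mderiv f assms Cc_inf_imp_Cc[OF \<phi>])
    moreover have "(LINT x|lborel. f x * mderiv \<eta> \<phi> x) = (- 1) ^ mdeg \<eta> * (LINT x|lborel. mderiv \<eta> f x * \<phi> x)"
      using assms(3)
    proof (cases rule: mindex_le_2_cases)
      case 1
      then show ?thesis by (simp add: mderiv_0 mdeg_mi)
    next
      case (2 i)
      then show ?thesis using integral_by_parts_Cc[OF f1 U[OF \<phi>], of i] by (simp add: mderiv_mi1 mdeg_mi)
    next
      case (3 i j)
      have "Ck_on 2 UNIV \<phi>" using U[OF \<phi>, of 2] by (simp add: Cc_def)
      then have "(LINT x|lborel. f x * mderiv \<eta> \<phi> x) = (LINT x|lborel. f x * partial_deriv i (partial_deriv j \<phi>) x)"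
        using 3 by (simp add: mderiv_mi2)
      also have "\<dots> = - (LINT x|lborel. partial_deriv i f x * partial_deriv j \<phi> x)"
        by (rule integral_by_parts_Cc[OF f1 U[OF Cc_inf_partial_deriv[OF \<phi>]]])
      also have "\<dots> = (LINT x|lborel. partial_deriv j (partial_deriv i f) x * \<phi> x)"
        using integral_by_parts_Cc[OF pf U[OF \<phi>], of i j] by simp
      also have "\<dots> = (LINT x|lborel. mderiv \<eta> f x * \<phi> x)"
        using 3 partial_deriv_commute[OF f2] by (simp add: mderiv_mi2[OF f2])
      finally show ?thesis using 3 by (simp add: mdeg_mi)
    qed
    ultimately show ?thesis by simp
  qed
  moreover have "loc_integrable \<Omega> (mderiv \<eta> f)" "loc_integrable \<Omega> f"
    by (intro Cc_loc_integrable Cc_mderiv f f0 assms)+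
  ultimately show ?thesis unfolding has_weak_deriv_def by blast
qed

section \<open>Mollification\<close>

lemma partial_deriv_reflect:
  assumes "f differentiable (at (x - z))"
  shows "partial_deriv i (\<lambda>z. f (x - z)) z = - partial_deriv i f (x - z)"
    and "(\<lambda>z. f (x - z)) differentiable (at z)"
proof -
  note f' = assms[unfolded frechet_derivative_works]
  have "((\<lambda>z. x - z) has_derivative (\<lambda>h. - h)) (at z)"
    by (auto intro!: derivative_eq_intros)
  then have *: "((\<lambda>z. f (x - z)) has_derivative (\<lambda>h. frechet_derivative f (at (x - z)) (- h))) (at z)"
    using diff_chain_at[of "\<lambda>z. x - z" "\<lambda>h. - h" z f] f' by (simp add: o_def)
  show "partial_deriv i (\<lambda>z. f (x - z)) z = - partial_deriv i f (x - z)"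
    using linear_frechet_derivative[OF assms]
    by (subst partial_deriv_eqI[OF *]) (simp add: partial_deriv_def linear_neg)
  show "(\<lambda>z. f (x - z)) differentiable (at z)" using * by (auto simp: differentiable_def)
qed

lemma integral_cbox_eq_lborel:
  fixes f :: "'a::euclidean_space \<Rightarrow> real"
  assumes "continuous_on UNIV f" "\<And>x. x \<notin> cbox a b \<Longrightarrow> f x = 0"
  shows "integral (cbox a b) f = (LINT x|lborel. f x)"
proof -
  have "integral (cbox a b) f = integral UNIV (\<lambda>x. if x \<in> cbox a b then f x else 0)"
    by (simp add: integral_restrict_UNIV)
  also have "(\<lambda>x. if x \<in> cbox a b then f x else 0) = f" using assms(2) by (auto simp: fun_eq_iff)
  also have "integral UNIV f = (LINT x|lborel. f x)"
    by (rule integral_lborel) (rule integrable_continuous_compact_support[OF assms(1) compact_cbox assms(2)])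
  finally show ?thesis .
qed

definition convolution :: "(real^'n::finite \<Rightarrow> real) \<Rightarrow> (real^'n \<Rightarrow> real) \<Rightarrow> real^'n \<Rightarrow> real" where
  "convolution f g x = (LINT z|lborel. f z * g (x - z))"

text \<open>The support of f lies in a fixed box, so the integral runs over a compact set and
  differentiation under the integral sign applies. The derivative falls on g, hence the convolution
  is as smooth as g even if f is merely continuous.\<close>

lemma
  fixes f g :: "real^'n::finite \<Rightarrow> real"
  assumes f: "f \<in> Cc 0 UNIV" and g: "Ck_on 1 UNIV g"
  shows partial_deriv_convolution: "partial_deriv i (convolution f g) = convolution f (partial_deriv i g)"
    and convolution_differentiable: "convolution f g differentiable (at x)"
proof -
  obtain K where K: "compact K" "\<And>x. x \<notin> K \<Longrightarrow> f x = 0" using Cc_support[OF f] by blast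
  obtain a where a: "K \<subseteq> cbox (- a) a"
    using bounded_subset_cbox_symmetric[OF compact_imp_bounded[OF K(1)]] by blast
  let ?B = "cbox (- a) a"
  have cf: "continuous_on S f" for S using Cc_continuous[OF f] continuous_on_subset by blast
  have cg: "continuous_on S g" "continuous_on S (partial_deriv i g)" for i S
    using g Ck_on_le[OF g, of 0] continuous_on_subset by auto
  have dg: "g differentiable (at x)" for x using Ck_on_SucD[of 0 UNIV g x] g by simp
  have conv: "convolution f h y = integral ?B (\<lambda>z. f z * h (y - z))" if h: "continuous_on UNIV h" for h y
    unfolding convolution_def
  proof (rule integral_cbox_eq_lborel[symmetric])
    show "continuous_on UNIV (\<lambda>z. f z * h (y - z))"
      by (intro continuous_on_mult cf continuous_on_compose2[OF h] continuous_intros) auto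
    show "f z * h (y - z) = 0" if "z \<notin> ?B" for z using that a K(2)[of z] by auto
  qed
  \<comment> \<open>\<open>leibniz_rule\<close> asks for the derivative in y as a jointly continuous
    map into the bounded linear functionals; L packages f times the gradient of g in this
    form.\<close>
  define L :: "real^'n \<Rightarrow> real^'n \<Rightarrow> (real^'n) \<Rightarrow>\<^sub>L real" where
    "L y z = (\<Sum>i\<in>UNIV. (f z * partial_deriv i g (y - z)) *\<^sub>R blinfun_inner_right (axis i 1))" for y z
  have L: "blinfun_apply (L y z) h = f z * (\<Sum>i\<in>UNIV. partial_deriv i g (y - z) * h $ i)" for y z h
    by (simp add: L_def blinfun.sum_left blinfun.scaleR_left inner_axis' sum_distrib_left mult.assoc)
  have Lc: "continuous_on (UNIV \<times> ?B) (\<lambda>(y, z). L y z)"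
    unfolding L_def split_beta
    by (intro continuous_intros continuous_on_compose2[OF cf[of UNIV]] continuous_on_compose2[OF cg(2)[of UNIV]]) auto
  have der: "((\<lambda>y. integral ?B (\<lambda>z. f z * g (y - z))) has_derivative integral ?B (L x)) (at x within UNIV)" for x
  proof (rule leibniz_rule[OF _ _ Lc])
    fix y z
    have "((\<lambda>y. g (y - z)) has_derivative (\<lambda>h. \<Sum>i\<in>UNIV. partial_deriv i g (y - z) * h $ i)) (at y)"
    proof -
      have "((\<lambda>y. y - z) has_derivative (\<lambda>h. h)) (at y)" by (auto intro!: derivative_eq_intros)
      from diff_chain_at[OF this has_derivative_partial_deriv[OF dg]] show ?thesis by (simp add: o_def)
    qed
    then have "((\<lambda>y. f z * g (y - z)) has_derivative (\<lambda>h. f z * (\<Sum>i\<in>UNIV. partial_deriv i g (y - z) * h $ i))) (at y)"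
      by (rule has_derivative_mult_right)
    then show "((\<lambda>y. f z * g (y - z)) has_derivative blinfun_apply (L y z)) (at y within UNIV)"
      unfolding L[abs_def] by simp
  next
    show "(\<lambda>z. f z * g (y - z)) integrable_on ?B" for y
      by (intro integrable_continuous continuous_on_mult cf continuous_on_compose2[OF cg(1)[of UNIV]] continuous_intros) auto
  qed auto
  have eq: "convolution f g = (\<lambda>y. integral ?B (\<lambda>z. f z * g (y - z)))"
    by (rule ext) (rule conv[OF cg(1)])
  show "convolution f g differentiable (at x)"
    unfolding eq differentiable_def using der[of x] by auto
  have Lint: "L x integrable_on ?B" for x
    unfolding L_def
    by (intro integrable_continuous continuous_intros cf continuous_on_compose2[OF cg(2)[of UNIV]]) auto
  show "partial_deriv i (convolution f g) = convolution f (partial_deriv i g)"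
  proof
    fix x
    have "partial_deriv i (convolution f g) x = blinfun_apply (integral ?B (L x)) (axis i 1)"
      unfolding eq using der[of x] by (intro partial_deriv_eqI) simp
    also have "\<dots> = integral ?B (\<lambda>z. blinfun_apply (L x z) (axis i 1))"
      by (rule blinfun_apply_integral[OF Lint])
    also have "(\<lambda>z. blinfun_apply (L x z) (axis i 1)) = (\<lambda>z. f z * partial_deriv i g (x - z))"
      by (simp add: L axis_def if_distrib cong: if_cong)
    also have "integral ?B \<dots> = convolution f (partial_deriv i g) x" by (rule conv[OF cg(2), symmetric])
    finally show "partial_deriv i (convolution f g) x = convolution f (partial_deriv i g) x" .
  qed
qed

lemma Ck_on_convolution:
  assumes f: "f \<in> Cc 0 UNIV" and g: "\<And>k. Ck_on k UNIV g"
  shows "Ck_on k UNIV (convolution f g)"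
  using g
proof (induction k arbitrary: g)
  case 0
  have "convolution f g differentiable_on UNIV"
    by (intro differentiable_at_imp_differentiable_on ballI convolution_differentiable[OF f 0])
  then show ?case by (simp add: differentiable_imp_continuous_on)
next
  case (Suc k)
  have "convolution f g differentiable_on UNIV"
    by (intro differentiable_at_imp_differentiable_on ballI convolution_differentiable[OF f Suc.prems])
  moreover have "Ck_on k UNIV (convolution f (partial_deriv i g))" for i
  proof (rule Suc.IH)
    show "Ck_on k UNIV (partial_deriv i g)" for k using Suc.prems[of "Suc k"] by simp
  qed
  ultimately show ?case by (simp add: partial_deriv_convolution[OF f Suc.prems])
qed

text \<open>Here the derivative falls on f. Integration by parts in z produces one sign, the
  reflection of z to x - z another, and they cancel. Thus the derivatives of a mollified function
  are the mollified derivatives.\<close>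

lemma partial_deriv_convolution_left:
  assumes f: "f \<in> Cc 1 UNIV" and g: "Ck_on 1 UNIV g"
  shows "partial_deriv i (convolution f g) x = convolution (partial_deriv i f) g x"
proof -
  have dg: "g differentiable (at x)" for x using Ck_on_SucD[of 0 UNIV g x] g by simp
  have cg: "continuous_on UNIV g" "continuous_on UNIV (partial_deriv i g)" for i
    using g Ck_on_le[OF g, of 0] by auto
  define s where "s z = g (x - z)" for z
  have ds: "s differentiable (at z)" "partial_deriv i s z = - partial_deriv i g (x - z)" for i z
    unfolding s_def using partial_deriv_reflect[OF dg] by blast+
  have "continuous_on UNIV (\<lambda>z. - partial_deriv i g (x - z))" for i
    by (intro continuous_intros continuous_on_compose2[OF cg(2)]) auto
  then have "continuous_on UNIV (partial_deriv i s)" for i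
    using ds(2)[of i] by (simp add: fun_eq_iff[symmetric] cong: continuous_on_cong)
  then have s1: "Ck_on 1 UNIV s"
    using ds(1) by (simp add: differentiable_at_imp_differentiable_on)
  have "partial_deriv i (convolution f g) x = convolution f (partial_deriv i g) x"
    using partial_deriv_convolution[OF Cc_le[OF f] g, of i] by simp
  also have "\<dots> = - (LINT z|lborel. partial_deriv i s z * f z)"
    by (simp add: convolution_def ds(2) mult.commute)
  also have "\<dots> = (LINT z|lborel. s z * partial_deriv i f z)"
    using integral_by_parts_Cc[OF s1 f, of i] by simp
  also have "\<dots> = convolution (partial_deriv i f) g x"
    by (simp add: convolution_def s_def mult.commute)
  finally show ?thesis .
qed

text \<open>A mollifier supported in the cube of half-side e. The customary scaling factor is absent
  because the normalisation divides by the actual integral.\<close>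

definition mollifier :: "real \<Rightarrow> real^'n::finite \<Rightarrow> real" where
  "mollifier e x = box_bump 1 (\<chi> i. - e) (\<chi> i. e) x / (LINT x|lborel. box_bump 1 (\<chi> i. - e) (\<chi> i. e :: real^'n) x)"

text \<open>A zero integral would make the nonnegative bump vanish almost everywhere, so that a
  nonempty open box would be negligible.\<close>

lemma integral_box_bump_pos:
  assumes "e > 0"
  shows "0 < (LINT x|lborel. box_bump 1 (\<chi> i. - e) (\<chi> i. e :: real^'n::finite) x)"
proof -
  let ?b = "box_bump 1 (\<chi> i. - e) (\<chi> i. e :: real^'n)"
  have "?b \<in> Cc_inf UNIV" by (rule box_bump_Cc_inf) auto
  then have i: "integrable lborel ?b" using Cc_integrable[OF Cc_inf_imp_Cc] by blast
  have "(LINT x|lborel. ?b x) \<noteq> 0"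
  proof
    assume "(LINT x|lborel. ?b x) = 0"
    then have "AE x in lborel. ?b x = 0"
      using integral_nonneg_eq_0_iff_AE[OF i AE_I2[OF box_bump_bounds(1)]] by blast
    then have "AE x in lborel. x \<notin> box (\<chi> i. - e) (\<chi> i. e :: real^'n)"
      by eventually_elim (use box_bump_pos[of 1] in auto)
    then have "box (\<chi> i. - e) (\<chi> i. e :: real^'n) \<in> null_sets lborel"
      by (subst AE_iff_null_sets) auto
    then have "negligible (box (\<chi> i. - e) (\<chi> i. e :: real^'n))"
      using negligible_iff_null_sets null_sets_completionI by blast
    moreover have "0 \<in> box (\<chi> i. - e) (\<chi> i. e :: real^'n)" using assms by (simp add: mem_box_cart)
    ultimately show False using open_not_negligible[OF open_box] by blast
  qed
  moreover have "(LINT x|lborel. ?b x) \<ge> 0" by (intro Bochner_Integration.integral_nonneg box_bump_bounds)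
  ultimately show ?thesis by linarith
qed

lemma Ck_on_mollifier: "Ck_on k UNIV (mollifier e :: real^'n::finite \<Rightarrow> real)"
  using Ck_on_mult[OF open_UNIV Ck_on_box_bump Ck_on_const, of k 1 "\<chi> i. - e" "\<chi> i. e :: real^'n"
      "inverse (LINT x|lborel. box_bump 1 (\<chi> i. - e) (\<chi> i. e :: real^'n) x)"]
  by (simp add: mollifier_def[abs_def] divide_inverse)

lemma mollifier_even: "mollifier e (- x) = mollifier e x"
  unfolding mollifier_def box_bump_def by (simp add: mult.commute add.commute)

lemma mollifier_nonneg: "mollifier e x \<ge> 0"
  unfolding mollifier_def by (intro divide_nonneg_nonneg Bochner_Integration.integral_nonneg box_bump_bounds)

lemma mollifier_nonzero:
  assumes "mollifier e x \<noteq> 0" shows "\<bar>x $ i\<bar> < e"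
proof -
  have "x \<in> box (\<chi> i. - e) (\<chi> i. e)"
    using assms box_bump_pos[of 1 "\<chi> i. - e" "\<chi> i. e" x] by (auto simp: mollifier_def)
  then show ?thesis by (auto simp: mem_box_cart abs_less_iff) (metis minus_less_iff)
qed

lemma mollifier_integral:
 fixes x :: "real^'n::finite"
  assumes "e > 0"
  shows "(LINT z|lborel. mollifier e (x - z)) = 1" "integrable lborel (\<lambda>z. mollifier e (x - z))"
proof -
  have sym: "mollifier e (x - z) = mollifier e (z + - x)" for z
    using mollifier_even[of e "x - z"] by (simp add: algebra_simps)
  have c: "continuous_on UNIV (mollifier e :: real^'n \<Rightarrow> real)" using Ck_on_mollifier[of 0 e] by simp
  have "(LINT z|lborel. mollifier e (x - z)) = (LINT z|lborel. mollifier e (z :: real^'n))"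
    unfolding sym by (rule integral_lborel_translate[OF borel_measurable_continuous_onI[OF c]])
  also have "\<dots> = 1" unfolding mollifier_def using integral_box_bump_pos[OF assms, where 'n = 'n] by simp
  finally show *: "(LINT z|lborel. mollifier e (x - z)) = 1" .
  \<comment> \<open>A non-integrable function has integral 0 by convention, so the value 1 already
    forces integrability.\<close>
  show "integrable lborel (\<lambda>z. mollifier e (x - z))"
    using * not_integrable_integral_eq by fastforce
qed

lemma norm_vec_lt_if_components:
  fixes y :: "real^'n::finite"
  assumes "\<And>i. \<bar>y $ i\<bar> < e / real CARD('n)" 
  shows "norm y < e"
proof -
  have "norm y \<le> (\<Sum>i\<in>UNIV. \<bar>y $ i\<bar>)" by (rule norm_le_l1_cart)
  also have "\<dots> < (\<Sum>i\<in>(UNIV::'n set). e / real CARD('n))"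
    using assms by (intro sum_strict_mono) auto
  finally show ?thesis by simp
qed

text \<open>The cube of half-side e / CARD('n) lies in the euclidean ball of radius e, because the
  norm is at most the sum of the absolute values of the coordinates. The mollifier is a probability
  density, so the average of g z - g x inherits the bound h.\<close>

lemma convolution_mollifier_close:
  fixes g :: "real^'n::finite \<Rightarrow> real"
  assumes e: "e > 0" and g: "g \<in> Cc 0 UNIV"
    and u: "\<And>x z. dist x z < e \<Longrightarrow> \<bar>g z - g x\<bar> \<le> h"
  shows "\<bar>convolution g (mollifier (e / real CARD('n))) x - g x\<bar> \<le> h"
proof -
  let ?m = "mollifier (e / real CARD('n)) :: real^'n \<Rightarrow> real"
  have e': "e / real CARD('n) > 0" using e by simp
  have cm: "continuous_on UNIV (\<lambda>z. ?m (x - z))"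
  proof (rule continuous_on_compose2[of UNIV ?m])
    show "continuous_on UNIV ?m" using Ck_on_mollifier[of 0 "e / real CARD('n)"] by simp
  qed (auto intro!: continuous_intros)
  have "(\<lambda>z. ?m (x - z) * g z) \<in> Cc 0 UNIV" by (rule Cc_mult[OF open_UNIV _ g]) (use cm in simp)
  then have i1: "integrable lborel (\<lambda>z. g z * ?m (x - z))" using Cc_integrable by (simp add: mult.commute)
  note i2 = mollifier_integral[OF e', of x]
  have "convolution g ?m x - g x = (LINT z|lborel. (g z - g x) * ?m (x - z))"
    using i1 i2 by (simp add: convolution_def left_diff_distrib)
  also have "\<bar>\<dots>\<bar> \<le> (LINT z|lborel. h * ?m (x - z))"
  proof (rule integral_abs_bound[THEN order_trans], rule integral_mono)
    show "integrable lborel (\<lambda>z. \<bar>(g z - g x) * ?m (x - z)\<bar>)"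
      using i1 i2 by (intro integrable_abs) (simp add: left_diff_distrib)
    show "integrable lborel (\<lambda>z. h * ?m (x - z))" using i2 by simp
    show "\<bar>(g z - g x) * ?m (x - z)\<bar> \<le> h * ?m (x - z)" for z
    proof (cases "?m (x - z) = 0")
      case False
      have "norm (x - z) < e"
        by (rule norm_vec_lt_if_components) (use mollifier_nonzero[OF False] in simp)
      then have "\<bar>g z - g x\<bar> \<le> h" by (intro u) (simp add: dist_norm)
      then show ?thesis using mollifier_nonneg[of _ "x - z"] by (simp add: abs_mult mult_right_mono)
    qed simp
  qed
  also have "\<dots> = h" using i2 by simp
  finally show ?thesis .
qed

lemma Cc_uniformly_continuous:
  assumes g: "g \<in> Cc 0 UNIV" and h: "h > 0"
  shows "\<exists>d>0. \<forall>e. 0 < e \<and> e < d \<longrightarrow> (\<forall>x z. dist x z < e \<longrightarrow> \<bar>g z - g x\<bar> \<le> h)"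
proof -
  obtain K where K: "compact K" "\<And>x. x \<notin> K \<Longrightarrow> g x = 0" using Cc_support[OF g] by blast
  obtain R where R: "\<And>x. x \<in> K \<Longrightarrow> norm x \<le> R" using compact_imp_bounded[OF K(1)] by (auto simp: bounded_iff)
  have "uniformly_continuous_on (cball 0 (R + 1)) g"
    by (intro compact_uniformly_continuous continuous_on_subset[OF Cc_continuous[OF g]]) auto
  then obtain d where d: "d > 0" "\<And>x z. x \<in> cball 0 (R + 1) \<Longrightarrow> z \<in> cball 0 (R + 1) \<Longrightarrow> dist z x < d \<Longrightarrow> dist (g z) (g x) < h"
    using h unfolding uniformly_continuous_on_def by blast
  have "\<bar>g z - g x\<bar> \<le> h" if xz: "dist x z < e" "e < min d 1" for x z e
  proof (cases "x \<in> K \<or> z \<in> K")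
    case True
    have "norm x \<le> norm z + dist x z" "norm z \<le> norm x + dist x z"
      using norm_triangle_sub[of x z] norm_triangle_sub[of z x] by (simp_all add: dist_norm norm_minus_commute)
    then have "norm x \<le> R + 1" "norm z \<le> R + 1" using True R[of x] R[of z] xz by auto
    then have "dist (g z) (g x) < h" using xz by (intro d(2)) (auto simp: dist_commute)
    then show ?thesis by (simp add: dist_real_def)
  next
    case False
    then show ?thesis using K(2) h by simp
  qed
  then show ?thesis using d(1) by (intro exI[of _ "min d 1"]) auto
qed

lemma finite_mindex_le_2: "finite {\<eta>::'n::finite mindex. mdeg \<eta> \<le> 2}"
proof -
  have "{\<eta>::'n mindex. mdeg \<eta> \<le> 2} \<subseteq> {\<lambda>_. 0} \<union> range mi1 \<union> range (\<lambda>(i, j). mi2 i j)"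
  proof
    fix \<eta> :: "'n mindex" assume "\<eta> \<in> {\<eta>. mdeg \<eta> \<le> 2}"
    then have "mdeg \<eta> \<le> 2" by simp
    then show "\<eta> \<in> {\<lambda>_. 0} \<union> range mi1 \<union> range (\<lambda>(i, j). mi2 i j)"
      by (cases rule: mindex_le_2_cases) (auto simp: image_iff)
  qed
  then show ?thesis by (rule finite_subset) simp
qed

lemma mderiv_convolution:
  assumes f: "f \<in> Cc 2 UNIV" and g: "\<And>k. Ck_on k UNIV g" and "mdeg \<eta> \<le> 2"
  shows "mderiv \<eta> (convolution f g) = convolution (mderiv \<eta> f) g"
  using assms(3)
proof (cases rule: mindex_le_2_cases)
  case 1
  then show ?thesis by (simp add: mderiv_0)
next
  case (2 i)
  have "partial_deriv i (convolution f g) = convolution (partial_deriv i f) g"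
    by (rule ext) (rule partial_deriv_convolution_left[OF Cc_le[OF f] g], simp)
  then show ?thesis using 2 by (simp add: mderiv_mi1)
next
  case (3 i j)
  have f2: "Ck_on 2 UNIV f" using f by (simp add: Cc_def)
  have 1: "partial_deriv j (convolution f g) = convolution (partial_deriv j f) g"
    by (rule ext) (rule partial_deriv_convolution_left[OF Cc_le[OF f] g], simp)
  have "partial_deriv j f \<in> Cc 1 UNIV" using f Cc_partial_deriv[of f 1 UNIV j] by (simp add: numeral_2_eq_2)
  then have 2: "partial_deriv i (convolution (partial_deriv j f) g) = convolution (partial_deriv i (partial_deriv j f)) g"
    by (intro ext partial_deriv_convolution_left g)
  have "Ck_on 2 UNIV (convolution f g)" by (rule Ck_on_convolution[OF Cc_le[OF f] g]) simp
  then show ?thesis using 3 by (simp add: mderiv_mi2 f2 1 2)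
qed

text \<open>This lets C^2 functions of compact support serve as approximants in \<open>H20\<close>,
  whose definition asks for smooth ones. Uniform closeness turns into L^2 closeness on a bounded
  \<Omega>.\<close>

lemma Cc_inf_dense_Cc:
  fixes f :: "real^'n::finite \<Rightarrow> real"
  assumes \<Omega>: "open \<Omega>" and f: "f \<in> Cc 2 \<Omega>" and h: "h > 0"
  shows "\<exists>\<psi>\<in>Cc_inf \<Omega>. \<forall>\<eta> x. mdeg \<eta> \<le> 2 \<longrightarrow> \<bar>mderiv \<eta> \<psi> x - mderiv \<eta> f x\<bar> \<le> h"
proof -
  obtain K where K: "compact K" "K \<subseteq> \<Omega>" "\<And>x. x \<notin> K \<Longrightarrow> f x = 0" using Cc_support[OF f] by blast
  have fU: "f \<in> Cc 2 UNIV" using f by (simp add: Cc_def)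
  obtain r where r: "r > 0" "(\<Union>x\<in>K. cball x r) \<subseteq> \<Omega>"
    using compact_subset_open_imp_cball_epsilon_subset[OF K(1) \<Omega> K(2)] by blast
  define D where "D = {\<eta>::'n mindex. mdeg \<eta> \<le> 2}"
  have "\<exists>d>0. \<forall>e. 0 < e \<and> e < d \<longrightarrow> (\<forall>x z. dist x z < e \<longrightarrow> \<bar>mderiv \<eta> f z - mderiv \<eta> f x\<bar> \<le> h)" if "\<eta> \<in> D" for \<eta>
    by (rule Cc_uniformly_continuous[OF Cc_mderiv[OF fU] h]) (use that in \<open>simp add: D_def\<close>)
  then obtain d where d: "\<And>\<eta>. \<eta> \<in> D \<Longrightarrow> d \<eta> > 0"
    "\<And>\<eta> e x z. \<eta> \<in> D \<Longrightarrow> 0 < e \<Longrightarrow> e < d \<eta> \<Longrightarrow> dist x z < e \<Longrightarrow> \<bar>mderiv \<eta> f z - mderiv \<eta> f x\<bar> \<le> h"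
    by metis
  \<comment> \<open>The radius must stay below the moduli of continuity of finitely many derivatives
    and within the distance r by which the support may grow inside \<Omega>; halving the minimum
    makes the comparison with the moduli strict.\<close>
  define e where "e = Min (insert r (d ` D)) / 2"
  have fin: "finite (insert r (d ` D))" using finite_mindex_le_2[where 'n = 'n] unfolding D_def by blast
  have m0: "Min (insert r (d ` D)) > 0" using fin r d by (subst Min_gr_iff) auto
  have mr: "Min (insert r (d ` D)) \<le> r" by (rule Min_le[OF fin]) simp
  have md: "Min (insert r (d ` D)) \<le> d \<eta>" if "\<eta> \<in> D" for \<eta> by (rule Min_le[OF fin]) (use that in simp)
  have e: "e > 0" "e \<le> r" "\<And>\<eta>. \<eta> \<in> D \<Longrightarrow> e < d \<eta>"
    using m0 mr md unfolding e_def by fastforce+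
  let ?m = "mollifier (e / real CARD('n)) :: real^'n \<Rightarrow> real"
  define \<psi> where "\<psi> = convolution f ?m"
  have "\<psi> x = 0" if x: "x \<notin> {x + y |x y. x \<in> K \<and> y \<in> cball (0::real^'n) r}" for x
  proof -
    have "f z * ?m (x - z) = 0" for z
    proof (rule ccontr)
      assume "f z * ?m (x - z) \<noteq> 0"
      then have z: "f z \<noteq> 0" "?m (x - z) \<noteq> 0" by auto
      have "norm (x - z) < e" by (rule norm_vec_lt_if_components) (rule mollifier_nonzero[OF z(2)])
      then have "x - z \<in> cball 0 r" using e by simp
      moreover have "z \<in> K" using z K(3) by blast
      moreover have "x = z + (x - z)" by simp
      ultimately show False using x by blast
    qed
    then show ?thesis unfolding \<psi>_def convolution_def by (simp only: integral_zero)
  qed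
  moreover have "compact {x + y |x y. x \<in> K \<and> y \<in> cball (0::real^'n) r}"
    by (rule compact_sums[OF K(1) compact_cball])
  moreover have "{x + y |x y. x \<in> K \<and> y \<in> cball (0::real^'n) r} \<subseteq> \<Omega>"
  proof clarify
    fix x y :: "real^'n" assume xy: "x \<in> K" "y \<in> cball 0 r"
    then have "x + y \<in> cball x r" by (simp add: dist_norm)
    then show "x + y \<in> \<Omega>" using r(2) xy(1) by blast
  qed
  moreover have "Ck_on k UNIV \<psi>" for k
    unfolding \<psi>_def by (rule Ck_on_convolution[OF Cc_le[OF fU] Ck_on_mollifier]) simp_all
  ultimately have "\<psi> \<in> Cc k \<Omega>" for k by (intro Cc_I)
  then have "\<psi> \<in> Cc_inf \<Omega>" by (simp add: Cc_inf_def)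
  moreover have "\<bar>mderiv \<eta> \<psi> x - mderiv \<eta> f x\<bar> \<le> h" if \<eta>: "mdeg \<eta> \<le> 2" for \<eta> x
    unfolding \<psi>_def mderiv_convolution[OF fU Ck_on_mollifier \<eta>]
  proof (rule convolution_mollifier_close[OF e(1) Cc_mderiv[OF fU \<eta>]])
    have "\<eta> \<in> D" using \<eta> by (simp add: D_def)
    then show "\<bar>mderiv \<eta> f z - mderiv \<eta> f x\<bar> \<le> h" if "dist x z < e" for x z
      using d(2) e that by blast
  qed
  ultimately show ?thesis by blast
qed

section \<open>The space \<open>L\<^sup>2(\<Omega>)\<close>\<close>

lemma borel_measurable_lebesgue_on_AE:
  fixes f g :: "'a::euclidean_space \<Rightarrow> real"
  assumes "S \<in> sets lebesgue" "f \<in> borel_measurable (lebesgue_on S)" "AE x in lebesgue_on S. f x = g x"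
  shows "g \<in> borel_measurable (lebesgue_on S)"
proof -
  have S: "S \<inter> space lebesgue \<in> sets lebesgue" using assms(1) by simp
  have "(\<lambda>x. indicator S x *\<^sub>R f x) \<in> borel_measurable lebesgue"
    using assms(2) unfolding borel_measurable_restrict_space_iff[OF S] by simp
  moreover have "AE x in lebesgue. indicator S x *\<^sub>R f x = indicator S x *\<^sub>R g x"
    using assms(3) unfolding AE_restrict_space_iff[OF S] by eventually_elim (auto simp: indicator_def)
  ultimately have "(\<lambda>x. indicator S x *\<^sub>R g x) \<in> borel_measurable lebesgue"
    by (rule borel_measurable_AE)
  then show ?thesis unfolding borel_measurable_restrict_space_iff[OF S] by simp
qed

lemma L2_measurable: "f \<in> L2 \<Omega> \<Longrightarrow> f \<in> borel_measurable (lebesgue_on \<Omega>)"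
  by (simp add: L2_def)

lemma L2_integrable_mult:
  assumes "f \<in> L2 \<Omega>" "g \<in> L2 \<Omega>"
  shows "integrable (lebesgue_on \<Omega>) (\<lambda>x. f x * g x)"
proof (rule Bochner_Integration.integrable_bound)
  show "integrable (lebesgue_on \<Omega>) (\<lambda>x. (f x)\<^sup>2 + (g x)\<^sup>2)"
    using assms by (intro Bochner_Integration.integrable_add) (simp_all add: L2_def)
  show "(\<lambda>x. f x * g x) \<in> borel_measurable (lebesgue_on \<Omega>)"
    using assms by (intro borel_measurable_times L2_measurable)
  have "\<bar>a * b\<bar> \<le> a\<^sup>2 + b\<^sup>2" for a b :: real
  proof -
    have "2 * \<bar>a\<bar> * \<bar>b\<bar> \<le> a\<^sup>2 + b\<^sup>2" using sum_squares_bound[of "\<bar>a\<bar>" "\<bar>b\<bar>"] by simp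
    moreover have "0 \<le> \<bar>a\<bar> * \<bar>b\<bar>" by simp
    ultimately show ?thesis unfolding abs_mult by linarith
  qed
  then show "AE x in lebesgue_on \<Omega>. norm (f x * g x) \<le> norm ((f x)\<^sup>2 + (g x)\<^sup>2)"
    by (intro AE_I2) (simp add: abs_of_nonneg)
qed

lemma L2_I_bounded_square:
  assumes "f \<in> borel_measurable (lebesgue_on \<Omega>)" "g \<in> L2 \<Omega>"
    "AE x in lebesgue_on \<Omega>. \<bar>f x\<bar> \<le> C * \<bar>g x\<bar>"
  shows "f \<in> L2 \<Omega>"
proof -
  have "integrable (lebesgue_on \<Omega>) (\<lambda>x. (f x)\<^sup>2)"
  proof (rule Bochner_Integration.integrable_bound)
    show "integrable (lebesgue_on \<Omega>) (\<lambda>x. C\<^sup>2 * (g x)\<^sup>2)" using assms(2) by (simp add: L2_def)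
    show "AE x in lebesgue_on \<Omega>. norm ((f x)\<^sup>2) \<le> norm (C\<^sup>2 * (g x)\<^sup>2)"
      using assms(3)
    proof eventually_elim
      case (elim x)
      have "\<bar>f x\<bar>\<^sup>2 \<le> (C * \<bar>g x\<bar>)\<^sup>2" by (rule power_mono[OF elim]) simp
      then show ?case by (simp add: power_mult_distrib)
    qed
  qed (use assms(1) in measurable)
  then show ?thesis using assms(1) by (simp add: L2_def)
qed

lemma L2_add: "f \<in> L2 \<Omega> \<Longrightarrow> g \<in> L2 \<Omega> \<Longrightarrow> (\<lambda>x. f x + g x) \<in> L2 \<Omega>"
  using L2_integrable_mult[of f \<Omega> g] unfolding L2_def
  by (simp add: power2_sum mult.assoc borel_measurable_add)

lemma L2_scale: "f \<in> L2 \<Omega> \<Longrightarrow> (\<lambda>x. c * f x) \<in> L2 \<Omega>"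
  by (rule L2_I_bounded_square[of _ _ f "\<bar>c\<bar>"]) (auto simp: L2_def abs_mult)

lemma L2_diff: "f \<in> L2 \<Omega> \<Longrightarrow> g \<in> L2 \<Omega> \<Longrightarrow> (\<lambda>x. f x - g x) \<in> L2 \<Omega>"
  using L2_add[of f \<Omega> "\<lambda>x. (-1) * g x"] L2_scale[of g \<Omega> "-1"] by simp

lemma L2_zero: "(\<lambda>x. 0) \<in> L2 \<Omega>" by (simp add: L2_def)

lemma L2_sum: "(\<And>i. i \<in> I \<Longrightarrow> f i \<in> L2 \<Omega>) \<Longrightarrow> (\<lambda>x. \<Sum>i\<in>I. f i x) \<in> L2 \<Omega>"
  by (induction I rule: infinite_finite_induct) (auto intro: L2_add L2_zero)

lemma L2_cong_AE:
  assumes "\<Omega> \<in> sets lebesgue" "f \<in> L2 \<Omega>" "AE x in lebesgue_on \<Omega>. f x = g x"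
  shows "g \<in> L2 \<Omega>"
proof (rule L2_I_bounded_square[OF _ assms(2), of _ 1])
  show "g \<in> borel_measurable (lebesgue_on \<Omega>)"
    by (rule borel_measurable_lebesgue_on_AE[OF assms(1) L2_measurable[OF assms(2)] assms(3)])
  show "AE x in lebesgue_on \<Omega>. \<bar>g x\<bar> \<le> 1 * \<bar>f x\<bar>" using assms(3) by eventually_elim simp
qed

lemma L2_bounded_measurable:
  assumes "\<Omega> \<in> lmeasurable" "f \<in> borel_measurable (lebesgue_on \<Omega>)" "\<And>x. x \<in> \<Omega> \<Longrightarrow> \<bar>f x\<bar> \<le> h"
  shows "f \<in> L2 \<Omega>"
proof (rule L2_I_bounded_square[OF assms(2), of "\<lambda>_. 1" h])
  have "integrable (lebesgue_on \<Omega>) (\<lambda>x. 1 :: real)"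
    using assms(1) by (intro finite_measure.integrable_const finite_measure_lebesgue_on)
  then show "(\<lambda>_. 1) \<in> L2 \<Omega>" by (simp add: L2_def)
  show "AE x in lebesgue_on \<Omega>. \<bar>f x\<bar> \<le> h * \<bar>1\<bar>"
    using assms(3) by (intro AE_I2) (simp add: space_restrict_space)
qed

section \<open>Inner product and norm on square integrable functions\<close>

lemma L2_inner_commute: "L2_inner \<Omega> f g = L2_inner \<Omega> g f"
  by (simp add: L2_inner_def mult.commute)

lemma L2_inner_add_left:
  "f \<in> L2 \<Omega> \<Longrightarrow> g \<in> L2 \<Omega> \<Longrightarrow> h \<in> L2 \<Omega> \<Longrightarrow> L2_inner \<Omega> (\<lambda>x. f x + g x) h = L2_inner \<Omega> f h + L2_inner \<Omega> g h"
  unfolding L2_inner_def using L2_integrable_mult[of f \<Omega> h] L2_integrable_mult[of g \<Omega> h]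
  by (simp add: distrib_right)

lemma L2_inner_diff_left:
  "f \<in> L2 \<Omega> \<Longrightarrow> g \<in> L2 \<Omega> \<Longrightarrow> h \<in> L2 \<Omega> \<Longrightarrow> L2_inner \<Omega> (\<lambda>x. f x - g x) h = L2_inner \<Omega> f h - L2_inner \<Omega> g h"
  unfolding L2_inner_def using L2_integrable_mult[of f \<Omega> h] L2_integrable_mult[of g \<Omega> h]
  by (simp add: left_diff_distrib)

lemma L2_inner_scale_left: "L2_inner \<Omega> (\<lambda>x. c * f x) h = c * L2_inner \<Omega> f h"
  unfolding L2_inner_def by (simp add: mult.assoc)

lemma L2_inner_add_right:
  "f \<in> L2 \<Omega> \<Longrightarrow> g \<in> L2 \<Omega> \<Longrightarrow> h \<in> L2 \<Omega> \<Longrightarrow> L2_inner \<Omega> h (\<lambda>x. f x + g x) = L2_inner \<Omega> h f + L2_inner \<Omega> h g"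
  using L2_inner_add_left[of f \<Omega> g h] by (simp add: L2_inner_commute)

lemma L2_inner_diff_right:
  "f \<in> L2 \<Omega> \<Longrightarrow> g \<in> L2 \<Omega> \<Longrightarrow> h \<in> L2 \<Omega> \<Longrightarrow> L2_inner \<Omega> h (\<lambda>x. f x - g x) = L2_inner \<Omega> h f - L2_inner \<Omega> h g"
  using L2_inner_diff_left[of f \<Omega> g h] by (simp add: L2_inner_commute)

lemma L2_inner_cong_AE:
  assumes "\<Omega> \<in> sets lebesgue" "f \<in> L2 \<Omega>" "g \<in> L2 \<Omega>"
    "AE x in lebesgue_on \<Omega>. f x = f' x" "AE x in lebesgue_on \<Omega>. g x = g' x"
  shows "L2_inner \<Omega> f g = L2_inner \<Omega> f' g'"
  unfolding L2_inner_def
proof (rule integral_cong_AE)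
  have "f' \<in> L2 \<Omega>" "g' \<in> L2 \<Omega>" using L2_cong_AE assms by blast+
  then show "(\<lambda>x. f' x * g' x) \<in> borel_measurable (lebesgue_on \<Omega>)"
    by (intro borel_measurable_times L2_measurable)
  show "(\<lambda>x. f x * g x) \<in> borel_measurable (lebesgue_on \<Omega>)"
    using assms by (intro borel_measurable_times L2_measurable)
  show "AE x in lebesgue_on \<Omega>. f x * g x = f' x * g' x"
    using assms(4,5) by eventually_elim simp
qed

lemma L2_inner_self_nonneg: "L2_inner \<Omega> f f \<ge> 0"
  unfolding L2_inner_def by (rule Bochner_Integration.integral_nonneg) simp

lemma L2_norm_nonneg: "L2_norm \<Omega> f \<ge> 0"
  by (simp add: L2_norm_def L2_inner_self_nonneg)

lemma L2_norm_square: "(L2_norm \<Omega> f)\<^sup>2 = L2_inner \<Omega> f f"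
  by (simp add: L2_norm_def L2_inner_self_nonneg)

lemma L2_norm_scale: "L2_norm \<Omega> (\<lambda>x. c * f x) = \<bar>c\<bar> * L2_norm \<Omega> f"
proof -
  have "L2_inner \<Omega> (\<lambda>x. c * f x) (\<lambda>x. c * f x) = c\<^sup>2 * L2_inner \<Omega> f f"
    unfolding L2_inner_def power2_eq_square by (simp add: algebra_simps flip: Bochner_Integration.integral_mult_right_zero)
  then show ?thesis by (simp add: L2_norm_def real_sqrt_mult)
qed

lemma L2_Cauchy_Schwarz:
  assumes f: "f \<in> L2 \<Omega>" and g: "g \<in> L2 \<Omega>"
  shows "\<bar>L2_inner \<Omega> f g\<bar> \<le> L2_norm \<Omega> f * L2_norm \<Omega> g"
proof -
  let ?A = "L2_inner \<Omega> f f" and ?B = "L2_inner \<Omega> f g" and ?C = "L2_inner \<Omega> g g"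
  have q: "0 \<le> ?A - 2 * t * ?B + t\<^sup>2 * ?C" for t
  proof -
    have tg: "(\<lambda>x. t * g x) \<in> L2 \<Omega>" by (rule L2_scale[OF g])
    have "0 \<le> L2_inner \<Omega> (\<lambda>x. f x - t * g x) (\<lambda>x. f x - t * g x)" by (rule L2_inner_self_nonneg)
    also have "\<dots> = ?A - 2 * t * ?B + t\<^sup>2 * ?C"
      using f g tg L2_inner_commute[of \<Omega> f "\<lambda>x. t * g x"] L2_inner_commute[of \<Omega> g "\<lambda>x. t * g x"]
        L2_inner_commute[of \<Omega> g f]
      by (simp add: L2_inner_diff_left L2_inner_diff_right L2_diff L2_inner_scale_left power2_eq_square algebra_simps)
    finally show ?thesis .
  qed
  have "?B\<^sup>2 \<le> ?A * ?C"
  proof (cases "?C = 0")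
    case True
    have "?B = 0"
    proof (rule ccontr)
      assume "?B \<noteq> 0"
      \<comment> \<open>For \<open>?C = 0\<close> the quadratic is affine in t, and this t gives it
        the value -1.\<close>
      then show False using q[of "(?A + 1) / (2 * ?B)"] True by (simp add: field_simps)
    qed
    then show ?thesis using True by simp
  next
    case False
    then have "?C > 0" using L2_inner_self_nonneg[of \<Omega> g] by linarith
    then show ?thesis using q[of "?B / ?C"] by (simp add: power2_eq_square field_simps)
  qed
  then have "sqrt (?B\<^sup>2) \<le> sqrt (?A * ?C)" by (rule real_sqrt_le_mono)
  then show ?thesis by (simp add: L2_norm_def real_sqrt_mult)
qed

lemma L2_norm_triangle:
  assumes f: "f \<in> L2 \<Omega>" and g: "g \<in> L2 \<Omega>"
  shows "L2_norm \<Omega> (\<lambda>x. f x + g x) \<le> L2_norm \<Omega> f + L2_norm \<Omega> g"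
proof (rule power2_le_imp_le)
  have "L2_inner \<Omega> (\<lambda>x. f x + g x) (\<lambda>x. f x + g x) = L2_inner \<Omega> f f + 2 * L2_inner \<Omega> f g + L2_inner \<Omega> g g"
    using f g L2_inner_commute[of \<Omega> g f] by (simp add: L2_inner_add_left L2_inner_add_right L2_add)
  also have "\<dots> \<le> L2_inner \<Omega> f f + 2 * (L2_norm \<Omega> f * L2_norm \<Omega> g) + L2_inner \<Omega> g g"
    using L2_Cauchy_Schwarz[OF f g] by linarith
  finally show "(L2_norm \<Omega> (\<lambda>x. f x + g x))\<^sup>2 \<le> (L2_norm \<Omega> f + L2_norm \<Omega> g)\<^sup>2"
    by (simp add: L2_norm_square power2_sum)
qed (simp add: L2_norm_nonneg)

lemma L2_norm_triangle_diff:
  assumes f: "f \<in> L2 \<Omega>" and g: "g \<in> L2 \<Omega>" and h: "h \<in> L2 \<Omega>"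
  shows "L2_norm \<Omega> (\<lambda>x. f x - h x) \<le> L2_norm \<Omega> (\<lambda>x. f x - g x) + L2_norm \<Omega> (\<lambda>x. g x - h x)"
  using L2_norm_triangle[OF L2_diff[OF f g] L2_diff[OF g h]] by simp

lemma L2_norm_cong_AE:
  assumes "\<Omega> \<in> sets lebesgue" "f \<in> L2 \<Omega>" "AE x in lebesgue_on \<Omega>. f x = g x"
  shows "L2_norm \<Omega> f = L2_norm \<Omega> g"
  unfolding L2_norm_def using L2_inner_cong_AE[OF assms(1,2,2,3,3)] by simp

lemma nn_integral_square_L2:
  "f \<in> L2 \<Omega> \<Longrightarrow> (\<integral>\<^sup>+x. ennreal ((f x)\<^sup>2) \<partial>lebesgue_on \<Omega>) = ennreal ((L2_norm \<Omega> f)\<^sup>2)"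
  unfolding L2_norm_square L2_inner_def power2_eq_square[symmetric]
  by (rule nn_integral_eq_integral) (auto simp: L2_def)

lemma L2_I_nn_integral:
  assumes "f \<in> borel_measurable (lebesgue_on \<Omega>)" "(\<integral>\<^sup>+x. ennreal ((f x)\<^sup>2) \<partial>lebesgue_on \<Omega>) < \<infinity>"
  shows "f \<in> L2 \<Omega>"
  using assms by (auto simp: L2_def intro!: integrableI_nonneg)

lemma L2_norm_mono:
  assumes "g \<in> L2 \<Omega>" "f \<in> borel_measurable (lebesgue_on \<Omega>)" "C \<ge> 0"
    "AE x in lebesgue_on \<Omega>. \<bar>f x\<bar> \<le> C * \<bar>g x\<bar>"
  shows "L2_norm \<Omega> f \<le> C * L2_norm \<Omega> g"
proof (rule power2_le_imp_le)
  have f: "f \<in> L2 \<Omega>" by (rule L2_I_bounded_square[OF assms(2,1,4)])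
  have "L2_inner \<Omega> f f \<le> L2_inner \<Omega> (\<lambda>x. C * g x) (\<lambda>x. C * g x)"
    unfolding L2_inner_def
  proof (rule integral_mono_AE)
    show "AE x in lebesgue_on \<Omega>. f x * f x \<le> C * g x * (C * g x)"
      using assms(4)
    proof eventually_elim
      case (elim x)
      have "\<bar>f x\<bar>\<^sup>2 \<le> (C * \<bar>g x\<bar>)\<^sup>2" by (rule power_mono[OF elim]) simp
      then show ?case by (simp add: power_mult_distrib power2_eq_square mult_ac)
    qed
  qed (intro L2_integrable_mult f L2_scale[OF assms(1)])+
  then have "(L2_norm \<Omega> f)\<^sup>2 \<le> (L2_norm \<Omega> (\<lambda>x. C * g x))\<^sup>2" by (simp add: L2_norm_square)
  then show "(L2_norm \<Omega> f)\<^sup>2 \<le> (C * L2_norm \<Omega> g)\<^sup>2" using assms(3) by (simp add: L2_norm_scale)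
  show "0 \<le> C * L2_norm \<Omega> g" using assms(3) by (simp add: L2_norm_nonneg)
qed

lemma L2_norm_le_sup:
  assumes "\<Omega> \<in> lmeasurable" "f \<in> borel_measurable (lebesgue_on \<Omega>)" "\<And>x. x \<in> \<Omega> \<Longrightarrow> \<bar>f x\<bar> \<le> h" "h \<ge> 0"
  shows "L2_norm \<Omega> f \<le> h * L2_norm \<Omega> (\<lambda>_. 1)"
  by (rule L2_norm_mono[OF L2_bounded_measurable[OF assms(1), of _ 1]])
     (use assms in \<open>auto intro!: AE_I2 simp: space_restrict_space\<close>)

lemma L2_inner_tendsto:
  assumes f: "\<And>m. f m \<in> L2 \<Omega>" "f' \<in> L2 \<Omega>" "(\<lambda>m. L2_norm \<Omega> (\<lambda>x. f m x - f' x)) \<longlonglongrightarrow> 0"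
    and g: "\<And>m. g m \<in> L2 \<Omega>" "g' \<in> L2 \<Omega>" "(\<lambda>m. L2_norm \<Omega> (\<lambda>x. g m x - g' x)) \<longlonglongrightarrow> 0"
  shows "(\<lambda>m. L2_inner \<Omega> (f m) (g m)) \<longlonglongrightarrow> L2_inner \<Omega> f' g'"
proof -
  let ?F = "\<lambda>m. L2_norm \<Omega> (\<lambda>x. f m x - f' x)" and ?G = "\<lambda>m. L2_norm \<Omega> (\<lambda>x. g m x - g' x)"
  have bound: "norm (L2_inner \<Omega> (f m) (g m) - L2_inner \<Omega> f' g') \<le> ?F m * ?G m + ?F m * L2_norm \<Omega> g' + L2_norm \<Omega> f' * ?G m" for m
  proof -
    have fd: "(\<lambda>x. f m x - f' x) \<in> L2 \<Omega>" and gd: "(\<lambda>x. g m x - g' x) \<in> L2 \<Omega>"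
      using f g L2_diff by blast+
    have "L2_inner \<Omega> (f m) (g m) - L2_inner \<Omega> f' g' =
      L2_inner \<Omega> (\<lambda>x. f m x - f' x) (\<lambda>x. g m x - g' x) + L2_inner \<Omega> (\<lambda>x. f m x - f' x) g'
        + L2_inner \<Omega> f' (\<lambda>x. g m x - g' x)"
      using f(1)[of m] f(2) g(1)[of m] g(2) fd gd
      by (simp add: L2_inner_diff_left L2_inner_diff_right)
    then show ?thesis
      using L2_Cauchy_Schwarz[OF fd gd] L2_Cauchy_Schwarz[OF fd g(2)] L2_Cauchy_Schwarz[OF f(2) gd]
      by simp
  qed
  have "(\<lambda>m. ?F m * ?G m + ?F m * L2_norm \<Omega> g' + L2_norm \<Omega> f' * ?G m) \<longlonglongrightarrow>
      0 * 0 + 0 * L2_norm \<Omega> g' + L2_norm \<Omega> f' * 0"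
    by (intro tendsto_intros f g)
  then have lim: "(\<lambda>m. ?F m * ?G m + ?F m * L2_norm \<Omega> g' + L2_norm \<Omega> f' * ?G m) \<longlonglongrightarrow> 0" by simp
  have "(\<lambda>m. L2_inner \<Omega> (f m) (g m) - L2_inner \<Omega> f' g') \<longlonglongrightarrow> 0"
    by (rule Lim_null_comparison[OF always_eventually lim]) (intro allI bound)
  then show ?thesis by (rule LIM_zero_cancel)
qed

text \<open>Fatou's lemma along an almost everywhere convergent subsequence.\<close>

lemma weighted_L2_lower_semicontinuous:
  assumes f: "\<And>m. f m \<in> L2 \<Omega>" "f' \<in> L2 \<Omega>" "(\<lambda>m. L2_norm \<Omega> (\<lambda>x. f m x - f' x)) \<longlonglongrightarrow> 0"
    and w: "w \<in> borel_measurable (lebesgue_on \<Omega>)"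
    and le: "\<And>m. (\<integral>\<^sup>+x. ennreal (w x * (f m x)\<^sup>2) \<partial>lebesgue_on \<Omega>) \<le> ennreal (C m)"
    and C: "C \<longlonglongrightarrow> C'"
  shows "(\<integral>\<^sup>+x. ennreal (w x * (f' x)\<^sup>2) \<partial>lebesgue_on \<Omega>) \<le> ennreal C'"
proof -
  let ?M = "lebesgue_on \<Omega>"
  have d: "(\<lambda>x. f m x - f' x) \<in> L2 \<Omega>" for m using f L2_diff by blast
  have "\<exists>r::nat\<Rightarrow>nat. strict_mono r \<and> (AE x in ?M. (\<lambda>m. (f (r m) x - f' x)\<^sup>2) \<longlonglongrightarrow> 0)"
  proof (rule tendsto_L1_AE_subseq)
    show "integrable ?M (\<lambda>x. (f m x - f' x)\<^sup>2)" for m using d[of m] by (simp add: L2_def)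
    have "(\<lambda>m. (L2_norm \<Omega> (\<lambda>x. f m x - f' x))\<^sup>2) \<longlonglongrightarrow> 0\<^sup>2" by (intro tendsto_intros f)
    then show "(\<lambda>m. LINT x|?M. norm ((f m x - f' x)\<^sup>2)) \<longlonglongrightarrow> 0"
      unfolding L2_norm_square L2_inner_def by (simp add: power2_eq_square)
  qed
  then obtain r :: "nat \<Rightarrow> nat" where r: "strict_mono r" "AE x in ?M. (\<lambda>m. (f (r m) x - f' x)\<^sup>2) \<longlonglongrightarrow> 0" by blast
  have mf: "f m \<in> borel_measurable ?M" for m using f L2_measurable by blast
  have ae: "AE x in ?M. ennreal (w x * (f' x)\<^sup>2) = liminf (\<lambda>m. ennreal (w x * (f (r m) x)\<^sup>2))"
    using r(2)
  proof eventually_elim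
    case (elim x)
    then have "(\<lambda>m. sqrt ((f (r m) x - f' x)\<^sup>2)) \<longlonglongrightarrow> sqrt 0" by (intro tendsto_intros)
    then have "(\<lambda>m. f (r m) x - f' x) \<longlonglongrightarrow> 0"
      by (simp add: tendsto_rabs_zero_iff)
    then have "(\<lambda>m. f (r m) x) \<longlonglongrightarrow> f' x" by (rule LIM_zero_cancel)
    then have "(\<lambda>m. ennreal (w x * (f (r m) x)\<^sup>2)) \<longlonglongrightarrow> ennreal (w x * (f' x)\<^sup>2)"
      by (intro tendsto_intros tendsto_ennrealI)
    then show ?case by (intro lim_imp_Liminf[symmetric]) simp_all
  qed
  have "(\<integral>\<^sup>+x. ennreal (w x * (f' x)\<^sup>2) \<partial>?M) = (\<integral>\<^sup>+x. liminf (\<lambda>m. ennreal (w x * (f (r m) x)\<^sup>2)) \<partial>?M)"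
    by (rule nn_integral_cong_AE[OF ae])
  also have "\<dots> \<le> liminf (\<lambda>m. \<integral>\<^sup>+x. ennreal (w x * (f (r m) x)\<^sup>2) \<partial>?M)"
    using w mf by (intro nn_integral_liminf measurable_compose[OF _ measurable_ennreal]
        borel_measurable_times borel_measurable_power)
  also have "\<dots> \<le> liminf (\<lambda>m. ennreal (C (r m)))"
    by (intro Liminf_mono always_eventually allI le)
  also have "\<dots> = ennreal C'"
    using LIMSEQ_subseq_LIMSEQ[OF C r(1)] by (intro lim_imp_Liminf tendsto_ennrealI) (auto simp: o_def)
  finally show ?thesis .
qed

lemma L2_norm_tendsto_norm:
  assumes f: "\<And>m. f m \<in> L2 \<Omega>" "f' \<in> L2 \<Omega>" "(\<lambda>m. L2_norm \<Omega> (\<lambda>x. f m x - f' x)) \<longlonglongrightarrow> 0"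
  shows "(\<lambda>m. L2_norm \<Omega> (f m)) \<longlonglongrightarrow> L2_norm \<Omega> f'"
  unfolding L2_norm_def by (intro tendsto_intros L2_inner_tendsto f)

section \<open>The space \<open>H\<^sup>2\<^sub>0(\<Omega>)\<close>\<close>

lemma L2_norm_tendsto_trans:
  assumes f: "\<And>m. f m \<in> L2 \<Omega>" "\<And>m. g m \<in> L2 \<Omega>" "h \<in> L2 \<Omega>"
    and lim: "(\<lambda>m. L2_norm \<Omega> (\<lambda>x. f m x - g m x)) \<longlonglongrightarrow> 0" "(\<lambda>m. L2_norm \<Omega> (\<lambda>x. g m x - h x)) \<longlonglongrightarrow> 0"
  shows "(\<lambda>m. L2_norm \<Omega> (\<lambda>x. f m x - h x)) \<longlonglongrightarrow> 0"
proof (rule Lim_null_comparison[OF always_eventually])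
  show "\<forall>m. norm (L2_norm \<Omega> (\<lambda>x. f m x - h x)) \<le> L2_norm \<Omega> (\<lambda>x. f m x - g m x) + L2_norm \<Omega> (\<lambda>x. g m x - h x)"
    using L2_norm_triangle_diff[OF f(1,2,3)] L2_norm_nonneg[of \<Omega>] by simp
  show "(\<lambda>m. L2_norm \<Omega> (\<lambda>x. f m x - g m x) + L2_norm \<Omega> (\<lambda>x. g m x - h x)) \<longlonglongrightarrow> 0"
    using tendsto_add[OF lim] by simp
qed

context
  fixes \<Omega> :: "(real^'n::finite) set"
  assumes op: "open \<Omega>" and bd: "bounded \<Omega>"
begin

lemma lmeasurable_domain: "\<Omega> \<in> lmeasurable" "\<Omega> \<in> sets lebesgue"
  using lmeasurable_open[OF bd op] op by auto

lemma L2_loc_integrable: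
  assumes "f \<in> L2 \<Omega>" shows "loc_integrable \<Omega> f"
  unfolding loc_integrable_def
proof (intro allI impI)
  fix K assume K: "compact K \<and> K \<subseteq> \<Omega>"
  have Ks: "K \<in> sets lebesgue" using K by (auto simp: compact_imp_closed)
  have "indicator K \<in> borel_measurable (lebesgue_on \<Omega>)"
    using Ks by (intro measurable_restrict_space1 borel_measurable_indicator)
  then have "indicator K \<in> L2 \<Omega>"
    by (rule L2_bounded_measurable[OF lmeasurable_domain(1), of _ 1]) simp
  then have "integrable (lebesgue_on \<Omega>) (\<lambda>x. f x * indicator K x)" by (rule L2_integrable_mult[OF assms])
  then have "integrable lebesgue (\<lambda>x. indicator \<Omega> x *\<^sub>R (f x * indicator K x))"
    using lmeasurable_domain by (simp add: integrable_restrict_space)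
  moreover have "indicator \<Omega> x *\<^sub>R (f x * indicator K x) = indicator K x *\<^sub>R f x" for x
    using K by (auto simp: indicator_def)
  ultimately show "set_integrable lebesgue K f" by (simp only: set_integrable_def)
qed

lemma Cc_L2:
  assumes "f \<in> Cc k \<Omega>" shows "f \<in> L2 \<Omega>"
proof -
  obtain M where M: "M > 0" "\<And>x. \<bar>f x\<bar> \<le> M" using Cc_bounded[OF assms] by blast
  have "f \<in> borel_measurable lebesgue"
    using borel_measurable_continuous_onI[OF Cc_continuous[OF assms]] by (intro measurable_completion) simp
  then have "f \<in> borel_measurable (lebesgue_on \<Omega>)" by (rule measurable_restrict_space1)
  then show ?thesis by (rule L2_bounded_measurable[OF lmeasurable_domain(1)]) (rule M(2))
qed

lemma Cc_mderiv_L2: "f \<in> Cc 2 \<Omega> \<Longrightarrow> mdeg \<eta> \<le> 2 \<Longrightarrow> mderiv \<eta> f \<in> L2 \<Omega>"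
  by (rule Cc_L2[OF Cc_mderiv])

lemma has_weak_deriv_limit:
  assumes \<phi>: "\<And>m. \<phi> m \<in> Cc 2 \<Omega>" and u: "u \<in> L2 \<Omega>" and g: "g \<in> L2 \<Omega>" and \<eta>: "mdeg \<eta> \<le> 2"
    and lim: "(\<lambda>m. L2_norm \<Omega> (\<lambda>x. \<phi> m x - u x)) \<longlonglongrightarrow> 0"
      "(\<lambda>m. L2_norm \<Omega> (\<lambda>x. mderiv \<eta> (\<phi> m) x - g x)) \<longlonglongrightarrow> 0"
  shows "has_weak_deriv \<Omega> \<eta> u g"
proof -
  have "(LINT x|lebesgue_on \<Omega>. u x * mderiv \<eta> \<psi> x) = (- 1) ^ mdeg \<eta> * (LINT x|lebesgue_on \<Omega>. g x * \<psi> x)"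
    if \<psi>: "\<psi> \<in> Cc_inf \<Omega>" for \<psi>
  proof -
    have \<psi>2: "\<psi> \<in> L2 \<Omega>" "mderiv \<eta> \<psi> \<in> L2 \<Omega>"
      using Cc_L2 Cc_mderiv_L2 \<eta> Cc_inf_imp_Cc[OF \<psi>] by blast+
    have triv: "(\<lambda>m. L2_norm \<Omega> (\<lambda>x. h x - h x)) \<longlonglongrightarrow> 0" for h
      by (simp add: L2_norm_def L2_inner_def)
    have "(\<lambda>m. L2_inner \<Omega> (\<phi> m) (mderiv \<eta> \<psi>)) \<longlonglongrightarrow> L2_inner \<Omega> u (mderiv \<eta> \<psi>)"
      by (rule L2_inner_tendsto[OF Cc_L2[OF \<phi>] u lim(1) \<psi>2(2) \<psi>2(2) triv])
    moreover have "(\<lambda>m. (- 1) ^ mdeg \<eta> * L2_inner \<Omega> (mderiv \<eta> (\<phi> m)) \<psi>) \<longlonglongrightarrow> (- 1) ^ mdeg \<eta> * L2_inner \<Omega> g \<psi>"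
      by (intro tendsto_mult tendsto_const L2_inner_tendsto[OF Cc_mderiv_L2[OF \<phi> \<eta>] g lim(2) \<psi>2(1) \<psi>2(1) triv])
    moreover have "L2_inner \<Omega> (\<phi> m) (mderiv \<eta> \<psi>) = (- 1) ^ mdeg \<eta> * L2_inner \<Omega> (mderiv \<eta> (\<phi> m)) \<psi>" for m
      using Cc_has_weak_deriv[OF op \<phi> \<eta>] \<psi> by (simp add: has_weak_deriv_def L2_inner_def)
    ultimately have "L2_inner \<Omega> u (mderiv \<eta> \<psi>) = (- 1) ^ mdeg \<eta> * L2_inner \<Omega> g \<psi>"
      by (simp only: LIMSEQ_unique)
    then show ?thesis by (simp add: L2_inner_def)
  qed
  then show ?thesis using L2_loc_integrable u g by (simp add: has_weak_deriv_def)
qed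

text \<open>The approximants may be merely C^2: each is replaced by a smooth function that is
  uniformly 1/(m + 1)-close in all derivatives up to order two. The candidates g are weak
  derivatives because integrals against test functions pass to L^2 limits. The component of order
  zero is matched with u only almost everywhere, as representatives are arbitrary.\<close>

lemma H20_I:
  assumes \<phi>: "\<And>m. \<phi> m \<in> Cc 2 \<Omega>" and u: "u \<in> L2 \<Omega>"
    and g: "\<And>\<eta>. mdeg \<eta> \<le> 2 \<Longrightarrow> g \<eta> \<in> L2 \<Omega>"
    and u0: "AE x in lebesgue_on \<Omega>. g (\<lambda>_. 0) x = u x"
    and lim: "\<And>\<eta>. mdeg \<eta> \<le> 2 \<Longrightarrow> (\<lambda>m. L2_norm \<Omega> (\<lambda>x. mderiv \<eta> (\<phi> m) x - g \<eta> x)) \<longlonglongrightarrow> 0"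
  shows "u \<in> H20 \<Omega>"
    and "\<And>\<eta>. mdeg \<eta> \<le> 2 \<Longrightarrow> AE x in lebesgue_on \<Omega>. weak_deriv \<Omega> \<eta> u x = g \<eta> x"
proof -
  have lim0: "(\<lambda>m. L2_norm \<Omega> (\<lambda>x. \<phi> m x - u x)) \<longlonglongrightarrow> 0"
  proof -
    have g0: "g (\<lambda>_. 0) \<in> L2 \<Omega>" by (rule g) (simp add: mdeg_mi)
    have "L2_norm \<Omega> (\<lambda>x. \<phi> m x - g (\<lambda>_. 0) x) = L2_norm \<Omega> (\<lambda>x. \<phi> m x - u x)" for m
      by (rule L2_norm_cong_AE[OF lmeasurable_domain(2) L2_diff[OF Cc_L2[OF \<phi>] g0]])
         (use u0 in eventually_elim, simp)
    then show ?thesis using lim[of "\<lambda>_. 0"] by (simp add: mdeg_mi mderiv_0)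
  qed
  have wd: "has_weak_deriv \<Omega> \<eta> u (g \<eta>)" if "mdeg \<eta> \<le> 2" for \<eta>
    by (rule has_weak_deriv_limit[OF \<phi> u g[OF that] that lim0 lim[OF that]])
  show ae: "AE x in lebesgue_on \<Omega>. weak_deriv \<Omega> \<eta> u x = g \<eta> x" if "mdeg \<eta> \<le> 2" for \<eta>
    by (rule weak_deriv_AE(1)[OF op wd[OF that]])
  define h where "h m = inverse (real (Suc m))" for m
  have h: "h m > 0" for m by (simp add: h_def)
  have h0: "h \<longlonglongrightarrow> 0" unfolding h_def[abs_def] by (rule LIMSEQ_inverse_real_of_nat)
  have "\<forall>m. \<exists>\<psi>. \<psi> \<in> Cc_inf \<Omega> \<and> (\<forall>\<eta> x. mdeg \<eta> \<le> 2 \<longrightarrow> \<bar>mderiv \<eta> \<psi> x - mderiv \<eta> (\<phi> m) x\<bar> \<le> h m)"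
    using Cc_inf_dense_Cc[OF op \<phi> h] by blast
  from choice[OF this] obtain \<psi> where \<psi>: "\<And>m. \<psi> m \<in> Cc_inf \<Omega>"
    "\<And>m \<eta> x. mdeg \<eta> \<le> 2 \<Longrightarrow> \<bar>mderiv \<eta> (\<psi> m) x - mderiv \<eta> (\<phi> m) x\<bar> \<le> h m" by blast
  have "(\<lambda>m. L2_norm \<Omega> (\<lambda>x. mderiv \<eta> (\<psi> m) x - weak_deriv \<Omega> \<eta> u x)) \<longlonglongrightarrow> 0" if \<eta>: "mdeg \<eta> \<le> 2" for \<eta>
  proof -
    note L = Cc_mderiv_L2[OF Cc_inf_imp_Cc[OF \<psi>(1)] \<eta>] Cc_mderiv_L2[OF \<phi> \<eta>] g[OF \<eta>]
    have 1: "(\<lambda>m. L2_norm \<Omega> (\<lambda>x. mderiv \<eta> (\<psi> m) x - mderiv \<eta> (\<phi> m) x)) \<longlonglongrightarrow> 0"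
    proof (rule Lim_null_comparison[OF always_eventually])
      show "\<forall>m. norm (L2_norm \<Omega> (\<lambda>x. mderiv \<eta> (\<psi> m) x - mderiv \<eta> (\<phi> m) x)) \<le> h m * L2_norm \<Omega> (\<lambda>_. 1)"
        using L2_norm_le_sup[OF lmeasurable_domain(1) L2_measurable[OF L2_diff[OF L(1,2)]] \<psi>(2)[OF \<eta>] less_imp_le[OF h]]
        by (simp add: L2_norm_nonneg)
      show "(\<lambda>m. h m * L2_norm \<Omega> (\<lambda>_. 1)) \<longlonglongrightarrow> 0" using tendsto_mult_left_zero[OF h0] by blast
    qed
    have "(\<lambda>m. L2_norm \<Omega> (\<lambda>x. mderiv \<eta> (\<psi> m) x - g \<eta> x)) \<longlonglongrightarrow> 0"
      by (rule L2_norm_tendsto_trans[OF L 1 lim[OF \<eta>]])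
    moreover have "L2_norm \<Omega> (\<lambda>x. mderiv \<eta> (\<psi> m) x - g \<eta> x) = L2_norm \<Omega> (\<lambda>x. mderiv \<eta> (\<psi> m) x - weak_deriv \<Omega> \<eta> u x)" for m
      by (rule L2_norm_cong_AE[OF lmeasurable_domain(2) L2_diff[OF L(1,3)]])
         (use ae[OF \<eta>] in eventually_elim, simp)
    ultimately show ?thesis by simp
  qed
  then show "u \<in> H20 \<Omega>"
    unfolding H20_def using u g wd \<psi>(1) by blast
qed

lemma Cc_H20:
  assumes "f \<in> Cc 2 \<Omega>"
  shows "f \<in> H20 \<Omega>" and "\<And>\<eta>. mdeg \<eta> \<le> 2 \<Longrightarrow> AE x in lebesgue_on \<Omega>. weak_deriv \<Omega> \<eta> f x = mderiv \<eta> f x"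
proof -
  have z: "(\<lambda>m::nat. L2_norm \<Omega> (\<lambda>x. mderiv \<eta> f x - mderiv \<eta> f x)) \<longlonglongrightarrow> 0" for \<eta>
    by (simp add: L2_norm_def L2_inner_def)
  have a: "AE x in lebesgue_on \<Omega>. mderiv (\<lambda>_. 0) f x = f x" by (simp add: mderiv_0)
  show "f \<in> H20 \<Omega>"
    by (rule H20_I(1)[where \<phi> = "\<lambda>_. f" and g = "\<lambda>\<eta>. mderiv \<eta> f", OF assms Cc_L2[OF assms] Cc_mderiv_L2[OF assms] a z])
  show "AE x in lebesgue_on \<Omega>. weak_deriv \<Omega> \<eta> f x = mderiv \<eta> f x" if "mdeg \<eta> \<le> 2" for \<eta>
    by (rule H20_I(2)[where \<phi> = "\<lambda>_. f" and g = "\<lambda>\<eta>. mderiv \<eta> f", OF assms Cc_L2[OF assms] Cc_mderiv_L2[OF assms] a z that])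
qed

lemma H20_L2: "u \<in> H20 \<Omega> \<Longrightarrow> u \<in> L2 \<Omega>" by (simp add: H20_def)

lemma H20_weak_deriv:
  assumes "u \<in> H20 \<Omega>" "mdeg \<eta> \<le> 2"
  shows "weak_deriv \<Omega> \<eta> u \<in> L2 \<Omega>" "has_weak_deriv \<Omega> \<eta> u (weak_deriv \<Omega> \<eta> u)"
proof -
  obtain g where g: "g \<in> L2 \<Omega>" "has_weak_deriv \<Omega> \<eta> u g" using assms by (auto simp: H20_def)
  have ae: "AE x in lebesgue_on \<Omega>. g x = weak_deriv \<Omega> \<eta> u x"
    using weak_deriv_AE(1)[OF op g(2)] by eventually_elim simp
  show "weak_deriv \<Omega> \<eta> u \<in> L2 \<Omega>" by (rule L2_cong_AE[OF lmeasurable_domain(2) g(1) ae])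
  show "has_weak_deriv \<Omega> \<eta> u (weak_deriv \<Omega> \<eta> u)" by (rule weak_deriv_AE(2)[OF op g(2)])
qed

lemma weak_deriv_0:
  assumes "u \<in> L2 \<Omega>" shows "AE x in lebesgue_on \<Omega>. weak_deriv \<Omega> (\<lambda>_. 0) u x = u x"
  by (rule weak_deriv_AE(1)[OF op])
     (use L2_loc_integrable[OF assms] in \<open>simp add: has_weak_deriv_def mderiv_0 mdeg_mi\<close>)

lemma H20_E:
  assumes "u \<in> H20 \<Omega>"
  obtains \<phi> where "\<And>m. \<phi> m \<in> Cc_inf \<Omega>"
    "\<And>\<eta>. mdeg \<eta> \<le> 2 \<Longrightarrow> (\<lambda>m. L2_norm \<Omega> (\<lambda>x. mderiv \<eta> (\<phi> m) x - weak_deriv \<Omega> \<eta> u x)) \<longlonglongrightarrow> 0"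
  using assms unfolding H20_def by blast

lemma mderiv_diff:
  assumes "f \<in> Cc 2 \<Omega>" "g \<in> Cc 2 \<Omega>" "mdeg \<eta> \<le> 2"
  shows "mderiv \<eta> (\<lambda>x. f x - g x) x = mderiv \<eta> f x - mderiv \<eta> g x"
proof -
  have C: "Ck_on 2 UNIV f" "Ck_on 2 UNIV g" "Ck_on 2 UNIV (\<lambda>x. f x - g x)"
    using assms(1,2) Cc_diff[OF assms(1,2)] by (simp_all add: Cc_def)
  have d: "f differentiable (at x)" "g differentiable (at x)" for x
    using Ck_on_SucD[of 1 UNIV] C(1,2) by (simp_all add: numeral_2_eq_2)
  have "Ck_on 1 UNIV (partial_deriv j f)" "Ck_on 1 UNIV (partial_deriv j g)" for j
    using C(1,2) by (simp_all add: numeral_2_eq_2)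
  then have d2: "partial_deriv j f differentiable (at x)" "partial_deriv j g differentiable (at x)" for j x
    using Ck_on_SucD[OF _ open_UNIV UNIV_I, of 0] unfolding One_nat_def by blast+
  have p: "partial_deriv j (\<lambda>x. f x - g x) = (\<lambda>x. partial_deriv j f x - partial_deriv j g x)" for j
    by (rule ext) (rule partial_deriv_diff[OF d])
  show ?thesis
    using assms(3)
    by (cases rule: mindex_le_2_cases)
       (simp_all add: mderiv_0 mderiv_mi1 mderiv_mi2[OF C(1)] mderiv_mi2[OF C(2)] mderiv_mi2[OF C(3)]
          p partial_deriv_diff[OF d] partial_deriv_diff[OF d2])
qed

text \<open>Estimates for elements of \<open>H20\<close> are later applied to the errors phi_m - u
  of an approximation, which therefore have to lie in \<open>H20\<close>.\<close>

lemma H20_diff: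
  assumes u: "u \<in> H20 \<Omega>" and v: "v \<in> H20 \<Omega>"
  shows "(\<lambda>x. u x - v x) \<in> H20 \<Omega>"
    and "\<And>\<eta>. mdeg \<eta> \<le> 2 \<Longrightarrow>
      AE x in lebesgue_on \<Omega>. weak_deriv \<Omega> \<eta> (\<lambda>x. u x - v x) x = weak_deriv \<Omega> \<eta> u x - weak_deriv \<Omega> \<eta> v x"
proof -
  obtain \<phi> where \<phi>: "\<And>m. \<phi> m \<in> Cc_inf \<Omega>"
    "\<And>\<eta>. mdeg \<eta> \<le> 2 \<Longrightarrow> (\<lambda>m. L2_norm \<Omega> (\<lambda>x. mderiv \<eta> (\<phi> m) x - weak_deriv \<Omega> \<eta> u x)) \<longlonglongrightarrow> 0"
    using H20_E[OF u] by blast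
  obtain \<psi> where \<psi>: "\<And>m. \<psi> m \<in> Cc_inf \<Omega>"
    "\<And>\<eta>. mdeg \<eta> \<le> 2 \<Longrightarrow> (\<lambda>m. L2_norm \<Omega> (\<lambda>x. mderiv \<eta> (\<psi> m) x - weak_deriv \<Omega> \<eta> v x)) \<longlonglongrightarrow> 0"
    using H20_E[OF v] by blast
  note C = Cc_inf_imp_Cc[OF \<phi>(1), where k = 2] Cc_inf_imp_Cc[OF \<psi>(1), where k = 2]
  define g where "g \<eta> x = weak_deriv \<Omega> \<eta> u x - weak_deriv \<Omega> \<eta> v x" for \<eta> x
  have gL: "g \<eta> \<in> L2 \<Omega>" if "mdeg \<eta> \<le> 2" for \<eta>
    unfolding g_def using H20_weak_deriv[OF u that] H20_weak_deriv[OF v that] by (intro L2_diff)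
  have g0: "AE x in lebesgue_on \<Omega>. g (\<lambda>_. 0) x = u x - v x"
    using weak_deriv_0[OF H20_L2[OF u]] weak_deriv_0[OF H20_L2[OF v]] by eventually_elim (simp add: g_def)
  have lim: "(\<lambda>m. L2_norm \<Omega> (\<lambda>x. mderiv \<eta> (\<lambda>x. \<phi> m x - \<psi> m x) x - g \<eta> x)) \<longlonglongrightarrow> 0" if \<eta>: "mdeg \<eta> \<le> 2" for \<eta>
  proof (rule Lim_null_comparison[OF always_eventually])
    let ?a = "\<lambda>m x. mderiv \<eta> (\<phi> m) x - weak_deriv \<Omega> \<eta> u x" and ?b = "\<lambda>m x. mderiv \<eta> (\<psi> m) x - weak_deriv \<Omega> \<eta> v x"
    have ab: "?a m \<in> L2 \<Omega>" "?b m \<in> L2 \<Omega>" for m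
      using Cc_mderiv_L2[OF C(1) \<eta>] Cc_mderiv_L2[OF C(2) \<eta>] H20_weak_deriv[OF u \<eta>] H20_weak_deriv[OF v \<eta>]
      by (blast intro: L2_diff)+
    have nb: "L2_norm \<Omega> (\<lambda>x. (-1) * ?b m x) = L2_norm \<Omega> (?b m)" for m
      using L2_norm_scale[of \<Omega> "-1" "?b m"] by simp
    have eq: "mderiv \<eta> (\<lambda>x. \<phi> m x - \<psi> m x) x - g \<eta> x = ?a m x + (-1) * ?b m x" for m x
      using mderiv_diff[OF C(1)[of m] C(2)[of m] \<eta>] by (simp add: g_def)
    show "\<forall>m. norm (L2_norm \<Omega> (\<lambda>x. mderiv \<eta> (\<lambda>x. \<phi> m x - \<psi> m x) x - g \<eta> x)) \<le> L2_norm \<Omega> (?a m) + L2_norm \<Omega> (?b m)"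
    proof
      fix m
      have "L2_norm \<Omega> (\<lambda>x. ?a m x + (-1) * ?b m x) \<le> L2_norm \<Omega> (?a m) + L2_norm \<Omega> (\<lambda>x. (-1) * ?b m x)"
        by (rule L2_norm_triangle[OF ab(1) L2_scale[OF ab(2)]])
      then show "norm (L2_norm \<Omega> (\<lambda>x. mderiv \<eta> (\<lambda>x. \<phi> m x - \<psi> m x) x - g \<eta> x)) \<le> L2_norm \<Omega> (?a m) + L2_norm \<Omega> (?b m)"
        unfolding eq nb real_norm_def abs_of_nonneg[OF L2_norm_nonneg] .
    qed
    show "(\<lambda>m. L2_norm \<Omega> (?a m) + L2_norm \<Omega> (?b m)) \<longlonglongrightarrow> 0"
      using tendsto_add[OF \<phi>(2)[OF \<eta>] \<psi>(2)[OF \<eta>]] by simp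
  qed
  note L = L2_diff[OF H20_L2[OF u] H20_L2[OF v]]
  show "(\<lambda>x. u x - v x) \<in> H20 \<Omega>"
    by (rule H20_I(1)[where \<phi> = "\<lambda>m x. \<phi> m x - \<psi> m x" and g = g, OF Cc_diff[OF C] L gL g0 lim])
  show "AE x in lebesgue_on \<Omega>. weak_deriv \<Omega> \<eta> (\<lambda>x. u x - v x) x = weak_deriv \<Omega> \<eta> u x - weak_deriv \<Omega> \<eta> v x"
    if "mdeg \<eta> \<le> 2" for \<eta>
    using H20_I(2)[where \<phi> = "\<lambda>m x. \<phi> m x - \<psi> m x" and g = g, OF Cc_diff[OF C] L gL g0 lim that]
    by (simp add: g_def)
qed

end

section \<open>The distance to the boundary\<close>

lemma partial_deriv_le_Lipschitz:
  assumes "open U" "x \<in> U" "f differentiable (at x)" "\<And>y. y \<in> U \<Longrightarrow> \<bar>f y - f x\<bar> \<le> C * norm (y - x)"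
  shows "\<bar>partial_deriv i f x\<bar> \<le> C"
proof -
  have "((\<lambda>t. f (x + t *\<^sub>R axis i 1)) has_real_derivative partial_deriv i f x) (at 0)"
    using has_real_derivative_line[of f x 0 i] assms(3) by simp
  then have lim: "((\<lambda>t. \<bar>(f (x + t *\<^sub>R axis i 1) - f x) / t\<bar>) \<longlongrightarrow> \<bar>partial_deriv i f x\<bar>) (at 0)"
    by (intro tendsto_rabs) (simp add: has_field_derivative_iff)
  have "((\<lambda>t. x + t *\<^sub>R axis i 1) \<longlongrightarrow> x + 0 *\<^sub>R axis i 1) (at 0)" by (intro tendsto_intros)
  then have "\<forall>\<^sub>F t in at 0. x + t *\<^sub>R axis i 1 \<in> U"
    using assms(1,2) by (intro topological_tendstoD) simp_all
  then have "\<forall>\<^sub>F t in at 0. \<bar>(f (x + t *\<^sub>R axis i 1) - f x) / t\<bar> \<le> C"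
    using eventually_neq_at_within[of 0 0 UNIV]
  proof eventually_elim
    case (elim t)
    then show ?case using assms(4)[OF elim(1)] by (simp add: abs_divide divide_le_eq)
  qed
  then show ?thesis using tendsto_upperbound[OF lim] by simp
qed

text \<open>By the triangle inequality and the upper bound of (D1), \<open>d x\<close> is
  c2-Lipschitz and extends continuously to the closure. So \<open>Lim\<close> is a genuine limit and
  not an unspecified value; the filter is nontrivial because a frontier point of an open set lies in
  its closure but not in the set.\<close>

lemma bdry_dist_limit:
  assumes op: "open \<Omega>" and m: "Metric_space \<Omega> d" and c2: "\<And>x y. x \<in> \<Omega> \<Longrightarrow> y \<in> \<Omega> \<Longrightarrow> d x y \<le> c2 * norm (x - y)"
    "c2 > 0" and x: "x \<in> \<Omega>" and y: "y \<in> frontier \<Omega>"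
  shows "(d x \<longlongrightarrow> Lim (at y within \<Omega>) (d x)) (at y within \<Omega>)" "at y within \<Omega> \<noteq> bot"
proof -
  have yc: "y \<in> closure \<Omega>" "y \<notin> \<Omega>"
    using y op by (auto simp: frontier_def interior_open)
  then show nb: "at y within \<Omega> \<noteq> bot"
    by (simp add: trivial_limit_within closure_def)
  have "c2-lipschitz_on \<Omega> (d x)"
  proof (rule lipschitz_onI)
    fix u v assume uv: "u \<in> \<Omega>" "v \<in> \<Omega>"
    have "d x u \<le> d x v + d v u" "d x v \<le> d x u + d u v" "d v u = d u v"
      by (rule Metric_space.triangle[OF m x uv(2,1)], rule Metric_space.triangle[OF m x uv],
          rule Metric_space.commute[OF m])
    then show "dist (d x u) (d x v) \<le> c2 * dist u v"
      using c2(1)[OF uv] by (simp add: dist_real_def dist_norm)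
  qed (use c2 in simp)
  then obtain g where g: "c2-lipschitz_on (closure \<Omega>) g" "\<And>z. z \<in> \<Omega> \<Longrightarrow> g z = d x z"
    using lipschitz_extend_closure[of c2 \<Omega> "d x"] by blast
  have "continuous_on (closure \<Omega>) g" by (rule lipschitz_on_continuous_on[OF g(1)])
  then have "(g \<longlongrightarrow> g y) (at y within closure \<Omega>)" using yc by (simp add: continuous_on)
  then have "(g \<longlongrightarrow> g y) (at y within \<Omega>)" by (rule tendsto_within_subset) (rule closure_subset)
  moreover have "\<forall>\<^sub>F z in at y within \<Omega>. g z = d x z"
    using g(2) by (simp add: eventually_at_filter)
  ultimately have *: "(d x \<longlongrightarrow> g y) (at y within \<Omega>)" by (rule Lim_transform_eventually)
  show "(d x \<longlongrightarrow> Lim (at y within \<Omega>) (d x)) (at y within \<Omega>)"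
    using * tendsto_Lim[OF nb *] by simp
qed

text \<open>In the limit (D1) bounds the extended distance to a frontier point y between c1 |x - y|
  and c2 |x - y|. Hence \<open>bdry_dist\<close> is comparable with \<open>infdist\<close> to the
  frontier. Compactness of the superlevel sets confines the region where \<delta> may differ from
  \<open>bdry_dist\<close>.\<close>

lemma bdry_dist_facts:
  fixes \<Omega> :: "(real^'n::finite) set"
  assumes op: "open \<Omega>" and bd: "bounded \<Omega>" and ne: "\<Omega> \<noteq> {}" and d: "d \<in> dist_class \<Omega>"
  shows "\<exists>C>0. (\<forall>x\<in>\<Omega>. 0 < bdry_dist \<Omega> d x \<and> bdry_dist \<Omega> d x \<le> C) \<and>
    (\<forall>x\<in>\<Omega>. \<forall>y\<in>\<Omega>. \<bar>bdry_dist \<Omega> d x - bdry_dist \<Omega> d y\<bar> \<le> C * norm (x - y)) \<and>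
    (\<forall>\<theta>>0. compact {x \<in> \<Omega>. \<theta> \<le> bdry_dist \<Omega> d x})"
proof -
  obtain c1 c2 where c: "c1 > 0" "c2 > 0"
    and c12: "\<And>x y. x \<in> \<Omega> \<Longrightarrow> y \<in> \<Omega> \<Longrightarrow> c1 * norm (x - y) \<le> d x y \<and> d x y \<le> c2 * norm (x - y)"
    using d unfolding dist_class_def cond_D1_def by blast
  have m: "Metric_space \<Omega> d" using d by (simp add: dist_class_def)
  define l where "l x y = Lim (at y within \<Omega>) (d x)" for x y
  let ?F = "frontier \<Omega>" and ?b = "bdry_dist \<Omega> d"
  have l: "(d x \<longlongrightarrow> l x y) (at y within \<Omega>)" "at y within \<Omega> \<noteq> bot" if "x \<in> \<Omega>" "y \<in> ?F" for x y
    unfolding l_def using bdry_dist_limit[OF op m _ c(2) that] c12 by blast+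
  have ev: "\<forall>\<^sub>F z in at y within \<Omega>. z \<in> \<Omega>" for y by (simp add: eventually_at_filter)
  have ln: "((\<lambda>z. norm (x - z)) \<longlongrightarrow> norm (x - y)) (at y within \<Omega>)" for x y by (intro tendsto_intros)
  have lb: "c1 * norm (x - y) \<le> l x y" "l x y \<le> c2 * norm (x - y)" if "x \<in> \<Omega>" "y \<in> ?F" for x y
  proof -
    show "c1 * norm (x - y) \<le> l x y"
      by (rule tendsto_le[OF l(2)[OF that] l(1)[OF that] tendsto_mult_left[OF ln]])
         (use c12 that in \<open>auto intro: eventually_mono[OF ev]\<close>)
    show "l x y \<le> c2 * norm (x - y)"
      by (rule tendsto_le[OF l(2)[OF that] tendsto_mult_left[OF ln] l(1)[OF that]])
         (use c12 that in \<open>auto intro: eventually_mono[OF ev]\<close>)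
  qed
  have lt: "l x y \<le> l x' y + c2 * norm (x - x')" if "x \<in> \<Omega>" "x' \<in> \<Omega>" "y \<in> ?F" for x x' y
  proof (rule tendsto_le[OF l(2)[OF that(1,3)] tendsto_add[OF l(1)[OF that(2,3)] tendsto_const] l(1)[OF that(1,3)]])
    show "\<forall>\<^sub>F z in at y within \<Omega>. d x z \<le> d x' z + c2 * norm (x - x')"
      using ev
    proof eventually_elim
      case (elim z)
      have "d x z \<le> d x x' + d x' z" using Metric_space.triangle[OF m that(1,2) elim] .
      then show ?case using c12[OF that(1,2)] by simp
    qed
  qed
  have b: "?b x = (INF y\<in>?F. l x y)" for x by (simp add: bdry_dist_def l_def)
  \<comment> \<open>An infimum over the empty set would be meaningless; a nonempty set that is not
    the whole space has frontier points.\<close>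
  have Fne: "?F \<noteq> {}" using frontier_not_empty[OF ne] bd not_bounded_UNIV by metis
  have Fcl: "closed ?F" by simp
  have bdd: "bdd_below (l x ` ?F)" if "x \<in> \<Omega>" for x
  proof (rule bdd_belowI2)
    show "0 \<le> l x y" if "y \<in> ?F" for y using lb(1)[OF \<open>x \<in> \<Omega>\<close> that] c(1)
      by (meson mult_nonneg_nonneg norm_ge_zero less_imp_le order_trans)
  qed
  have low: "c1 * infdist x ?F \<le> ?b x" if "x \<in> \<Omega>" for x
    unfolding b
  proof (rule cINF_greatest[OF Fne])
    fix y assume y: "y \<in> ?F"
    have "infdist x ?F \<le> norm (x - y)" using infdist_le[OF y, of x] by (simp add: dist_norm)
    then have "c1 * infdist x ?F \<le> c1 * norm (x - y)" using c by simp
    then show "c1 * infdist x ?F \<le> l x y" using lb(1)[OF that y] by linarith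
  qed
  have upp: "?b x \<le> c2 * infdist x ?F" if "x \<in> \<Omega>" for x
  proof -
    obtain y where y: "y \<in> ?F" "infdist x ?F = dist x y"
      using infdist_attains_inf[OF Fcl Fne] by blast
    have "?b x \<le> l x y" unfolding b by (rule cINF_lower[OF bdd[OF that] y(1)])
    then show ?thesis using lb(2)[OF that y(1)] y(2) by (simp add: dist_norm)
  qed
  have pos: "0 < ?b x" if "x \<in> \<Omega>" for x
  proof -
    have "x \<notin> ?F" using that op by (simp add: frontier_def interior_open)
    then have "infdist x ?F \<noteq> 0" using in_closed_iff_infdist_zero[OF Fcl Fne] by blast
    then have "infdist x ?F > 0" using infdist_nonneg[of x ?F] by linarith
    then have "0 < c1 * infdist x ?F" using c by simp
    then show ?thesis using low[OF that] by linarith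
  qed
  have lip1: "?b x \<le> ?b x' + c2 * norm (x - x')" if "x \<in> \<Omega>" "x' \<in> \<Omega>" for x x'
  proof -
    have "?b x - c2 * norm (x - x') \<le> ?b x'"
      unfolding b[of x']
    proof (rule cINF_greatest[OF Fne])
      fix y assume y: "y \<in> ?F"
      have "?b x \<le> l x y" unfolding b by (rule cINF_lower[OF bdd[OF that(1)] y])
      then show "?b x - c2 * norm (x - x') \<le> l x' y" using lt[OF that y] by simp
    qed
    then show ?thesis by simp
  qed
  have lip: "\<bar>?b x - ?b x'\<bar> \<le> c2 * norm (x - x')" if "x \<in> \<Omega>" "x' \<in> \<Omega>" for x x'
    using lip1[OF that] lip1[OF that(2,1)] by (simp add: norm_minus_commute abs_le_iff)
  obtain R where R: "R > 0" "\<And>x. x \<in> \<Omega> \<Longrightarrow> ?b x \<le> R"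
  proof -
    obtain x0 where x0: "x0 \<in> \<Omega>" using ne by blast
    obtain B where B: "B > 0" "\<And>x. x \<in> \<Omega> \<Longrightarrow> norm x \<le> B" using bd by (auto simp: bounded_pos)
    have "?b x \<le> ?b x0 + c2 * (2 * B)" if "x \<in> \<Omega>" for x
    proof -
      have "norm (x - x0) \<le> 2 * B" using norm_triangle_ineq4[of x x0] B(2)[OF that] B(2)[OF x0] by linarith
      then have "c2 * norm (x - x0) \<le> c2 * (2 * B)" using c by simp
      then show ?thesis using lip1[OF that x0] by linarith
    qed
    moreover have "?b x0 + c2 * (2 * B) > 0" using pos[OF x0] c B by (simp add: add_pos_pos)
    ultimately show ?thesis using that by blast
  qed
  have comp: "compact {x \<in> \<Omega>. \<theta> \<le> ?b x}" if "\<theta> > 0" for \<theta>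
    unfolding compact_eq_bounded_closed
  proof
    show "bounded {x \<in> \<Omega>. \<theta> \<le> ?b x}" by (rule bounded_subset[OF bd]) blast
    show "closed {x \<in> \<Omega>. \<theta> \<le> ?b x}"
    proof (subst closed_sequential_limits, intro allI impI, elim conjE)
      fix s a assume s: "\<forall>n. s n \<in> {x \<in> \<Omega>. \<theta> \<le> ?b x}" "s \<longlonglongrightarrow> a"
      have sO: "s n \<in> \<Omega>" "\<theta> \<le> ?b (s n)" for n using s(1) by auto
      have "a \<in> closure \<Omega>" using closure_sequential s(2) sO(1) by blast
      \<comment> \<open>If the limit a were a frontier point, \<open>upp\<close> would force the
        values \<open>?b (s n)\<close> to tend to zero.\<close>
      moreover have "a \<notin> ?F"
      proof
        assume "a \<in> ?F"
        then have "infdist a ?F = 0" using in_closed_iff_infdist_zero[OF Fcl Fne] by blast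
        moreover have "(\<lambda>n. c2 * infdist (s n) ?F) \<longlonglongrightarrow> c2 * infdist a ?F" (is ?L)
          by (intro tendsto_intros tendsto_infdist s(2))
        moreover have "\<theta> \<le> c2 * infdist (s n) ?F" for n using upp[OF sO(1)] sO(2) order_trans by blast
        moreover have "\<theta> \<le> c2 * infdist a ?F" if ?L
          using that by (rule LIMSEQ_le_const) (use calculation(3) in blast)
        ultimately have "\<theta> \<le> c2 * 0" by simp
        then show False using that by simp
      qed
      ultimately have a: "a \<in> \<Omega>" by (metis Diff_iff frontier_def interior_subset subsetD)
      have lim: "(\<lambda>n. ?b a + c2 * norm (s n - a)) \<longlonglongrightarrow> ?b a + c2 * norm (a - a)"
        by (intro tendsto_intros s(2))
      have le: "\<theta> \<le> ?b a + c2 * norm (s n - a)" for n using lip1[OF sO(1) a, of n] sO(2)[of n] by linarith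
      have "\<theta> \<le> ?b a + c2 * norm (a - a)" by (rule LIMSEQ_le_const[OF lim]) (use le in blast)
      then show "a \<in> {x \<in> \<Omega>. \<theta> \<le> ?b x}" using a by simp
    qed
  qed
  show ?thesis
  proof (intro exI[of _ "max c2 R"] conjI ballI allI impI)
    show "0 < max c2 R" using c by simp
    show "\<bar>?b x - ?b y\<bar> \<le> max c2 R * norm (x - y)" if "x \<in> \<Omega>" "y \<in> \<Omega>" for x y
      using lip[OF that] mult_right_mono[of c2 "max c2 R" "norm (x - y)"] by simp
  qed (use pos R comp in \<open>auto simp: le_max_iff_disj\<close>)
qed

text \<open>\<Omega> splits into U near the boundary, where \<delta> equals \<open>bdry_dist\<close>
  and the Lipschitz bound and (D2) apply, and the compact remainder K, where \<delta>, 1/\<delta>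
  and the derivatives are bounded by continuity. The second derivatives are measured against
  1/\<delta> because this is the growth that the weights of Hardy and Rellich compensate.\<close>

lemma regularised_dist_facts:
  fixes \<Omega> :: "(real^'n::finite) set"
  assumes op: "open \<Omega>" and bd: "bounded \<Omega>" and ne: "\<Omega> \<noteq> {}"
    and d: "d \<in> dist_class \<Omega>" and r: "regularised_dist \<Omega> d \<delta>"
  shows "\<exists>C>0. \<forall>x\<in>\<Omega>. 0 < \<delta> x \<and> \<delta> x \<le> C \<and> bdry_dist \<Omega> d x \<le> C * \<delta> x \<and> 0 < bdry_dist \<Omega> d x \<and>
    (\<forall>i. \<bar>partial_deriv i \<delta> x\<bar> \<le> C) \<and> (\<forall>i j. \<bar>partial_deriv i (partial_deriv j \<delta>) x\<bar> \<le> C / \<delta> x)"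
proof -
  let ?b = "bdry_dist \<Omega> d"
  obtain L where L: "L > 0" "\<And>x. x \<in> \<Omega> \<Longrightarrow> 0 < ?b x" "\<And>x. x \<in> \<Omega> \<Longrightarrow> ?b x \<le> L"
    "\<And>x y. x \<in> \<Omega> \<Longrightarrow> y \<in> \<Omega> \<Longrightarrow> \<bar>?b x - ?b y\<bar> \<le> L * norm (x - y)"
    "\<And>\<theta>. \<theta> > 0 \<Longrightarrow> compact {x \<in> \<Omega>. \<theta> \<le> ?b x}"
    using bdry_dist_facts[OF op bd ne d] by blast
  have \<delta>: "Ck_on 2 \<Omega> \<delta>" "\<And>x. x \<in> \<Omega> \<Longrightarrow> 0 < \<delta> x" using r by (auto simp: regularised_dist_def)
  obtain t2 where t2: "t2 > 0" "\<And>x. x \<in> \<Omega> \<Longrightarrow> ?b x < t2 \<Longrightarrow> \<delta> x = ?b x"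
    using r unfolding regularised_dist_def by blast
  obtain t1 \<tau> c where t1: "t1 > 0" "\<tau> > 0"
    and h: "\<And>x. x \<in> \<Omega> \<Longrightarrow> 0 < ?b x \<Longrightarrow> ?b x < t1 \<Longrightarrow> norm (hessian ?b x) \<le> c * ?b x powr (- 1 + \<tau>)"
    and C2: "Ck_on 2 {x\<in>\<Omega>. 0 < ?b x \<and> ?b x < t1} ?b"
    using d unfolding dist_class_def cond_D2_def Let_def by blast
  define t where "t = min t1 t2"
  have t: "t > 0" "t \<le> t1" "t \<le> t2" using t1 t2 by (auto simp: t_def)
  define U where "U = {x \<in> \<Omega>. ?b x < t}"
  define K where "K = {x \<in> \<Omega>. t \<le> ?b x}"
  have cb: "continuous_on \<Omega> ?b"
  proof (rule continuous_on_eq_continuous_within[THEN iffD2], rule ballI)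
    fix x assume x: "x \<in> \<Omega>"
    have "L-lipschitz_on \<Omega> ?b"
      by (rule lipschitz_onI) (use L(1,4) in \<open>auto simp: dist_real_def dist_norm\<close>)
    then show "continuous (at x within \<Omega>) ?b" by (rule lipschitz_on_continuous_within[OF _ x])
  qed
  have U: "open U" "U \<subseteq> \<Omega>" "\<And>x. x \<in> U \<Longrightarrow> \<delta> x = ?b x"
  proof -
    have "U = \<Omega> \<inter> ?b -` {..<t}" by (auto simp: U_def)
    then show "open U" using continuous_open_preimage[OF cb op] by simp
    show "U \<subseteq> \<Omega>" by (auto simp: U_def)
    show "\<delta> x = ?b x" if "x \<in> U" for x using that t2(2)[of x] t by (auto simp: U_def)
  qed
  have K: "compact K" "K \<subseteq> \<Omega>" unfolding K_def using L(5)[OF t(1)] by auto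
  have UK: "x \<in> U \<or> x \<in> K" if "x \<in> \<Omega>" for x using that by (auto simp: U_def K_def)
  have pd: "partial_deriv i \<delta> x = partial_deriv i ?b x" if "x \<in> U" for x i
    by (rule partial_deriv_cong_open[OF U(1) that U(3)])
  have pd2: "partial_deriv i (partial_deriv j \<delta>) x = partial_deriv i (partial_deriv j ?b) x" if "x \<in> U" for x i j
    by (rule partial_deriv_cong_open[OF U(1) that pd])
  have d1: "\<delta> differentiable (at x)" if "x \<in> \<Omega>" for x
    using Ck_on_SucD[of 1 \<Omega> \<delta> x] \<delta>(1) op that by (simp add: numeral_2_eq_2)
  have bound: "\<exists>M>0. \<forall>x\<in>K. \<bar>f x\<bar> \<le> M" if "continuous_on \<Omega> f" for f :: "real^'n \<Rightarrow> real"
  proof -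
    have "bounded (f ` K)"
      by (intro compact_imp_bounded compact_continuous_image continuous_on_subset[OF that] K)
    then show ?thesis by (auto simp: bounded_pos)
  qed
  have cd: "continuous_on \<Omega> \<delta>" "continuous_on \<Omega> (partial_deriv i \<delta>)" "continuous_on \<Omega> (partial_deriv i (partial_deriv j \<delta>))" for i j
    using \<delta>(1) Ck_on_le[OF \<delta>(1), of 0] Ck_on_le[OF \<delta>(1), of 1] by (simp_all add: numeral_2_eq_2)
  have "continuous_on \<Omega> (\<lambda>x. 1 / \<delta> x)"
    by (intro continuous_intros cd) (use \<delta>(2) in force)
  from bound[OF this] obtain M0 where M0: "M0 > 0" "\<And>x. x \<in> K \<Longrightarrow> \<bar>1 / \<delta> x\<bar> \<le> M0" by blast
  obtain M1 where M1: "M1 > 0" "\<And>x. x \<in> K \<Longrightarrow> \<bar>\<delta> x\<bar> \<le> M1" using bound[OF cd(1)] by blast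
  obtain M2 where M2: "\<And>i. M2 i > 0" "\<And>i x. x \<in> K \<Longrightarrow> \<bar>partial_deriv i \<delta> x\<bar> \<le> M2 i"
    using bound[OF cd(2)] by metis
  obtain M3 where M3: "\<And>i j. M3 i j > 0" "\<And>i j x. x \<in> K \<Longrightarrow> \<bar>partial_deriv i (partial_deriv j \<delta>) x\<bar> \<le> M3 i j"
    using bound[OF cd(3)] by metis
  define N2 where "N2 = (\<Sum>i\<in>UNIV. M2 i)"
  define N3 where "N3 = (\<Sum>i\<in>UNIV. \<Sum>j\<in>UNIV. M3 i j)"
  have N2: "M2 i \<le> N2" for i
    unfolding N2_def by (rule member_le_sum) (use M2(1) in \<open>auto intro: less_imp_le\<close>)
  have N3: "M3 i j \<le> N3" for i j
  proof -
    have "M3 i j \<le> (\<Sum>j\<in>UNIV. M3 i j)" by (rule member_le_sum) (use M3(1) in \<open>auto intro: less_imp_le\<close>)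
    also have "\<dots> \<le> N3" unfolding N3_def
      by (rule member_le_sum) (simp_all add: sum_nonneg less_imp_le[OF M3(1)])
    finally show ?thesis .
  qed
  have N0: "N2 \<ge> 0" "N3 \<ge> 0" using N2 N3 M2(1) M3(1) by (meson less_imp_le order_trans)+
  \<comment> \<open>On U one has b^(\<tau> - 1) = b^\<tau> / b, which is at most t^\<tau> / b; H is
    the resulting constant in the Hessian bound.\<close>
  define H where "H = \<bar>c\<bar> * t powr \<tau>"
  define C where "C = 1 + L + M1 + L * M0 + N2 + H + N3 * M1"
  have nn: "L \<ge> 0" "M1 \<ge> 0" "L * M0 \<ge> 0" "N2 \<ge> 0" "H \<ge> 0" "N3 * M1 \<ge> 0" "N3 \<ge> 0"
    using L(1) M1(1) M0(1) N0 by (auto simp: H_def intro: mult_nonneg_nonneg)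
  have Cge: "1 \<le> C" "L \<le> C" "M1 \<le> C" "L * M0 \<le> C" "N2 \<le> C" "H \<le> C" "N3 * M1 \<le> C"
    using nn by (simp_all add: C_def)
  show ?thesis
  proof (intro exI[of _ C] conjI ballI allI)
    show "C > 0" using Cge by simp
    fix x assume x: "x \<in> \<Omega>"
    show "0 < \<delta> x" "0 < ?b x" using \<delta>(2) L(2) x by auto
    show "\<delta> x \<le> C"
      using UK[OF x] U(3)[of x] L(3)[OF x] M1(2)[of x] Cge by fastforce
    show "?b x \<le> C * \<delta> x"
      using UK[OF x]
    proof
      assume "x \<in> U"
      then show ?thesis using U(3)[of x] Cge(1) \<open>0 < ?b x\<close> mult_right_mono[of 1 C "?b x"] by simp
    next
      assume k: "x \<in> K"
      then have "1 \<le> M0 * \<delta> x" using M0(2)[OF k] \<delta>(2)[OF x] by (simp add: field_simps)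
      then have "L * 1 \<le> L * (M0 * \<delta> x)" using nn by (intro mult_left_mono) auto
      also have "\<dots> \<le> C * \<delta> x" using Cge(4) \<delta>(2)[OF x] by (simp add: mult.assoc[symmetric] mult_right_mono)
      finally show ?thesis using L(3)[OF x] by simp
    qed
    show "\<bar>partial_deriv i \<delta> x\<bar> \<le> C" for i
      using UK[OF x]
    proof
      assume u: "x \<in> U"
      have "\<bar>partial_deriv i \<delta> x\<bar> \<le> L"
        by (rule partial_deriv_le_Lipschitz[OF U(1) u d1[OF x]]) (use U L(4) x u in auto)
      then show ?thesis using Cge by linarith
    next
      assume "x \<in> K"
      then show ?thesis using M2(2)[of x i] N2[of i] Cge by linarith
    qed
    show "\<bar>partial_deriv i (partial_deriv j \<delta>) x\<bar> \<le> C / \<delta> x" for i j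
      using UK[OF x]
    proof
      assume u: "x \<in> U"
      then have bt: "0 < ?b x" "?b x < t" "?b x < t1" using L(2)[OF x] t by (auto simp: U_def)
      have "\<bar>hessian ?b x $ i $ j\<bar> \<le> norm (hessian ?b x)"
        by (rule order_trans[OF component_le_norm_cart Finite_Cartesian_Product.norm_nth_le])
      then have "\<bar>partial_deriv i (partial_deriv j \<delta>) x\<bar> \<le> c * ?b x powr (- 1 + \<tau>)"
        using h[OF x bt(1,3)] by (simp add: hessian_def pd2[OF u])
      also have "\<dots> \<le> \<bar>c\<bar> * ?b x powr (- 1 + \<tau>)" by (simp add: mult_right_mono)
      also have "?b x powr (- 1 + \<tau>) = ?b x powr \<tau> / ?b x"
        using bt(1) by (simp add: powr_diff)
      also have "\<bar>c\<bar> * (?b x powr \<tau> / ?b x) \<le> \<bar>c\<bar> * (t powr \<tau> / ?b x)"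
        using bt t1(2) by (intro mult_left_mono divide_right_mono powr_mono2) auto
      also have "\<dots> = H / \<delta> x" using U(3)[OF u] by (simp add: H_def)
      also have "\<dots> \<le> C / \<delta> x" using Cge \<delta>(2)[OF x] by (intro divide_right_mono) auto
      finally show ?thesis .
    next
      assume k: "x \<in> K"
      have "\<bar>partial_deriv i (partial_deriv j \<delta>) x\<bar> * \<delta> x \<le> N3 * M1"
        using M3(2)[OF k, of i j] N3[of i j] M1(2)[OF k] \<delta>(2)[OF x] nn by (intro mult_mono) auto
      then show ?thesis using Cge \<delta>(2)[OF x] by (simp add: field_simps)
    qed
  qed
qed

section \<open>Hardy and Rellich inequalities\<close>

text \<open>Put s = \<delta> + 1/n, so that \<omega> = s^(-p); each derivative costs a factor 1/s
  \<le> 1/\<delta>, uniformly in n. B adds the constant pC of the first derivatives to p((p + 1) C^2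
  + C), that of the second ones, where the last C stems from the Hessian of \<delta>. General p
  covers both \<omega>_n and its square.\<close>

lemma omega_facts:
  fixes \<Omega> :: "(real^'n::finite) set"
  assumes op: "open \<Omega>" and \<delta>: "Ck_on 2 \<Omega> \<delta>" and p: "p > 0" and C: "C > 0"
    and pos: "\<And>x. x \<in> \<Omega> \<Longrightarrow> 0 < \<delta> x"
    and b1: "\<And>x i. x \<in> \<Omega> \<Longrightarrow> \<bar>partial_deriv i \<delta> x\<bar> \<le> C"
    and b2: "\<And>x i j. x \<in> \<Omega> \<Longrightarrow> \<bar>partial_deriv i (partial_deriv j \<delta>) x\<bar> \<le> C / \<delta> x"
  defines "B \<equiv> p * C + p * ((p + 1) * C\<^sup>2 + C)"
  shows "Ck_on 2 \<Omega> (omega \<delta> p n)"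
    and "\<And>x i. x \<in> \<Omega> \<Longrightarrow> \<bar>partial_deriv i (omega \<delta> p n) x\<bar> \<le> B * (omega \<delta> p n x / \<delta> x)"
    and "\<And>x i j. x \<in> \<Omega> \<Longrightarrow> \<bar>partial_deriv i (partial_deriv j (omega \<delta> p n)) x\<bar> \<le> B * (omega \<delta> p n x / (\<delta> x)\<^sup>2)"
proof -
  let ?o = "omega \<delta> p n"
  define s where "s x = \<delta> x + 1 / real n" for x
  have s: "Ck_on 2 \<Omega> s" unfolding s_def by (intro Ck_on_add op \<delta> Ck_on_const)
  have sd: "\<delta> x \<le> s x" for x by (simp add: s_def)
  have sp: "0 < s x" if "x \<in> \<Omega>" for x using sd[of x] pos[OF that] by linarith
  have o: "?o = (\<lambda>x. s x powr (- p))" by (simp add: omega_def s_def fun_eq_iff)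
  show "Ck_on 2 \<Omega> ?o" unfolding o by (rule Ck_on_powr[OF op s sp])
  have d\<delta>: "\<delta> differentiable (at x)" if "x \<in> \<Omega>" for x
    using Ck_on_SucD[of 1 \<Omega> \<delta> x] \<delta> op that by (simp add: numeral_2_eq_2)
  have ds: "s differentiable (at x)" if "x \<in> \<Omega>" for x
    unfolding s_def using d\<delta>[OF that] by (intro differentiable_add) simp_all
  have d\<delta>2: "partial_deriv j \<delta> differentiable (at x)" if "x \<in> \<Omega>" for x j
    using Ck_on_SucD[of 0 \<Omega> "partial_deriv j \<delta>" x] \<delta> op that by (simp add: numeral_2_eq_2)
  have ps: "partial_deriv i s x = partial_deriv i \<delta> x" if "x \<in> \<Omega>" for x i
    unfolding s_def using partial_deriv_add[OF d\<delta>[OF that], of "\<lambda>_. 1 / real n" i] by simp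
  have pw: "((\<lambda>t. t powr q) has_real_derivative q * t powr (q - 1)) (at t)" if "t > 0" for t q :: real
    using that by (auto intro!: derivative_eq_intros)
  have ppow: "partial_deriv i (\<lambda>x. s x powr q) x = q * s x powr (q - 1) * partial_deriv i \<delta> x"
    "(\<lambda>x. s x powr q) differentiable (at x)" if "x \<in> \<Omega>" for x i q
    using partial_deriv_compose[OF ds[OF that] pw[OF sp[OF that]]] ps[OF that] by simp_all
  have d1: "partial_deriv i ?o x = - p * s x powr (- p - 1) * partial_deriv i \<delta> x" if "x \<in> \<Omega>" for x i
    unfolding o by (rule ppow(1)[OF that])
  have d2: "partial_deriv i (partial_deriv j ?o) x = - p * ((- p - 1) * s x powr (- p - 2) * partial_deriv i \<delta> x * partial_deriv j \<delta> x
      + s x powr (- p - 1) * partial_deriv i (partial_deriv j \<delta>) x)" if x: "x \<in> \<Omega>" for x i j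
  proof -
    have "partial_deriv i (partial_deriv j ?o) x
        = partial_deriv i (\<lambda>x. - p * (s x powr (- p - 1) * partial_deriv j \<delta> x)) x"
      by (rule partial_deriv_cong_open[OF op x]) (simp add: d1)
    also have "\<dots> = - p * partial_deriv i (\<lambda>x. s x powr (- p - 1) * partial_deriv j \<delta> x) x"
      using partial_deriv_mult[of "\<lambda>_. - p" x "\<lambda>x. s x powr (- p - 1) * partial_deriv j \<delta> x" i]
        ppow(2)[OF x, of "- p - 1"] d\<delta>2[OF x, of j] by (simp add: differentiable_mult)
    also have "partial_deriv i (\<lambda>x. s x powr (- p - 1) * partial_deriv j \<delta> x) x
        = ((- p - 1) * s x powr (- p - 1 - 1) * partial_deriv i \<delta> x) * partial_deriv j \<delta> x
          + s x powr (- p - 1) * partial_deriv i (partial_deriv j \<delta>) x"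
      using partial_deriv_mult[OF ppow(2)[OF x] d\<delta>2[OF x]] ppow(1)[OF x] by simp
    finally have "partial_deriv i (partial_deriv j ?o) x = - p * (((- p - 1) * s x powr (- p - 1 - 1) * partial_deriv i \<delta> x) * partial_deriv j \<delta> x
          + s x powr (- p - 1) * partial_deriv i (partial_deriv j \<delta>) x)" .
    moreover have "- p - 1 - 1 = - p - 2" by simp
    ultimately show ?thesis by (simp only:)
  qed
  have nn: "p * C \<ge> 0" "p * ((p + 1) * C\<^sup>2 + C) \<ge> 0" using p C by (auto intro!: mult_nonneg_nonneg add_nonneg_nonneg)
  have e1: "s x powr (- p - 1) = ?o x / s x" "s x powr (- p - 2) = ?o x / (s x)\<^sup>2" if "x \<in> \<Omega>" for x
    using sp[OF that] powr_realpow[of "s x" 2] by (simp_all add: o powr_diff)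
  have onn: "?o x \<ge> 0" for x by (simp add: o)
  have q1: "?o x / s x \<le> ?o x / \<delta> x" "?o x / (s x)\<^sup>2 \<le> ?o x / (\<delta> x)\<^sup>2" "?o x / s x * (C / \<delta> x) \<le> C * (?o x / (\<delta> x)\<^sup>2)"
    if "x \<in> \<Omega>" for x
  proof -
    show *: "?o x / s x \<le> ?o x / \<delta> x" by (rule divide_left_mono[OF sd onn]) (use pos[OF that] sp[OF that] in simp)
    have "(\<delta> x)\<^sup>2 \<le> (s x)\<^sup>2" using pos[OF that] by (intro power_mono sd) simp
    then show "?o x / (s x)\<^sup>2 \<le> ?o x / (\<delta> x)\<^sup>2"
      by (rule divide_left_mono[OF _ onn]) (use pos[OF that] sp[OF that] in simp)
    have "?o x / s x * (C / \<delta> x) \<le> ?o x / \<delta> x * (C / \<delta> x)"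
      by (rule mult_right_mono[OF *]) (use C pos[OF that] in simp)
    then show "?o x / s x * (C / \<delta> x) \<le> C * (?o x / (\<delta> x)\<^sup>2)" by (simp add: power2_eq_square mult.commute)
  qed
  show "\<bar>partial_deriv i ?o x\<bar> \<le> B * (?o x / \<delta> x)" if x: "x \<in> \<Omega>" for x i
  proof -
    have "\<bar>partial_deriv i ?o x\<bar> = p * (?o x / s x) * \<bar>partial_deriv i \<delta> x\<bar>"
      using p sp[OF x] onn[of x] by (simp add: d1[OF x] e1[OF x] abs_mult)
    also have "\<dots> \<le> p * (?o x / \<delta> x) * C"
      using p onn[of x] sp[OF x] pos[OF x] by (intro mult_mono q1(1)[OF x] b1[OF x] order_refl) auto
    also have "\<dots> = (p * C) * (?o x / \<delta> x)" by simp
    also have "\<dots> \<le> B * (?o x / \<delta> x)"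
      unfolding B_def using nn onn[of x] pos[OF x] by (intro mult_right_mono) auto
    finally show ?thesis .
  qed
  show "\<bar>partial_deriv i (partial_deriv j ?o) x\<bar> \<le> B * (?o x / (\<delta> x)\<^sup>2)" if x: "x \<in> \<Omega>" for x i j
  proof -
    let ?X = "(- p - 1) * (?o x / (s x)\<^sup>2) * partial_deriv i \<delta> x * partial_deriv j \<delta> x"
    let ?Y = "?o x / s x * partial_deriv i (partial_deriv j \<delta>) x"
    have "\<bar>?X\<bar> = (p + 1) * (?o x / (s x)\<^sup>2) * (\<bar>partial_deriv i \<delta> x\<bar> * \<bar>partial_deriv j \<delta> x\<bar>)"
      using p onn[of x] by (simp add: abs_mult abs_minus_commute mult.assoc)
    also have "\<dots> \<le> (p + 1) * (?o x / (\<delta> x)\<^sup>2) * (C * C)"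
      using p onn[of x] C by (intro mult_mono q1(2)[OF x] b1[OF x] order_refl) auto
    finally have X: "\<bar>?X\<bar> \<le> (p + 1) * C\<^sup>2 * (?o x / (\<delta> x)\<^sup>2)" by (simp add: power2_eq_square mult_ac)
    have "\<bar>?Y\<bar> = ?o x / s x * \<bar>partial_deriv i (partial_deriv j \<delta>) x\<bar>"
      using onn[of x] sp[OF x] by (simp add: abs_mult)
    also have "\<dots> \<le> ?o x / s x * (C / \<delta> x)"
      using onn[of x] sp[OF x] by (intro mult_left_mono b2[OF x]) auto
    finally have Y: "\<bar>?Y\<bar> \<le> C * (?o x / (\<delta> x)\<^sup>2)" using q1(3)[OF x] by linarith
    have "\<bar>partial_deriv i (partial_deriv j ?o) x\<bar> = p * \<bar>?X + ?Y\<bar>"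
      using p by (simp add: d2[OF x] e1[OF x] abs_mult)
    also have "\<dots> \<le> p * (((p + 1) * C\<^sup>2 + C) * (?o x / (\<delta> x)\<^sup>2))"
    proof (rule mult_left_mono)
      have "\<bar>?X + ?Y\<bar> \<le> (p + 1) * C\<^sup>2 * (?o x / (\<delta> x)\<^sup>2) + C * (?o x / (\<delta> x)\<^sup>2)"
        by (rule order_trans[OF abs_triangle_ineq add_mono[OF X Y]])
      then show "\<bar>?X + ?Y\<bar> \<le> ((p + 1) * C\<^sup>2 + C) * (?o x / (\<delta> x)\<^sup>2)" by (simp only: distrib_right)
    qed (use p in simp)
    also have "\<dots> = (p * ((p + 1) * C\<^sup>2 + C)) * (?o x / (\<delta> x)\<^sup>2)" by (simp add: mult_ac)
    also have "\<dots> \<le> B * (?o x / (\<delta> x)\<^sup>2)"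
      unfolding B_def using nn onn[of x] by (intro mult_right_mono) auto
    finally show ?thesis .
  qed
qed

lemma laplacian_Cc: "v \<in> Cc 2 \<Omega> \<Longrightarrow> laplacian v = (\<lambda>x. \<Sum>i\<in>UNIV. mderiv (mi2 i i) v x)"
  by (simp add: laplacian_def Cc_def mderiv_mi2 fun_eq_iff)

text \<open>The bound \<open>bdry_dist\<close> \<le> C \<delta> turns into \<delta>^(-k) \<le> C^k
  b^(-k) with b = \<open>bdry_dist\<close>, which transfers (D3) to the weights in \<delta>. The
  gradient inequality is kept one component at a time.\<close>

lemma hardy_rellich_Cc:
  fixes \<Omega> :: "(real^'n::finite) set"
  assumes op: "open \<Omega>" and bd: "bounded \<Omega>" and d: "cond_D3 \<Omega> d" and \<delta>: "Ck_on 2 \<Omega> \<delta>"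
    and C: "C > 0" "\<And>x. x \<in> \<Omega> \<Longrightarrow> 0 < \<delta> x \<and> 0 < bdry_dist \<Omega> d x \<and> bdry_dist \<Omega> d x \<le> C * \<delta> x"
  shows "\<exists>K>0. \<forall>v\<in>Cc 2 \<Omega>. 
     (\<integral>\<^sup>+x. ennreal (1 / \<delta> x ^ 4 * (v x)\<^sup>2) \<partial>lebesgue_on \<Omega>) \<le> ennreal (K * (L2_norm \<Omega> (laplacian v))\<^sup>2) \<and>
     (\<forall>i. (\<integral>\<^sup>+x. ennreal (1 / \<delta> x ^ 2 * (partial_deriv i v x)\<^sup>2) \<partial>lebesgue_on \<Omega>) \<le> ennreal (K * (L2_norm \<Omega> (laplacian v))\<^sup>2))"
proof -
  let ?M = "lebesgue_on \<Omega>" and ?b = "bdry_dist \<Omega> d"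
  obtain c3 where c3: "c3 > 0" and D3: "\<And>v. v \<in> Cc 2 \<Omega> \<Longrightarrow>
     (\<integral>\<^sup>+x. ennreal ((laplacian v x)\<^sup>2) \<partial>?M) \<ge> ennreal c3 * (\<integral>\<^sup>+x. ennreal ((v x)\<^sup>2 / ?b x ^ 4) \<partial>?M) \<and>
     (\<integral>\<^sup>+x. ennreal ((laplacian v x)\<^sup>2) \<partial>?M) \<ge> ennreal c3 * (\<integral>\<^sup>+x. ennreal ((norm (gradient v x))\<^sup>2 / (?b x)\<^sup>2) \<partial>?M)"
    using d unfolding cond_D3_def by blast
  have inv: "A \<le> ennreal (1 / c3) * B" if "ennreal c3 * A \<le> B" for A B :: ennreal
  proof -
    have "ennreal (1 / c3) * (ennreal c3 * A) \<le> ennreal (1 / c3) * B" using that by (rule mult_left_mono) simp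
    moreover have "ennreal (1 / c3) * (ennreal c3 * A) = A"
      using c3 by (simp add: mult.assoc[symmetric] ennreal_mult[symmetric])
    ultimately show ?thesis by simp
  qed
  have wk: "1 / \<delta> x ^ k \<le> C ^ k * (1 / ?b x ^ k)" if "x \<in> \<Omega>" for x k
  proof -
    have "?b x ^ k \<le> (C * \<delta> x) ^ k" using C(2)[OF that] by (intro power_mono) auto
    then show ?thesis using C(2)[OF that] by (simp add: field_simps power_mult_distrib)
  qed
  have bound: "(\<integral>\<^sup>+x. ennreal (1 / \<delta> x ^ k * (f x)\<^sup>2) \<partial>?M) \<le> ennreal (C ^ k / c3 * (L2_norm \<Omega> (laplacian v))\<^sup>2)"
    if f: "\<And>x. x \<in> \<Omega> \<Longrightarrow> (f x)\<^sup>2 / ?b x ^ k \<le> g x" 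
      and le: "(\<integral>\<^sup>+x. ennreal ((laplacian v x)\<^sup>2) \<partial>?M) \<ge> ennreal c3 * (\<integral>\<^sup>+x. ennreal (g x) \<partial>?M)"
      and v: "v \<in> Cc 2 \<Omega>" and m: "(\<lambda>x. ennreal (f x ^ 2 / \<delta> x ^ k)) \<in> borel_measurable ?M" for k f g v
  proof -
    have lv: "laplacian v \<in> L2 \<Omega>" unfolding laplacian_Cc[OF v]
      by (intro L2_sum Cc_mderiv_L2[OF op bd v]) (simp add: mdeg_mi)
    \<comment> \<open>C^k is moved out of an integrand built from \<delta>, which is measurable; the
      integrand with \<open>bdry_dist\<close> enters afterwards by monotonicity alone.\<close>
    have "(\<integral>\<^sup>+x. ennreal (1 / \<delta> x ^ k * (f x)\<^sup>2) \<partial>?M) = ennreal (C ^ k) * (\<integral>\<^sup>+x. ennreal (1 / C ^ k) * ennreal ((f x)\<^sup>2 / \<delta> x ^ k) \<partial>?M)"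
      using C(1) by (subst nn_integral_cmult[OF m]) (simp add: mult.assoc[symmetric] ennreal_mult[symmetric])
    also have "(\<integral>\<^sup>+x. ennreal (1 / C ^ k) * ennreal ((f x)\<^sup>2 / \<delta> x ^ k) \<partial>?M) \<le> (\<integral>\<^sup>+x. ennreal (g x) \<partial>?M)"
    proof (rule nn_integral_mono)
      fix x assume "x \<in> space ?M"
      then have x: "x \<in> \<Omega>" by (simp add: space_restrict_space)
      have "1 / C ^ k * ((f x)\<^sup>2 / \<delta> x ^ k) = (f x)\<^sup>2 * (1 / C ^ k * (1 / \<delta> x ^ k))" by simp
      also have "\<dots> \<le> (f x)\<^sup>2 * (1 / C ^ k * (C ^ k * (1 / ?b x ^ k)))"
        using C(1) by (intro mult_left_mono wk[OF x]) auto
      also have "\<dots> = (f x)\<^sup>2 / ?b x ^ k" using C(1) by simp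
      also have "\<dots> \<le> g x" by (rule f[OF x])
      finally show "ennreal (1 / C ^ k) * ennreal ((f x)\<^sup>2 / \<delta> x ^ k) \<le> ennreal (g x)"
        using C by (simp add: ennreal_mult'[symmetric] ennreal_leI)
    qed
    also have "\<dots> \<le> ennreal (1 / c3) * (\<integral>\<^sup>+x. ennreal ((laplacian v x)\<^sup>2) \<partial>?M)" by (rule inv[OF le])
    also have "\<dots> = ennreal (1 / c3) * ennreal ((L2_norm \<Omega> (laplacian v))\<^sup>2)" by (simp only: nn_integral_square_L2[OF lv])
    finally have "(\<integral>\<^sup>+x. ennreal (1 / \<delta> x ^ k * (f x)\<^sup>2) \<partial>?M) \<le> ennreal (C ^ k) * (ennreal (1 / c3) * ennreal ((L2_norm \<Omega> (laplacian v))\<^sup>2))"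
      by (simp add: mult_left_mono)
    also have "\<dots> = ennreal (C ^ k / c3 * (L2_norm \<Omega> (laplacian v))\<^sup>2)"
      using C(1) c3 by (simp add: ennreal_mult[symmetric])
    finally show ?thesis .
  qed
  have m\<delta>: "\<delta> \<in> borel_measurable ?M"
    using Ck_on_le[OF \<delta>, of 0] op by (intro continuous_imp_measurable_on_sets_lebesgue) auto
  show ?thesis
  proof (intro exI[of _ "C ^ 4 / c3 + C ^ 2 / c3"] conjI ballI allI)
    show "0 < C ^ 4 / c3 + C ^ 2 / c3" using C c3 by (simp add: add_pos_pos)
    fix v assume v: "v \<in> Cc 2 \<Omega>"
    have v1: "partial_deriv i v \<in> L2 \<Omega>" for i
      using Cc_mderiv_L2[OF op bd v, of "mi1 i"] by (simp add: mdeg_mi mderiv_mi1)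
    have nn: "C ^ 4 / c3 \<ge> 0" "C ^ 2 / c3 \<ge> 0" using C c3 by simp_all
    have "(\<integral>\<^sup>+x. ennreal (1 / \<delta> x ^ 4 * (v x)\<^sup>2) \<partial>?M) \<le> ennreal (C ^ 4 / c3 * (L2_norm \<Omega> (laplacian v))\<^sup>2)"
      by (rule bound[OF order_refl conjunct1[OF D3[OF v]] v])
         (use m\<delta> L2_measurable[OF Cc_L2[OF op bd v]] in measurable)
    also have "\<dots> \<le> ennreal ((C ^ 4 / c3 + C ^ 2 / c3) * (L2_norm \<Omega> (laplacian v))\<^sup>2)"
      using nn by (intro ennreal_leI mult_right_mono) auto
    finally show "(\<integral>\<^sup>+x. ennreal (1 / \<delta> x ^ 4 * (v x)\<^sup>2) \<partial>?M) \<le> ennreal ((C ^ 4 / c3 + C ^ 2 / c3) * (L2_norm \<Omega> (laplacian v))\<^sup>2)" .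
    fix i
    have "(\<integral>\<^sup>+x. ennreal (1 / \<delta> x ^ 2 * (partial_deriv i v x)\<^sup>2) \<partial>?M) \<le> ennreal (C ^ 2 / c3 * (L2_norm \<Omega> (laplacian v))\<^sup>2)"
    proof (rule bound[OF _ conjunct2[OF D3[OF v]] v])
      fix x assume x: "x \<in> \<Omega>"
      have "\<bar>gradient v x $ i\<bar>\<^sup>2 \<le> (norm (gradient v x))\<^sup>2" by (rule power_mono[OF component_le_norm_cart]) simp
      then show "(partial_deriv i v x)\<^sup>2 / ?b x ^ 2 \<le> (norm (gradient v x))\<^sup>2 / (?b x)\<^sup>2"
        by (intro divide_right_mono) (simp_all add: gradient_def)
    qed (use m\<delta> L2_measurable[OF v1] in measurable)
    also have "\<dots> \<le> ennreal ((C ^ 4 / c3 + C ^ 2 / c3) * (L2_norm \<Omega> (laplacian v))\<^sup>2)"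
      using nn by (intro ennreal_leI mult_right_mono) auto
    finally show "(\<integral>\<^sup>+x. ennreal (1 / \<delta> x ^ 2 * (partial_deriv i v x)\<^sup>2) \<partial>?M) \<le> ennreal ((C ^ 4 / c3 + C ^ 2 / c3) * (L2_norm \<Omega> (laplacian v))\<^sup>2)" .
  qed
qed

text \<open>Two integrations by parts exchange the roles of the indices; they pass through third
  derivatives, which explains the smooth test functions.\<close>

lemma integral_hessian_eq_laplacian:
  fixes \<phi> :: "real^'n::finite \<Rightarrow> real"
  assumes "\<phi> \<in> Cc_inf \<Omega>"
  shows "(LINT x|lborel. (partial_deriv i (partial_deriv j \<phi>) x)\<^sup>2)
    = (LINT x|lborel. partial_deriv i (partial_deriv i \<phi>) x * partial_deriv j (partial_deriv j \<phi>) x)"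
proof -
  have C: "\<psi> \<in> Cc k UNIV" "Ck_on k UNIV \<psi>" if "\<psi> \<in> Cc_inf \<Omega>" for \<psi> k
    using Cc_inf_imp_Cc[OF that, of k] by (simp_all add: Cc_def)
  note p = Cc_inf_partial_deriv
  have comm: "partial_deriv k (partial_deriv l \<psi>) = partial_deriv l (partial_deriv k \<psi>)" if "\<psi> \<in> Cc_inf \<Omega>" for k l \<psi>
    by (rule ext) (rule partial_deriv_commute[OF C(2)[OF that]])
  have eq: "partial_deriv i (partial_deriv i (partial_deriv j \<phi>)) = partial_deriv j (partial_deriv i (partial_deriv i \<phi>))"
    using comm[OF assms, of i j] comm[OF p[OF assms], of i j i] by simp
  have "(LINT x|lborel. (partial_deriv i (partial_deriv j \<phi>) x)\<^sup>2)
      = - (LINT x|lborel. partial_deriv j \<phi> x * partial_deriv i (partial_deriv i (partial_deriv j \<phi>)) x)"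
    using integral_by_parts_Cc[OF C(2)[OF p[OF assms]] C(1)[OF p[OF p[OF assms]]], of j i i j]
    by (simp add: power2_eq_square)
  also have "\<dots> = (LINT x|lborel. partial_deriv j (partial_deriv j \<phi>) x * partial_deriv i (partial_deriv i \<phi>) x)"
    unfolding eq using integral_by_parts_Cc[OF C(2)[OF p[OF assms]] C(1)[OF p[OF p[OF assms]]], of j j i i] by simp
  finally show ?thesis by (simp add: mult.commute)
qed

text \<open>Summed over i and j, the preceding identity equates the squared norm of the full Hessian
  with that of the Laplacian; a single entry is one nonnegative summand.\<close>

lemma L2_norm_hessian_le_laplacian:
  fixes \<phi> :: "real^'n::finite \<Rightarrow> real"
  assumes op: "open \<Omega>" and bd: "bounded \<Omega>" and \<phi>: "\<phi> \<in> Cc_inf \<Omega>"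
  shows "L2_norm \<Omega> (partial_deriv i (partial_deriv j \<phi>)) \<le> L2_norm \<Omega> (laplacian \<phi>)"
proof -
  let ?D = "\<lambda>i j. partial_deriv i (partial_deriv j \<phi>)"
  have D: "?D i j \<in> Cc_inf \<Omega>" for i j by (intro Cc_inf_partial_deriv \<phi>)
  have L: "?D i j \<in> L2 \<Omega>" for i j by (rule Cc_L2[OF op bd Cc_inf_imp_Cc[OF D]])
  have inner: "L2_inner \<Omega> (?D i j) (?D k l) = (LINT x|lborel. ?D i j x * ?D k l x)" for i j k l
    unfolding L2_inner_def
    by (rule Cc_integral_lebesgue_on(1)[OF op Cc_mult[OF op _ Cc_inf_imp_Cc[OF D]]])
       (use Cc_continuous[OF Cc_inf_imp_Cc[OF D], THEN continuous_on_subset] in auto)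
  have eq: "L2_inner \<Omega> (?D i j) (?D i j) = L2_inner \<Omega> (?D i i) (?D j j)" for i j
    unfolding inner using integral_hessian_eq_laplacian[OF \<phi>, of i j] by (simp add: power2_eq_square)
  have lap: "laplacian \<phi> = (\<lambda>x. \<Sum>i\<in>UNIV. ?D i i x)" by (simp add: laplacian_def fun_eq_iff)
  have "L2_inner \<Omega> (laplacian \<phi>) (laplacian \<phi>) = (\<Sum>i\<in>UNIV. \<Sum>j\<in>UNIV. L2_inner \<Omega> (?D i i) (?D j j))"
    unfolding L2_inner_def lap sum_product
    using L2_integrable_mult[OF L L] by (simp add: Bochner_Integration.integral_sum Bochner_Integration.integrable_sum)
  also have "\<dots> = (\<Sum>i\<in>UNIV. \<Sum>j\<in>UNIV. L2_inner \<Omega> (?D i j) (?D i j))" by (simp add: eq)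
  also have "\<dots> \<ge> (\<Sum>j\<in>UNIV. L2_inner \<Omega> (?D i j) (?D i j))"
    by (rule member_le_sum) (auto intro!: sum_nonneg L2_inner_self_nonneg)
  also have "(\<Sum>j\<in>UNIV. L2_inner \<Omega> (?D i j) (?D i j)) \<ge> L2_inner \<Omega> (?D i j) (?D i j)"
    by (rule member_le_sum) (auto intro!: L2_inner_self_nonneg)
  finally show ?thesis unfolding L2_norm_def by (rule real_sqrt_le_mono)
qed

section \<open>Multipliers on \<open>H\<^sup>2\<^sub>0(\<Omega>)\<close>\<close>

lemma L2_norm_sum:
  assumes "finite I" "\<And>i. i \<in> I \<Longrightarrow> f i \<in> L2 \<Omega>"
  shows "L2_norm \<Omega> (\<lambda>x. \<Sum>i\<in>I. f i x) \<le> (\<Sum>i\<in>I. L2_norm \<Omega> (f i))"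
  using assms
proof (induction I rule: finite_induct)
  case empty
  then show ?case by (simp add: L2_norm_def L2_inner_def)
next
  case (insert i I)
  have "L2_norm \<Omega> (\<lambda>x. f i x + (\<Sum>i\<in>I. f i x)) \<le> L2_norm \<Omega> (f i) + L2_norm \<Omega> (\<lambda>x. \<Sum>i\<in>I. f i x)"
    using insert.prems by (intro L2_norm_triangle L2_sum) auto
  also have "\<dots> \<le> L2_norm \<Omega> (f i) + (\<Sum>i\<in>I. L2_norm \<Omega> (f i))"
    using insert.IH insert.prems by simp
  finally show ?case using insert.hyps by simp
qed

lemma L2_norm_abs: "L2_norm \<Omega> (\<lambda>x. \<bar>f x\<bar>) = L2_norm \<Omega> f"
  by (simp add: L2_norm_def L2_inner_def)

lemma L2_abs: "f \<in> L2 \<Omega> \<Longrightarrow> (\<lambda>x. \<bar>f x\<bar>) \<in> L2 \<Omega>"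
  by (rule L2_I_bounded_square[of _ _ f 1]) (auto simp: L2_def)

text \<open>The derivative of order \<open>\<eta>\<close> of \<open>\<omega> u\<close>, where \<open>D\<close> are the derivatives of \<open>u\<close>.\<close>

definition leibniz ::
  "(real^'n::finite \<Rightarrow> real) \<Rightarrow> ('n mindex \<Rightarrow> real^'n \<Rightarrow> real) \<Rightarrow> 'n mindex \<Rightarrow> real^'n \<Rightarrow> real" where
  "leibniz \<omega> D \<eta> x =
    (if mdeg \<eta> = 0 then \<omega> x * D \<eta> x
     else if mdeg \<eta> = 1 then
       (let i = (SOME i. \<eta> = mi1 i) in partial_deriv i \<omega> x * D (\<lambda>_. 0) x + \<omega> x * D \<eta> x)
     else (let (i, j) = (SOME (i, j). \<eta> = mi2 i j) in
       \<omega> x * D \<eta> x + partial_deriv i \<omega> x * D (mi1 j) x + partial_deriv j \<omega> x * D (mi1 i) x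
         + partial_deriv i (partial_deriv j \<omega>) x * D (\<lambda>_. 0) x))"

text \<open>The indices inside \<open>leibniz\<close> are recovered by choice, so for a mixed second
  derivative they may come in either order. The rule hands out the chosen indices, for which the
  formula is literally true, and spares a symmetry argument.\<close>

lemma leibniz_cases:
  fixes \<eta> :: "'n::finite mindex"
  assumes "mdeg \<eta> \<le> 2"
  obtains (zero) "\<eta> = (\<lambda>_. 0)" "\<And>\<omega> D x. leibniz \<omega> D \<eta> x = \<omega> x * D (\<lambda>_. 0) x"
  | (one) i where "\<eta> = mi1 i"
      "\<And>\<omega> D x. leibniz \<omega> D \<eta> x = partial_deriv i \<omega> x * D (\<lambda>_. 0) x + \<omega> x * D (mi1 i) x"
  | (two) i j where "\<eta> = mi2 i j"
      "\<And>\<omega> D x. leibniz \<omega> D \<eta> x = \<omega> x * D (mi2 i j) x + partial_deriv i \<omega> x * D (mi1 j) x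
        + partial_deriv j \<omega> x * D (mi1 i) x + partial_deriv i (partial_deriv j \<omega>) x * D (\<lambda>_. 0) x"
  using assms
proof (cases rule: mindex_le_2_cases)
  case 1
  then show ?thesis by (intro zero) (simp_all add: leibniz_def mdeg_mi)
next
  case (2 i)
  define k where "k = (SOME i. \<eta> = mi1 i)"
  have k: "\<eta> = mi1 k" unfolding k_def by (rule someI[of "\<lambda>i. \<eta> = mi1 i"]) (rule 2)
  show ?thesis
  proof (rule one[OF k])
    have "mdeg \<eta> = 1" by (simp add: k mdeg_mi)
    then show "leibniz \<omega> D \<eta> x = partial_deriv k \<omega> x * D (\<lambda>_. 0) x + \<omega> x * D (mi1 k) x" for \<omega> D x
      unfolding leibniz_def k_def[symmetric] Let_def by (simp add: k[symmetric])
  qed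
next
  case (3 i j)
  define k where "k = (SOME p. case p of (i, j) \<Rightarrow> \<eta> = mi2 i j)"
  have "case k of (i, j) \<Rightarrow> \<eta> = mi2 i j"
    unfolding k_def by (rule someI[of "\<lambda>p. case p of (i, j) \<Rightarrow> \<eta> = mi2 i j" "(i, j)"]) (use 3 in simp)
  then obtain l m where lm: "k = (l, m)" and k: "\<eta> = mi2 l m" by (cases k) auto
  show ?thesis
  proof (rule two[OF k])
    have "mdeg \<eta> = 2" by (simp add: k mdeg_mi)
    then show "leibniz \<omega> D \<eta> x = \<omega> x * D (mi2 l m) x + partial_deriv l \<omega> x * D (mi1 m) x
        + partial_deriv m \<omega> x * D (mi1 l) x + partial_deriv l (partial_deriv m \<omega>) x * D (\<lambda>_. 0) x" for \<omega> D x
      unfolding leibniz_def k_def[symmetric] lm by (simp add: k[symmetric])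
  qed
qed

lemma leibniz_diff:
  assumes "mdeg \<eta> \<le> 2"
  shows "leibniz \<omega> (\<lambda>\<zeta> x. D \<zeta> x - D' \<zeta> x) \<eta> x = leibniz \<omega> D \<eta> x - leibniz \<omega> D' \<eta> x"
  using assms by (cases rule: leibniz_cases) (simp_all add: algebra_simps)

lemma mderiv_leibniz:
  assumes op: "open \<Omega>" and f: "f \<in> Cc 2 \<Omega>" and \<omega>: "Ck_on 2 \<Omega> \<omega>" and x: "x \<in> \<Omega>" and \<eta>: "mdeg \<eta> \<le> 2"
  shows "mderiv \<eta> (\<lambda>x. \<omega> x * f x) x = leibniz \<omega> (\<lambda>\<zeta>. mderiv \<zeta> f) \<eta> x"
proof -
  have f2: "Ck_on 2 UNIV f" "Ck_on 2 UNIV (\<lambda>x. \<omega> x * f x)"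
    using f Cc_mult[OF op \<omega> f] by (simp_all add: Cc_def)
  have d: "\<omega> differentiable (at y)" "f differentiable (at y)" if "y \<in> \<Omega>" for y
    using Ck_on_SucD[of 1 \<Omega> \<omega> y] Ck_on_SucD[of 1 UNIV f y] \<omega> f2 op that by (simp_all add: numeral_2_eq_2)
  have d2: "partial_deriv j \<omega> differentiable (at y)" "partial_deriv j f differentiable (at y)" if "y \<in> \<Omega>" for y j
    using Ck_on_SucD[of 0 \<Omega> "partial_deriv j \<omega>" y] Ck_on_SucD[of 0 UNIV "partial_deriv j f" y] \<omega> f2 op that
    by (simp_all add: numeral_2_eq_2)
  have p1: "partial_deriv j (\<lambda>x. \<omega> x * f x) y = partial_deriv j \<omega> y * f y + \<omega> y * partial_deriv j f y"
    if "y \<in> \<Omega>" for y j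
    by (rule partial_deriv_mult[OF d[OF that]])
  have p2: "partial_deriv i (partial_deriv j (\<lambda>x. \<omega> x * f x)) x = \<omega> x * partial_deriv i (partial_deriv j f) x
      + partial_deriv i \<omega> x * partial_deriv j f x + partial_deriv j \<omega> x * partial_deriv i f x
      + partial_deriv i (partial_deriv j \<omega>) x * f x" for i j
  proof -
    have "partial_deriv i (partial_deriv j (\<lambda>x. \<omega> x * f x)) x
        = partial_deriv i (\<lambda>y. partial_deriv j \<omega> y * f y + \<omega> y * partial_deriv j f y) x"
      by (rule partial_deriv_cong_open[OF op x p1])
    also have "\<dots> = partial_deriv i (\<lambda>y. partial_deriv j \<omega> y * f y) x + partial_deriv i (\<lambda>y. \<omega> y * partial_deriv j f y) x"
      by (intro partial_deriv_add differentiable_mult d d2 x)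
    finally show ?thesis
      by (simp add: partial_deriv_mult[OF d2(1)[OF x] d(2)[OF x]] partial_deriv_mult[OF d(1)[OF x] d2(2)[OF x]])
  qed
  show ?thesis
    using \<eta>
    by (cases rule: leibniz_cases)
       (simp_all add: mderiv_0 mderiv_mi1 mderiv_mi2[OF f2(1)] mderiv_mi2[OF f2(2)] p1[OF x] p2)
qed

text \<open>The content of (D3) in the form used from here on: weights in \<delta>, single
  components of the gradient, one constant K. R \<ge> 1 makes R^2 dominate every power \<delta>^k
  with k \<le> 2.\<close>

locale hardy_rellich =
  fixes \<Omega> :: "(real^'n::finite) set" and \<delta> :: "real^'n \<Rightarrow> real" and K R :: real
  assumes op: "open \<Omega>" and bd: "bounded \<Omega>" and \<delta>2: "Ck_on 2 \<Omega> \<delta>"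
    and pos: "x \<in> \<Omega> \<Longrightarrow> 0 < \<delta> x" and le: "x \<in> \<Omega> \<Longrightarrow> \<delta> x \<le> R" and R: "1 \<le> R" and K: "K > 0"
    and rellich: "v \<in> Cc 2 \<Omega> \<Longrightarrow>
      (\<integral>\<^sup>+x. ennreal (1 / \<delta> x ^ 4 * (v x)\<^sup>2) \<partial>lebesgue_on \<Omega>) \<le> ennreal (K * (L2_norm \<Omega> (laplacian v))\<^sup>2)"
    and hardy: "v \<in> Cc 2 \<Omega> \<Longrightarrow>
      (\<integral>\<^sup>+x. ennreal (1 / \<delta> x ^ 2 * (partial_deriv i v x)\<^sup>2) \<partial>lebesgue_on \<Omega>) \<le> ennreal (K * (L2_norm \<Omega> (laplacian v))\<^sup>2)"
begin

abbreviation "M \<equiv> lebesgue_on \<Omega>"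
abbreviation "I \<equiv> {\<eta> :: 'n mindex. mdeg \<eta> \<le> 2}"
abbreviation "D \<equiv> weak_deriv \<Omega>"

definition energy :: "(real^'n \<Rightarrow> real) \<Rightarrow> real" where
  "energy u = L2_norm \<Omega> (weak_laplacian \<Omega> u)"

text \<open>Only used for \<open>mdeg \<eta> \<le> 2\<close>, so that the subtraction is not truncated.\<close>

definition scaled :: "('n mindex \<Rightarrow> real^'n \<Rightarrow> real) \<Rightarrow> 'n mindex \<Rightarrow> real^'n \<Rightarrow> real" where
  "scaled G \<eta> x = G \<eta> x / \<delta> x ^ (2 - mdeg \<eta>)"

text \<open>Derivatives of order k may grow like \<delta>^(-k), which is exactly what the weights in
  Hardy and Rellich compensate. For \<open>omega\<close> the constant B depends on n; the notion
  serves for membership in \<open>H20\<close> and for limits, not for the final constant.\<close>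

definition multiplier :: "(real^'n \<Rightarrow> real) \<Rightarrow> real \<Rightarrow> bool" where
  "multiplier \<omega> B \<longleftrightarrow> 0 \<le> B \<and> Ck_on 2 \<Omega> \<omega> \<and> (\<forall>x\<in>\<Omega>. \<bar>\<omega> x\<bar> \<le> B \<and> (\<forall>i. \<bar>partial_deriv i \<omega> x\<bar> \<le> B / \<delta> x)
    \<and> (\<forall>i j. \<bar>partial_deriv i (partial_deriv j \<omega>) x\<bar> \<le> B / (\<delta> x)\<^sup>2))"

lemma domain_lebesgue: "\<Omega> \<in> sets lebesgue" using op by simp

lemma continuous_measurable: "continuous_on \<Omega> f \<Longrightarrow> f \<in> borel_measurable M"
  by (intro continuous_imp_measurable_on_sets_lebesgue domain_lebesgue)

lemma \<delta>_measurable: "\<delta> \<in> borel_measurable M"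
  using Ck_on_le[OF \<delta>2, of 0] by (intro continuous_measurable) simp

lemma H20_energy_measurable:
  assumes "u \<in> H20 \<Omega>" shows "weak_laplacian \<Omega> u \<in> L2 \<Omega>"
  unfolding weak_laplacian_def[abs_def]
  by (intro L2_sum H20_weak_deriv(1)[OF op bd assms]) (simp add: mdeg_mi)

lemma energy_nonneg: "energy u \<ge> 0" by (simp add: energy_def L2_norm_nonneg)

lemma energy_square: "(energy u)\<^sup>2 = Q0 \<Omega> u"
  unfolding energy_def L2_norm_square by (simp add: Q0_def L2_inner_def power2_eq_square)

text \<open>For test functions, order zero is Rellich, order one is Hardy and order two is the
  Hessian bound; K + 1 covers the constants K and 1. Lower semicontinuity of weighted norms carries
  the bounds over to \<open>H20\<close>.\<close>

lemma scaled_L2_bound: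
  assumes u: "u \<in> H20 \<Omega>" and \<eta>: "mdeg \<eta> \<le> 2"
  shows "scaled (\<lambda>\<zeta>. D \<zeta> u) \<eta> \<in> L2 \<Omega>"
    and "L2_norm \<Omega> (scaled (\<lambda>\<zeta>. D \<zeta> u) \<eta>) \<le> sqrt (K + 1) * energy u"
proof -
  obtain \<phi> where \<phi>: "\<And>m. \<phi> m \<in> Cc_inf \<Omega>"
    "\<And>\<eta>. mdeg \<eta> \<le> 2 \<Longrightarrow> (\<lambda>m. L2_norm \<Omega> (\<lambda>x. mderiv \<eta> (\<phi> m) x - D \<eta> u x)) \<longlonglongrightarrow> 0"
    using H20_E[OF op bd u] by blast
  note \<phi>2 = Cc_inf_imp_Cc[OF \<phi>(1), where k = 2]
  have \<phi>C: "Ck_on 2 UNIV (\<phi> m)" for m using \<phi>2 by (simp add: Cc_def)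
  have two: "mdeg (mi2 i i) \<le> 2" for i :: 'n by (simp add: mdeg_mi)
  have lapL: "laplacian (\<phi> m) \<in> L2 \<Omega>" for m
    unfolding laplacian_Cc[OF \<phi>2] by (intro L2_sum Cc_mderiv_L2[OF op bd \<phi>2] two)
  have lap: "(\<lambda>m. L2_norm \<Omega> (\<lambda>x. laplacian (\<phi> m) x - weak_laplacian \<Omega> u x)) \<longlonglongrightarrow> 0"
  proof (rule Lim_null_comparison[OF always_eventually])
    let ?S = "\<lambda>m. \<Sum>i\<in>UNIV. L2_norm \<Omega> (\<lambda>x. mderiv (mi2 i i) (\<phi> m) x - D (mi2 i i) u x)"
    have "L2_norm \<Omega> (\<lambda>x. laplacian (\<phi> m) x - weak_laplacian \<Omega> u x) \<le> ?S m" for m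
      unfolding laplacian_Cc[OF \<phi>2] weak_laplacian_def sum_subtractf[symmetric]
      by (intro L2_norm_sum L2_diff Cc_mderiv_L2[OF op bd \<phi>2] H20_weak_deriv(1)[OF op bd u] two finite)
    then show "\<forall>m. norm (L2_norm \<Omega> (\<lambda>x. laplacian (\<phi> m) x - weak_laplacian \<Omega> u x)) \<le> ?S m"
      by (simp add: L2_norm_nonneg)
    show "?S \<longlonglongrightarrow> 0" using tendsto_sum[of UNIV, OF \<phi>(2)[OF two]] by simp
  qed
  have C: "(\<lambda>m. (K + 1) * (L2_norm \<Omega> (laplacian (\<phi> m)))\<^sup>2) \<longlonglongrightarrow> (K + 1) * (energy u)\<^sup>2"
    unfolding energy_def by (intro tendsto_intros L2_norm_tendsto_norm lapL H20_energy_measurable u lap)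
  have bound: "(\<integral>\<^sup>+x. ennreal ((1 / \<delta> x ^ (2 - mdeg \<eta>))\<^sup>2 * (mderiv \<eta> (\<phi> m) x)\<^sup>2) \<partial>M)
      \<le> ennreal ((K + 1) * (L2_norm \<Omega> (laplacian (\<phi> m)))\<^sup>2)" for m
  proof -
    let ?L = "(L2_norm \<Omega> (laplacian (\<phi> m)))\<^sup>2"
    have up: "ennreal (K * ?L) \<le> ennreal ((K + 1) * ?L)" "ennreal ?L \<le> ennreal ((K + 1) * ?L)"
      using K by (intro ennreal_leI; simp add: distrib_right)+
    show ?thesis
      using \<eta>
    proof (cases rule: mindex_le_2_cases)
      case 1
      then show ?thesis using order_trans[OF rellich[OF \<phi>2[of m]] up(1)]
        by (simp add: mderiv_0 mdeg_mi power_divide flip: power_mult)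
    next
      case (2 i)
      then show ?thesis using order_trans[OF hardy[OF \<phi>2[of m], of i] up(1)]
        by (simp add: mderiv_mi1 mdeg_mi power_divide)
    next
      case (3 i j)
      have h: "partial_deriv i (partial_deriv j (\<phi> m)) \<in> L2 \<Omega>"
        using Cc_mderiv_L2[OF op bd \<phi>2 \<eta>] by (simp add: 3 mderiv_mi2[OF \<phi>C])
      have "(\<integral>\<^sup>+x. ennreal ((1 / \<delta> x ^ (2 - mdeg \<eta>))\<^sup>2 * (mderiv \<eta> (\<phi> m) x)\<^sup>2) \<partial>M)
          = ennreal ((L2_norm \<Omega> (partial_deriv i (partial_deriv j (\<phi> m))))\<^sup>2)"
        by (simp add: 3 mderiv_mi2[OF \<phi>C] mdeg_mi nn_integral_square_L2[OF h])
      also have "\<dots> \<le> ennreal ?L"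
        by (intro ennreal_leI power_mono L2_norm_hessian_le_laplacian[OF op bd \<phi>(1)] L2_norm_nonneg)
      finally show ?thesis using up(2) by (rule order_trans)
    qed
  qed
  have wm: "(\<lambda>x. (1 / \<delta> x ^ (2 - mdeg \<eta>))\<^sup>2) \<in> borel_measurable M" using \<delta>_measurable by measurable
  have "(\<integral>\<^sup>+x. ennreal ((1 / \<delta> x ^ (2 - mdeg \<eta>))\<^sup>2 * (D \<eta> u x)\<^sup>2) \<partial>M) \<le> ennreal ((K + 1) * (energy u)\<^sup>2)"
    by (rule weighted_L2_lower_semicontinuous[OF Cc_mderiv_L2[OF op bd \<phi>2 \<eta>] H20_weak_deriv(1)[OF op bd u \<eta>] \<phi>(2)[OF \<eta>] wm bound C])
  then have *: "(\<integral>\<^sup>+x. ennreal ((scaled (\<lambda>\<zeta>. D \<zeta> u) \<eta> x)\<^sup>2) \<partial>M) \<le> ennreal ((K + 1) * (energy u)\<^sup>2)"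
    by (simp add: scaled_def power_divide)
  have m: "scaled (\<lambda>\<zeta>. D \<zeta> u) \<eta> \<in> borel_measurable M"
    unfolding scaled_def[abs_def] using \<delta>_measurable L2_measurable[OF H20_weak_deriv(1)[OF op bd u \<eta>]] by measurable
  show L: "scaled (\<lambda>\<zeta>. D \<zeta> u) \<eta> \<in> L2 \<Omega>"
    by (rule L2_I_nn_integral[OF m]) (rule le_less_trans[OF *], simp)
  have "(L2_norm \<Omega> (scaled (\<lambda>\<zeta>. D \<zeta> u) \<eta>))\<^sup>2 \<le> (K + 1) * (energy u)\<^sup>2"
    using * K unfolding nn_integral_square_L2[OF L] by (subst (asm) ennreal_le_iff) auto
  also have "\<dots> = (sqrt (K + 1) * energy u)\<^sup>2" using K by (simp add: power_mult_distrib)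
  finally show "L2_norm \<Omega> (scaled (\<lambda>\<zeta>. D \<zeta> u) \<eta>) \<le> sqrt (K + 1) * energy u"
    by (rule power2_le_imp_le) (use K energy_nonneg in simp)
qed

text \<open>Each Leibniz term pairs a coefficient of size B / \<delta>^k with some
  \<open>G \<zeta>\<close> of order at most 2 - k. Expressing \<open>G \<zeta>\<close> by
  \<open>scaled\<close> supplies enough powers of \<delta> to cancel the denominator, and the
  surplus is at most R^2. There are at most four terms.\<close>

lemma leibniz_bound:
  assumes \<omega>: "multiplier \<omega> B" and x: "x \<in> \<Omega>" and \<eta>: "mdeg \<eta> \<le> 2"
  shows "\<bar>leibniz \<omega> G \<eta> x\<bar> \<le> 4 * B * R\<^sup>2 * (\<Sum>\<zeta>\<in>I. \<bar>scaled G \<zeta> x\<bar>)"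
proof -
  let ?S = "\<Sum>\<zeta>\<in>I. \<bar>scaled G \<zeta> x\<bar>"
  have B: "0 \<le> B" "\<bar>\<omega> x\<bar> \<le> B" "\<And>i. \<bar>partial_deriv i \<omega> x\<bar> \<le> B / \<delta> x"
    "\<And>i j. \<bar>partial_deriv i (partial_deriv j \<omega>) x\<bar> \<le> B / (\<delta> x)\<^sup>2"
    using \<omega> x by (auto simp: multiplier_def)
  have d: "0 < \<delta> x" "\<delta> x \<le> R" "1 \<le> R" using pos[OF x] le[OF x] R by auto
  have S: "\<bar>G \<zeta> x\<bar> \<le> \<delta> x ^ (2 - mdeg \<zeta>) * ?S" if "mdeg \<zeta> \<le> 2" for \<zeta>
  proof -
    have "\<bar>scaled G \<zeta> x\<bar> \<le> ?S" by (rule member_le_sum) (use that finite_mindex_le_2 in auto)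
    then show ?thesis using d by (simp add: scaled_def divide_le_eq mult.commute)
  qed
  have S0: "0 \<le> ?S" by (simp add: sum_nonneg)
  have dk: "\<delta> x ^ k \<le> R\<^sup>2" if "k \<le> 2" for k
  proof -
    have "\<delta> x ^ k \<le> R ^ k" using d by (intro power_mono) auto
    also have "\<dots> \<le> R ^ 2" using R that by (intro power_increasing) auto
    finally show ?thesis .
  qed
  have gen: "\<bar>a * G \<zeta> x\<bar> \<le> B * R\<^sup>2 * ?S"
    if a: "\<bar>a\<bar> \<le> B / \<delta> x ^ k" and k: "k \<le> 2 - mdeg \<zeta>" and \<zeta>: "mdeg \<zeta> \<le> 2" for a k \<zeta>
  proof -
    have "\<bar>a * G \<zeta> x\<bar> \<le> (B / \<delta> x ^ k) * (\<delta> x ^ (2 - mdeg \<zeta>) * ?S)"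
      unfolding abs_mult using a S[OF \<zeta>] B(1) d by (intro mult_mono) auto
    also have "\<dots> = B * \<delta> x ^ (2 - mdeg \<zeta> - k) * ?S"
    proof -
      obtain l where l: "2 - mdeg \<zeta> = k + l" using k le_Suc_ex by blast
      show ?thesis using d unfolding l by (simp add: power_add)
    qed
    also have "\<dots> \<le> B * R\<^sup>2 * ?S"
      using B(1) S0 by (intro mult_right_mono mult_left_mono dk) auto
    finally show ?thesis .
  qed
  have t0: "\<bar>\<omega> x * G \<zeta> x\<bar> \<le> B * R\<^sup>2 * ?S" if "mdeg \<zeta> \<le> 2" for \<zeta>
    by (rule gen[of _ 0]) (use B that in auto)
  have t1: "\<bar>partial_deriv i \<omega> x * G \<zeta> x\<bar> \<le> B * R\<^sup>2 * ?S" if "mdeg \<zeta> \<le> 1" for i \<zeta>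
    by (rule gen[of _ 1]) (use B that in auto)
  have t2: "\<bar>partial_deriv i (partial_deriv j \<omega>) x * G (\<lambda>_. 0) x\<bar> \<le> B * R\<^sup>2 * ?S" for i j
    by (rule gen[of _ 2]) (use B in \<open>auto simp: mdeg_mi\<close>)
  have nn: "0 \<le> B * R\<^sup>2 * ?S" using B S0 by simp
  have "\<bar>leibniz \<omega> G \<eta> x\<bar> \<le> 4 * (B * R\<^sup>2 * ?S)"
    using \<eta>
  proof (cases rule: leibniz_cases)
    case zero
    then show ?thesis using t0[of "\<lambda>_. 0"] nn by (simp add: mdeg_mi)
  next
    case (one i)
    then show ?thesis using t1[of "\<lambda>_. 0" i] t0[of "mi1 i"] nn by (simp add: mdeg_mi)
  next
    case (two i j)
    then show ?thesis using t0[of "mi2 i j"] t1[of "mi1 j" i] t1[of "mi1 i" j] t2[of i j] by (simp add: mdeg_mi)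
  qed
  then show ?thesis by (simp add: mult.assoc)
qed

lemma leibniz_measurable:
  assumes \<omega>: "multiplier \<omega> B" and G: "\<And>\<zeta>. mdeg \<zeta> \<le> 2 \<Longrightarrow> G \<zeta> \<in> borel_measurable M" and \<eta>: "mdeg \<eta> \<le> 2"
  shows "leibniz \<omega> G \<eta> \<in> borel_measurable M"
proof -
  have C: "Ck_on 2 \<Omega> \<omega>" using \<omega> by (simp add: multiplier_def)
  have m: "\<omega> \<in> borel_measurable M" "partial_deriv i \<omega> \<in> borel_measurable M"
    "partial_deriv i (partial_deriv j \<omega>) \<in> borel_measurable M" for i j
    using C Ck_on_le[OF C, of 0] Ck_on_le[OF C, of 1]
    by (intro continuous_measurable; simp add: numeral_2_eq_2)+
  have G': "G (\<lambda>_. 0) \<in> borel_measurable M" "G (mi1 i) \<in> borel_measurable M" "G (mi2 i j) \<in> borel_measurable M" for i j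
    by (simp_all add: G mdeg_mi)
  show ?thesis
    using \<eta>
  proof (cases rule: leibniz_cases)
    case zero
    show ?thesis unfolding zero(2)[abs_def] by (intro borel_measurable_times m G')
  next
    case (one i)
    show ?thesis unfolding one(2)[abs_def] by (intro borel_measurable_times borel_measurable_add m G')
  next
    case (two i j)
    show ?thesis unfolding two(2)[abs_def] by (intro borel_measurable_times borel_measurable_add m G')
  qed
qed

lemma leibniz_L2:
  assumes \<omega>: "multiplier \<omega> B" and G: "\<And>\<zeta>. mdeg \<zeta> \<le> 2 \<Longrightarrow> G \<zeta> \<in> borel_measurable M"
    "\<And>\<zeta>. mdeg \<zeta> \<le> 2 \<Longrightarrow> scaled G \<zeta> \<in> L2 \<Omega>" and \<eta>: "mdeg \<eta> \<le> 2"
  shows "leibniz \<omega> G \<eta> \<in> L2 \<Omega>"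
    and "L2_norm \<Omega> (leibniz \<omega> G \<eta>) \<le> 4 * B * R\<^sup>2 * (\<Sum>\<zeta>\<in>I. L2_norm \<Omega> (scaled G \<zeta>))"
proof -
  have B: "0 \<le> 4 * B * R\<^sup>2" using \<omega> by (simp add: multiplier_def)
  have L: "(\<lambda>x. \<Sum>\<zeta>\<in>I. \<bar>scaled G \<zeta> x\<bar>) \<in> L2 \<Omega>" using G(2) by (intro L2_sum L2_abs) simp
  have m: "leibniz \<omega> G \<eta> \<in> borel_measurable M" by (rule leibniz_measurable[OF \<omega> G(1) \<eta>])
  have ae: "AE x in M. \<bar>leibniz \<omega> G \<eta> x\<bar> \<le> 4 * B * R\<^sup>2 * \<bar>\<Sum>\<zeta>\<in>I. \<bar>scaled G \<zeta> x\<bar>\<bar>"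
    using leibniz_bound[OF \<omega> _ \<eta>, of _ G] by (intro AE_I2) (simp add: space_restrict_space sum_nonneg)
  show "leibniz \<omega> G \<eta> \<in> L2 \<Omega>" by (rule L2_I_bounded_square[OF m L ae])
  have "L2_norm \<Omega> (leibniz \<omega> G \<eta>) \<le> 4 * B * R\<^sup>2 * L2_norm \<Omega> (\<lambda>x. \<Sum>\<zeta>\<in>I. \<bar>scaled G \<zeta> x\<bar>)"
    by (rule L2_norm_mono[OF L m B ae])
  also have "\<dots> \<le> 4 * B * R\<^sup>2 * (\<Sum>\<zeta>\<in>I. L2_norm \<Omega> (\<lambda>x. \<bar>scaled G \<zeta> x\<bar>))"
    using G(2) finite_mindex_le_2 by (intro mult_left_mono[OF _ B] L2_norm_sum L2_abs) auto
  finally show "L2_norm \<Omega> (leibniz \<omega> G \<eta>) \<le> 4 * B * R\<^sup>2 * (\<Sum>\<zeta>\<in>I. L2_norm \<Omega> (scaled G \<zeta>))"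
    by (simp add: L2_norm_abs)
qed

text \<open>\<open>leibniz\<close> is linear in the derivatives, so the difference is the Leibniz
  expression of the error phi_m - u, an element of \<open>H20\<close>. Its scaled norms are
  controlled by its energy, hence by unweighted L^2 norms of second derivatives, which tend to zero.
  Convergence in the weighted norms is thus a consequence and not an assumption.\<close>

lemma multiplier_tendsto:
  assumes \<omega>: "multiplier \<omega> B" and u: "u \<in> H20 \<Omega>" and \<phi>: "\<And>m. \<phi> m \<in> Cc_inf \<Omega>"
    and lim: "\<And>\<eta>. mdeg \<eta> \<le> 2 \<Longrightarrow> (\<lambda>m. L2_norm \<Omega> (\<lambda>x. mderiv \<eta> (\<phi> m) x - D \<eta> u x)) \<longlonglongrightarrow> 0"
    and \<eta>: "mdeg \<eta> \<le> 2"
  shows "(\<lambda>m. L2_norm \<Omega> (\<lambda>x. mderiv \<eta> (\<lambda>x. \<omega> x * \<phi> m x) x - leibniz \<omega> (\<lambda>\<zeta>. D \<zeta> u) \<eta> x)) \<longlonglongrightarrow> 0"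
proof (rule Lim_null_comparison[OF always_eventually])
  note \<phi>2 = Cc_inf_imp_Cc[OF \<phi>, where k = 2]
  have C: "Ck_on 2 \<Omega> \<omega>" and B: "0 \<le> 4 * B * R\<^sup>2" using \<omega> by (simp_all add: multiplier_def)
  define v where "v m x = \<phi> m x - u x" for m x
  define G where "G m \<zeta> x = mderiv \<zeta> (\<phi> m) x - D \<zeta> u x" for m \<zeta> x
  have v: "v m \<in> H20 \<Omega>" for m unfolding v_def by (rule H20_diff(1)[OF op bd Cc_H20(1)[OF op bd \<phi>2] u])
  have vG: "AE x in M. D \<zeta> (v m) x = G m \<zeta> x" if "mdeg \<zeta> \<le> 2" for m \<zeta>
    using H20_diff(2)[OF op bd Cc_H20(1)[OF op bd \<phi>2[of m]] u that] Cc_H20(2)[OF op bd \<phi>2[of m] that]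
    by eventually_elim (simp add: v_def[abs_def] G_def)
  have sG: "AE x in M. scaled (\<lambda>\<zeta>. D \<zeta> (v m)) \<zeta> x = scaled (G m) \<zeta> x" if "mdeg \<zeta> \<le> 2" for m \<zeta>
    using vG[OF that, of m] by eventually_elim (simp add: scaled_def)
  have GL: "G m \<zeta> \<in> L2 \<Omega>" if "mdeg \<zeta> \<le> 2" for m \<zeta>
    unfolding G_def by (intro L2_diff Cc_mderiv_L2[OF op bd \<phi>2 that] H20_weak_deriv(1)[OF op bd u that])
  have sGL: "scaled (G m) \<zeta> \<in> L2 \<Omega>" and sGn: "L2_norm \<Omega> (scaled (G m) \<zeta>) \<le> sqrt (K + 1) * energy (v m)"
    if "mdeg \<zeta> \<le> 2" for m \<zeta>
    using L2_cong_AE[OF domain_lebesgue scaled_L2_bound(1)[OF v that] sG[OF that]]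
      L2_norm_cong_AE[OF domain_lebesgue scaled_L2_bound(1)[OF v that] sG[OF that]]
      scaled_L2_bound(2)[OF v that] by simp_all
  have E: "energy (v m) \<le> (\<Sum>i\<in>UNIV. L2_norm \<Omega> (G m (mi2 i i)))" for m
  proof -
    have two: "mdeg (mi2 i i) \<le> 2" for i :: 'n by (simp add: mdeg_mi)
    have "AE x in M. \<forall>i\<in>UNIV. D (mi2 i i) (v m) x = G m (mi2 i i) x"
      by (rule AE_finite_allI) (use vG[OF two] in auto)
    then have "AE x in M. weak_laplacian \<Omega> (v m) x = (\<Sum>i\<in>UNIV. G m (mi2 i i) x)"
      by eventually_elim (simp add: weak_laplacian_def)
    then have "energy (v m) = L2_norm \<Omega> (\<lambda>x. \<Sum>i\<in>UNIV. G m (mi2 i i) x)"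
      unfolding energy_def by (rule L2_norm_cong_AE[OF domain_lebesgue H20_energy_measurable[OF v]])
    also have "\<dots> \<le> (\<Sum>i\<in>UNIV. L2_norm \<Omega> (G m (mi2 i i)))"
      by (rule L2_norm_sum) (use GL two in auto)
    finally show ?thesis .
  qed
  let ?c = "4 * B * R\<^sup>2 * (real (card I) * sqrt (K + 1))"
  show "\<forall>m. norm (L2_norm \<Omega> (\<lambda>x. mderiv \<eta> (\<lambda>x. \<omega> x * \<phi> m x) x - leibniz \<omega> (\<lambda>\<zeta>. D \<zeta> u) \<eta> x))
      \<le> ?c * (\<Sum>i\<in>UNIV. L2_norm \<Omega> (G m (mi2 i i)))"
  proof
    fix m
    have ae: "AE x in M. leibniz \<omega> (G m) \<eta> x = mderiv \<eta> (\<lambda>x. \<omega> x * \<phi> m x) x - leibniz \<omega> (\<lambda>\<zeta>. D \<zeta> u) \<eta> x"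
      by (intro AE_I2) (simp add: space_restrict_space mderiv_leibniz[OF op \<phi>2 C _ \<eta>] G_def[abs_def] leibniz_diff[OF \<eta>])
    have "L2_norm \<Omega> (\<lambda>x. mderiv \<eta> (\<lambda>x. \<omega> x * \<phi> m x) x - leibniz \<omega> (\<lambda>\<zeta>. D \<zeta> u) \<eta> x) = L2_norm \<Omega> (leibniz \<omega> (G m) \<eta>)"
      using L2_norm_cong_AE[OF domain_lebesgue leibniz_L2(1)[OF \<omega> L2_measurable[OF GL] sGL \<eta>] ae] by simp
    also have "\<dots> \<le> 4 * B * R\<^sup>2 * (\<Sum>\<zeta>\<in>I. L2_norm \<Omega> (scaled (G m) \<zeta>))"
      by (rule leibniz_L2(2)[OF \<omega> L2_measurable[OF GL] sGL \<eta>])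
    also have "\<dots> \<le> 4 * B * R\<^sup>2 * (\<Sum>\<zeta>\<in>I. sqrt (K + 1) * energy (v m))"
      using sGn by (intro mult_left_mono[OF _ B] sum_mono) simp
    also have "\<dots> = ?c * energy (v m)" by simp
    also have "\<dots> \<le> ?c * (\<Sum>i\<in>UNIV. L2_norm \<Omega> (G m (mi2 i i)))"
      using B K E[of m] by (intro mult_left_mono mult_nonneg_nonneg[OF B]) auto
    finally show "norm (L2_norm \<Omega> (\<lambda>x. mderiv \<eta> (\<lambda>x. \<omega> x * \<phi> m x) x - leibniz \<omega> (\<lambda>\<zeta>. D \<zeta> u) \<eta> x))
      \<le> ?c * (\<Sum>i\<in>UNIV. L2_norm \<Omega> (G m (mi2 i i)))"
      by (simp add: L2_norm_nonneg)
  qed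
  have "(\<lambda>m. \<Sum>i\<in>(UNIV::'n set). L2_norm \<Omega> (G m (mi2 i i))) \<longlonglongrightarrow> (\<Sum>i\<in>(UNIV::'n set). 0)"
    unfolding G_def by (intro tendsto_sum lim) (simp add: mdeg_mi)
  then have "(\<lambda>m. ?c * (\<Sum>i\<in>(UNIV::'n set). L2_norm \<Omega> (G m (mi2 i i)))) \<longlonglongrightarrow> ?c * (\<Sum>i\<in>(UNIV::'n set). 0)"
    by (rule tendsto_mult_left)
  then show "(\<lambda>m. ?c * (\<Sum>i\<in>UNIV. L2_norm \<Omega> (G m (mi2 i i)))) \<longlonglongrightarrow> 0" by simp
qed

text \<open>The products of \<omega> with the approximants are C^2 of compact support and converge,
  with all derivatives up to order two, to the Leibniz expressions; \<open>H20_I\<close> then gives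
  membership and the product rule at once.\<close>

lemma multiplier_H20:
  assumes \<omega>: "multiplier \<omega> B" and u: "u \<in> H20 \<Omega>"
  shows "(\<lambda>x. \<omega> x * u x) \<in> H20 \<Omega>"
    and "\<And>\<eta>. mdeg \<eta> \<le> 2 \<Longrightarrow> AE x in M. D \<eta> (\<lambda>x. \<omega> x * u x) x = leibniz \<omega> (\<lambda>\<zeta>. D \<zeta> u) \<eta> x"
    and "\<And>\<eta>. mdeg \<eta> \<le> 2 \<Longrightarrow> leibniz \<omega> (\<lambda>\<zeta>. D \<zeta> u) \<eta> \<in> L2 \<Omega>"
proof -
  obtain \<phi> where \<phi>: "\<And>m. \<phi> m \<in> Cc_inf \<Omega>"
    "\<And>\<eta>. mdeg \<eta> \<le> 2 \<Longrightarrow> (\<lambda>m. L2_norm \<Omega> (\<lambda>x. mderiv \<eta> (\<phi> m) x - D \<eta> u x)) \<longlonglongrightarrow> 0"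
    using H20_E[OF op bd u] by blast
  have C: "Ck_on 2 \<Omega> \<omega>" using \<omega> by (simp add: multiplier_def)
  have c: "(\<lambda>x. \<omega> x * \<phi> m x) \<in> Cc 2 \<Omega>" for m by (rule Cc_mult[OF op C Cc_inf_imp_Cc[OF \<phi>(1)]])
  show L: "leibniz \<omega> (\<lambda>\<zeta>. D \<zeta> u) \<eta> \<in> L2 \<Omega>" if "mdeg \<eta> \<le> 2" for \<eta>
    by (rule leibniz_L2(1)[OF \<omega> L2_measurable[OF H20_weak_deriv(1)[OF op bd u]] scaled_L2_bound(1)[OF u] that])
  have "(\<lambda>x. \<omega> x * u x) \<in> L2 \<Omega>"
  proof (rule L2_I_bounded_square[OF _ H20_L2[OF op bd u], of _ B])
    have "\<omega> \<in> borel_measurable M" using Ck_on_le[OF C, of 0] by (intro continuous_measurable) simp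
    then show "(\<lambda>x. \<omega> x * u x) \<in> borel_measurable M"
      by (rule borel_measurable_times) (rule L2_measurable[OF H20_L2[OF op bd u]])
    show "AE x in M. \<bar>\<omega> x * u x\<bar> \<le> B * \<bar>u x\<bar>"
      using \<omega> by (intro AE_I2) (simp add: space_restrict_space multiplier_def abs_mult mult_right_mono)
  qed
  moreover have "AE x in M. leibniz \<omega> (\<lambda>\<zeta>. D \<zeta> u) (\<lambda>_. 0) x = \<omega> x * u x"
    using weak_deriv_0[OF op bd H20_L2[OF op bd u]] by eventually_elim (simp add: leibniz_def mdeg_mi)
  moreover note H20_I[OF op bd c _ L _ multiplier_tendsto[OF \<omega> u \<phi>]]
  ultimately show "(\<lambda>x. \<omega> x * u x) \<in> H20 \<Omega>"
    "\<And>\<eta>. mdeg \<eta> \<le> 2 \<Longrightarrow> AE x in M. D \<eta> (\<lambda>x. \<omega> x * u x) x = leibniz \<omega> (\<lambda>\<zeta>. D \<zeta> u) \<eta> x"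
    by blast+
qed

end

context hardy_rellich
begin

lemma multiplier_weak_deriv_tendsto:
  assumes \<omega>: "multiplier \<omega> B" and u: "u \<in> H20 \<Omega>" and \<phi>: "\<And>m. \<phi> m \<in> Cc_inf \<Omega>"
    and lim: "\<And>\<eta>. mdeg \<eta> \<le> 2 \<Longrightarrow> (\<lambda>m. L2_norm \<Omega> (\<lambda>x. mderiv \<eta> (\<phi> m) x - D \<eta> u x)) \<longlonglongrightarrow> 0"
    and \<eta>: "mdeg \<eta> \<le> 2"
  shows "(\<lambda>m. L2_norm \<Omega> (\<lambda>x. D \<eta> (\<lambda>x. \<omega> x * \<phi> m x) x - D \<eta> (\<lambda>x. \<omega> x * u x) x)) \<longlonglongrightarrow> 0"
proof -
  have C: "Ck_on 2 \<Omega> \<omega>" using \<omega> by (simp add: multiplier_def)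
  have c: "(\<lambda>x. \<omega> x * \<phi> m x) \<in> Cc 2 \<Omega>" for m by (rule Cc_mult[OF op C Cc_inf_imp_Cc[OF \<phi>]])
  have "L2_norm \<Omega> (\<lambda>x. mderiv \<eta> (\<lambda>x. \<omega> x * \<phi> m x) x - leibniz \<omega> (\<lambda>\<zeta>. D \<zeta> u) \<eta> x)
      = L2_norm \<Omega> (\<lambda>x. D \<eta> (\<lambda>x. \<omega> x * \<phi> m x) x - D \<eta> (\<lambda>x. \<omega> x * u x) x)" for m
  proof (rule L2_norm_cong_AE[OF domain_lebesgue L2_diff[OF Cc_mderiv_L2[OF op bd c \<eta>] multiplier_H20(3)[OF \<omega> u \<eta>]]])
    show "AE x in M. mderiv \<eta> (\<lambda>x. \<omega> x * \<phi> m x) x - leibniz \<omega> (\<lambda>\<zeta>. D \<zeta> u) \<eta> x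
        = D \<eta> (\<lambda>x. \<omega> x * \<phi> m x) x - D \<eta> (\<lambda>x. \<omega> x * u x) x"
      using Cc_H20(2)[OF op bd c[of m] \<eta>] multiplier_H20(2)[OF \<omega> u \<eta>] by eventually_elim simp
  qed
  then show ?thesis using multiplier_tendsto[OF \<omega> u \<phi> lim \<eta>] by simp
qed

text \<open>The Leibniz formulas for v = \<omega> u are solved for \<omega> times the derivatives of
  u, order by order; lower-order terms are absorbed by bounds already obtained. The constants are 1,
  then 1 + B, then 1 + 2B(1 + B) + B = 1 + 3B + 2B^2. The estimate contains B, which is relative to
  \<omega> itself, and not the absolute constant B' that places v in \<open>H20\<close>.\<close>

lemma weighted_scaled_bound:
  assumes \<omega>: "multiplier \<omega> B'" and u: "u \<in> H20 \<Omega>" and B: "0 \<le> B"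
    and \<omega>0: "\<And>x. x \<in> \<Omega> \<Longrightarrow> 0 \<le> \<omega> x"
    and \<omega>1: "\<And>x i. x \<in> \<Omega> \<Longrightarrow> \<bar>partial_deriv i \<omega> x\<bar> \<le> B * (\<omega> x / \<delta> x)"
    and \<omega>2: "\<And>x i j. x \<in> \<Omega> \<Longrightarrow> \<bar>partial_deriv i (partial_deriv j \<omega>) x\<bar> \<le> B * (\<omega> x / (\<delta> x)\<^sup>2)"
    and \<eta>: "mdeg \<eta> \<le> 2"
  shows "(\<lambda>x. \<omega> x * scaled (\<lambda>\<zeta>. D \<zeta> u) \<eta> x) \<in> L2 \<Omega>"
    and "L2_norm \<Omega> (\<lambda>x. \<omega> x * scaled (\<lambda>\<zeta>. D \<zeta> u) \<eta> x)
      \<le> (1 + 3 * B + 2 * B\<^sup>2) * (real (card I) * sqrt (K + 1)) * energy (\<lambda>x. \<omega> x * u x)"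
proof -
  let ?v = "\<lambda>x. \<omega> x * u x" and ?b = "1 + 3 * B + 2 * B\<^sup>2"
  define V where "V \<zeta> x = D \<zeta> ?v x" for \<zeta> x
  define T where "T x = (\<Sum>\<zeta>\<in>I. \<bar>scaled V \<zeta> x\<bar>)" for x
  have v: "?v \<in> H20 \<Omega>" by (rule multiplier_H20(1)[OF \<omega> u])
  have b: "0 \<le> ?b" "1 \<le> ?b" "1 + B \<le> ?b" "1 + 2 * (B * (1 + B)) + B \<le> ?b"
    using B by (simp_all add: power2_eq_square algebra_simps)
  have point: "\<bar>\<omega> x * scaled (\<lambda>\<zeta>. D \<zeta> u) \<eta> x\<bar> \<le> ?b * T x"
    if x: "x \<in> \<Omega>" and VL: "\<And>\<zeta>. mdeg \<zeta> \<le> 2 \<Longrightarrow> V \<zeta> x = leibniz \<omega> (\<lambda>\<zeta>. D \<zeta> u) \<zeta> x" for x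
  proof -
    have d: "0 < \<delta> x" and w: "0 \<le> \<omega> x" using pos[OF x] \<omega>0[OF x] by auto
    have T0: "0 \<le> T x" by (simp add: T_def sum_nonneg)
    have T: "\<bar>V \<zeta> x\<bar> / \<delta> x ^ (2 - mdeg \<zeta>) \<le> T x" if "mdeg \<zeta> \<le> 2" for \<zeta>
    proof -
      have "\<bar>scaled V \<zeta> x\<bar> \<le> T x" unfolding T_def by (rule member_le_sum) (use that finite_mindex_le_2 in auto)
      then show ?thesis using d by (simp add: scaled_def)
    qed
    have a0: "\<omega> x * \<bar>D (\<lambda>_. 0) u x\<bar> / (\<delta> x)\<^sup>2 \<le> T x"
    proof -
      have "V (\<lambda>_. 0) x = \<omega> x * D (\<lambda>_. 0) u x" using VL[of "\<lambda>_. 0"] by (simp add: mdeg_mi leibniz_def)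
      then show ?thesis using T[of "\<lambda>_. 0"] w by (simp add: mdeg_mi abs_mult)
    qed
    have p1: "\<bar>partial_deriv i \<omega> x * g\<bar> / \<delta> x ^ k \<le> B * (\<omega> x * \<bar>g\<bar> / \<delta> x ^ (k + 1))" for i g k
    proof -
      have "\<bar>partial_deriv i \<omega> x\<bar> * (\<bar>g\<bar> / \<delta> x ^ k) \<le> B * (\<omega> x / \<delta> x) * (\<bar>g\<bar> / \<delta> x ^ k)"
        using d by (intro mult_right_mono \<omega>1[OF x]) auto
      then show ?thesis by (simp add: abs_mult mult_ac)
    qed
    have p2: "\<bar>partial_deriv i (partial_deriv j \<omega>) x * g\<bar> \<le> B * (\<omega> x * \<bar>g\<bar> / (\<delta> x)\<^sup>2)" for i j g
      using mult_right_mono[OF \<omega>2[OF x, of i j], of "\<bar>g\<bar>"] by (simp add: abs_mult mult_ac)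
    have BT: "B * a \<le> B * c" if "a \<le> c" for a c using B that by (rule mult_left_mono[rotated])
    \<comment> \<open>Stated for arbitrary \<eta>, so that the index returned by
      \<open>leibniz_cases\<close> never has to be identified with the given one.\<close>
    have a1': "\<omega> x * \<bar>D \<eta> u x\<bar> / \<delta> x \<le> (1 + B) * T x"
      if \<eta>: "\<eta> = mi1 i" and L: "\<And>\<omega> D x. leibniz \<omega> D \<eta> x = partial_deriv i \<omega> x * D (\<lambda>_. 0) x + \<omega> x * D (mi1 i) x" for \<eta> i
    proof -
      have "V \<eta> x = partial_deriv i \<omega> x * D (\<lambda>_. 0) u x + \<omega> x * D \<eta> u x"
        using VL[of \<eta>] unfolding L by (simp add: \<eta> mdeg_mi)
      then have "\<omega> x * \<bar>D \<eta> u x\<bar> = \<bar>V \<eta> x - partial_deriv i \<omega> x * D (\<lambda>_. 0) u x\<bar>"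
        using w by (simp add: abs_mult)
      also have "\<dots> \<le> \<bar>V \<eta> x\<bar> + \<bar>partial_deriv i \<omega> x * D (\<lambda>_. 0) u x\<bar>" by (rule abs_triangle_ineq4)
      finally have "\<omega> x * \<bar>D \<eta> u x\<bar> / \<delta> x \<le> (\<bar>V \<eta> x\<bar> + \<bar>partial_deriv i \<omega> x * D (\<lambda>_. 0) u x\<bar>) / \<delta> x"
        using d by (intro divide_right_mono) auto
      also have "\<dots> \<le> T x + B * T x"
        using T[of \<eta>] p1[of i "D (\<lambda>_. 0) u x" 1] BT[OF a0] by (simp add: \<eta> mdeg_mi add_divide_distrib numeral_2_eq_2)
      finally show ?thesis by (simp add: distrib_right)
    qed
    have a1: "\<omega> x * \<bar>D (mi1 i) u x\<bar> / \<delta> x \<le> (1 + B) * T x" for i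
    proof -
      have "mdeg (mi1 i) \<le> 2" by (simp add: mdeg_mi)
      then show ?thesis
      proof (cases rule: leibniz_cases)
        case zero
        then have "mdeg (mi1 i) = mdeg (\<lambda>_::'n. 0)" by simp
        then show ?thesis by (simp add: mdeg_mi)
      next
        case (one k)
        show ?thesis by (rule a1'[OF one])
      next
        case (two k l)
        then have "mdeg (mi1 i) = mdeg (mi2 k l)" by simp
        then show ?thesis by (simp add: mdeg_mi)
      qed
    qed
    have "\<omega> x * \<bar>D \<eta> u x\<bar> / \<delta> x ^ (2 - mdeg \<eta>) \<le> ?b * T x"
      using \<eta>
    proof (cases rule: leibniz_cases)
      case zero
      have "\<omega> x * \<bar>D \<eta> u x\<bar> / \<delta> x ^ (2 - mdeg \<eta>) \<le> 1 * T x" using a0 by (simp add: zero mdeg_mi)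
      also have "\<dots> \<le> ?b * T x" by (rule mult_right_mono[OF b(2) T0])
      finally show ?thesis .
    next
      case (one i)
      have "\<omega> x * \<bar>D \<eta> u x\<bar> / \<delta> x ^ (2 - mdeg \<eta>) \<le> (1 + B) * T x" using a1[of i] by (simp add: one mdeg_mi)
      also have "\<dots> \<le> ?b * T x" by (rule mult_right_mono[OF b(3) T0])
      finally show ?thesis .
    next
      case (two i j)
      let ?p = "partial_deriv i \<omega> x * D (mi1 j) u x" and ?q = "partial_deriv j \<omega> x * D (mi1 i) u x"
        and ?r = "partial_deriv i (partial_deriv j \<omega>) x * D (\<lambda>_. 0) u x"
      have "V \<eta> x = \<omega> x * D \<eta> u x + ?p + ?q + ?r"
        using VL[OF \<eta>] unfolding two(2) by (simp add: two(1))
      then have "\<omega> x * \<bar>D \<eta> u x\<bar> = \<bar>V \<eta> x - ?p - ?q - ?r\<bar>" using w by (simp add: abs_mult)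
      also have "\<dots> \<le> \<bar>V \<eta> x\<bar> + \<bar>?p\<bar> + \<bar>?q\<bar> + \<bar>?r\<bar>" by linarith
      also have "\<dots> \<le> T x + B * ((1 + B) * T x) + B * ((1 + B) * T x) + B * T x"
      proof (intro add_mono)
        show "\<bar>V \<eta> x\<bar> \<le> T x" using T[of \<eta>] by (simp add: two(1) mdeg_mi)
        show "\<bar>?p\<bar> \<le> B * ((1 + B) * T x)"
          using p1[of i "D (mi1 j) u x" 0] BT[OF a1[of j]] by simp
        show "\<bar>?q\<bar> \<le> B * ((1 + B) * T x)"
          using p1[of j "D (mi1 i) u x" 0] BT[OF a1[of i]] by simp
        show "\<bar>?r\<bar> \<le> B * T x" using p2[of i j "D (\<lambda>_. 0) u x"] BT[OF a0] by linarith
      qed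
      also have "\<dots> = (1 + 2 * (B * (1 + B)) + B) * T x" by (simp add: algebra_simps)
      also have "\<dots> \<le> ?b * T x" by (rule mult_right_mono[OF b(4) T0])
      finally show ?thesis by (simp add: two(1) mdeg_mi)
    qed
    then show ?thesis using w d by (simp add: scaled_def abs_mult)
  qed
  \<comment> \<open>There are finitely many multi-indices of order at most two, so the product rule
    holds for all of them off one common null set.\<close>
  have "AE x in M. \<forall>\<zeta>\<in>I. V \<zeta> x = leibniz \<omega> (\<lambda>\<zeta>. D \<zeta> u) \<zeta> x"
    unfolding V_def by (rule AE_finite_allI[OF finite_mindex_le_2]) (use multiplier_H20(2)[OF \<omega> u] in simp)
  then have ae: "AE x in M. \<bar>\<omega> x * scaled (\<lambda>\<zeta>. D \<zeta> u) \<eta> x\<bar> \<le> ?b * \<bar>T x\<bar>"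
    using AE_space
  proof eventually_elim
    case (elim x)
    then have "x \<in> \<Omega>" by (simp add: space_restrict_space)
    then have "\<bar>\<omega> x * scaled (\<lambda>\<zeta>. D \<zeta> u) \<eta> x\<bar> \<le> ?b * T x" using elim(1) by (intro point) auto
    moreover have "0 \<le> T x" by (simp add: T_def sum_nonneg)
    ultimately show ?case by simp
  qed
  have V: "scaled V \<zeta> \<in> L2 \<Omega>" "L2_norm \<Omega> (scaled V \<zeta>) \<le> sqrt (K + 1) * energy ?v" if "mdeg \<zeta> \<le> 2" for \<zeta>
    unfolding V_def[abs_def] using scaled_L2_bound[OF v that] by blast+
  have TL: "T \<in> L2 \<Omega>" unfolding T_def[abs_def] using V(1) by (intro L2_sum L2_abs) simp
  have "Ck_on 0 \<Omega> \<omega>" using \<omega> Ck_on_le[of 2 \<Omega> \<omega> 0] by (simp add: multiplier_def)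
  then have "\<omega> \<in> borel_measurable M" by (intro continuous_measurable) simp
  then have m: "(\<lambda>x. \<omega> x * scaled (\<lambda>\<zeta>. D \<zeta> u) \<eta> x) \<in> borel_measurable M"
    by (rule borel_measurable_times[OF _ L2_measurable[OF scaled_L2_bound(1)[OF u \<eta>]]])
  show "(\<lambda>x. \<omega> x * scaled (\<lambda>\<zeta>. D \<zeta> u) \<eta> x) \<in> L2 \<Omega>" by (rule L2_I_bounded_square[OF m TL ae])
  have "L2_norm \<Omega> (\<lambda>x. \<omega> x * scaled (\<lambda>\<zeta>. D \<zeta> u) \<eta> x) \<le> ?b * L2_norm \<Omega> T"
    by (rule L2_norm_mono[OF TL m b(1) ae])
  also have "L2_norm \<Omega> T \<le> (\<Sum>\<zeta>\<in>I. L2_norm \<Omega> (\<lambda>x. \<bar>scaled V \<zeta> x\<bar>))"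
    unfolding T_def[abs_def] using V(1) finite_mindex_le_2 by (intro L2_norm_sum L2_abs) auto
  also have "\<dots> \<le> (\<Sum>\<zeta>\<in>I. sqrt (K + 1) * energy ?v)"
    using V(2) by (intro sum_mono) (simp add: L2_norm_abs)
  finally show "L2_norm \<Omega> (\<lambda>x. \<omega> x * scaled (\<lambda>\<zeta>. D \<zeta> u) \<eta> x)
      \<le> ?b * (real (card I) * sqrt (K + 1)) * energy ?v"
    using b(1) by (simp add: mult_left_mono mult.assoc)
qed

end

section \<open>Continuity of the quadratic form\<close>

lemma L2_Linf_mult:
  assumes "a \<in> borel_measurable (lebesgue_on \<Omega>)" "AE x in lebesgue_on \<Omega>. \<bar>a x\<bar> \<le> N" "f \<in> L2 \<Omega>"
  shows "(\<lambda>x. a x * f x) \<in> L2 \<Omega>" "L2_norm \<Omega> (\<lambda>x. a x * f x) \<le> \<bar>N\<bar> * L2_norm \<Omega> f"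
proof -
  have m: "(\<lambda>x. a x * f x) \<in> borel_measurable (lebesgue_on \<Omega>)"
    by (intro borel_measurable_times assms(1) L2_measurable[OF assms(3)])
  have ae: "AE x in lebesgue_on \<Omega>. \<bar>a x * f x\<bar> \<le> \<bar>N\<bar> * \<bar>f x\<bar>"
    using assms(2) by eventually_elim (simp add: abs_mult mult_right_mono)
  show "(\<lambda>x. a x * f x) \<in> L2 \<Omega>" by (rule L2_I_bounded_square[OF m assms(3) ae])
  show "L2_norm \<Omega> (\<lambda>x. a x * f x) \<le> \<bar>N\<bar> * L2_norm \<Omega> f" by (rule L2_norm_mono[OF assms(3) m _ ae]) simp
qed

lemma Qform_eq_sum:
  assumes a: "Linf_symmetric \<Omega> a"
    and u: "\<And>\<eta>. mdeg \<eta> = 2 \<Longrightarrow> weak_deriv \<Omega> \<eta> u \<in> L2 \<Omega>" and v: "\<And>\<eta>. mdeg \<eta> = 2 \<Longrightarrow> weak_deriv \<Omega> \<eta> v \<in> L2 \<Omega>"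
  shows "Qform \<Omega> a u v = (\<Sum>\<eta> | mdeg \<eta> = 2. \<Sum>\<zeta> | mdeg \<zeta> = 2.
    L2_inner \<Omega> (\<lambda>x. a \<eta> \<zeta> x * weak_deriv \<Omega> \<eta> u x) (weak_deriv \<Omega> \<zeta> v))"
proof -
  have i: "integrable (lebesgue_on \<Omega>) (\<lambda>x. a \<eta> \<zeta> x * weak_deriv \<Omega> \<eta> u x * weak_deriv \<Omega> \<zeta> v x)"
    if h: "mdeg \<eta> = 2" "mdeg \<zeta> = 2" for \<eta> \<zeta>
  proof -
    obtain N where "AE x in lebesgue_on \<Omega>. \<bar>a \<eta> \<zeta> x\<bar> \<le> N" using a h unfolding Linf_symmetric_def by blast
    then have "(\<lambda>x. a \<eta> \<zeta> x * weak_deriv \<Omega> \<eta> u x) \<in> L2 \<Omega>"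
      using a h unfolding Linf_symmetric_def by (intro L2_Linf_mult(1)[OF _ _ u[OF h(1)]]) auto
    then show ?thesis by (rule L2_integrable_mult[OF _ v[OF h(2)]])
  qed
  show ?thesis
    unfolding Qform_def L2_inner_def
    by (subst Bochner_Integration.integral_sum, use i in \<open>auto intro!: Bochner_Integration.integrable_sum sum.cong Bochner_Integration.integral_sum\<close>)
qed

text \<open>Bounded coefficients make every term an L^2 pairing of second derivatives, continuous in
  both arguments jointly.\<close>

lemma Qform_tendsto:
  assumes a: "Linf_symmetric \<Omega> a"
    and u: "\<And>m \<eta>. mdeg \<eta> = 2 \<Longrightarrow> weak_deriv \<Omega> \<eta> (u m) \<in> L2 \<Omega>" "\<And>\<eta>. mdeg \<eta> = 2 \<Longrightarrow> weak_deriv \<Omega> \<eta> u' \<in> L2 \<Omega>"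
      "\<And>\<eta>. mdeg \<eta> = 2 \<Longrightarrow> (\<lambda>m. L2_norm \<Omega> (\<lambda>x. weak_deriv \<Omega> \<eta> (u m) x - weak_deriv \<Omega> \<eta> u' x)) \<longlonglongrightarrow> 0"
    and v: "\<And>m \<eta>. mdeg \<eta> = 2 \<Longrightarrow> weak_deriv \<Omega> \<eta> (v m) \<in> L2 \<Omega>" "\<And>\<eta>. mdeg \<eta> = 2 \<Longrightarrow> weak_deriv \<Omega> \<eta> v' \<in> L2 \<Omega>"
      "\<And>\<eta>. mdeg \<eta> = 2 \<Longrightarrow> (\<lambda>m. L2_norm \<Omega> (\<lambda>x. weak_deriv \<Omega> \<eta> (v m) x - weak_deriv \<Omega> \<eta> v' x)) \<longlonglongrightarrow> 0"
  shows "(\<lambda>m. Qform \<Omega> a (u m) (v m)) \<longlonglongrightarrow> Qform \<Omega> a u' v'"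
proof -
  have "(\<lambda>m. L2_inner \<Omega> (\<lambda>x. a \<eta> \<zeta> x * weak_deriv \<Omega> \<eta> (u m) x) (weak_deriv \<Omega> \<zeta> (v m)))
      \<longlonglongrightarrow> L2_inner \<Omega> (\<lambda>x. a \<eta> \<zeta> x * weak_deriv \<Omega> \<eta> u' x) (weak_deriv \<Omega> \<zeta> v')"
    if h: "mdeg \<eta> = 2" "mdeg \<zeta> = 2" for \<eta> \<zeta>
  proof -
    obtain N where N: "AE x in lebesgue_on \<Omega>. \<bar>a \<eta> \<zeta> x\<bar> \<le> N" using a h unfolding Linf_symmetric_def by blast
    have m: "a \<eta> \<zeta> \<in> borel_measurable (lebesgue_on \<Omega>)" using a h unfolding Linf_symmetric_def by blast
    show ?thesis
    proof (rule L2_inner_tendsto[OF L2_Linf_mult(1)[OF m N u(1)[OF h(1)]] L2_Linf_mult(1)[OF m N u(2)[OF h(1)]] _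
          v(1)[OF h(2)] v(2)[OF h(2)] v(3)[OF h(2)]])
      let ?d = "\<lambda>m x. weak_deriv \<Omega> \<eta> (u m) x - weak_deriv \<Omega> \<eta> u' x"
      show "(\<lambda>m. L2_norm \<Omega> (\<lambda>x. a \<eta> \<zeta> x * weak_deriv \<Omega> \<eta> (u m) x - a \<eta> \<zeta> x * weak_deriv \<Omega> \<eta> u' x)) \<longlonglongrightarrow> 0"
        unfolding right_diff_distrib[symmetric]
      proof (rule Lim_null_comparison[OF always_eventually])
        show "\<forall>m. norm (L2_norm \<Omega> (\<lambda>x. a \<eta> \<zeta> x * ?d m x)) \<le> \<bar>N\<bar> * L2_norm \<Omega> (?d m)"
          using L2_Linf_mult(2)[OF m N L2_diff[OF u(1)[OF h(1)] u(2)[OF h(1)]]] by (simp add: L2_norm_nonneg)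
        show "(\<lambda>m. \<bar>N\<bar> * L2_norm \<Omega> (?d m)) \<longlonglongrightarrow> 0"
          using tendsto_mult_right_zero[OF u(3)[OF h(1)]] by blast
      qed
    qed
  qed
  then have "(\<lambda>m. \<Sum>\<eta> | mdeg \<eta> = 2. \<Sum>\<zeta> | mdeg \<zeta> = 2. L2_inner \<Omega> (\<lambda>x. a \<eta> \<zeta> x * weak_deriv \<Omega> \<eta> (u m) x) (weak_deriv \<Omega> \<zeta> (v m)))
      \<longlonglongrightarrow> (\<Sum>\<eta> | mdeg \<eta> = 2. \<Sum>\<zeta> | mdeg \<zeta> = 2. L2_inner \<Omega> (\<lambda>x. a \<eta> \<zeta> x * weak_deriv \<Omega> \<eta> u' x) (weak_deriv \<Omega> \<zeta> v'))"
    by (intro tendsto_sum) auto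
  moreover have "Qform \<Omega> a (u m) (v m) = (\<Sum>\<eta> | mdeg \<eta> = 2. \<Sum>\<zeta> | mdeg \<zeta> = 2.
      L2_inner \<Omega> (\<lambda>x. a \<eta> \<zeta> x * weak_deriv \<Omega> \<eta> (u m) x) (weak_deriv \<Omega> \<zeta> (v m)))" for m
    by (rule Qform_eq_sum[OF a u(1) v(1)])
  moreover note Qform_eq_sum[OF a u(2) v(2)]
  ultimately show ?thesis by (simp only:)
qed

context hardy_rellich
begin

text \<open>Both sides converge along an approximation of u by test functions, so k and k' stay the
  same. The right-hand side also contains \<omega>^2 u, hence the second multiplier
  assumption.\<close>

lemma weighted_form_H20:
  assumes a: "Linf_symmetric \<Omega> a" and \<omega>: "multiplier \<omega> B" and \<omega>2: "multiplier (\<lambda>x. (\<omega> x)\<^sup>2) B2"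
    and ineq: "\<And>u. u \<in> Cc 2 \<Omega> \<Longrightarrow> Qform \<Omega> a (\<lambda>x. \<omega> x * u x) (\<lambda>x. \<omega> x * u x)
      \<le> k * Qform \<Omega> a u (\<lambda>x. (\<omega> x)\<^sup>2 * u x) + k' * (L2_norm \<Omega> u)\<^sup>2"
    and u: "u \<in> H20 \<Omega>"
  shows "Qform \<Omega> a (\<lambda>x. \<omega> x * u x) (\<lambda>x. \<omega> x * u x)
    \<le> k * Qform \<Omega> a u (\<lambda>x. (\<omega> x)\<^sup>2 * u x) + k' * (L2_norm \<Omega> u)\<^sup>2"
proof -
  obtain \<phi> where \<phi>: "\<And>m. \<phi> m \<in> Cc_inf \<Omega>"
    "\<And>\<eta>. mdeg \<eta> \<le> 2 \<Longrightarrow> (\<lambda>m. L2_norm \<Omega> (\<lambda>x. mderiv \<eta> (\<phi> m) x - D \<eta> u x)) \<longlonglongrightarrow> 0"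
    using H20_E[OF op bd u] by blast
  note \<phi>2 = Cc_inf_imp_Cc[OF \<phi>(1), where k = 2]
  have C: "Ck_on 2 \<Omega> \<omega>" "Ck_on 2 \<Omega> (\<lambda>x. (\<omega> x)\<^sup>2)" using \<omega> \<omega>2 by (simp_all add: multiplier_def)
  have h: "(\<lambda>x. \<omega> x * \<phi> m x) \<in> H20 \<Omega>" "(\<lambda>x. (\<omega> x)\<^sup>2 * \<phi> m x) \<in> H20 \<Omega>" "\<phi> m \<in> H20 \<Omega>" for m
    by (intro Cc_H20(1)[OF op bd] Cc_mult[OF op] C \<phi>2)+
  have w: "D \<eta> v \<in> L2 \<Omega>" if "v \<in> H20 \<Omega>" "mdeg \<eta> = 2" for v \<eta>
    using H20_weak_deriv(1)[OF op bd that(1), of \<eta>] that(2) by simp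
  have \<phi>D: "(\<lambda>m. L2_norm \<Omega> (\<lambda>x. D \<eta> (\<phi> m) x - D \<eta> u x)) \<longlonglongrightarrow> 0" if \<eta>: "mdeg \<eta> \<le> 2" for \<eta>
  proof -
    have "L2_norm \<Omega> (\<lambda>x. mderiv \<eta> (\<phi> m) x - D \<eta> u x) = L2_norm \<Omega> (\<lambda>x. D \<eta> (\<phi> m) x - D \<eta> u x)" for m
      by (rule L2_norm_cong_AE[OF domain_lebesgue L2_diff[OF Cc_mderiv_L2[OF op bd \<phi>2 \<eta>] H20_weak_deriv(1)[OF op bd u \<eta>]]])
         (use Cc_H20(2)[OF op bd \<phi>2[of m] \<eta>] in eventually_elim, simp)
    then show ?thesis using \<phi>(2)[OF \<eta>] by simp
  qed
  have \<phi>0: "(\<lambda>m. L2_norm \<Omega> (\<lambda>x. \<phi> m x - u x)) \<longlonglongrightarrow> 0"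
  proof -
    have z: "mdeg (\<lambda>_::'n. 0) \<le> 2" by (simp add: mdeg_mi)
    have "L2_norm \<Omega> (\<lambda>x. mderiv (\<lambda>_. 0) (\<phi> m) x - D (\<lambda>_. 0) u x) = L2_norm \<Omega> (\<lambda>x. \<phi> m x - u x)" for m
      by (rule L2_norm_cong_AE[OF domain_lebesgue L2_diff[OF Cc_mderiv_L2[OF op bd \<phi>2 z] H20_weak_deriv(1)[OF op bd u z]]])
         (use weak_deriv_0[OF op bd H20_L2[OF op bd u]] in eventually_elim, simp add: mderiv_0)
    then show ?thesis using \<phi>(2)[OF z] by simp
  qed
  show ?thesis
  proof (rule LIMSEQ_le)
    show "(\<lambda>m. Qform \<Omega> a (\<lambda>x. \<omega> x * \<phi> m x) (\<lambda>x. \<omega> x * \<phi> m x)) \<longlonglongrightarrow> Qform \<Omega> a (\<lambda>x. \<omega> x * u x) (\<lambda>x. \<omega> x * u x)"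
      by (rule Qform_tendsto[OF a]; (intro w h multiplier_H20(1)[OF \<omega> u] multiplier_weak_deriv_tendsto[OF \<omega> u \<phi>])?; simp)
    show "(\<lambda>m. k * Qform \<Omega> a (\<phi> m) (\<lambda>x. (\<omega> x)\<^sup>2 * \<phi> m x) + k' * (L2_norm \<Omega> (\<phi> m))\<^sup>2)
      \<longlonglongrightarrow> k * Qform \<Omega> a u (\<lambda>x. (\<omega> x)\<^sup>2 * u x) + k' * (L2_norm \<Omega> u)\<^sup>2"
    proof (intro tendsto_intros)
      show "(\<lambda>m. Qform \<Omega> a (\<phi> m) (\<lambda>x. (\<omega> x)\<^sup>2 * \<phi> m x)) \<longlonglongrightarrow> Qform \<Omega> a u (\<lambda>x. (\<omega> x)\<^sup>2 * u x)"
        by (rule Qform_tendsto[OF a];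
            (intro w h u multiplier_H20(1)[OF \<omega>2 u] multiplier_weak_deriv_tendsto[OF \<omega>2 u \<phi>] \<phi>D)?; simp)
      show "(\<lambda>m. L2_norm \<Omega> (\<phi> m)) \<longlonglongrightarrow> L2_norm \<Omega> u"
        by (rule L2_norm_tendsto_norm[OF H20_L2[OF op bd h(3)] H20_L2[OF op bd u] \<phi>0])
    qed
    show "\<exists>N. \<forall>m\<ge>N. Qform \<Omega> a (\<lambda>x. \<omega> x * \<phi> m x) (\<lambda>x. \<omega> x * \<phi> m x)
        \<le> k * Qform \<Omega> a (\<phi> m) (\<lambda>x. (\<omega> x)\<^sup>2 * \<phi> m x) + k' * (L2_norm \<Omega> (\<phi> m))\<^sup>2"
      using ineq[OF \<phi>2] by blast
  qed
qed

end

section \<open>Spectral measures\<close>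

text \<open>The polarised formula compares differences of measures. Written with a sum of two
  measures on each side, the comparison avoids subtraction, which is truncated in
  \<open>ennreal\<close>.\<close>

lemma nn_integral_eq_if_emeasure_eq:
  fixes f :: "'a \<Rightarrow> ennreal"
  assumes s: "sets M2 = sets M1" "sets M3 = sets M1" "sets M4 = sets M1"
    and eq: "\<And>A. A \<in> sets M1 \<Longrightarrow> emeasure M1 A + emeasure M2 A = emeasure M3 A + emeasure M4 A"
    and f: "f \<in> borel_measurable M1"
  shows "(\<integral>\<^sup>+x. f x \<partial>M1) + (\<integral>\<^sup>+x. f x \<partial>M2) = (\<integral>\<^sup>+x. f x \<partial>M3) + (\<integral>\<^sup>+x. f x \<partial>M4)"
  using f
proof (induction f rule: borel_measurable_induct)
  case (cong f g)
  have "space M2 = space M1" "space M3 = space M1" "space M4 = space M1" using s sets_eq_imp_space_eq by blast+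
  then have "(\<integral>\<^sup>+x. g x \<partial>N) = (\<integral>\<^sup>+x. f x \<partial>N)" if "N \<in> {M1, M2, M3, M4}" for N
    using cong(3) that by (intro nn_integral_cong) auto
  then show ?case using cong by simp
next
  case (set A)
  then show ?case using eq[of A] s by simp
next
  case (mult u c)
  have "u \<in> borel_measurable N" if "N \<in> {M1, M2, M3, M4}" for N
    using mult(2) s that by (auto cong: measurable_cong_sets)
  then show ?case using mult by (simp add: nn_integral_cmult flip: distrib_left)
next
  case (add u v)
  have m: "u \<in> borel_measurable N" "v \<in> borel_measurable N" if "N \<in> {M1, M2, M3, M4}" for N
  proof -
    have "u \<in> borel_measurable M1" "v \<in> borel_measurable M1" by fact+
    then show "u \<in> borel_measurable N" "v \<in> borel_measurable N"
      using s that by (auto cong: measurable_cong_sets)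
  qed
  have "(\<integral>\<^sup>+x. v x + u x \<partial>N) = (\<integral>\<^sup>+x. v x \<partial>N) + (\<integral>\<^sup>+x. u x \<partial>N)" if "N \<in> {M1, M2, M3, M4}" for N
    by (intro nn_integral_add m that)
  then show ?case using add.IH by (simp add: add_ac)
next
  case (seq U)
  have m: "U i \<in> borel_measurable N" if "N \<in> {M1, M2, M3, M4}" for N i
    using seq(1)[of i] s that by (auto cong: measurable_cong_sets)
  have "(\<integral>\<^sup>+x. (SUP i. U i x) \<partial>N) = (SUP i. \<integral>\<^sup>+x. U i x \<partial>N)" if "N \<in> {M1, M2, M3, M4}" for N
    using seq(3) by (intro nn_integral_monotone_convergence_SUP m that) (auto simp: incseq_def le_fun_def)
  then have S: "(\<integral>\<^sup>+x. (SUP i. U i) x \<partial>N) = (SUP i. \<integral>\<^sup>+x. U i x \<partial>N)" if "N \<in> {M1, M2, M3, M4}" for N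
    using that by (simp add: SUP_apply[abs_def])
  have inc: "incseq (\<lambda>i. \<integral>\<^sup>+x. U i x \<partial>N)" for N
    using seq(3) by (auto simp: incseq_def le_fun_def intro!: nn_integral_mono)
  have "(\<integral>\<^sup>+x. (SUP i. U i) x \<partial>M1) + (\<integral>\<^sup>+x. (SUP i. U i) x \<partial>M2)
      = (SUP i. (\<integral>\<^sup>+x. U i x \<partial>M1) + (\<integral>\<^sup>+x. U i x \<partial>M2))"
    by (simp only: S insert_iff simp_thms ennreal_SUP_add[OF inc inc])
  also have "\<dots> = (SUP i. (\<integral>\<^sup>+x. U i x \<partial>M3) + (\<integral>\<^sup>+x. U i x \<partial>M4))" using seq.IH by simp
  also have "\<dots> = (\<integral>\<^sup>+x. (SUP i. U i) x \<partial>M3) + (\<integral>\<^sup>+x. (SUP i. U i) x \<partial>M4)"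
    by (simp only: S insert_iff simp_thms ennreal_SUP_add[OF inc inc])
  finally show ?case .
qed

lemma integral_eq_if_emeasure_eq:
  fixes f :: "'a \<Rightarrow> real"
  assumes s: "sets M2 = sets M1" "sets M3 = sets M1" "sets M4 = sets M1"
    and eq: "\<And>A. A \<in> sets M1 \<Longrightarrow> emeasure M1 A + emeasure M2 A = emeasure M3 A + emeasure M4 A"
    and f: "integrable M1 f" "integrable M2 f" "integrable M3 f" "integrable M4 f"
  shows "(LINT x|M1. f x) + (LINT x|M2. f x) = (LINT x|M3. f x) + (LINT x|M4. f x)"
proof -
  let ?P = "\<lambda>N. \<integral>\<^sup>+x. ennreal (f x) \<partial>N" and ?N = "\<lambda>N. \<integral>\<^sup>+x. ennreal (- f x) \<partial>N"
  have m: "f \<in> borel_measurable M1" using f(1) by simp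
  have "?P M1 + ?P M2 = ?P M3 + ?P M4" "?N M1 + ?N M2 = ?N M3 + ?N M4"
    by (rule nn_integral_eq_if_emeasure_eq[OF s eq]; use m in simp)+
  moreover have fin: "?P N < top" "?N N < top" if "integrable N f" for N
  proof -
    show "?P N < top" using that by (simp add: real_integrable_def less_top)
    show "?N N < top" using that by (simp add: real_integrable_def less_top)
  qed
  ultimately have "enn2real (?P M1) + enn2real (?P M2) = enn2real (?P M3) + enn2real (?P M4)"
    "enn2real (?N M1) + enn2real (?N M2) = enn2real (?N M3) + enn2real (?N M4)"
    using fin f by (metis enn2real_plus)+
  then show ?thesis using f by (simp add: real_lebesgue_integral_def)
qed

section \<open>Calculus with a projection-valued measure and its scalar measures\<close>

locale spectral =
  fixes \<Omega> :: "(real^'n::finite) set" and E :: "real set \<Rightarrow> (real^'n \<Rightarrow> real) \<Rightarrow> (real^'n \<Rightarrow> real)"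
  assumes fin: "\<Omega> \<in> lmeasurable" and spec: "spectral_measure \<Omega> E"
begin

abbreviation "ip \<equiv> L2_inner \<Omega>"
abbreviation "\<mu> \<equiv> scalar_measure \<Omega> E"

lemma dom: "\<Omega> \<in> sets lebesgue" using fin by (rule fmeasurableD)

lemma E_L2: "B \<in> sets borel \<Longrightarrow> u \<in> L2 \<Omega> \<Longrightarrow> E B u \<in> L2 \<Omega>"
  using spec by (simp add: spectral_measure_def)

lemma E_sym: "B \<in> sets borel \<Longrightarrow> u \<in> L2 \<Omega> \<Longrightarrow> v \<in> L2 \<Omega> \<Longrightarrow> ip (E B u) v = ip u (E B v)"
  using spec by (simp add: spectral_measure_def)

lemma E_E: "A \<in> sets borel \<Longrightarrow> B \<in> sets borel \<Longrightarrow> u \<in> L2 \<Omega> \<Longrightarrow> v \<in> L2 \<Omega> \<Longrightarrow>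
    ip (E A u) (E B v) = ip (E (A \<inter> B) u) v"
proof -
  assume A: "A \<in> sets borel" and B: "B \<in> sets borel" and u: "u \<in> L2 \<Omega>" and v: "v \<in> L2 \<Omega>"
  have ae: "AE x in lebesgue_on \<Omega>. E B (E A u) x = E (A \<inter> B) u x"
    using spec[unfolded spectral_measure_def, THEN conjunct2, THEN conjunct2, THEN conjunct1, rule_format, OF B A u]
    by (simp add: Int_commute)
  have "ip (E A u) (E B v) = ip (E B (E A u)) v" using E_sym[OF B E_L2[OF A u] v] by simp
  also have "\<dots> = ip (E (A \<inter> B) u) v"
    by (rule L2_inner_cong_AE[OF dom E_L2[OF B E_L2[OF A u]] v ae]) simp
  finally show ?thesis .
qed

lemma E_E_left: "A \<in> sets borel \<Longrightarrow> B \<in> sets borel \<Longrightarrow> u \<in> L2 \<Omega> \<Longrightarrow> v \<in> L2 \<Omega> \<Longrightarrow>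
    ip (E A (E B u)) v = ip (E (A \<inter> B) u) v"
  using E_sym[of A "E B u" v] E_E[of B A u v] E_L2[of B u] by (simp add: Int_commute)

lemma E_UNIV: "u \<in> L2 \<Omega> \<Longrightarrow> AE x in lebesgue_on \<Omega>. E UNIV u x = u x"
  using spec by (simp add: spectral_measure_def)

lemma E_nonneg: "B \<in> sets borel \<Longrightarrow> u \<in> L2 \<Omega> \<Longrightarrow> ip (E B u) u \<ge> 0"
  using E_E[of B B u u] L2_inner_self_nonneg[of \<Omega> "E B u"] by simp

lemma E_add: "B \<in> sets borel \<Longrightarrow> u \<in> L2 \<Omega> \<Longrightarrow> v \<in> L2 \<Omega> \<Longrightarrow> w \<in> L2 \<Omega> \<Longrightarrow>
    ip (E B (\<lambda>x. u x + v x)) w = ip (E B u) w + ip (E B v) w"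
  by (simp add: E_sym L2_add L2_inner_add_left E_L2)

lemma E_diff: "B \<in> sets borel \<Longrightarrow> u \<in> L2 \<Omega> \<Longrightarrow> v \<in> L2 \<Omega> \<Longrightarrow> w \<in> L2 \<Omega> \<Longrightarrow>
    ip (E B (\<lambda>x. u x - v x)) w = ip (E B u) w - ip (E B v) w"
  by (simp add: E_sym L2_diff L2_inner_diff_left E_L2)

lemma E_swap: "B \<in> sets borel \<Longrightarrow> u \<in> L2 \<Omega> \<Longrightarrow> v \<in> L2 \<Omega> \<Longrightarrow> ip (E B v) u = ip (E B u) v"
  using E_sym[of B v u] L2_inner_commute[of \<Omega> v "E B u"] by simp

lemma E_quadratic_add: "B \<in> sets borel \<Longrightarrow> u \<in> L2 \<Omega> \<Longrightarrow> v \<in> L2 \<Omega> \<Longrightarrow>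
    ip (E B (\<lambda>x. u x + v x)) (\<lambda>x. u x + v x) = ip (E B u) u + 2 * ip (E B u) v + ip (E B v) v"
  using E_swap[of B u v] by (simp add: E_add L2_add L2_inner_add_right E_L2)

lemma E_quadratic_diff: "B \<in> sets borel \<Longrightarrow> u \<in> L2 \<Omega> \<Longrightarrow> v \<in> L2 \<Omega> \<Longrightarrow>
    ip (E B (\<lambda>x. u x - v x)) (\<lambda>x. u x - v x) = ip (E B u) u - 2 * ip (E B u) v + ip (E B v) v"
  using E_swap[of B u v] by (simp add: E_diff L2_diff L2_inner_diff_right E_L2)

text \<open>Countable additivity over a sequence of empty sets makes a constant series converge, so
  its term vanishes.\<close>

lemma E_empty: "u \<in> L2 \<Omega> \<Longrightarrow> v \<in> L2 \<Omega> \<Longrightarrow> ip (E {} u) v = 0"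
proof -
  assume u: "u \<in> L2 \<Omega>" and v: "v \<in> L2 \<Omega>"
  have "(\<lambda>i::nat. ip (E {} u) v) sums ip (E (\<Union>i::nat. {}) u) v"
    using spec[unfolded spectral_measure_def] u v
    by (elim conjE allE[of _ "\<lambda>i::nat. {}"]) (auto simp: disjoint_family_on_def)
  then have "(\<lambda>i::nat. ip (E {} u) v) \<longlonglongrightarrow> 0" using summable_LIMSEQ_zero sums_summable by blast
  then show ?thesis by (simp add: LIMSEQ_const_iff)
qed

lemma sets_\<mu> [simp]: "sets (\<mu> u) = sets borel" and space_\<mu> [simp]: "space (\<mu> u) = UNIV"
  unfolding scalar_measure_def using sets.sigma_sets_eq[of "borel :: real measure"]
  by (simp_all add: space_measure_of_conv sets_measure_of_conv)

lemma emeasure_\<mu>: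
  assumes u: "u \<in> L2 \<Omega>" and B: "B \<in> sets borel"
  shows "emeasure (\<mu> u) B = ennreal (ip (E B u) u)"
proof (rule emeasure_measure_of[OF scalar_measure_def])
  show "sets borel \<subseteq> Pow (UNIV :: real set)" by simp
  show "positive (sets (\<mu> u)) (\<lambda>B. ennreal (ip (E B u) u))"
    by (simp add: positive_def E_empty[OF u u])
  show "countably_additive (sets (\<mu> u)) (\<lambda>B. ennreal (ip (E B u) u))"
  proof (rule countably_additiveI)
    fix A :: "nat \<Rightarrow> real set" assume A: "range A \<subseteq> sets (\<mu> u)" "disjoint_family A"
    have "(\<lambda>i. ip (E (A i) u) u) sums ip (E (\<Union>i. A i) u) u"
      using spec[unfolded spectral_measure_def, THEN conjunct2, THEN conjunct2, THEN conjunct2, THEN conjunct2,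
          rule_format, of A, OF conjI u u] A by simp
    then show "(\<Sum>i. ennreal (ip (E (A i) u) u)) = ennreal (ip (E (\<Union>(range A)) u) u)"
      using A E_nonneg[OF _ u] by (intro suminf_ennreal_eq) auto
  qed
  show "B \<in> sets (\<mu> u)" using B by simp
qed

lemma finite_\<mu>: "u \<in> L2 \<Omega> \<Longrightarrow> finite_measure (\<mu> u)"
  by (rule finite_measureI) (simp add: emeasure_\<mu>)

lemma measurable_\<mu>: "f \<in> borel_measurable borel \<Longrightarrow> f \<in> borel_measurable (\<mu> u)"
  by (simp cong: measurable_cong_sets)

lemma \<mu>_integrable:
  assumes "f \<in> borel_measurable borel" "u \<in> spectral_dom \<Omega> E f"
  shows "integrable (\<mu> u) f"
  using assms finite_measure.square_integrable_imp_integrable[OF finite_\<mu>, of u f]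
  by (simp add: spectral_dom_def measurable_\<mu>)

text \<open>The parallelogram law for the scalar measures shows that the domain is a subspace.\<close>

lemma spectral_dom_add_diff:
  assumes f: "f \<in> borel_measurable borel" and u: "u \<in> spectral_dom \<Omega> E f" and v: "v \<in> spectral_dom \<Omega> E f"
  shows "(\<lambda>x. u x + v x) \<in> spectral_dom \<Omega> E f" "(\<lambda>x. u x - v x) \<in> spectral_dom \<Omega> E f"
proof -
  have L: "u \<in> L2 \<Omega>" "v \<in> L2 \<Omega>" using u v by (auto simp: spectral_dom_def)
  let ?p = "\<lambda>x. u x + v x" and ?m = "\<lambda>x. u x - v x"
  let ?g = "\<lambda>t. ennreal ((f t)\<^sup>2)"
  let ?N = "\<lambda>w. density (\<mu> w) (\<lambda>_. 2)"
  have "(\<integral>\<^sup>+t. ?g t \<partial>\<mu> ?p) + (\<integral>\<^sup>+t. ?g t \<partial>\<mu> ?m) = (\<integral>\<^sup>+t. ?g t \<partial>?N u) + (\<integral>\<^sup>+t. ?g t \<partial>?N v)"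
  proof (rule nn_integral_eq_if_emeasure_eq)
    fix A assume "A \<in> sets (\<mu> ?p)"
    then have A: "A \<in> sets borel" by simp
    note nn = E_nonneg[OF A L2_add[OF L]] E_nonneg[OF A L2_diff[OF L]] E_nonneg[OF A L(1)] E_nonneg[OF A L(2)]
    have "ip (E A ?p) ?p + ip (E A ?m) ?m = 2 * ip (E A u) u + 2 * ip (E A v) v"
      by (simp add: E_quadratic_add[OF A L] E_quadratic_diff[OF A L])
    then have "ennreal (ip (E A ?p) ?p) + ennreal (ip (E A ?m) ?m) = 2 * ennreal (ip (E A u) u) + 2 * ennreal (ip (E A v) v)"
      using nn by (simp add: ennreal_plus[symmetric] ennreal_mult'[symmetric] ennreal_numeral[symmetric]
          del: ennreal_plus ennreal_numeral)
    then show "emeasure (\<mu> ?p) A + emeasure (\<mu> ?m) A = emeasure (?N u) A + emeasure (?N v) A"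
      using A L by (simp add: emeasure_\<mu> L2_add L2_diff emeasure_density nn_integral_cmult_indicator)
  qed (use f in \<open>auto intro!: measurable_\<mu>\<close>)
  moreover have "(\<integral>\<^sup>+t. ?g t \<partial>?N w) < top" if "w \<in> spectral_dom \<Omega> E f" for w
  proof -
    have i: "integrable (\<mu> w) (\<lambda>t. (f t)\<^sup>2)" using that by (simp add: spectral_dom_def)
    have "(\<integral>\<^sup>+t. ?g t \<partial>?N w) = 2 * (\<integral>\<^sup>+t. ?g t \<partial>\<mu> w)"
      using f by (simp add: nn_integral_density nn_integral_cmult measurable_\<mu>)
    also have "\<dots> < top" using integrableD(2)[OF i] by (simp add: ennreal_mult_less_top less_top)
    finally show ?thesis .
  qed
  ultimately have "(\<integral>\<^sup>+t. ?g t \<partial>\<mu> ?p) + (\<integral>\<^sup>+t. ?g t \<partial>\<mu> ?m) < top" using u v by simp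
  then have "(\<integral>\<^sup>+t. ?g t \<partial>\<mu> ?p) < top" "(\<integral>\<^sup>+t. ?g t \<partial>\<mu> ?m) < top"
    by (simp_all add: ennreal_add_less_top)
  then show "?p \<in> spectral_dom \<Omega> E f" "?m \<in> spectral_dom \<Omega> E f"
    using f L by (auto simp: spectral_dom_def L2_add L2_diff measurable_\<mu> intro!: integrableI_nonneg)
qed

text \<open>The densities are the squares of 1_B, 1 + 1_B and 1 - 1_B, where 1_B is the indicator of
  B; since 1_B is idempotent, (1 + 1_B)^2 = 1 + 3 1_B and (1 - 1_B)^2 = 1 - 1_B.\<close>

lemma \<mu>_E:
  assumes u: "u \<in> L2 \<Omega>" and B: "B \<in> sets borel"
  shows "\<mu> (E B u) = density (\<mu> u) (indicator B)"
    and "\<mu> (\<lambda>x. u x + E B u x) = density (\<mu> u) (\<lambda>t. ennreal (1 + 3 * indicator B t))"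
    and "\<mu> (\<lambda>x. u x - E B u x) = density (\<mu> u) (\<lambda>t. ennreal (1 - indicator B t))"
proof -
  note EL = E_L2[OF B u]
  have i: "ip (E A u) (E B u) = ip (E (A \<inter> B) u) u" "ip (E A (E B u)) (E B u) = ip (E (A \<inter> B) u) u"
    if A: "A \<in> sets borel" for A
    using E_E[OF A B u u] E_E_left[OF A B u EL] E_E[OF sets.Int[OF A B] B u u] by (simp_all add: Int_assoc)
  have e: "emeasure (density (\<mu> u) (indicator B)) A = ennreal (ip (E (A \<inter> B) u) u)" if A: "A \<in> sets borel" for A
  proof -
    have "emeasure (density (\<mu> u) (indicator B)) A = (\<integral>\<^sup>+t. indicator B t * indicator A t \<partial>\<mu> u)"
      using A B by (intro emeasure_density measurable_\<mu>) auto
    also have "\<dots> = (\<integral>\<^sup>+t. indicator (A \<inter> B) t \<partial>\<mu> u)"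
      by (intro nn_integral_cong) (auto split: split_indicator)
    also have "\<dots> = emeasure (\<mu> u) (A \<inter> B)" using A B by (intro nn_integral_indicator) simp
    finally show ?thesis using A B u by (simp add: emeasure_\<mu>)
  qed
  show "\<mu> (E B u) = density (\<mu> u) (indicator B)"
    by (rule measure_eqI) (simp_all add: e emeasure_\<mu> EL i)
  show "\<mu> (\<lambda>x. u x + E B u x) = density (\<mu> u) (\<lambda>t. ennreal (1 + 3 * indicator B t))"
  proof (rule measure_eqI)
    fix A assume "A \<in> sets (\<mu> (\<lambda>x. u x + E B u x))"
    then have A: "A \<in> sets borel" by simp
    have nn: "0 \<le> ip (E A u) u" "0 \<le> ip (E (A \<inter> B) u) u" using A B u by (simp_all add: E_nonneg)
    have "emeasure (density (\<mu> u) (\<lambda>t. ennreal (1 + 3 * indicator B t))) A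
        = (\<integral>\<^sup>+t. indicator A t + 3 * indicator (A \<inter> B) t \<partial>\<mu> u)"
      using A B by (subst emeasure_density)
        (auto intro!: nn_integral_cong measurable_\<mu> split: split_indicator)
    also have "\<dots> = ennreal (ip (E A u) u) + 3 * ennreal (ip (E (A \<inter> B) u) u)"
    proof -
      have m: "(indicator C :: real \<Rightarrow> ennreal) \<in> borel_measurable (\<mu> u)" if "C \<in> sets borel" for C
        using that by (intro measurable_\<mu>) simp
      have AB: "A \<inter> B \<in> sets borel" using A B by simp
      have "(\<integral>\<^sup>+t. indicator A t + 3 * indicator (A \<inter> B) t \<partial>\<mu> u)
          = (\<integral>\<^sup>+t. indicator A t \<partial>\<mu> u) + (\<integral>\<^sup>+t. 3 * indicator (A \<inter> B) t \<partial>\<mu> u)"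
        by (intro nn_integral_add m A borel_measurable_times_ennreal AB borel_measurable_const)
      also have "(\<integral>\<^sup>+t. 3 * indicator (A \<inter> B) t \<partial>\<mu> u) = 3 * emeasure (\<mu> u) (A \<inter> B)"
        using AB by (intro nn_integral_cmult_indicator) simp
      also have "(\<integral>\<^sup>+t. indicator A t \<partial>\<mu> u) = emeasure (\<mu> u) A"
        using A by (intro nn_integral_indicator) simp
      finally show ?thesis using A AB u by (simp add: emeasure_\<mu>)
    qed
    also have "\<dots> = ennreal (ip (E A u) u + 3 * ip (E (A \<inter> B) u) u)"
      using nn by (simp add: ennreal_mult' add.commute)
    finally show "emeasure (\<mu> (\<lambda>x. u x + E B u x)) A = emeasure (density (\<mu> u) (\<lambda>t. ennreal (1 + 3 * indicator B t))) A"
      using A B u by (simp add: emeasure_\<mu> L2_add EL E_quadratic_add i add.commute)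
  qed simp
  show "\<mu> (\<lambda>x. u x - E B u x) = density (\<mu> u) (\<lambda>t. ennreal (1 - indicator B t))"
  proof (rule measure_eqI)
    fix A assume "A \<in> sets (\<mu> (\<lambda>x. u x - E B u x))"
    then have A: "A \<in> sets borel" by simp
    have "emeasure (density (\<mu> u) (\<lambda>t. ennreal (1 - indicator B t))) A = (\<integral>\<^sup>+t. indicator (A - B) t \<partial>\<mu> u)"
    proof -
      have "emeasure (density (\<mu> u) (\<lambda>t. ennreal (1 - indicator B t))) A = (\<integral>\<^sup>+t. ennreal (1 - indicator B t) * indicator A t \<partial>\<mu> u)"
        using A B by (intro emeasure_density measurable_\<mu>) auto
      also have "\<dots> = (\<integral>\<^sup>+t. indicator (A - B) t \<partial>\<mu> u)"
        by (intro nn_integral_cong) (auto split: split_indicator)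
      finally show ?thesis .
    qed
    also have "\<dots> = emeasure (\<mu> u) (A - A \<inter> B)" using A B by (simp add: Diff_Int)
    also have "\<dots> = emeasure (\<mu> u) A - emeasure (\<mu> u) (A \<inter> B)"
      using A B by (intro emeasure_Diff) (auto simp: finite_measure.emeasure_eq_measure[OF finite_\<mu>[OF u]])
    also have "\<dots> = ennreal (ip (E A u) u - ip (E (A \<inter> B) u) u)"
      using A B u by (simp add: emeasure_\<mu> ennreal_minus E_nonneg)
    finally show "emeasure (\<mu> (\<lambda>x. u x - E B u x)) A = emeasure (density (\<mu> u) (\<lambda>t. ennreal (1 - indicator B t))) A"
      using A B u by (simp add: emeasure_\<mu> L2_diff EL E_quadratic_diff i)
  qed simp
qed

lemma spectral_dom_E:
  assumes f: "f \<in> borel_measurable borel" and u: "u \<in> spectral_dom \<Omega> E f" and B: "B \<in> sets borel"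
  shows "E B u \<in> spectral_dom \<Omega> E f"
proof -
  have L: "u \<in> L2 \<Omega>" and i: "integrable (\<mu> u) (\<lambda>t. (f t)\<^sup>2)" using u by (auto simp: spectral_dom_def)
  have "density (\<mu> u) (indicator B) = density (\<mu> u) (\<lambda>t. ennreal (indicator B t))" by (simp add: ennreal_indicator)
  moreover have "integrable (density (\<mu> u) (\<lambda>t. ennreal (indicator B t))) (\<lambda>t. (f t)\<^sup>2)"
    using i f B integrable_real_mult_indicator[of B "\<mu> u" "\<lambda>t. (f t)\<^sup>2"]
    by (subst integrable_density) (auto intro!: measurable_\<mu> simp: mult.commute)
  ultimately show ?thesis using E_L2[OF B L] \<mu>_E(1)[OF L B] by (simp add: spectral_dom_def)
qed

text \<open>With the test vector E(B)u the two measures of the polarised definition have densities 1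
  + 3 1_B and 1 - 1_B with respect to that of u. Their difference is 4 1_B, which matches the factor
  4.\<close>

lemma inner_E_spectral_integral:
  assumes f: "f \<in> borel_measurable borel" and uw: "(u, w) \<in> spectral_integral \<Omega> E f" and B: "B \<in> sets borel"
  shows "ip w (E B u) = (LINT t|\<mu> u. f t * indicator B t)"
proof -
  have u: "u \<in> spectral_dom \<Omega> E f" and L: "u \<in> L2 \<Omega>" using uw by (auto simp: spectral_integral_def spectral_dom_def)
  have i: "integrable (\<mu> u) f" by (rule \<mu>_integrable[OF f u])
  have iB: "integrable (\<mu> u) (\<lambda>t. f t * indicator B t)" using i B by (intro integrable_real_mult_indicator) auto
  have m: "f \<in> borel_measurable (\<mu> u)" by (rule measurable_\<mu>[OF f])
  have "4 * ip w (E B u) = (LINT t|\<mu> (\<lambda>x. u x + E B u x). f t) - (LINT t|\<mu> (\<lambda>x. u x - E B u x). f t)"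
    using uw spectral_dom_E[OF f u B] by (simp add: spectral_integral_def)
  also have "(LINT t|\<mu> (\<lambda>x. u x + E B u x). f t) = (LINT t|\<mu> u. (1 + 3 * indicator B t) * f t)"
    unfolding \<mu>_E(2)[OF L B] using m B
    by (subst integral_density) (auto intro!: measurable_\<mu>)
  also have "\<dots> = (LINT t|\<mu> u. f t + 3 * (f t * indicator B t))" by (simp add: algebra_simps)
  also have "\<dots> = (LINT t|\<mu> u. f t) + 3 * (LINT t|\<mu> u. f t * indicator B t)" using i iB by simp
  also have "(LINT t|\<mu> (\<lambda>x. u x - E B u x). f t) = (LINT t|\<mu> u. (1 - indicator B t) * f t)"
    unfolding \<mu>_E(3)[OF L B] using m B
    by (subst integral_density) (auto intro!: measurable_\<mu> simp: indicator_def)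
  also have "\<dots> = (LINT t|\<mu> u. f t - f t * indicator B t)" by (simp add: algebra_simps)
  also have "\<dots> = (LINT t|\<mu> u. f t) - (LINT t|\<mu> u. f t * indicator B t)" using i iB by simp
  finally show ?thesis by simp
qed

text \<open>The integral commutes with E(B). Pairing E(B)w with v amounts to pairing w with E(B)v,
  and the polarisations of (E(B)u, v) and (u, E(B)v) agree because on every set A their cross terms
  are both <E(A \<inter> B)u, v>.\<close>

lemma spectral_integral_E:
  assumes f: "f \<in> borel_measurable borel" and uw: "(u, w) \<in> spectral_integral \<Omega> E f" and B: "B \<in> sets borel"
  shows "(E B u, E B w) \<in> spectral_integral \<Omega> E f"
proof -
  have u: "u \<in> spectral_dom \<Omega> E f" and L: "u \<in> L2 \<Omega>" "w \<in> L2 \<Omega>"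
    using uw by (auto simp: spectral_integral_def spectral_dom_def)
  note Eu = spectral_dom_E[OF f u B]
  have "4 * ip (E B w) v = (LINT t|\<mu> (\<lambda>x. E B u x + v x). f t) - (LINT t|\<mu> (\<lambda>x. E B u x - v x). f t)"
    if v: "v \<in> spectral_dom \<Omega> E f" for v
  proof -
    have Lv: "v \<in> L2 \<Omega>" using v by (simp add: spectral_dom_def)
    note Ev = spectral_dom_E[OF f v B]
    note EL = E_L2[OF B L(1)] E_L2[OF B Lv]
    have "(LINT t|\<mu> (\<lambda>x. u x + E B v x). f t) + (LINT t|\<mu> (\<lambda>x. E B u x - v x). f t)
        = (LINT t|\<mu> (\<lambda>x. E B u x + v x). f t) + (LINT t|\<mu> (\<lambda>x. u x - E B v x). f t)"
    proof (rule integral_eq_if_emeasure_eq)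
      fix A assume "A \<in> sets (\<mu> (\<lambda>x. u x + E B v x))"
      then have A: "A \<in> sets borel" by simp
      have "ip (E A u) (E B v) = ip (E A (E B u)) v" using E_E[OF A B L(1) Lv] E_E_left[OF A B L(1) Lv] by simp
      then show "emeasure (\<mu> (\<lambda>x. u x + E B v x)) A + emeasure (\<mu> (\<lambda>x. E B u x - v x)) A
          = emeasure (\<mu> (\<lambda>x. E B u x + v x)) A + emeasure (\<mu> (\<lambda>x. u x - E B v x)) A"
        using A L Lv EL E_nonneg[OF A L2_add[OF L(1) EL(2)]] E_nonneg[OF A L2_diff[OF EL(1) Lv]]
          E_nonneg[OF A L2_add[OF EL(1) Lv]] E_nonneg[OF A L2_diff[OF L(1) EL(2)]]
        by (simp add: emeasure_\<mu> L2_add L2_diff ennreal_plus[symmetric] E_quadratic_add E_quadratic_diff del: ennreal_plus)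
    qed (simp_all add: \<mu>_integrable[OF f] spectral_dom_add_diff[OF f] u v Eu Ev)
    moreover have "4 * ip w (E B v) = (LINT t|\<mu> (\<lambda>x. u x + E B v x). f t) - (LINT t|\<mu> (\<lambda>x. u x - E B v x). f t)"
      using uw Ev by (simp add: spectral_integral_def)
    ultimately show ?thesis using E_sym[OF B L(2) Lv] by simp
  qed
  then show ?thesis using Eu E_L2[OF B L(2)] by (simp add: spectral_integral_def)
qed

end

section \<open>Interpolation\<close>

lemma L2_inner_sum_right:
  assumes "finite I" "\<And>i. i \<in> I \<Longrightarrow> f i \<in> L2 \<Omega>" "w \<in> L2 \<Omega>"
  shows "L2_inner \<Omega> w (\<lambda>x. \<Sum>i\<in>I. c i * f i x) = (\<Sum>i\<in>I. c i * L2_inner \<Omega> w (f i))"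
  using assms(1,2)
proof (induction I rule: finite_induct)
  case empty
  then show ?case by (simp add: L2_inner_def)
next
  case (insert i I)
  have L: "(\<lambda>x. c i * f i x) \<in> L2 \<Omega>" "(\<lambda>x. \<Sum>i\<in>I. c i * f i x) \<in> L2 \<Omega>"
    using insert.prems by (intro L2_scale L2_sum; simp)+
  have "L2_inner \<Omega> w (\<lambda>x. c i * f i x) = c i * L2_inner \<Omega> w (f i)"
    using L2_inner_scale_left[of \<Omega> "c i" "f i" w] by (simp add: L2_inner_commute)
  then show ?case using insert L2_inner_add_right[OF L assms(3)] by simp
qed

text \<open>Splitting at s = y leaves the integral of s^(\<alpha> - 1) over (0, y) and y times that
  of s^(\<alpha> - 2) over (y, \<infinity>), with values y^\<alpha>/\<alpha> and y^\<alpha>/(1 -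
  \<alpha>). The first converges because \<alpha> > 0, the second because \<alpha> < 1.\<close>

lemma nn_integral_min_powr:
  fixes \<alpha> y :: real
  assumes \<alpha>: "0 < \<alpha>" "\<alpha> < 1" and y: "0 \<le> y"
  shows "(\<integral>\<^sup>+s. ennreal (indicator {0<..} s * s powr (\<alpha> - 2) * min y s) \<partial>lborel)
    = ennreal ((1 / \<alpha> + 1 / (1 - \<alpha>)) * y powr \<alpha>)"
proof (cases "y = 0")
  case True
  have "indicator {0<..} s * s powr (\<alpha> - 2) * min y s = 0" for s :: real
    using True by (auto simp: indicator_def min_def)
  then have "(\<integral>\<^sup>+s. ennreal (indicator {0<..} s * s powr (\<alpha> - 2) * min y s) \<partial>lborel) = (\<integral>\<^sup>+s. 0 \<partial>(lborel :: real measure))"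
    by (simp only: ennreal_0)
  then show ?thesis using True by simp
next
  case False
  then have y: "y > 0" using y by simp
  have p: "s powr (\<alpha> - 2) * s = s powr (\<alpha> - 1)" if "s > 0" for s :: real
  proof -
    have "s powr (\<alpha> - 2) * s powr 1 = s powr (\<alpha> - 2 + 1)" by (rule powr_add[symmetric])
    then show ?thesis using that by simp
  qed
  have h1: "((\<lambda>s. s powr (\<alpha> - 1)) has_integral y powr \<alpha> / \<alpha>) {0..y}"
    using has_integral_powr_from_0[of "\<alpha> - 1" y] \<alpha> y by simp
  have "((\<lambda>s. y * s powr (\<alpha> - 2)) has_integral y * (- (y powr (\<alpha> - 2 + 1)) / (\<alpha> - 2 + 1))) {y..}"
    by (intro has_integral_mult_right has_integral_powr_to_inf) (use \<alpha> y in auto)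
  also have "y * (- (y powr (\<alpha> - 2 + 1)) / (\<alpha> - 2 + 1)) = y powr \<alpha> / (1 - \<alpha>)"
  proof -
    have "y * y powr (\<alpha> - 1) = y powr 1 * y powr (\<alpha> - 1)" using y by simp
    also have "\<dots> = y powr (1 + (\<alpha> - 1))" by (rule powr_add[symmetric])
    finally have e: "y * y powr (\<alpha> - 1) = y powr \<alpha>" by simp
    have "\<alpha> - 2 + 1 = \<alpha> - 1" by simp
    then have "y * (- (y powr (\<alpha> - 2 + 1)) / (\<alpha> - 2 + 1)) = - (y * y powr (\<alpha> - 1)) / (\<alpha> - 1)" by simp
    also have "\<dots> = y powr \<alpha> / (1 - \<alpha>)" unfolding e using \<alpha> by (simp add: divide_simps algebra_simps)
    finally show ?thesis .
  qed
  finally have h2: "((\<lambda>s. y * s powr (\<alpha> - 2)) has_integral y powr \<alpha> / (1 - \<alpha>)) {y..}" .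
  have n1: "(\<integral>\<^sup>+s. ennreal (s powr (\<alpha> - 1)) * indicator {0..y} s \<partial>lborel) = ennreal (y powr \<alpha> / \<alpha>)"
    by (rule nn_integral_has_integral_lebesgue'[OF _ h1]) simp
  have n2: "(\<integral>\<^sup>+s. ennreal (y * s powr (\<alpha> - 2)) * indicator {y..} s \<partial>lborel) = ennreal (y powr \<alpha> / (1 - \<alpha>))"
    by (rule nn_integral_has_integral_lebesgue'[OF _ h2]) (use y in simp)
  \<comment> \<open>Both closed pieces contain y, so the decomposition holds only off this null
    set.\<close>
  have "AE s in lborel. s \<noteq> y" by (rule AE_lborel_singleton)
  then have "AE s in lborel. ennreal (indicator {0<..} s * s powr (\<alpha> - 2) * min y s)
      = ennreal (s powr (\<alpha> - 1)) * indicator {0..y} s + ennreal (y * s powr (\<alpha> - 2)) * indicator {y..} s"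
  proof eventually_elim
    case (elim s)
    consider "s < 0" | "s = 0" | "0 < s" "s < y" | "y < s" using elim by linarith
    then show ?case using y p[of s] by cases (auto simp: min_def mult.commute)
  qed
  then have "(\<integral>\<^sup>+s. ennreal (indicator {0<..} s * s powr (\<alpha> - 2) * min y s) \<partial>lborel)
      = (\<integral>\<^sup>+s. ennreal (s powr (\<alpha> - 1)) * indicator {0..y} s + ennreal (y * s powr (\<alpha> - 2)) * indicator {y..} s \<partial>lborel)"
    by (rule nn_integral_cong_AE)
  also have "\<dots> = ennreal (y powr \<alpha> / \<alpha>) + ennreal (y powr \<alpha> / (1 - \<alpha>))"
    unfolding n1[symmetric] n2[symmetric] by (rule nn_integral_add) measurable
  also have "\<dots> = ennreal ((1 / \<alpha> + 1 / (1 - \<alpha>)) * y powr \<alpha>)"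
    using \<alpha> y by (simp add: ennreal_plus[symmetric] distrib_right del: ennreal_plus)
  finally show ?thesis .
qed

text \<open>Real interpolation: comparing the truncations at every level and integrating over the levels
  compares the fractional powers.\<close>

lemma nn_integral_powr_le_if_min_le:
  fixes \<beta> v :: "'a \<Rightarrow> real" and \<tau> :: "'b \<Rightarrow> real"
  assumes \<alpha>: "0 < \<alpha>" "\<alpha> < 1"
    and M: "sigma_finite_measure M" "\<beta> \<in> borel_measurable M" "v \<in> borel_measurable M" "\<And>x. x \<in> space M \<Longrightarrow> 0 \<le> \<beta> x"
    and N: "sigma_finite_measure N" "\<tau> \<in> borel_measurable N" "\<And>x. x \<in> space N \<Longrightarrow> 0 \<le> \<tau> x"
    and le: "\<And>s. s > 0 \<Longrightarrow> (\<integral>\<^sup>+x. ennreal (min (\<beta> x) s * (v x)\<^sup>2) \<partial>M) \<le> ennreal C * (\<integral>\<^sup>+t. ennreal (min (\<tau> t) s) \<partial>N)"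
  shows "(\<integral>\<^sup>+x. ennreal (\<beta> x powr \<alpha> * (v x)\<^sup>2) \<partial>M) \<le> ennreal C * (\<integral>\<^sup>+t. ennreal (\<tau> t powr \<alpha>) \<partial>N)"
proof -
  interpret M: sigma_finite_measure M by (rule M(1))
  interpret N: sigma_finite_measure N by (rule N(1))
  interpret PM: pair_sigma_finite lborel M ..
  interpret PN: pair_sigma_finite lborel N ..
  define r where "r s = indicator {0<..} s * s powr (\<alpha> - 2)" for s :: real
  define \<kappa> where "\<kappa> = 1 / \<alpha> + 1 / (1 - \<alpha>)"
  have r0: "0 \<le> r s" for s by (simp add: r_def)
  have rm [measurable]: "r \<in> borel_measurable borel" unfolding r_def by measurable
  have \<kappa>: "\<kappa> > 0" using \<alpha> by (simp add: \<kappa>_def add_pos_pos)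
  note [measurable] = M(2,3) N(2)
  have A: "(\<integral>\<^sup>+s. ennreal (r s) * (\<integral>\<^sup>+x. ennreal (min (\<beta> x) s * (v x)\<^sup>2) \<partial>M) \<partial>lborel)
      = ennreal \<kappa> * (\<integral>\<^sup>+x. ennreal (\<beta> x powr \<alpha> * (v x)\<^sup>2) \<partial>M)"
  proof -
    have "(\<integral>\<^sup>+s. ennreal (r s) * (\<integral>\<^sup>+x. ennreal (min (\<beta> x) s * (v x)\<^sup>2) \<partial>M) \<partial>lborel)
        = (\<integral>\<^sup>+s. (\<integral>\<^sup>+x. ennreal (r s) * ennreal (min (\<beta> x) s * (v x)\<^sup>2) \<partial>M) \<partial>lborel)"
      by (intro nn_integral_cong nn_integral_cmult[symmetric]) measurable
    also have "\<dots> = (\<integral>\<^sup>+x. (\<integral>\<^sup>+s. ennreal (r s) * ennreal (min (\<beta> x) s * (v x)\<^sup>2) \<partial>lborel) \<partial>M)"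
      by (rule PM.Fubini'[symmetric]) measurable
    also have "\<dots> = (\<integral>\<^sup>+x. ennreal \<kappa> * ennreal (\<beta> x powr \<alpha> * (v x)\<^sup>2) \<partial>M)"
    proof (rule nn_integral_cong)
      fix x assume x: "x \<in> space M"
      have "(\<integral>\<^sup>+s. ennreal (r s) * ennreal (min (\<beta> x) s * (v x)\<^sup>2) \<partial>lborel)
          = (\<integral>\<^sup>+s. ennreal ((v x)\<^sup>2) * ennreal (r s * min (\<beta> x) s) \<partial>lborel)"
        by (intro nn_integral_cong) (simp add: ennreal_mult'[symmetric] ennreal_mult''[symmetric] r0 mult_ac)
      also have "\<dots> = ennreal ((v x)\<^sup>2) * ennreal (\<kappa> * \<beta> x powr \<alpha>)"
        using nn_integral_min_powr[OF \<alpha> M(4)[OF x]] by (subst nn_integral_cmult) (simp_all add: r_def \<kappa>_def)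
      also have "\<dots> = ennreal \<kappa> * ennreal (\<beta> x powr \<alpha> * (v x)\<^sup>2)"
        using \<kappa> by (simp add: ennreal_mult[symmetric] mult_ac)
      finally show "(\<integral>\<^sup>+s. ennreal (r s) * ennreal (min (\<beta> x) s * (v x)\<^sup>2) \<partial>lborel) = ennreal \<kappa> * ennreal (\<beta> x powr \<alpha> * (v x)\<^sup>2)" .
    qed
    also have "\<dots> = ennreal \<kappa> * (\<integral>\<^sup>+x. ennreal (\<beta> x powr \<alpha> * (v x)\<^sup>2) \<partial>M)" by (rule nn_integral_cmult) measurable
    finally show ?thesis .
  qed
  have B: "(\<integral>\<^sup>+s. ennreal (r s) * (ennreal C * (\<integral>\<^sup>+t. ennreal (min (\<tau> t) s) \<partial>N)) \<partial>lborel)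
      = ennreal \<kappa> * (ennreal C * (\<integral>\<^sup>+t. ennreal (\<tau> t powr \<alpha>) \<partial>N))"
  proof -
    have "(\<integral>\<^sup>+s. ennreal (r s) * (ennreal C * (\<integral>\<^sup>+t. ennreal (min (\<tau> t) s) \<partial>N)) \<partial>lborel)
        = (\<integral>\<^sup>+s. ennreal C * (\<integral>\<^sup>+t. ennreal (r s) * ennreal (min (\<tau> t) s) \<partial>N) \<partial>lborel)"
    proof (rule nn_integral_cong)
      fix s :: real
      have "(\<integral>\<^sup>+t. ennreal (r s) * ennreal (min (\<tau> t) s) \<partial>N) = ennreal (r s) * (\<integral>\<^sup>+t. ennreal (min (\<tau> t) s) \<partial>N)"
        by (rule nn_integral_cmult) measurable
      then show "ennreal (r s) * (ennreal C * (\<integral>\<^sup>+t. ennreal (min (\<tau> t) s) \<partial>N)) = ennreal C * (\<integral>\<^sup>+t. ennreal (r s) * ennreal (min (\<tau> t) s) \<partial>N)"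
        by (simp add: mult_ac)
    qed
    also have "\<dots> = ennreal C * (\<integral>\<^sup>+s. (\<integral>\<^sup>+t. ennreal (r s) * ennreal (min (\<tau> t) s) \<partial>N) \<partial>lborel)"
      by (rule nn_integral_cmult) measurable
    also have "(\<integral>\<^sup>+s. (\<integral>\<^sup>+t. ennreal (r s) * ennreal (min (\<tau> t) s) \<partial>N) \<partial>lborel)
        = (\<integral>\<^sup>+t. (\<integral>\<^sup>+s. ennreal (r s) * ennreal (min (\<tau> t) s) \<partial>lborel) \<partial>N)"
      by (rule PN.Fubini'[symmetric]) measurable
    also have "\<dots> = (\<integral>\<^sup>+t. ennreal \<kappa> * ennreal (\<tau> t powr \<alpha>) \<partial>N)"
    proof (rule nn_integral_cong)
      fix t assume t: "t \<in> space N"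
      have "(\<integral>\<^sup>+s. ennreal (r s) * ennreal (min (\<tau> t) s) \<partial>lborel) = ennreal (\<kappa> * \<tau> t powr \<alpha>)"
        using nn_integral_min_powr[OF \<alpha> N(3)[OF t]] r0 by (simp add: r_def \<kappa>_def ennreal_mult'[symmetric])
      then show "(\<integral>\<^sup>+s. ennreal (r s) * ennreal (min (\<tau> t) s) \<partial>lborel) = ennreal \<kappa> * ennreal (\<tau> t powr \<alpha>)"
        using \<kappa> by (simp add: ennreal_mult)
    qed
    also have "\<dots> = ennreal \<kappa> * (\<integral>\<^sup>+t. ennreal (\<tau> t powr \<alpha>) \<partial>N)" by (rule nn_integral_cmult) measurable
    finally show ?thesis by (simp add: mult_ac)
  qed
  have "ennreal \<kappa> * (\<integral>\<^sup>+x. ennreal (\<beta> x powr \<alpha> * (v x)\<^sup>2) \<partial>M) \<le> ennreal \<kappa> * (ennreal C * (\<integral>\<^sup>+t. ennreal (\<tau> t powr \<alpha>) \<partial>N))"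
    unfolding A[symmetric] B[symmetric]
  proof (rule nn_integral_mono)
    fix s :: real
    show "ennreal (r s) * (\<integral>\<^sup>+x. ennreal (min (\<beta> x) s * (v x)\<^sup>2) \<partial>M) \<le> ennreal (r s) * (ennreal C * (\<integral>\<^sup>+t. ennreal (min (\<tau> t) s) \<partial>N))"
      using le[of s] by (cases "s > 0") (auto intro: mult_left_mono simp: r_def)
  qed
  \<comment> \<open>The factor \<kappa> occurs on both sides, so C survives the interpolation
    unchanged.\<close>
  then have "ennreal (1 / \<kappa>) * (ennreal \<kappa> * (\<integral>\<^sup>+x. ennreal (\<beta> x powr \<alpha> * (v x)\<^sup>2) \<partial>M))
      \<le> ennreal (1 / \<kappa>) * (ennreal \<kappa> * (ennreal C * (\<integral>\<^sup>+t. ennreal (\<tau> t powr \<alpha>) \<partial>N)))" by (rule mult_left_mono) simp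
  moreover have "ennreal (1 / \<kappa>) * (ennreal \<kappa> * X) = X" for X
    using \<kappa> by (simp add: mult.assoc[symmetric] ennreal_mult[symmetric])
  ultimately show ?thesis by (simp only:)
qed

section \<open>Norm of a spectral integral and comparison of fractional powers\<close>

context spectral
begin

text \<open>One half of the isometry property. Let g \<le> f^2 be simple with values c_y^2 on
  disjoint sets B_y and integral S. The vector v, the sum of the c_y E(B_y)u, has |v|^2 = S, and <w,
  v> \<ge> S because c_y \<le> f on B_y. Cauchy-Schwarz then gives S \<le> |w|^2.\<close>

lemma nn_integral_square_le_norm:
  assumes f: "f \<in> borel_measurable borel" "\<And>t. 0 \<le> f t" and uw: "(u, w) \<in> spectral_integral \<Omega> E f"
  shows "(\<integral>\<^sup>+t. ennreal ((f t)\<^sup>2) \<partial>\<mu> u) \<le> ennreal ((L2_norm \<Omega> w)\<^sup>2)"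
  unfolding nn_integral_def
proof (rule SUP_least)
  have u: "u \<in> spectral_dom \<Omega> E f" and L: "u \<in> L2 \<Omega>" "w \<in> L2 \<Omega>"
    using uw by (auto simp: spectral_integral_def spectral_dom_def)
  interpret \<mu>: finite_measure "\<mu> u" by (rule finite_\<mu>[OF L(1)])
  fix g assume "g \<in> {g. simple_function (\<mu> u) g \<and> g \<le> (\<lambda>t. ennreal ((f t)\<^sup>2))}"
  then have g: "simple_function (\<mu> u) g" "\<And>t. g t \<le> ennreal ((f t)\<^sup>2)" by (auto simp: le_fun_def)
  define Y where "Y = range g"
  define B where "B y = g -` {y}" for y
  define c where "c y = sqrt (enn2real y)" for y
  have Y: "finite Y" using simple_functionD(1)[OF g(1)] by (simp add: Y_def)
  have B: "B y \<in> sets borel" for y using simple_functionD(2)[OF g(1), of "{y}"] by (simp add: B_def)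
  have c0: "0 \<le> c y" "(c y)\<^sup>2 = enn2real y" for y by (simp_all add: c_def)
  \<comment> \<open>g is bounded by the finite function f^2, so no value in Y is infinite and
    \<open>enn2real\<close> loses nothing.\<close>
  have top: "ennreal ((c y)\<^sup>2) = y" if y: "y \<in> Y" for y
  proof -
    obtain t where "y = g t" using y unfolding Y_def by blast
    then have "y < top" using g(2)[of t] by (simp add: le_less_trans)
    then show ?thesis by (simp add: c0(2))
  qed
  have cf: "c y \<le> f t" if "t \<in> B y" for y t
  proof -
    have "y \<le> ennreal ((f t)\<^sup>2)" using g(2)[of t] that by (simp add: B_def)
    then have "enn2real y \<le> (f t)\<^sup>2" by (intro enn2real_leI) auto
    then have "c y \<le> sqrt ((f t)\<^sup>2)" unfolding c_def by (rule real_sqrt_le_mono)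
    then show ?thesis using f(2) by simp
  qed
  define S where "S = (\<Sum>y\<in>Y. (c y)\<^sup>2 * ip (E (B y) u) u)"
  have S0: "0 \<le> S" unfolding S_def by (intro sum_nonneg mult_nonneg_nonneg E_nonneg[OF B L(1)]) auto
  have "integral\<^sup>S (\<mu> u) g = (\<Sum>y\<in>Y. y * emeasure (\<mu> u) (B y))"
    by (simp add: simple_integral_def Y_def B_def)
  also have "\<dots> = (\<Sum>y\<in>Y. ennreal ((c y)\<^sup>2 * ip (E (B y) u) u))"
    by (intro sum.cong refl) (simp add: top emeasure_\<mu>[OF L(1) B] ennreal_mult' E_nonneg[OF B L(1)])
  also have "\<dots> = ennreal S" unfolding S_def by (intro sum_ennreal mult_nonneg_nonneg E_nonneg[OF B L(1)]) auto
  finally have gS: "integral\<^sup>S (\<mu> u) g = ennreal S" .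
  define v where "v x = (\<Sum>y\<in>Y. c y * E (B y) u x)" for x
  have v: "v \<in> L2 \<Omega>" unfolding v_def[abs_def] by (intro L2_sum L2_scale E_L2[OF B L(1)])
  have inner_v: "ip h v = (\<Sum>y\<in>Y. c y * ip h (E (B y) u))" if "h \<in> L2 \<Omega>" for h
    unfolding v_def[abs_def] by (rule L2_inner_sum_right[OF Y E_L2[OF B L(1)] that])
  have "ip v v = (\<Sum>y\<in>Y. c y * ip (E (B y) u) v)"
    unfolding inner_v[OF v] by (simp add: L2_inner_commute)
  also have "\<dots> = (\<Sum>y\<in>Y. c y * (\<Sum>z\<in>Y. if z = y then c y * ip (E (B y) u) u else 0))"
  proof (intro sum.cong refl arg_cong[where f = "(*) _"])
    fix y assume y: "y \<in> Y"
    show "ip (E (B y) u) v = (\<Sum>z\<in>Y. if z = y then c y * ip (E (B y) u) u else 0)"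
      unfolding inner_v[OF E_L2[OF B L(1)]]
    proof (intro sum.cong refl)
      fix z
      have "B y \<inter> B z = (if z = y then B y else {})" by (auto simp: B_def)
      then show "c z * ip (E (B y) u) (E (B z) u) = (if z = y then c y * ip (E (B y) u) u else 0)"
        using E_E[OF B B L(1) L(1), of y z] E_empty[OF L(1) L(1)] by auto
    qed
  qed
  also have "\<dots> = S" unfolding S_def using Y by (simp add: power2_eq_square mult.assoc)
  finally have vv: "L2_norm \<Omega> v = sqrt S" by (simp add: L2_norm_def)
  have "S \<le> ip w v"
    unfolding S_def inner_v[OF L(2)]
  proof (rule sum_mono)
    fix y assume "y \<in> Y"
    have i: "integrable (\<mu> u) (\<lambda>t. f t * indicator (B y) t)"
      using \<mu>_integrable[OF f(1) u] B by (intro integrable_real_mult_indicator) auto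
    have "c y * ip (E (B y) u) u = c y * measure (\<mu> u) (B y)"
      using E_nonneg[OF B L(1)] by (simp add: measure_def emeasure_\<mu>[OF L(1) B])
    also have "\<dots> = (LINT t|\<mu> u. c y * indicator (B y) t)" using B by simp
    also have "\<dots> \<le> (LINT t|\<mu> u. f t * indicator (B y) t)"
      using B by (intro integral_mono i integrable_mult_right integrable_real_indicator)
        (auto simp: \<mu>.emeasure_eq_measure cf split: split_indicator)
    also have "\<dots> = ip w (E (B y) u)" using inner_E_spectral_integral[OF f(1) uw B] by simp
    finally show "(c y)\<^sup>2 * ip (E (B y) u) u \<le> c y * ip w (E (B y) u)"
      using c0(1)[of y] by (simp add: power2_eq_square mult.assoc mult_left_mono)
  qed
  also have "\<dots> \<le> L2_norm \<Omega> w * sqrt S" using L2_Cauchy_Schwarz[OF L(2) v] by (simp add: vv)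
  finally have "sqrt S * sqrt S \<le> L2_norm \<Omega> w * sqrt S" using S0 by simp
  then have "sqrt S \<le> L2_norm \<Omega> w"
    using L2_norm_nonneg[of \<Omega> w] S0 mult_right_le_imp_le[of "sqrt S" "sqrt S" "L2_norm \<Omega> w"]
    by (cases "S = 0") auto
  then have "(sqrt S)\<^sup>2 \<le> (L2_norm \<Omega> w)\<^sup>2" using S0 by (intro power_mono) auto
  then show "integral\<^sup>S (\<mu> u) g \<le> ennreal ((L2_norm \<Omega> w)\<^sup>2)"
    unfolding gS using S0 by (intro ennreal_leI) simp
qed

text \<open>At level s, the low part E({..s})u lies in the domain and the form inequality yields the
  density 2Ct for 0 \<le> t \<le> s; the high part is measured by its plain norm and yields 2s for t
  > s. Both are at most (2C + 2) min(t, s), which is the origin of the constant.\<close>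

lemma fractional_form_bound:
  assumes b: "b \<in> borel_measurable (lebesgue_on \<Omega>)" and C: "C > 0"
    and form: "\<And>x y. (x, y) \<in> spectral_integral \<Omega> E (\<lambda>t. t) \<Longrightarrow>
      (\<integral>\<^sup>+z. ennreal ((b z * x z)\<^sup>2) \<partial>lebesgue_on \<Omega>) \<le> ennreal (C * ip y x)"
    and \<alpha>: "0 < \<alpha>" "\<alpha> < 1"
    and u: "(u, h) \<in> spectral_integral \<Omega> E (\<lambda>t. t)"
  shows "(\<integral>\<^sup>+z. ennreal (((b z)\<^sup>2) powr \<alpha> * (u z)\<^sup>2) \<partial>lebesgue_on \<Omega>)
    \<le> ennreal (2 * C + 2) * (\<integral>\<^sup>+t. ennreal ((max t 0) powr \<alpha>) \<partial>\<mu> u)"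
proof (rule nn_integral_powr_le_if_min_le[OF \<alpha>])
  let ?M = "lebesgue_on \<Omega>"
  have L: "u \<in> L2 \<Omega>" "h \<in> L2 \<Omega>" using u by (auto simp: spectral_integral_def spectral_dom_def)
  have udom: "u \<in> spectral_dom \<Omega> E (\<lambda>t. t)" using u by (simp add: spectral_integral_def)
  interpret \<mu>: finite_measure "\<mu> u" by (rule finite_\<mu>[OF L(1)])
  show "sigma_finite_measure ?M"
    by (rule finite_measure.axioms(1)[OF finite_measure_lebesgue_on[OF fin]])
  show "sigma_finite_measure (\<mu> u)" by unfold_locales
  show "(\<lambda>z. (b z)\<^sup>2) \<in> borel_measurable ?M" using b by measurable
  show "u \<in> borel_measurable ?M" by (rule L2_measurable[OF L(1)])
  show "(\<lambda>t. max t 0) \<in> borel_measurable (\<mu> u)" by (intro measurable_\<mu>) measurable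
  fix s :: real assume s: "s > 0"
  define B where "B = {..s}"
  have B: "B \<in> sets borel" by (simp add: B_def)
  define x where "x = E B u"
  have x: "x \<in> L2 \<Omega>" unfolding x_def by (rule E_L2[OF B L(1)])
  have xy: "(x, E B h) \<in> spectral_integral \<Omega> E (\<lambda>t. t)"
    unfolding x_def by (rule spectral_integral_E[OF _ u B]) simp
  have d: "(\<lambda>z. u z - x z) \<in> L2 \<Omega>" by (rule L2_diff[OF L(1) x])
  have "ip (E B h) x = ip h (E B u)"
    unfolding x_def using E_E[OF B B L(2) L(1)] E_sym[OF B L(2) L(1)] by simp
  also have "\<dots> = (LINT t|\<mu> u. t * indicator B t)" by (rule inner_E_spectral_integral[OF _ u B]) simp
  finally have hx: "ip (E B h) x = (LINT t|\<mu> u. t * indicator B t)" .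
  have it: "integrable (\<mu> u) (\<lambda>t. t * indicator B t)"
    using \<mu>_integrable[OF _ udom] B by (intro integrable_real_mult_indicator) auto
  \<comment> \<open>Passing to the positive part only enlarges the integral; this handles the
    negative half-line, about which nothing is known here.\<close>
  have low: "(\<integral>\<^sup>+z. ennreal ((b z * x z)\<^sup>2) \<partial>?M) \<le> ennreal C * (\<integral>\<^sup>+t. ennreal (max (t * indicator B t) 0) \<partial>\<mu> u)"
  proof -
    have "(LINT t|\<mu> u. t * indicator B t) \<le> (LINT t|\<mu> u. max (t * indicator B t) 0)"
      using it by (intro integral_mono integrable_max) auto
    then have "ennreal (C * ip (E B h) x) \<le> ennreal C * ennreal (LINT t|\<mu> u. max (t * indicator B t) 0)"
      using C by (simp add: hx ennreal_mult'[symmetric] ennreal_leI)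
    also have "ennreal (LINT t|\<mu> u. max (t * indicator B t) 0) = (\<integral>\<^sup>+t. ennreal (max (t * indicator B t) 0) \<partial>\<mu> u)"
      using it by (intro nn_integral_eq_integral[symmetric] integrable_max) auto
    finally show ?thesis using form[OF xy] by (rule order_trans[rotated])
  qed
  have nd: "(L2_norm \<Omega> (\<lambda>z. u z - x z))\<^sup>2 = ip u u - ip (E B u) u"
  proof -
    have "ip x x = ip (E B u) u" unfolding x_def using E_E[OF B B L(1) L(1)] by simp
    moreover have "ip u x = ip (E B u) u" unfolding x_def by (rule L2_inner_commute)
    moreover have "ip x u = ip (E B u) u" unfolding x_def ..
    ultimately show ?thesis
      unfolding L2_norm_square using L2_inner_diff_left[OF L(1) x d] L2_inner_diff_right[OF L(1) x L(1)] L2_inner_diff_right[OF L(1) x x]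
      by simp
  qed
  have uu: "ip u u = ip (E UNIV u) u"
    by (rule L2_inner_cong_AE[OF dom L(1) L(1)]) (use E_UNIV[OF L(1)] in \<open>auto elim: eventually_mono\<close>)
  have high: "(\<integral>\<^sup>+z. ennreal ((u z - x z)\<^sup>2) \<partial>?M) = emeasure (\<mu> u) (- B)"
  proof -
    have "(\<integral>\<^sup>+z. ennreal ((u z - x z)\<^sup>2) \<partial>?M) = ennreal (ip (E UNIV u) u - ip (E B u) u)"
      using nn_integral_square_L2[OF d] by (simp add: nd uu)
    also have "\<dots> = emeasure (\<mu> u) UNIV - emeasure (\<mu> u) B"
      using B L by (simp add: emeasure_\<mu> ennreal_minus E_nonneg)
    also have "\<dots> = emeasure (\<mu> u) (UNIV - B)"
      using B by (intro emeasure_Diff[symmetric]) auto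
    finally show ?thesis by (simp add: Compl_eq_Diff_UNIV)
  qed
  have m1: "(\<lambda>z. ennreal ((b z * x z)\<^sup>2)) \<in> borel_measurable ?M" "(\<lambda>z. ennreal ((u z - x z)\<^sup>2)) \<in> borel_measurable ?M"
    using b L2_measurable[OF x] L2_measurable[OF L(1)] by measurable
  have m2: "(\<lambda>t. ennreal (max (t * indicator B t) 0)) \<in> borel_measurable (\<mu> u)"
    by (intro measurable_\<mu> measurable_compose[OF _ measurable_ennreal] borel_measurable_max borel_measurable_times
        borel_measurable_indicator B borel_measurable_const) simp
  \<comment> \<open>After u^2 \<le> 2x^2 + 2(u - x)^2 the minimum is estimated by b^2 in front of
    the low part and by s in front of the high part.\<close>
  have pw: "min ((b z)\<^sup>2) s * (u z)\<^sup>2 \<le> 2 * (b z * x z)\<^sup>2 + 2 * s * (u z - x z)\<^sup>2" for z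
  proof -
    have "(u z)\<^sup>2 \<le> 2 * (x z)\<^sup>2 + 2 * (u z - x z)\<^sup>2"
      using sum_squares_bound[of "x z" "u z - x z"] by (simp add: power2_eq_square algebra_simps)
    then have "min ((b z)\<^sup>2) s * (u z)\<^sup>2 \<le> min ((b z)\<^sup>2) s * (2 * (x z)\<^sup>2) + min ((b z)\<^sup>2) s * (2 * (u z - x z)\<^sup>2)"
      unfolding distrib_left[symmetric] using s by (intro mult_left_mono) auto
    also have "\<dots> \<le> (b z)\<^sup>2 * (2 * (x z)\<^sup>2) + s * (2 * (u z - x z)\<^sup>2)"
      by (intro add_mono mult_right_mono) auto
    finally show ?thesis by (simp add: power_mult_distrib mult_ac)
  qed
  have "(\<integral>\<^sup>+z. ennreal (min ((b z)\<^sup>2) s * (u z)\<^sup>2) \<partial>?M)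
      \<le> (\<integral>\<^sup>+z. ennreal 2 * ennreal ((b z * x z)\<^sup>2) + ennreal (2 * s) * ennreal ((u z - x z)\<^sup>2) \<partial>?M)"
    using pw s by (intro nn_integral_mono) (simp add: ennreal_mult[symmetric] ennreal_plus[symmetric] ennreal_leI del: ennreal_plus ennreal_numeral)
  also have "\<dots> = ennreal 2 * (\<integral>\<^sup>+z. ennreal ((b z * x z)\<^sup>2) \<partial>?M) + ennreal (2 * s) * emeasure (\<mu> u) (- B)"
    unfolding high[symmetric] using m1 by (subst nn_integral_add) (simp_all add: nn_integral_cmult)
  also have "\<dots> \<le> ennreal 2 * (ennreal C * (\<integral>\<^sup>+t. ennreal (max (t * indicator B t) 0) \<partial>\<mu> u)) + ennreal (2 * s) * emeasure (\<mu> u) (- B)"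
    by (intro add_right_mono mult_left_mono low) simp
  also have "\<dots> = (\<integral>\<^sup>+t. ennreal (2 * C) * ennreal (max (t * indicator B t) 0) + ennreal (2 * s) * indicator (- B) t \<partial>\<mu> u)"
  proof -
    have mi: "(\<lambda>t. ennreal (2 * s) * indicator (- B) t) \<in> borel_measurable (\<mu> u)"
      using B by (intro measurable_\<mu> borel_measurable_times_ennreal borel_measurable_const borel_measurable_indicator) auto
    have "(\<integral>\<^sup>+t. ennreal (2 * s) * indicator (- B) t \<partial>\<mu> u) = ennreal (2 * s) * emeasure (\<mu> u) (- B)"
      using B by (intro nn_integral_cmult_indicator) auto
    moreover have "(\<integral>\<^sup>+t. ennreal (2 * C) * ennreal (max (t * indicator B t) 0) \<partial>\<mu> u)
        = ennreal 2 * (ennreal C * (\<integral>\<^sup>+t. ennreal (max (t * indicator B t) 0) \<partial>\<mu> u))"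
      using C by (subst nn_integral_cmult[OF m2]) (simp add: ennreal_mult mult.assoc)
    ultimately show ?thesis
      using nn_integral_add[OF borel_measurable_times_ennreal[OF borel_measurable_const m2] mi] by simp
  qed
  also have "\<dots> \<le> (\<integral>\<^sup>+t. ennreal (2 * C + 2) * ennreal (min (max t 0) s) \<partial>\<mu> u)"
  proof (rule nn_integral_mono)
    fix t :: real
    have "2 * C * max (t * indicator B t) 0 + 2 * s * indicator (- B) t \<le> (2 * C + 2) * min (max t 0) s"
    proof (cases "t \<le> s")
      case True
      then have "2 * C * max t 0 \<le> (2 * C + 2) * max t 0" by (intro mult_right_mono) auto
      then show ?thesis using True s by (simp add: B_def min_absorb1)
    next
      case False
      have "2 * s \<le> (2 * C + 2) * s" using C s by (intro mult_right_mono) auto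
      then show ?thesis using False s by (simp add: B_def min_absorb2)
    qed
    then have "ennreal (2 * C * max (t * indicator B t) 0 + 2 * s * indicator (- B) t) \<le> ennreal ((2 * C + 2) * min (max t 0) s)"
      by (rule ennreal_leI)
    then show "ennreal (2 * C) * ennreal (max (t * indicator B t) 0) + ennreal (2 * s) * indicator (- B) t
        \<le> ennreal (2 * C + 2) * ennreal (min (max t 0) s)"
      using C s by (simp add: ennreal_mult'[symmetric] ennreal_plus[symmetric] ennreal_indicator[symmetric] del: ennreal_plus)
  qed
  also have "\<dots> = ennreal (2 * C + 2) * (\<integral>\<^sup>+t. ennreal (min (max t 0) s) \<partial>\<mu> u)"
    by (intro nn_integral_cmult measurable_\<mu>) measurable
  finally show "(\<integral>\<^sup>+z. ennreal (min ((b z)\<^sup>2) s * (u z)\<^sup>2) \<partial>?M) \<le> ennreal (2 * C + 2) * (\<integral>\<^sup>+t. ennreal (min (max t 0) s) \<partial>\<mu> u)" .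
qed auto

end

section \<open>Boundary decay\<close>

lemma norm_vec_square: "(norm (x :: real^'n::finite))\<^sup>2 = (\<Sum>i\<in>UNIV. (x $ i)\<^sup>2)"
  by (simp add: norm_vec_def L2_set_def sum_nonneg)

lemma norm_mat_square: "(norm (x :: real^'n::finite^'m::finite))\<^sup>2 = (\<Sum>i\<in>UNIV. \<Sum>j\<in>UNIV. (x $ i $ j)\<^sup>2)"
  by (simp add: norm_vec_def[of x] L2_set_def sum_nonneg norm_vec_square)

lemma powr_square: "((x :: real) powr p)\<^sup>2 = x powr (2 * p)"
  by (simp only: power2_eq_square powr_add[symmetric] mult_2)

lemma omega_square: "(omega \<delta> p n x)\<^sup>2 = omega \<delta> (2 * p) n x"
  by (simp add: omega_def powr_square)

context hardy_rellich
begin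

text \<open>The shift gives \<omega> \<le> (1/n)^(-p) on \<Omega>. This is where n \<ge> 1 matters:
  for n = 0 the convention 1/0 = 0 removes the shift and with it the bound.\<close>

lemma omega_multiplier:
  assumes C: "Ck_on 2 \<Omega> (omega \<delta> p n)" and p: "p > 0" and n: "n \<ge> 1" and B: "0 \<le> B"
    and b1: "\<And>x i. x \<in> \<Omega> \<Longrightarrow> \<bar>partial_deriv i (omega \<delta> p n) x\<bar> \<le> B * (omega \<delta> p n x / \<delta> x)"
    and b2: "\<And>x i j. x \<in> \<Omega> \<Longrightarrow> \<bar>partial_deriv i (partial_deriv j (omega \<delta> p n)) x\<bar> \<le> B * (omega \<delta> p n x / (\<delta> x)\<^sup>2)"
  shows "multiplier (omega \<delta> p n) ((1 + B) * (1 / real n) powr (- p))"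
proof -
  let ?N = "(1 / real n) powr (- p)"
  have le: "0 \<le> omega \<delta> p n x" "omega \<delta> p n x \<le> ?N" if "x \<in> \<Omega>" for x
  proof -
    show "0 \<le> omega \<delta> p n x" by (simp add: omega_def)
    show "omega \<delta> p n x \<le> ?N"
      unfolding omega_def by (rule powr_mono2') (use p n pos[OF that] in auto)
  qed
  have NB: "?N \<le> (1 + B) * ?N" "B * ?N \<le> (1 + B) * ?N"
    using B by (simp_all add: distrib_right)
  have B1: "\<bar>partial_deriv i (omega \<delta> p n) x\<bar> \<le> (1 + B) * ?N / \<delta> x" if "x \<in> \<Omega>" for x i
  proof -
    have "\<bar>partial_deriv i (omega \<delta> p n) x\<bar> \<le> B * (?N / \<delta> x)"
      by (rule order_trans[OF b1[OF that]]) (use le[OF that] pos[OF that] B in \<open>intro mult_left_mono divide_right_mono; simp\<close>)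
    also have "\<dots> = B * ?N / \<delta> x" by simp
    also have "\<dots> \<le> (1 + B) * ?N / \<delta> x" by (rule divide_right_mono[OF NB(2)]) (use pos[OF that] in simp)
    finally show ?thesis .
  qed
  have B2: "\<bar>partial_deriv i (partial_deriv j (omega \<delta> p n)) x\<bar> \<le> (1 + B) * ?N / (\<delta> x)\<^sup>2" if "x \<in> \<Omega>" for x i j
  proof -
    have "\<bar>partial_deriv i (partial_deriv j (omega \<delta> p n)) x\<bar> \<le> B * (?N / (\<delta> x)\<^sup>2)"
      by (rule order_trans[OF b2[OF that]]) (use le[OF that] B in \<open>intro mult_left_mono divide_right_mono; simp\<close>)
    also have "\<dots> = B * ?N / (\<delta> x)\<^sup>2" by simp
    also have "\<dots> \<le> (1 + B) * ?N / (\<delta> x)\<^sup>2" by (rule divide_right_mono[OF NB(2)]) simp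
    finally show ?thesis .
  qed
  have B0: "\<bar>omega \<delta> p n x\<bar> \<le> (1 + B) * ?N" if "x \<in> \<Omega>" for x
    using le[OF that] NB(1) by linarith
  have "0 \<le> (1 + B) * ?N" using B by simp
  then show ?thesis unfolding multiplier_def using C B0 B1 B2 by blast
qed

lemma zero_mindex: "mdeg (\<lambda>_::'n. 0) \<le> 2" by (simp add: mdeg_mi)

lemma rellich_H20:
  assumes u: "u \<in> H20 \<Omega>"
  shows "(\<lambda>x. 1 / (\<delta> x)\<^sup>2 * u x) \<in> L2 \<Omega>"
    and "(L2_norm \<Omega> (\<lambda>x. 1 / (\<delta> x)\<^sup>2 * u x))\<^sup>2 \<le> (K + 1) * Q0 \<Omega> u"
proof -
  have ae: "AE x in M. scaled (\<lambda>\<zeta>. D \<zeta> u) (\<lambda>_. 0) x = 1 / (\<delta> x)\<^sup>2 * u x"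
    using weak_deriv_0[OF op bd H20_L2[OF op bd u]] by eventually_elim (simp add: scaled_def mdeg_mi)
  note s = scaled_L2_bound[OF u zero_mindex]
  show "(\<lambda>x. 1 / (\<delta> x)\<^sup>2 * u x) \<in> L2 \<Omega>" by (rule L2_cong_AE[OF domain_lebesgue s(1) ae])
  have "L2_norm \<Omega> (\<lambda>x. 1 / (\<delta> x)\<^sup>2 * u x) \<le> sqrt (K + 1) * energy u"
    using s(2) L2_norm_cong_AE[OF domain_lebesgue s(1) ae] by simp
  then have "(L2_norm \<Omega> (\<lambda>x. 1 / (\<delta> x)\<^sup>2 * u x))\<^sup>2 \<le> (sqrt (K + 1) * energy u)\<^sup>2"
    by (rule power_mono) (rule L2_norm_nonneg)
  also have "\<dots> = (K + 1) * Q0 \<Omega> u" using K by (simp add: power_mult_distrib energy_square)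
  finally show "(L2_norm \<Omega> (\<lambda>x. 1 / (\<delta> x)\<^sup>2 * u x))\<^sup>2 \<le> (K + 1) * Q0 \<Omega> u" .
qed

lemma omega_le:
  assumes "x \<in> \<Omega>" "p > 0" shows "0 \<le> omega \<delta> p n x" "omega \<delta> p n x \<le> \<delta> x powr (- p)"
  unfolding omega_def using assms pos[OF assms(1)] by (auto intro: powr_mono2')

lemma boundary_weight_powr:
  assumes "x \<in> \<Omega>" shows "((1 / (\<delta> x)\<^sup>2)\<^sup>2) powr \<alpha> = (\<delta> x powr (- (2 * \<alpha>)))\<^sup>2"
proof -
  have "(1 / (\<delta> x)\<^sup>2)\<^sup>2 = \<delta> x powr (- 4)"
    using pos[OF assms] by (simp add: powr_minus powr_numeral power_divide divide_inverse power_inverse flip: power_mult)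
  then show ?thesis using pos[OF assms] by (simp add: powr_powr powr_square)
qed

text \<open>Rellich and ellipticity combine to |\<delta>^(-2) x|^2 \<le> C <Hx, x>. The first
  estimate adds \<delta> \<le> R and Cauchy-Schwarz and cancels a factor |u|; the second feeds the
  inequality into the interpolation with the weight b = \<delta>^(-2).\<close>

lemma form_operator_estimates:
  assumes lam: "lam > 0" and ell: "\<And>u. u \<in> H20 \<Omega> \<Longrightarrow> lam * Q0 \<Omega> u \<le> Qform \<Omega> a u u"
    and \<alpha>: "0 < \<alpha>" "\<alpha> < 1"
    and u: "(u, h) \<in> form_operator \<Omega> a" and g: "(u, g) \<in> frac_power \<Omega> (form_operator \<Omega> a) (\<alpha> / 2)"
  defines "C \<equiv> (K + 1) / lam"
  shows "L2_norm \<Omega> u \<le> (R\<^sup>2)\<^sup>2 * C * L2_norm \<Omega> h"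
    and "(\<integral>\<^sup>+x. ennreal ((\<delta> x powr (- (2 * \<alpha>)) * u x)\<^sup>2) \<partial>M) \<le> ennreal ((2 * C + 2) * (L2_norm \<Omega> g)\<^sup>2)"
proof -
  have C: "C > 0" using K lam by (simp add: C_def)
  have form: "(L2_norm \<Omega> (\<lambda>z. 1 / (\<delta> z)\<^sup>2 * x z))\<^sup>2 \<le> C * L2_inner \<Omega> y x"
    if "(x, y) \<in> form_operator \<Omega> a" for x y
  proof -
    have x: "x \<in> H20 \<Omega>" and q: "Qform \<Omega> a x x = L2_inner \<Omega> y x" using that by (auto simp: form_operator_def)
    have "(K + 1) * Q0 \<Omega> x = C * (lam * Q0 \<Omega> x)" using lam by (simp add: C_def)
    also have "\<dots> \<le> C * Qform \<Omega> a x x" using ell[OF x] C by simp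
    finally show ?thesis using rellich_H20(2)[OF x] q by simp
  qed
  have uH: "u \<in> H20 \<Omega>" and hL: "h \<in> L2 \<Omega>" using u by (auto simp: form_operator_def)
  note uL = H20_L2[OF op bd uH]
  show "L2_norm \<Omega> u \<le> (R\<^sup>2)\<^sup>2 * C * L2_norm \<Omega> h"
  proof -
    have "AE x in M. \<bar>u x\<bar> \<le> R\<^sup>2 * \<bar>1 / (\<delta> x)\<^sup>2 * u x\<bar>"
    proof (rule AE_I2)
      fix x assume "x \<in> space M"
      then have x: "x \<in> \<Omega>" by (simp add: space_restrict_space)
      have "(\<delta> x)\<^sup>2 \<le> R\<^sup>2" using pos[OF x] le[OF x] by (intro power_mono) auto
      then have "1 \<le> R\<^sup>2 / (\<delta> x)\<^sup>2" using pos[OF x] by simp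
      then have "1 * \<bar>u x\<bar> \<le> R\<^sup>2 / (\<delta> x)\<^sup>2 * \<bar>u x\<bar>" by (rule mult_right_mono) simp
      then show "\<bar>u x\<bar> \<le> R\<^sup>2 * \<bar>1 / (\<delta> x)\<^sup>2 * u x\<bar>" by (simp add: abs_mult)
    qed
    then have "L2_norm \<Omega> u \<le> R\<^sup>2 * L2_norm \<Omega> (\<lambda>x. 1 / (\<delta> x)\<^sup>2 * u x)"
      by (intro L2_norm_mono rellich_H20(1)[OF uH] L2_measurable[OF uL]) auto
    then have "(L2_norm \<Omega> u)\<^sup>2 \<le> (R\<^sup>2 * L2_norm \<Omega> (\<lambda>x. 1 / (\<delta> x)\<^sup>2 * u x))\<^sup>2"
      by (rule power_mono) (rule L2_norm_nonneg)
    also have "\<dots> = (R\<^sup>2)\<^sup>2 * (L2_norm \<Omega> (\<lambda>x. 1 / (\<delta> x)\<^sup>2 * u x))\<^sup>2" by (rule power_mult_distrib)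
    also have "\<dots> \<le> (R\<^sup>2)\<^sup>2 * (C * (L2_norm \<Omega> h * L2_norm \<Omega> u))"
    proof (rule mult_left_mono)
      have "L2_inner \<Omega> h u \<le> L2_norm \<Omega> h * L2_norm \<Omega> u" using L2_Cauchy_Schwarz[OF hL uL] by linarith
      then have "C * L2_inner \<Omega> h u \<le> C * (L2_norm \<Omega> h * L2_norm \<Omega> u)" using C by simp
      then show "(L2_norm \<Omega> (\<lambda>x. 1 / (\<delta> x)\<^sup>2 * u x))\<^sup>2 \<le> C * (L2_norm \<Omega> h * L2_norm \<Omega> u)"
        using form[OF u] by linarith
    qed simp
    finally have "L2_norm \<Omega> u * L2_norm \<Omega> u \<le> ((R\<^sup>2)\<^sup>2 * C * L2_norm \<Omega> h) * L2_norm \<Omega> u"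
      by (simp add: power2_eq_square mult_ac)
    then show ?thesis
      using L2_norm_nonneg[of \<Omega> u] L2_norm_nonneg[of \<Omega> h] C
      by (cases "L2_norm \<Omega> u = 0") (auto intro: mult_right_le_imp_le)
  qed
  \<comment> \<open>The measure hidden in the fractional power is by definition a spectral measure
    of H itself, so the same E describes h and g.\<close>
  obtain E where E: "spectral_measure_of \<Omega> (form_operator \<Omega> a) E"
    and gE: "(u, g) \<in> spectral_integral \<Omega> E (\<lambda>t. if 0 \<le> t then t powr (\<alpha> / 2) else 0)"
    using g by (auto simp: frac_power_def)
  interpret spectral \<Omega> E
    by unfold_locales (use E lmeasurable_domain[OF op bd] in \<open>auto simp: spectral_measure_of_def\<close>)
  have H: "form_operator \<Omega> a = spectral_integral \<Omega> E (\<lambda>t. t)" using E by (simp add: spectral_measure_of_def)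
  have "(\<integral>\<^sup>+x. ennreal ((\<delta> x powr (- (2 * \<alpha>)) * u x)\<^sup>2) \<partial>M)
      = (\<integral>\<^sup>+x. ennreal (((1 / (\<delta> x)\<^sup>2)\<^sup>2) powr \<alpha> * (u x)\<^sup>2) \<partial>M)"
    by (intro nn_integral_cong) (simp add: space_restrict_space boundary_weight_powr power_mult_distrib)
  also have "\<dots> \<le> ennreal (2 * C + 2) * (\<integral>\<^sup>+t. ennreal ((max t 0) powr \<alpha>) \<partial>\<mu> u)"
  proof (rule fractional_form_bound[OF _ C _ \<alpha>])
    show "(\<lambda>x. 1 / (\<delta> x)\<^sup>2) \<in> borel_measurable M" using \<delta>_measurable by measurable
    show "(\<integral>\<^sup>+z. ennreal ((1 / (\<delta> z)\<^sup>2 * x z)\<^sup>2) \<partial>M) \<le> ennreal (C * ip y x)"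
      if "(x, y) \<in> spectral_integral \<Omega> E (\<lambda>t. t)" for x y
    proof -
      have xy: "(x, y) \<in> form_operator \<Omega> a" using that H by simp
      then have "x \<in> H20 \<Omega>" by (simp add: form_operator_def)
      then show ?thesis using form[OF xy] nn_integral_square_L2[OF rellich_H20(1)] by (simp add: ennreal_leI)
    qed
    show "(u, h) \<in> spectral_integral \<Omega> E (\<lambda>t. t)" using u H by simp
  qed
  \<comment> \<open>For t \<ge> 0, t^\<alpha> is the square of t^(\<alpha>/2), and for t < 0 both
    integrands vanish. This is how the norm of H^(\<alpha>/2) u appears.\<close>
  also have "(\<integral>\<^sup>+t. ennreal ((max t 0) powr \<alpha>) \<partial>\<mu> u) = (\<integral>\<^sup>+t. ennreal ((if 0 \<le> t then t powr (\<alpha> / 2) else 0)\<^sup>2) \<partial>\<mu> u)"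
    by (intro nn_integral_cong) (auto simp: powr_square max_def)
  also have "ennreal (2 * C + 2) * \<dots> \<le> ennreal (2 * C + 2) * ennreal ((L2_norm \<Omega> g)\<^sup>2)"
    by (intro mult_left_mono nn_integral_square_le_norm[OF _ _ gE]) (simp_all, measurable)
  also have "\<dots> = ennreal ((2 * C + 2) * (L2_norm \<Omega> g)\<^sup>2)" using C by (simp add: ennreal_mult)
  finally show "(\<integral>\<^sup>+x. ennreal ((\<delta> x powr (- (2 * \<alpha>)) * u x)\<^sup>2) \<partial>M) \<le> ennreal ((2 * C + 2) * (L2_norm \<Omega> g)\<^sup>2)" .
qed

lemma boundary_decay_estimate:
  assumes a: "Linf_symmetric \<Omega> a" and lam: "lam > 0"
    and ell: "\<And>u. u \<in> H20 \<Omega> \<Longrightarrow> lam * Q0 \<Omega> u \<le> Qform \<Omega> a u u"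
    and \<alpha>: "0 < \<alpha>" "\<alpha> < 1" and k: "k > 0" "k' > 0" and B: "0 \<le> B"
    and mult: "\<And>n. n \<ge> 1 \<Longrightarrow> \<exists>N. multiplier (omega \<delta> \<alpha> n) N" "\<And>n. n \<ge> 1 \<Longrightarrow> \<exists>N. multiplier (omega \<delta> (2 * \<alpha>) n) N"
    and b1: "\<And>n x i. x \<in> \<Omega> \<Longrightarrow> \<bar>partial_deriv i (omega \<delta> \<alpha> n) x\<bar> \<le> B * (omega \<delta> \<alpha> n x / \<delta> x)"
    and b2: "\<And>n x i j. x \<in> \<Omega> \<Longrightarrow> \<bar>partial_deriv i (partial_deriv j (omega \<delta> \<alpha> n)) x\<bar> \<le> B * (omega \<delta> \<alpha> n x / (\<delta> x)\<^sup>2)"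
    and weighted: "\<And>n u. n \<ge> 1 \<Longrightarrow> u \<in> Cc 2 \<Omega> \<Longrightarrow>
      Qform \<Omega> a (\<lambda>x. omega \<delta> \<alpha> n x * u x) (\<lambda>x. omega \<delta> \<alpha> n x * u x)
        \<le> k * Qform \<Omega> a u (\<lambda>x. (omega \<delta> \<alpha> n x)\<^sup>2 * u x) + k' * (L2_norm \<Omega> u)\<^sup>2"
  shows "\<exists>c>0. \<forall>u h g. (u, h) \<in> form_operator \<Omega> a \<longrightarrow> (u, g) \<in> frac_power \<Omega> (form_operator \<Omega> a) (\<alpha> / 2) \<longrightarrow>
      (\<integral>\<^sup>+x. ennreal ((norm (weak_hessian \<Omega> u x))\<^sup>2 / \<delta> x powr (2 * \<alpha>)
                + (norm (weak_gradient \<Omega> u x))\<^sup>2 / \<delta> x powr (2 + 2 * \<alpha>)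
                + (u x)\<^sup>2 / \<delta> x powr (4 + 2 * \<alpha>)) \<partial>M)
        \<le> ennreal (c * L2_norm \<Omega> h * L2_norm \<Omega> g)"
proof -
  define C where "C = (K + 1) / lam"
  \<comment> \<open>A is the constant in the bound of |\<delta>^(-2\<alpha>) u| by |g|.\<close>
  define A where "A = sqrt (2 * C + 2)"
  \<comment> \<open>The first summand comes from k Q(u, \<omega>^2 u), the second from k' |u|^2,
    where one factor |u| is bounded by R^4 C |h| and the other by R^(2\<alpha>) A |g|.\<close>
  define C3 where "C3 = k * A + k' * ((R\<^sup>2)\<^sup>2 * C) * (R powr (2 * \<alpha>) * A)"
  define C4 where "C4 = (1 + 3 * B + 2 * B\<^sup>2) * (real (card I) * sqrt (K + 1))"
  \<comment> \<open>m counts the second derivatives, the first derivatives and the function itself;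
    the 1 added to c below makes it positive.\<close>
  define m where "m = real (CARD('n) * CARD('n) + CARD('n) + 1)"
  define c where "c = m * (C4\<^sup>2 * (C3 / lam)) + 1"
  have C: "C > 0" using K lam by (simp add: C_def)
  have A: "A > 0" using C by (simp add: A_def)
  have C3: "C3 \<ge> 0" using k C A by (simp add: C3_def)
  have c: "c > 0" using C3 lam by (simp add: c_def m_def add_nonneg_pos)
  show ?thesis
  proof (intro exI[of _ c] conjI allI impI)
    fix u h g
    assume u: "(u, h) \<in> form_operator \<Omega> a" and g: "(u, g) \<in> frac_power \<Omega> (form_operator \<Omega> a) (\<alpha> / 2)"
    have uH: "u \<in> H20 \<Omega>" and hL: "h \<in> L2 \<Omega>" and form: "\<And>v. v \<in> H20 \<Omega> \<Longrightarrow> Qform \<Omega> a u v = L2_inner \<Omega> h v"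
      using u by (auto simp: form_operator_def)
    note uL = H20_L2[OF op bd uH]
    let ?h = "L2_norm \<Omega> h" and ?g = "L2_norm \<Omega> g"
    have est: "L2_norm \<Omega> u \<le> (R\<^sup>2)\<^sup>2 * C * ?h"
      "(\<integral>\<^sup>+x. ennreal ((\<delta> x powr (- (2 * \<alpha>)) * u x)\<^sup>2) \<partial>M) \<le> ennreal ((2 * C + 2) * ?g\<^sup>2)"
      unfolding C_def
      by (rule form_operator_estimates(1)[OF lam ell \<alpha> u g], assumption)
         (rule form_operator_estimates(2)[OF lam ell \<alpha> u g])
    have hg: "0 \<le> ?h" "0 \<le> ?g" by (simp_all add: L2_norm_nonneg)
    define w where "w x = \<delta> x powr (- (2 * \<alpha>)) * u x" for x
    have wm: "w \<in> borel_measurable M" unfolding w_def using \<delta>_measurable L2_measurable[OF uL] by measurable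
    have wL: "w \<in> L2 \<Omega>"
      by (rule L2_I_nn_integral[OF wm], rule le_less_trans[OF est(2)[folded w_def]]) simp
    have "(L2_norm \<Omega> w)\<^sup>2 \<le> (2 * C + 2) * ?g\<^sup>2"
      using est(2)[folded w_def] C unfolding nn_integral_square_L2[OF wL] by (subst (asm) ennreal_le_iff) auto
    also have "\<dots> = (A * ?g)\<^sup>2" using C by (simp add: A_def power_mult_distrib)
    finally have wn: "L2_norm \<Omega> w \<le> A * ?g" by (rule power2_le_imp_le) (use A hg in simp)
    \<comment> \<open>A second bound of |u|, this time by |g|: the weight \<delta>^(-2\<alpha>) is
      at least R^(-2\<alpha>). It keeps the lower-order term of product form |h| |g|.\<close>
    have un: "L2_norm \<Omega> u \<le> R powr (2 * \<alpha>) * (A * ?g)"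
    proof -
      have "AE x in M. \<bar>u x\<bar> \<le> R powr (2 * \<alpha>) * \<bar>w x\<bar>"
      proof (rule AE_I2)
        fix x assume "x \<in> space M"
        then have x: "x \<in> \<Omega>" by (simp add: space_restrict_space)
        have "\<delta> x powr (2 * \<alpha>) * \<delta> x powr (- (2 * \<alpha>)) \<le> R powr (2 * \<alpha>) * \<delta> x powr (- (2 * \<alpha>))"
          using \<alpha> pos[OF x] le[OF x] by (intro mult_right_mono powr_mono2) auto
        then have "1 \<le> R powr (2 * \<alpha>) * \<delta> x powr (- (2 * \<alpha>))" using pos[OF x] by (simp add: powr_minus)
        then have "1 * \<bar>u x\<bar> \<le> R powr (2 * \<alpha>) * \<delta> x powr (- (2 * \<alpha>)) * \<bar>u x\<bar>" by (rule mult_right_mono) simp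
        then show "\<bar>u x\<bar> \<le> R powr (2 * \<alpha>) * \<bar>w x\<bar>" by (simp add: w_def abs_mult mult.assoc)
      qed
      then have "L2_norm \<Omega> u \<le> R powr (2 * \<alpha>) * L2_norm \<Omega> w"
        by (intro L2_norm_mono wL L2_measurable[OF uL]) auto
      also have "\<dots> \<le> R powr (2 * \<alpha>) * (A * ?g)" by (rule mult_left_mono[OF wn]) simp
      finally show ?thesis .
    qed
    have Q: "Q0 \<Omega> (\<lambda>x. omega \<delta> \<alpha> n x * u x) \<le> C3 / lam * (?h * ?g)" if n: "n \<ge> 1" for n
    proof -
      let ?o = "omega \<delta> \<alpha> n"
      obtain N1 where N1: "multiplier ?o N1" using mult(1)[OF n] by blast
      obtain N2 where N2: "multiplier (\<lambda>x. (?o x)\<^sup>2) N2" using mult(2)[OF n] unfolding omega_square by auto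
      have o1: "(\<lambda>x. ?o x * u x) \<in> H20 \<Omega>" and o2: "(\<lambda>x. (?o x)\<^sup>2 * u x) \<in> H20 \<Omega>"
        using multiplier_H20(1)[OF N1 uH] multiplier_H20(1)[OF N2 uH] by blast+
      have "L2_norm \<Omega> (\<lambda>x. (?o x)\<^sup>2 * u x) \<le> 1 * L2_norm \<Omega> w"
      proof (rule L2_norm_mono[OF wL L2_measurable[OF H20_L2[OF op bd o2]]])
        show "AE x in M. \<bar>(?o x)\<^sup>2 * u x\<bar> \<le> 1 * \<bar>w x\<bar>"
        proof (rule AE_I2)
          fix x assume "x \<in> space M"
          then have x: "x \<in> \<Omega>" by (simp add: space_restrict_space)
          show "\<bar>(?o x)\<^sup>2 * u x\<bar> \<le> 1 * \<bar>w x\<bar>"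
            using omega_le[OF x, of "2 * \<alpha>" n] \<alpha> by (simp add: omega_square w_def abs_mult mult_right_mono)
        qed
      qed simp
      then have on: "L2_norm \<Omega> (\<lambda>x. (?o x)\<^sup>2 * u x) \<le> A * ?g" using wn by simp
      have "lam * Q0 \<Omega> (\<lambda>x. ?o x * u x) \<le> Qform \<Omega> a (\<lambda>x. ?o x * u x) (\<lambda>x. ?o x * u x)" by (rule ell[OF o1])
      also have "\<dots> \<le> k * Qform \<Omega> a u (\<lambda>x. (?o x)\<^sup>2 * u x) + k' * (L2_norm \<Omega> u)\<^sup>2"
        by (rule weighted_form_H20[OF a N1 N2 weighted[OF n] uH])
      also have "\<dots> \<le> k * (?h * (A * ?g)) + k' * (((R\<^sup>2)\<^sup>2 * C * ?h) * (R powr (2 * \<alpha>) * (A * ?g)))"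
      proof (rule add_mono)
        have "L2_inner \<Omega> h (\<lambda>x. (?o x)\<^sup>2 * u x) \<le> ?h * L2_norm \<Omega> (\<lambda>x. (?o x)\<^sup>2 * u x)"
          using L2_Cauchy_Schwarz[OF hL H20_L2[OF op bd o2]] by linarith
        also have "\<dots> \<le> ?h * (A * ?g)" by (rule mult_left_mono[OF on hg(1)])
        finally show "k * Qform \<Omega> a u (\<lambda>x. (?o x)\<^sup>2 * u x) \<le> k * (?h * (A * ?g))"
          using k by (simp add: form[OF o2])
        have "L2_norm \<Omega> u * L2_norm \<Omega> u \<le> ((R\<^sup>2)\<^sup>2 * C * ?h) * (R powr (2 * \<alpha>) * (A * ?g))"
          by (rule mult_mono[OF est(1) un]) (use C hg in \<open>simp_all add: L2_norm_nonneg\<close>)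
        then show "k' * (L2_norm \<Omega> u)\<^sup>2 \<le> k' * (((R\<^sup>2)\<^sup>2 * C * ?h) * (R powr (2 * \<alpha>) * (A * ?g)))"
          unfolding power2_eq_square[of "L2_norm \<Omega> u"] by (rule mult_left_mono) (use k in simp)
      qed
      also have "\<dots> = C3 * (?h * ?g)" by (simp add: C3_def algebra_simps)
      finally show ?thesis using lam by (simp add: field_simps)
    qed
    \<comment> \<open>G is the target integrand without the common factor \<delta>^(-2\<alpha>),
      which \<omega>_n^2 approximates from below.\<close>
    define G where "G x = (norm (weak_hessian \<Omega> u x))\<^sup>2 + (norm (weak_gradient \<Omega> u x))\<^sup>2 / (\<delta> x)\<^sup>2 + (u x)\<^sup>2 / \<delta> x ^ 4" for x
    let ?s = "scaled (\<lambda>\<zeta>. D \<zeta> u)"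
    define S where "S x = (\<Sum>i\<in>(UNIV::'n set). \<Sum>j\<in>(UNIV::'n set). (?s (mi2 i j) x)\<^sup>2) + (\<Sum>i\<in>(UNIV::'n set). (?s (mi1 i) x)\<^sup>2)
      + (?s (\<lambda>_. 0) x)\<^sup>2" for x
    have GS: "AE x in M. G x = S x"
      using weak_deriv_0[OF op bd uL]
      by eventually_elim (simp add: G_def S_def norm_mat_square norm_vec_square weak_hessian_def weak_gradient_def
          scaled_def mdeg_mi power_divide sum_divide_distrib flip: power_mult)
    have sm: "?s \<eta> \<in> borel_measurable M" if "mdeg \<eta> \<le> 2" for \<eta>
      by (rule L2_measurable[OF scaled_L2_bound(1)[OF uH that]])
    have Sm: "S \<in> borel_measurable M"
      unfolding S_def by (intro borel_measurable_add borel_measurable_sum borel_measurable_power sm) (simp_all add: mdeg_mi)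
    have Gm: "G \<in> borel_measurable M"
      by (rule borel_measurable_lebesgue_on_AE[OF domain_lebesgue Sm]) (use GS in eventually_elim, simp)
    have om: "omega \<delta> \<alpha> n \<in> borel_measurable M" for n
      unfolding omega_def using \<delta>_measurable by measurable
    have bound: "(\<integral>\<^sup>+x. ennreal ((omega \<delta> \<alpha> n x)\<^sup>2 * G x) \<partial>M) \<le> ennreal (c * ?h * ?g)" if n: "n \<ge> 1" for n
    proof -
      let ?o = "omega \<delta> \<alpha> n"
      obtain N1 where N1: "multiplier ?o N1" using mult(1)[OF n] by blast
      define e where "e = C4\<^sup>2 * (C3 / lam * (?h * ?g))"
      have e0: "0 \<le> e" using C3 lam hg by (simp add: e_def)
      have each: "(\<integral>\<^sup>+x. ennreal ((?o x * ?s \<eta> x)\<^sup>2) \<partial>M) \<le> ennreal e" if \<eta>: "mdeg \<eta> \<le> 2" for \<eta>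
      proof -
        have "0 \<le> ?o x" if "x \<in> \<Omega>" for x using omega_le(1)[OF that \<alpha>(1)] .
        note ws = weighted_scaled_bound[OF N1 uH B this b1 b2 \<eta>]
        have "(L2_norm \<Omega> (\<lambda>x. ?o x * ?s \<eta> x))\<^sup>2 \<le> (C4 * energy (\<lambda>x. ?o x * u x))\<^sup>2"
          using ws(2) by (intro power_mono) (simp_all add: C4_def L2_norm_nonneg)
        also have "\<dots> = C4\<^sup>2 * Q0 \<Omega> (\<lambda>x. ?o x * u x)" by (simp add: power_mult_distrib energy_square)
        also have "\<dots> \<le> e" unfolding e_def by (rule mult_left_mono[OF Q[OF n]]) simp
        finally show ?thesis using nn_integral_square_L2[OF ws(1)] by (simp add: ennreal_leI)
      qed
      have em: "(\<lambda>x. ennreal ((?o x * ?s \<eta> x)\<^sup>2)) \<in> borel_measurable M" if "mdeg \<eta> \<le> 2" for \<eta>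
        by (intro measurable_compose[OF _ measurable_ennreal] borel_measurable_power borel_measurable_times om sm that)
      have d: "mdeg (mi2 i j) \<le> 2" "mdeg (mi1 i) \<le> 2" "mdeg (\<lambda>_::'n. 0) \<le> 2" for i j :: 'n by (simp_all add: mdeg_mi)
      have "(\<integral>\<^sup>+x. ennreal ((?o x)\<^sup>2 * G x) \<partial>M)
          = (\<integral>\<^sup>+x. (\<Sum>i\<in>(UNIV::'n set). \<Sum>j\<in>(UNIV::'n set). ennreal ((?o x * ?s (mi2 i j) x)\<^sup>2))
            + (\<Sum>i\<in>(UNIV::'n set). ennreal ((?o x * ?s (mi1 i) x)\<^sup>2)) + ennreal ((?o x * ?s (\<lambda>_. 0) x)\<^sup>2) \<partial>M)"
      proof (rule nn_integral_cong_AE)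
        show "AE x in M. ennreal ((?o x)\<^sup>2 * G x) = (\<Sum>i\<in>(UNIV::'n set). \<Sum>j\<in>(UNIV::'n set). ennreal ((?o x * ?s (mi2 i j) x)\<^sup>2))
            + (\<Sum>i\<in>(UNIV::'n set). ennreal ((?o x * ?s (mi1 i) x)\<^sup>2)) + ennreal ((?o x * ?s (\<lambda>_. 0) x)\<^sup>2)"
          using GS
        proof eventually_elim
          case (elim x)
          have "(?o x)\<^sup>2 * G x = (\<Sum>i\<in>(UNIV::'n set). \<Sum>j\<in>(UNIV::'n set). (?o x * ?s (mi2 i j) x)\<^sup>2)
            + (\<Sum>i\<in>(UNIV::'n set). (?o x * ?s (mi1 i) x)\<^sup>2) + (?o x * ?s (\<lambda>_. 0) x)\<^sup>2"
            by (simp add: elim S_def distrib_left sum_distrib_left power_mult_distrib)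
          then show ?case by (simp add: sum_nonneg)
        qed
      qed
      also have "\<dots> = (\<Sum>i\<in>(UNIV::'n set). \<Sum>j\<in>(UNIV::'n set). \<integral>\<^sup>+x. ennreal ((?o x * ?s (mi2 i j) x)\<^sup>2) \<partial>M)
            + (\<Sum>i\<in>(UNIV::'n set). \<integral>\<^sup>+x. ennreal ((?o x * ?s (mi1 i) x)\<^sup>2) \<partial>M) + (\<integral>\<^sup>+x. ennreal ((?o x * ?s (\<lambda>_. 0) x)\<^sup>2) \<partial>M)"
      proof -
        have T: "T (mi2 i j) \<in> borel_measurable M" "T (mi1 i) \<in> borel_measurable M" "T (\<lambda>_. 0) \<in> borel_measurable M"
          if "\<And>\<eta>. mdeg \<eta> \<le> 2 \<Longrightarrow> T \<eta> \<in> borel_measurable M" for i j :: 'n and T :: "'n mindex \<Rightarrow> real^'n \<Rightarrow> ennreal"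
          by (rule that[OF d(1)] that[OF d(2)] that[OF d(3)])+
        have *: "(\<integral>\<^sup>+x. (\<Sum>i\<in>(UNIV::'n set). \<Sum>j\<in>(UNIV::'n set). T (mi2 i j) x)
            + (\<Sum>i\<in>(UNIV::'n set). T (mi1 i) x) + T (\<lambda>_. 0) x \<partial>M)
          = (\<Sum>i\<in>(UNIV::'n set). \<Sum>j\<in>(UNIV::'n set). \<integral>\<^sup>+x. T (mi2 i j) x \<partial>M)
            + (\<Sum>i\<in>(UNIV::'n set). \<integral>\<^sup>+x. T (mi1 i) x \<partial>M) + (\<integral>\<^sup>+x. T (\<lambda>_. 0) x \<partial>M)"
          if "\<And>\<eta>. mdeg \<eta> \<le> 2 \<Longrightarrow> T \<eta> \<in> borel_measurable M" for T :: "'n mindex \<Rightarrow> real^'n \<Rightarrow> ennreal"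
          using T[OF that] by (simp add: nn_integral_add nn_integral_sum)
        show ?thesis by (rule *) (rule em)
      qed
      also have "\<dots> \<le> (\<Sum>i\<in>(UNIV::'n set). \<Sum>j\<in>(UNIV::'n set). ennreal e) + (\<Sum>i\<in>(UNIV::'n set). ennreal e) + ennreal e"
        by (intro add_mono sum_mono each d)
      also have "\<dots> = ennreal (m * e)"
        using e0 by (simp add: m_def distrib_right ennreal_mult' ennreal_of_nat_eq_real_of_nat mult.assoc)
      also have "\<dots> \<le> ennreal (c * ?h * ?g)"
      proof (rule ennreal_leI)
        have "m * e = m * (C4\<^sup>2 * (C3 / lam)) * (?h * ?g)" by (simp add: e_def)
        also have "\<dots> \<le> c * (?h * ?g)" unfolding c_def using hg by (intro mult_right_mono) auto
        finally show "m * e \<le> c * ?h * ?g" by (simp add: mult.assoc)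
      qed
      finally show ?thesis .
    qed
    \<comment> \<open>\<open>Suc n\<close> avoids the index 0, which the uniform bound excludes. The
      convergence holds at every point of \<Omega>, as the representatives of the derivatives are
      fixed and only the weight varies.\<close>
    have conv: "ennreal ((norm (weak_hessian \<Omega> u x))\<^sup>2 / \<delta> x powr (2 * \<alpha>)
                + (norm (weak_gradient \<Omega> u x))\<^sup>2 / \<delta> x powr (2 + 2 * \<alpha>)
                + (u x)\<^sup>2 / \<delta> x powr (4 + 2 * \<alpha>)) = liminf (\<lambda>n. ennreal ((omega \<delta> \<alpha> (Suc n) x)\<^sup>2 * G x))"
      if x: "x \<in> \<Omega>" for x
    proof -
      have d: "\<delta> x > 0" by (rule pos[OF x])
      have "(\<lambda>n. \<delta> x + inverse (real (Suc n))) \<longlonglongrightarrow> \<delta> x + 0"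
        by (rule tendsto_add[OF tendsto_const LIMSEQ_inverse_real_of_nat])
      then have "(\<lambda>n. (\<delta> x + inverse (real (Suc n))) powr (- (2 * \<alpha>)) * G x) \<longlonglongrightarrow> (\<delta> x + 0) powr (- (2 * \<alpha>)) * G x"
        by (rule tendsto_mult[OF tendsto_powr[OF _ tendsto_const] tendsto_const]) (use d in simp)
      then have lim: "(\<lambda>n. ennreal ((omega \<delta> \<alpha> (Suc n) x)\<^sup>2 * G x)) \<longlonglongrightarrow> ennreal (\<delta> x powr (- (2 * \<alpha>)) * G x)"
        unfolding omega_square by (intro tendsto_ennrealI) (simp add: omega_def inverse_eq_divide)
      have "\<delta> x powr (- (2 * \<alpha>)) * G x = (norm (weak_hessian \<Omega> u x))\<^sup>2 / \<delta> x powr (2 * \<alpha>)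
                + (norm (weak_gradient \<Omega> u x))\<^sup>2 / \<delta> x powr (2 + 2 * \<alpha>) + (u x)\<^sup>2 / \<delta> x powr (4 + 2 * \<alpha>)"
        using d by (simp add: G_def powr_minus powr_add powr_numeral distrib_left divide_inverse mult_ac)
      then show ?thesis using lim_imp_Liminf[OF _ lim] by simp
    qed
    have "(\<integral>\<^sup>+x. ennreal ((norm (weak_hessian \<Omega> u x))\<^sup>2 / \<delta> x powr (2 * \<alpha>)
                + (norm (weak_gradient \<Omega> u x))\<^sup>2 / \<delta> x powr (2 + 2 * \<alpha>)
                + (u x)\<^sup>2 / \<delta> x powr (4 + 2 * \<alpha>)) \<partial>M)
        = (\<integral>\<^sup>+x. liminf (\<lambda>n. ennreal ((omega \<delta> \<alpha> (Suc n) x)\<^sup>2 * G x)) \<partial>M)"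
      by (intro nn_integral_cong conv) (simp add: space_restrict_space)
    also have "\<dots> \<le> liminf (\<lambda>n. \<integral>\<^sup>+x. ennreal ((omega \<delta> \<alpha> (Suc n) x)\<^sup>2 * G x) \<partial>M)"
      by (intro nn_integral_liminf measurable_compose[OF _ measurable_ennreal] borel_measurable_times borel_measurable_power om Gm)
    also have "\<dots> \<le> liminf (\<lambda>n::nat. ennreal (c * ?h * ?g))"
      by (intro Liminf_mono always_eventually allI bound) simp
    also have "\<dots> = ennreal (c * ?h * ?g)" by (simp add: Liminf_const)
    finally show "(\<integral>\<^sup>+x. ennreal ((norm (weak_hessian \<Omega> u x))\<^sup>2 / \<delta> x powr (2 * \<alpha>)
                + (norm (weak_gradient \<Omega> u x))\<^sup>2 / \<delta> x powr (2 + 2 * \<alpha>)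
                + (u x)\<^sup>2 / \<delta> x powr (4 + 2 * \<alpha>)) \<partial>M) \<le> ennreal (c * ?h * ?g)" .
  qed (rule c)
qed

end

theorem theorem3:
  fixes \<Omega> :: "(real^'n::finite) set"
    and d :: "real^'n \<Rightarrow> real^'n \<Rightarrow> real"
    and \<delta> :: "real^'n \<Rightarrow> real"
    and a :: "'n mindex \<Rightarrow> 'n mindex \<Rightarrow> real^'n \<Rightarrow> real"
    and lam Lam \<alpha> k k' :: real
  assumes domain: "open \<Omega>" "connected \<Omega>" "bounded \<Omega>" "\<Omega> \<noteq> {}"
    and dist: "d \<in> dist_class \<Omega>" "regularised_dist \<Omega> d \<delta>"
    and coeffs: "Linf_symmetric \<Omega> a"
    and ellipticity: "lam > 0" "Lam > 0"
      "\<And>u. u \<in> H20 \<Omega> \<Longrightarrow> lam * Q0 \<Omega> u \<le> Qform \<Omega> a u u \<and> Qform \<Omega> a u u \<le> Lam * Q0 \<Omega> u"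
    and alpha: "0 < \<alpha>" "\<alpha> < 1"
    and k: "k > 0" "k' > 0"
    and weighted: "\<And>n u. n \<ge> 1 \<Longrightarrow> u \<in> Cc 2 \<Omega> \<Longrightarrow>
      Qform \<Omega> a (\<lambda>x. omega \<delta> \<alpha> n x * u x) (\<lambda>x. omega \<delta> \<alpha> n x * u x)
        \<le> k * Qform \<Omega> a u (\<lambda>x. (omega \<delta> \<alpha> n x)\<^sup>2 * u x) + k' * (L2_norm \<Omega> u)\<^sup>2"
  shows "\<exists>c>0. \<forall>u Hu Hsu. (u, Hu) \<in> form_operator \<Omega> a \<longrightarrow>
      (u, Hsu) \<in> frac_power \<Omega> (form_operator \<Omega> a) (\<alpha> / 2) \<longrightarrow>
      (\<integral>\<^sup>+x. ennreal ((norm (weak_hessian \<Omega> u x))\<^sup>2 / \<delta> x powr (2 * \<alpha>)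
                + (norm (weak_gradient \<Omega> u x))\<^sup>2 / \<delta> x powr (2 + 2 * \<alpha>)
                + (u x)\<^sup>2 / \<delta> x powr (4 + 2 * \<alpha>)) \<partial>lebesgue_on \<Omega>)
        \<le> ennreal (c * L2_norm \<Omega> Hu * L2_norm \<Omega> Hsu)"
proof -
  have \<delta>2: "Ck_on 2 \<Omega> \<delta>" using dist(2) by (simp add: regularised_dist_def)
  obtain C where C: "C > 0" and \<delta>: "\<And>x. x \<in> \<Omega> \<Longrightarrow> 0 < \<delta> x \<and> \<delta> x \<le> C \<and> bdry_dist \<Omega> d x \<le> C * \<delta> x \<and> 0 < bdry_dist \<Omega> d x \<and>
    (\<forall>i. \<bar>partial_deriv i \<delta> x\<bar> \<le> C) \<and> (\<forall>i j. \<bar>partial_deriv i (partial_deriv j \<delta>) x\<bar> \<le> C / \<delta> x)"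
    using regularised_dist_facts[OF domain(1,3,4) dist] by blast
  have "cond_D3 \<Omega> d" using dist(1) by (simp add: dist_class_def)
  then obtain K where K: "K > 0" "\<And>v. v \<in> Cc 2 \<Omega> \<Longrightarrow>
     (\<integral>\<^sup>+x. ennreal (1 / \<delta> x ^ 4 * (v x)\<^sup>2) \<partial>lebesgue_on \<Omega>) \<le> ennreal (K * (L2_norm \<Omega> (laplacian v))\<^sup>2) \<and>
     (\<forall>i. (\<integral>\<^sup>+x. ennreal (1 / \<delta> x ^ 2 * (partial_deriv i v x)\<^sup>2) \<partial>lebesgue_on \<Omega>) \<le> ennreal (K * (L2_norm \<Omega> (laplacian v))\<^sup>2))"
    using hardy_rellich_Cc[OF domain(1,3) _ \<delta>2 C] \<delta> by blast
  \<comment> \<open>The maximum with 1 meets the requirement R \<ge> 1 of the locale.\<close>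
  interpret hardy_rellich \<Omega> \<delta> K "max C 1"
    by unfold_locales (use domain \<delta>2 \<delta> K in \<open>auto simp: le_max_iff_disj\<close>)
  have b: "\<And>x. x \<in> \<Omega> \<Longrightarrow> 0 < \<delta> x" "\<And>x i. x \<in> \<Omega> \<Longrightarrow> \<bar>partial_deriv i \<delta> x\<bar> \<le> C"
    "\<And>x i j. x \<in> \<Omega> \<Longrightarrow> \<bar>partial_deriv i (partial_deriv j \<delta>) x\<bar> \<le> C / \<delta> x"
    using \<delta> by blast+
  have alpha2: "0 < 2 * \<alpha>" using alpha by simp
  have Bp: "0 \<le> p * C + p * ((p + 1) * C\<^sup>2 + C)" if "0 < p" for p using that C by simp
  note o1 = omega_facts[OF domain(1) \<delta>2 alpha(1) C b]
  \<comment> \<open>The square of \<omega>_n is \<open>omega\<close> with the exponent 2\<alpha>,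
    which has to be a multiplier as well; 2\<alpha> may exceed 1, and \<open>omega_facts\<close>
    asks only for a positive exponent.\<close>
  note o2 = omega_facts[OF domain(1) \<delta>2 alpha2 C b]
  show ?thesis
  proof (rule boundary_decay_estimate[OF coeffs ellipticity(1) _ alpha k Bp[OF alpha(1)] _ _ o1(2,3) weighted])
    show "\<exists>N. multiplier (omega \<delta> \<alpha> n) N" if "n \<ge> 1" for n
      using omega_multiplier[OF o1(1) alpha(1) that Bp[OF alpha(1)] o1(2,3)] by blast
    show "\<exists>N. multiplier (omega \<delta> (2 * \<alpha>) n) N" if "n \<ge> 1" for n
      using omega_multiplier[OF o2(1) alpha2 that Bp[OF alpha2] o2(2,3)] by blast
  qed (use ellipticity(3) in auto)
qed

end
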